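(* Every model map is in the class $\mathcal G$, i.e. $\Phi\subset\mathcal G$. Explicitly: let $S_g$ be a closed connected orientable surface of genus $g>1$; let $n,k\in\mathbb N$ and $l\in\mathbb Z$ with $l=0$ if $k=1$, and $l\in\{1,\dots,k-1\}$ coprime to $k$ if $k>1$; let $P\colon S_g\to S_g$ be an orientation-preserving pseudo-Anosov homeomorphism and $J\colon S_g\to S_g$ an orientation-preserving homeomorphism with $PJ=JP$ such that $J^lP^k$ is a pseudo-Anosov homeomorphism. Then the model map $\varphi_{P,J,n,k,l}\colon M_J\to M_J$ belongs to the class $\mathcal G$.
   Context: Model maps. Let $\gamma\colon S_g\times\mathbb R\to S_g\times\mathbb R$, $\gamma(z,r)=(J(z),r-1)$, let $M_J=(S_g\times\mathbb R)/\{\gamma^i: i\in\mathbb Z\}$ and let $p_J\colon S_g\times\mathbb R\to M_J$ be the natural projection. Put $\bar\varphi_{n,k,l}(r)=r+\frac{1}{4\pi nk}\sin(2\pi nkr)+\frac lk$ for $r\in\mathbb R$ and $\bar\varphi_{P,J,n,k,l}(z,r)=(P(z),\bar\varphi_{n,k,l}(r))$. This homeomorphism of $S_g\times \mathbb R$ commutes with $\gamma$, and $\varphi_{P,J,n,k,l}\colon M_J\to M_J$ is the induced homeomorphism, $\varphi_{P,J,n,k,l}(w)=p_J(\bar\varphi_{P,J,n,k,l}(p_J^{-1}(w)))$. The set of all such model maps is denoted $\Phi$. Class $\mathcal G$. It consists of the orientation-preserving homeomorphisms $f$ of closed connected orientable topological 3-manifolds $M^3$ whose non-wandering set $NW(f)$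 consists of finitely many connected components $B_0,\dots,B_{m-1}$ such that for each $i$: (1) $B_i$ is a cylindrical embedding of a closed orientable surface $\Sigma$ of genus greater than $1$, i.e. there is a homeomorphism onto its image $h\colon\Sigma\times[-1,1]\to M^3$ with $B_i=h(\Sigma\times\{0\})$; (2) there is a natural number $k_i$ with $f^{k_i}(B_i)=B_i$, $f^{\tilde k_i}(B_i)\ne B_i$ for every natural $\tilde k_i<k_i$, and $f^{k_i}|_{B_i}$ is topologically conjugate to an orientation-preserving pseudo-Anosov homeomorphism; (3) $B_i$ is either an attractor or a repeller of $f^{k_i}$. Here an invariant set $B$ of a homeomorphism $F$ is an attractor if there is a closed neighborhood $U$ of $B$ with $F(U)\subset\mathrm{int}\,U$ and $\bigcap_{j\ge0}F^j(U)=B$; a repeller of $F$ is an attractor of $F^{-1}$. Pseudo-Anosov homeomorphisms. For $q\in\mathbb N$, let $W_q$ be the standard saddle model on $\mathbb C$: the one-dimensional foliation of $\mathbb C\setminus\{0\}$ whose leaves are the maximal path-connected curves along which $\mathrm{Im}\, z^{q/2}$ is constant (using continuous local branches of $z^{q/2}$), together with the singular point $0$; the $q$ rays on which $\mathrm{Im}\, z^{q/2}=0$ are its separatrices. A foliation with saddle singularities on $S_g$ is a finite set $S\subset S_g$ together with a one-dimensional topological foliation $\mathcal F$ of $S_g\setminus S$ such that each $s\in S$ has a neighborhood $U$, a homeomorphism $\psi\colon U\to\mathbb C$ with $\psi(s)=0$, and a $q\in\mathbb N$ such that $\psi$ carries $\mathcal F|_{U\setminus\{s\}}$ to the foliation $W_q\setminus\{0\}$;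 then $s$ is called a saddle singularity with $q$ separatrices. A transversal measure $\mu$ for $\mathcal F$ assigns to each arc $\alpha$ transversal to $\mathcal F$ a finite Borel measure $\mu|_\alpha$, non-atomic and positive on every nondegenerate subarc, such that: (1) if $\beta\subset\alpha$ is a subarc then $\mu|_\beta$ is the restriction of $\mu|_\alpha$; (2) if $\alpha_0,\alpha_1$ are transversal arcs joined by a homotopy $\alpha\colon[0,1]\times[0,1]\to S_g$ with $\alpha([0,1]\times\{0\})=\alpha_0$, $\alpha([0,1]\times\{1\})=\alpha_1$ and each $\alpha(\{t\}\times[0,1])$ contained in a leaf of $\mathcal F$, then $\mu|_{\alpha_0}=\mu|_{\alpha_1}$ (under the identification given by the homotopy). Write $\mu(\alpha)$ for the total mass of $\mu|_\alpha$. Two foliations with the same set $S$ of saddle singularities are transversal if near each point of $S_g\setminus S$ there is a chart in which they become the horizontal and the vertical foliation, and near each point of $S$ there is a chart to $\mathbb C$ in which they become the foliations $\mathrm{Im}\,z^{q/2}=\mathrm{const}$ and $\mathrm{Re}\,z^{q/2}=\mathrm{const}$. A homeomorphism $P\colon S_g\to S_g$ is pseudo-Anosov with dilatation $\lambda>1$ if there are $P$-invariant transversal foliations $\mathcal F^s_P,\mathcal F^u_P$ with a common set $S$ of saddle singularities, each having at least three separatrices, and transversal measures $\mu_s,\mu_u$ for $\mathcal F^s_P,\mathcal F^u_P$ respectively such that $\mu_s(P(\alpha))=\lambda\mu_s(\alpha)$ for every arc $\alpha$ transversal to $\mathcal F^s_P$ and $\mu_u(P(\alpha))=\lambda^{-1}\mu_u(\alpha)$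 for every arc $\alpha$ transversal to $\mathcal F^u_P$. *)

theory Defs
  imports "HOL-Analysis.Analysis" "HOL-Homology.Homology"
begin

section \<open>Manifolds and orientation\<close>

definition topological_manifold :: "nat \<Rightarrow> 'a topology \<Rightarrow> bool" where
  "topological_manifold n X \<longleftrightarrow>
     Hausdorff_space X \<and> second_countable X \<and>
     (\<forall>x\<in>topspace X. \<exists>U. openin X U \<and> x \<in> U \<and>
        subtopology X U homeomorphic_space Euclidean_space n)"

text \<open>Orientations are the homological ones: a choice of a generator \<open>\<omega> x\<close> of the infinite cyclic
  group \<open>H\<^sub>n(X, X - x)\<close> for every \<open>x\<close>, such that near each point all these generators are the
  restrictions of a single class of \<open>H\<^sub>n(X, X - U)\<close>.\<close>

definition manifold_orientation :: "nat \<Rightarrow> 'a topology \<Rightarrow> ('a \<Rightarrow> 'a chain set) \<Rightarrow> bool" where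
  "manifold_orientation n X \<omega> \<longleftrightarrow>
     (\<forall>x\<in>topspace X.
        \<omega> x \<in> carrier (relative_homology_group (int n) X (topspace X - {x})) \<and>
        generate (relative_homology_group (int n) X (topspace X - {x})) {\<omega> x} =
          carrier (relative_homology_group (int n) X (topspace X - {x}))) \<and>
     (\<forall>x\<in>topspace X. \<exists>U. openin X U \<and> x \<in> U \<and>
        (\<exists>c\<in>carrier (relative_homology_group (int n) X (topspace X - U)).
           \<forall>y\<in>U. hom_induced (int n) X (topspace X - U) X (topspace X - {y}) id c = \<omega> y))"

definition orientable_manifold :: "nat \<Rightarrow> 'a topology \<Rightarrow> bool" where
  "orientable_manifold n X \<longleftrightarrow> (\<exists>\<omega>. manifold_orientation n X \<omega>)"

text \<open>The condition \<open>f\<^sub>* \<omega> = \<omega>\<close> is only used for homeomorphisms of connected manifolds,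
  where it does not depend on the choice of \<open>\<omega>\<close>.\<close>

definition orientation_preserving :: "nat \<Rightarrow> 'a topology \<Rightarrow> ('a \<Rightarrow> 'a) \<Rightarrow> bool" where
  "orientation_preserving n X f \<longleftrightarrow>
     (\<exists>\<omega>. manifold_orientation n X \<omega> \<and>
        (\<forall>x\<in>topspace X.
           hom_induced (int n) X (topspace X - {x}) X (topspace X - {f x}) f (\<omega> x) = \<omega> (f x)))"

definition closed_connected_orientable_manifold :: "nat \<Rightarrow> 'a topology \<Rightarrow> bool" where
  "closed_connected_orientable_manifold n X \<longleftrightarrow>
     topological_manifold n X \<and> compact_space X \<and> connected_space X \<and> topspace X \<noteq> {} \<and>
     orientable_manifold n X"

text \<open>The genus is the largest number of pairwise disjoint simple closed curves that together do not
  separate the surface.\<close>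

definition simple_closed_curve_in :: "'a topology \<Rightarrow> 'a set \<Rightarrow> bool" where
  "simple_closed_curve_in X C \<longleftrightarrow>
     (\<exists>\<gamma>. embedding_map (top_of_set (sphere (0::complex) 1)) X \<gamma> \<and> C = \<gamma> ` sphere 0 1)"

definition nonseparating_curve_system :: "'a topology \<Rightarrow> 'a set set \<Rightarrow> bool" where
  "nonseparating_curve_system X \<C> \<longleftrightarrow>
     finite \<C> \<and> (\<forall>C\<in>\<C>. simple_closed_curve_in X C) \<and> disjoint \<C> \<and>
     connected_space (subtopology X (topspace X - \<Union>\<C>))"

definition surface_genus :: "'a topology \<Rightarrow> nat \<Rightarrow> bool" where
  "surface_genus X g \<longleftrightarrow>
     (\<exists>\<C>. nonseparating_curve_system X \<C> \<and> card \<C> = g) \<and>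
     (\<forall>\<C>. nonseparating_curve_system X \<C> \<longrightarrow> card \<C> \<le> g)"

definition closed_orientable_surface :: "'a topology \<Rightarrow> nat \<Rightarrow> bool" where
  "closed_orientable_surface X g \<longleftrightarrow>
     closed_connected_orientable_manifold 2 X \<and> surface_genus X g"

section \<open>Foliations with saddle singularities\<close>

text \<open>A foliation is represented by its set of leaves. Its restriction to \<open>V\<close> has as leaves the path
  components of the sets \<open>L \<inter> V\<close>, where \<open>L\<close> is a leaf.\<close>

definition restricted_leaves :: "'a topology \<Rightarrow> 'a set set \<Rightarrow> 'a set \<Rightarrow> 'a set set" where
  "restricted_leaves X F V = (\<Union>L\<in>F. path_components_of (subtopology X (L \<inter> V)))"

definition horizontal_lines :: "complex set set" where
  "horizontal_lines = range (\<lambda>c. {z. Im z = c})"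

definition vertical_lines :: "complex set set" where
  "vertical_lines = range (\<lambda>c. {z. Re z = c})"

definition plane_chart :: "'a topology \<Rightarrow> 'a set \<Rightarrow> ('a \<Rightarrow> complex) \<Rightarrow> bool" where
  "plane_chart X U \<phi> \<longleftrightarrow> openin X U \<and> homeomorphic_map (subtopology X U) euclidean \<phi>"

definition foliation_chart ::
  "'a topology \<Rightarrow> 'a set set \<Rightarrow> 'a set \<Rightarrow> ('a \<Rightarrow> complex) \<Rightarrow> bool" where
  "foliation_chart X F U \<phi> \<longleftrightarrow>
     plane_chart X U \<phi> \<and> (`) \<phi> ` restricted_leaves X F U = horizontal_lines"

definition foliation :: "'a topology \<Rightarrow> 'a set set \<Rightarrow> bool" where
  "foliation X F \<longleftrightarrow>
     \<Union>F = topspace X \<and> disjoint F \<and>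
     (\<forall>L\<in>F. L \<noteq> {} \<and> path_connectedin X L) \<and>
     (\<forall>x\<in>topspace X. \<exists>U \<phi>. x \<in> U \<and> foliation_chart X F U \<phi>)"

text \<open>The leaf through \<open>z\<close> of the foliation \<open>Im z\<^bsup>q/2\<^esup> = const\<close> (\<open>component = Im\<close>, this is \<open>W\<^sub>q\<close>) or
  \<open>Re z\<^bsup>q/2\<^esup> = const\<close> (\<open>component = Re\<close>) of the punctured plane. The path \<open>b\<close> is a continuous branch
  of \<open>z\<^bsup>q/2\<^esup>\<close> along the path \<open>\<gamma>\<close>.\<close>

definition saddle_leaf :: "(complex \<Rightarrow> real) \<Rightarrow> nat \<Rightarrow> complex \<Rightarrow> complex set" where
  "saddle_leaf component q z =
     {w. \<exists>\<gamma> b. path \<gamma> \<and> path b \<and> pathstart \<gamma> = z \<and> pathfinish \<gamma> = w \<and>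
           (\<forall>t\<in>{0..1}. \<gamma> t \<noteq> 0 \<and> (b t)\<^sup>2 = \<gamma> t ^ q \<and> component (b t) = component (b 0))}"

definition saddle_leaves :: "(complex \<Rightarrow> real) \<Rightarrow> nat \<Rightarrow> complex set set" where
  "saddle_leaves component q = saddle_leaf component q ` (- {0})"

definition saddle_chart ::
  "(complex \<Rightarrow> real) \<Rightarrow> 'a topology \<Rightarrow> 'a set set \<Rightarrow> 'a \<Rightarrow> nat \<Rightarrow> 'a set \<Rightarrow> ('a \<Rightarrow> complex) \<Rightarrow> bool" where
  "saddle_chart component X F s q U \<psi> \<longleftrightarrow>
     plane_chart X U \<psi> \<and> s \<in> U \<and> \<psi> s = 0 \<and>
     (`) \<psi> ` restricted_leaves X F (U - {s}) = saddle_leaves component q"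

definition saddle_singularity :: "'a topology \<Rightarrow> 'a set set \<Rightarrow> 'a \<Rightarrow> nat \<Rightarrow> bool" where
  "saddle_singularity X F s q \<longleftrightarrow> q > 0 \<and> (\<exists>U \<psi>. saddle_chart Im X F s q U \<psi>)"

definition regular_part :: "'a topology \<Rightarrow> 'a set \<Rightarrow> 'a topology" where
  "regular_part X S = subtopology X (topspace X - S)"

definition saddle_foliation :: "'a topology \<Rightarrow> 'a set \<Rightarrow> 'a set set \<Rightarrow> bool" where
  "saddle_foliation X S F \<longleftrightarrow>
     finite S \<and> S \<subseteq> topspace X \<and> foliation (regular_part X S) F \<and>
     (\<forall>s\<in>S. \<exists>q. saddle_singularity X F s q)"

definition transversal_foliations ::
  "'a topology \<Rightarrow> 'a set \<Rightarrow> 'a set set \<Rightarrow> 'a set set \<Rightarrow> bool" where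
  "transversal_foliations X S F G \<longleftrightarrow>
     (\<forall>x\<in>topspace X - S. \<exists>U \<phi>. x \<in> U \<and> plane_chart (regular_part X S) U \<phi> \<and>
        (`) \<phi> ` restricted_leaves X F U = horizontal_lines \<and>
        (`) \<phi> ` restricted_leaves X G U = vertical_lines) \<and>
     (\<forall>s\<in>S. \<exists>q U \<psi>. q > 0 \<and> saddle_chart Im X F s q U \<psi> \<and> saddle_chart Re X G s q U \<psi>)"

section \<open>Transversal measures and pseudo-Anosov homeomorphisms\<close>

text \<open>An arc of the regular part is transversal if it locally meets each leaf of a foliation chart at
  most once.\<close>

definition transversal_path ::
  "'a topology \<Rightarrow> 'a set \<Rightarrow> 'a set set \<Rightarrow> (real \<Rightarrow> 'a) \<Rightarrow> bool" where
  "transversal_path X S F \<gamma> \<longleftrightarrow>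
     embedding_map (top_of_set {0..1}) (regular_part X S) \<gamma> \<and>
     (\<forall>t\<in>{0..1}. \<exists>U \<phi> T. foliation_chart (regular_part X S) F U \<phi> \<and>
        openin (top_of_set {0..1}) T \<and> t \<in> T \<and> \<gamma> ` T \<subseteq> U \<and> inj_on (Im \<circ> \<phi> \<circ> \<gamma>) T)"

definition transversal_arc :: "'a topology \<Rightarrow> 'a set \<Rightarrow> 'a set set \<Rightarrow> 'a set \<Rightarrow> bool" where
  "transversal_arc X S F A \<longleftrightarrow> (\<exists>\<gamma>. transversal_path X S F \<gamma> \<and> A = \<gamma> ` {0..1})"

text \<open>\<open>\<mu> A\<close> is the measure on the arc \<open>A\<close>; its values on sets that are not transversal arcs are
  irrelevant. In the homotopy \<open>H (t, s)\<close>, \<open>t\<close> is the parameter along the arcs.\<close>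

definition transversal_measure ::
  "'a topology \<Rightarrow> 'a set \<Rightarrow> 'a set set \<Rightarrow> ('a set \<Rightarrow> 'a measure) \<Rightarrow> bool" where
  "transversal_measure X S F \<mu> \<longleftrightarrow>
     (\<forall>A. transversal_arc X S F A \<longrightarrow>
        space (\<mu> A) = A \<and>
        sets (\<mu> A) = sigma_sets A {U. openin (subtopology X A) U} \<and>
        finite_measure (\<mu> A) \<and>
        (\<forall>x\<in>A. emeasure (\<mu> A) {x} = 0) \<and>
        (\<forall>B. transversal_arc X S F B \<and> B \<subseteq> A \<longrightarrow>
           emeasure (\<mu> A) B > 0 \<and> \<mu> B = restrict_space (\<mu> A) B)) \<and>
     (\<forall>H \<gamma>\<^sub>0 \<gamma>\<^sub>1.
        transversal_path X S F \<gamma>\<^sub>0 \<and> transversal_path X S F \<gamma>\<^sub>1 \<and>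
        continuous_map (prod_topology (top_of_set {0..1::real}) (top_of_set {0..1::real})) X H \<and>
        (\<forall>t\<in>{0..1}. H (t, 0) = \<gamma>\<^sub>0 t \<and> H (t, 1) = \<gamma>\<^sub>1 t) \<and>
        (\<forall>t\<in>{0..1}. \<exists>L\<in>F. \<forall>s\<in>{0..1}. H (t, s) \<in> L) \<longrightarrow>
        (\<forall>E\<in>sets borel. E \<subseteq> {0..1} \<longrightarrow>
           emeasure (\<mu> (\<gamma>\<^sub>0 ` {0..1})) (\<gamma>\<^sub>0 ` E) = emeasure (\<mu> (\<gamma>\<^sub>1 ` {0..1})) (\<gamma>\<^sub>1 ` E)))"

definition pseudo_anosov_with_dilatation :: "'a topology \<Rightarrow> real \<Rightarrow> ('a \<Rightarrow> 'a) \<Rightarrow> bool" where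
  "pseudo_anosov_with_dilatation X d P \<longleftrightarrow>
     homeomorphic_map X X P \<and> d > 1 \<and>
     (\<exists>S F\<^sub>s F\<^sub>u \<mu>\<^sub>s \<mu>\<^sub>u.
        saddle_foliation X S F\<^sub>s \<and> saddle_foliation X S F\<^sub>u \<and>
        transversal_foliations X S F\<^sub>s F\<^sub>u \<and>
        (`) P ` F\<^sub>s = F\<^sub>s \<and> (`) P ` F\<^sub>u = F\<^sub>u \<and>
        (\<forall>s\<in>S. (\<exists>q\<ge>3. saddle_singularity X F\<^sub>s s q) \<and> (\<exists>q\<ge>3. saddle_singularity X F\<^sub>u s q)) \<and>
        transversal_measure X S F\<^sub>s \<mu>\<^sub>s \<and> transversal_measure X S F\<^sub>u \<mu>\<^sub>u \<and>
        (\<forall>A. transversal_arc X S F\<^sub>s A \<longrightarrow>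
           measure (\<mu>\<^sub>s (P ` A)) (P ` A) = d * measure (\<mu>\<^sub>s A) A) \<and>
        (\<forall>A. transversal_arc X S F\<^sub>u A \<longrightarrow>
           measure (\<mu>\<^sub>u (P ` A)) (P ` A) = inverse d * measure (\<mu>\<^sub>u A) A))"

definition pseudo_anosov :: "'a topology \<Rightarrow> ('a \<Rightarrow> 'a) \<Rightarrow> bool" where
  "pseudo_anosov X P \<longleftrightarrow> (\<exists>d. pseudo_anosov_with_dilatation X d P)"

section \<open>The class of homeomorphisms of 3-manifolds\<close>

definition nonwandering_set :: "'a topology \<Rightarrow> ('a \<Rightarrow> 'a) \<Rightarrow> 'a set" where
  "nonwandering_set X f =
     {x \<in> topspace X. \<forall>U. openin X U \<and> x \<in> U \<longrightarrow> (\<exists>n>0. (f ^^ n) ` U \<inter> U \<noteq> {})}"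

definition attractor :: "'a topology \<Rightarrow> ('a \<Rightarrow> 'a) \<Rightarrow> 'a set \<Rightarrow> bool" where
  "attractor X f B \<longleftrightarrow>
     f ` B = B \<and>
     (\<exists>U. closedin X U \<and> B \<subseteq> X interior_of U \<and> f ` U \<subseteq> X interior_of U \<and>
        (\<Inter>j. (f ^^ j) ` U) = B)"

definition repeller :: "'a topology \<Rightarrow> ('a \<Rightarrow> 'a) \<Rightarrow> 'a set \<Rightarrow> bool" where
  "repeller X f B \<longleftrightarrow> attractor X (inv_into (topspace X) f) B"

text \<open>In the next two definitions the surfaces are taken on the type of points of \<open>M\<close>. This is no
  restriction, since they are homeomorphic to subspaces of \<open>M\<close>.\<close>

definition cylindrically_embedded_surface :: "'a topology \<Rightarrow> 'a set \<Rightarrow> bool" where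
  "cylindrically_embedded_surface M B \<longleftrightarrow>
     (\<exists>(\<Sigma> :: 'a topology) g h. g > 1 \<and> closed_orientable_surface \<Sigma> g \<and>
        embedding_map (prod_topology \<Sigma> (top_of_set {-1..1::real})) M h \<and>
        B = h ` (topspace \<Sigma> \<times> {0}))"

definition conjugate_to_pseudo_anosov :: "'a topology \<Rightarrow> 'a set \<Rightarrow> ('a \<Rightarrow> 'a) \<Rightarrow> bool" where
  "conjugate_to_pseudo_anosov M B F \<longleftrightarrow>
     (\<exists>(\<Sigma> :: 'a topology) g Q h. g > 1 \<and> closed_orientable_surface \<Sigma> g \<and>
        pseudo_anosov \<Sigma> Q \<and> orientation_preserving 2 \<Sigma> Q \<and>
        homeomorphic_map (subtopology M B) \<Sigma> h \<and> (\<forall>x\<in>B. h (F x) = Q (h x)))"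

definition class_G :: "('a topology \<times> ('a \<Rightarrow> 'a)) set" where
  "class_G = {(M, f).
     closed_connected_orientable_manifold 3 M \<and>
     homeomorphic_map M M f \<and> orientation_preserving 3 M f \<and>
     finite (connected_components_of (subtopology M (nonwandering_set M f))) \<and>
     (\<forall>B\<in>connected_components_of (subtopology M (nonwandering_set M f)).
        cylindrically_embedded_surface M B \<and>
        (\<exists>k>0. (f ^^ k) ` B = B \<and> (\<forall>k'. 0 < k' \<and> k' < k \<longrightarrow> (f ^^ k') ` B \<noteq> B) \<and>
           conjugate_to_pseudo_anosov M B (f ^^ k) \<and>
           (attractor M (f ^^ k) B \<or> repeller M (f ^^ k) B)))}"

section \<open>Model maps\<close>

definition int_iterate :: "'a set \<Rightarrow> ('a \<Rightarrow> 'a) \<Rightarrow> int \<Rightarrow> 'a \<Rightarrow> 'a" where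
  "int_iterate A f i = (if i \<ge> 0 then f ^^ nat i else inv_into A f ^^ nat (- i))"

definition quotient_topology :: "'a topology \<Rightarrow> ('a \<Rightarrow> 'b) \<Rightarrow> 'b topology" where
  "quotient_topology X p =
     topology (\<lambda>U. U \<subseteq> p ` topspace X \<and> openin X {x \<in> topspace X. p x \<in> U})"

lemma openin_quotient_topology:
  "openin (quotient_topology X p) U \<longleftrightarrow>
     U \<subseteq> p ` topspace X \<and> openin X {x \<in> topspace X. p x \<in> U}"
proof -
  have inter: "{x \<in> topspace X. p x \<in> U \<inter> V} =
      {x \<in> topspace X. p x \<in> U} \<inter> {x \<in> topspace X. p x \<in> V}" for U V
    by auto
  have union: "{x \<in> topspace X. p x \<in> \<Union>K} = (\<Union>U\<in>K. {x \<in> topspace X. p x \<in> U})" for K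
    by auto
  have "istopology (\<lambda>U. U \<subseteq> p ` topspace X \<and> openin X {x \<in> topspace X. p x \<in> U})"
    unfolding istopology_def inter union by (auto intro: openin_Int)
  then show ?thesis
    by (simp add: quotient_topology_def topology_inverse')
qed

lemma quotient_map_quotient_topology: "quotient_map X (quotient_topology X p) p"
proof -
  have "{x \<in> topspace X. p x \<in> p ` topspace X} = topspace X"
    by auto
  then have "openin (quotient_topology X p) (p ` topspace X)"
    by (simp add: openin_quotient_topology)
  then have "topspace (quotient_topology X p) = p ` topspace X"
    by (metis openin_quotient_topology openin_subset openin_topspace subset_antisym)
  then show ?thesis
    by (simp add: quotient_map_def openin_quotient_topology)
qed

definition deck_map :: "('a \<Rightarrow> 'a) \<Rightarrow> 'a \<times> real \<Rightarrow> 'a \<times> real" where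
  "deck_map J = (\<lambda>(z, r). (J z, r - 1))"

text \<open>Points of the mapping torus are the orbits of the deck map.\<close>

definition torus_proj :: "'a topology \<Rightarrow> ('a \<Rightarrow> 'a) \<Rightarrow> 'a \<times> real \<Rightarrow> ('a \<times> real) set" where
  "torus_proj S J x = range (\<lambda>i. int_iterate (topspace S \<times> UNIV) (deck_map J) i x)"

definition mapping_torus :: "'a topology \<Rightarrow> ('a \<Rightarrow> 'a) \<Rightarrow> ('a \<times> real) set topology" where
  "mapping_torus S J = quotient_topology (prod_topology S euclideanreal) (torus_proj S J)"

definition lifted_model_fun :: "nat \<Rightarrow> nat \<Rightarrow> int \<Rightarrow> real \<Rightarrow> real" where
  "lifted_model_fun n k l r =
     r + 1 / (4 * pi * real n * real k) * sin (2 * pi * real n * real k * r) + real_of_int l / real k"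

definition lifted_model_map ::
  "('a \<Rightarrow> 'a) \<Rightarrow> nat \<Rightarrow> nat \<Rightarrow> int \<Rightarrow> 'a \<times> real \<Rightarrow> 'a \<times> real" where
  "lifted_model_map P n k l = (\<lambda>(z, r). (P z, lifted_model_fun n k l r))"

text \<open>The set \<open>p (\<phi> (p\<^sup>-\<^sup>1 w))\<close> is a singleton when \<open>P\<close> and \<open>J\<close> are commuting
  homeomorphisms of \<open>S\<close>; the model map sends \<open>w\<close> to its only element.\<close>

definition model_map ::
  "'a topology \<Rightarrow> ('a \<Rightarrow> 'a) \<Rightarrow> ('a \<Rightarrow> 'a) \<Rightarrow> nat \<Rightarrow> nat \<Rightarrow> int \<Rightarrow>
     ('a \<times> real) set \<Rightarrow> ('a \<times> real) set" where
  "model_map S P J n k l w =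
     the_elem (torus_proj S J ` lifted_model_map P n k l `
       {x \<in> topspace S \<times> UNIV. torus_proj S J x = w})"

end

theory Submission
  imports Defs "HOL-Probability.Distribution_Functions"
begin

text \<open>In the rescaled coordinate \<open>x = 2nkr\<close> the model map lifts to
  \<open>(z, x) \<mapsto> (P z, x + sin (\<pi>x) / 2\<pi> + 2nl)\<close>. The map \<open>x \<mapsto> x + sin (\<pi>x) / 2\<pi>\<close> is increasing, fixes
  exactly the integers, and attracts to the odd and repels from the even ones. So points off the integer
  levels wander, and the \<open>k\<close>-th iterate maps each of the \<open>2nk\<close> integer levels to itself by \<open>J\<^sup>lP\<^sup>k\<close>. The
  levels are nonwandering because every pseudo-Anosov homeomorphism is recurrent: the two transversal
  measures multiply to an area that is positive on open sets, locally finite and invariant, and is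
  finite on the compact surface. An orientation of the surface that \<open>P\<close> and \<open>J\<close> preserve gives one of
  the quotient by crossing local homology classes with the line.\<close>

text \<open>\<open>orientation_preserving\<close> hides its own choice of local generators, so
  \<open>P\<close> and \<open>J\<close> may come with different ones; connectedness of
  \<open>S\<close>, which leaves only a global sign free, yields one \<omega> kept by both. The
  quotient is studied through slabs of length at most one, on which the projection is injective.
  Each level must be presented as a surface on the type of points of the quotient, so the whole
  pseudo-Anosov structure of \<open>S\<close>, with its leaves, charts and measures, is carried
  along a homeomorphism. For recurrence no measure on the surface is assembled: areas are compared
  only for open sets inside a single chart whose coordinates are the two transversal masses. The
  obstacle is the saddles, which such a chart must approach while its sides stay finite; branches of
  the inverse of z^(q/2) on half-planes provide finitely many charts that do this. That the period
  of a level is \<open>k\<close> is arithmetic: the map sends level i to level i + 2nl, levels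
  repeat modulo 2nk, and l is coprime to k.\<close>

section \<open>Orientations\<close>

text \<open>Singular chains have compact support. A chain that bounds modulo the complement of
  \<open>x\<close> does so with a remainder \<open>e\<close> whose simplices miss \<open>x\<close>;
  their union is compact, hence closed, and removing it from \<open>U\<close> leaves a neighbourhood
  relative to whose complement the class is already trivial.\<close>

lemma local_class_vanishes_nearby:
  assumes X: "Hausdorff_space X" and U: "openin X U" "x \<in> U"
    and c: "c \<in> carrier (relative_homology_group (int p) X (topspace X - U))"
    and one: "hom_induced (int p) X (topspace X - U) X (topspace X - {x}) id c =
      \<one>\<^bsub>relative_homology_group (int p) X (topspace X - {x})\<^esub>"
  obtains V where "openin X V" "x \<in> V" "V \<subseteq> U"
    "hom_induced (int p) X (topspace X - U) X (topspace X - V) id c =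
      \<one>\<^bsub>relative_homology_group (int p) X (topspace X - V)\<^esub>"
proof -
  obtain a where a: "singular_relcycle p X (topspace X - U) a"
    and ca: "c = homologous_rel_set p X (topspace X - U) a"
    using c by (auto simp: carrier_relative_homology_group)
  \<comment> \<open>Enlarging the subspace keeps the representing chain, so all restrictions of
    \<open>c\<close> are classes of the same \<open>a\<close>.\<close>
  have ind: "hom_induced (int p) X (topspace X - U) X T id c = homologous_rel_set p X T a"
    if "topspace X - U \<subseteq> T" for T
  proof -
    have "chain_map p id a = a"
      using a by (intro chain_map_id_gen[where X = X]) (auto simp: singular_relcycle)
    then show ?thesis
      using that a by (subst ca, subst hom_induced_chain_map) auto
  qed
  have "singular_relboundary p X (topspace X - {x}) a"
  proof -
    have "topspace X - U \<subseteq> topspace X - {x}" using U by blast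
    from ind[OF this] one show ?thesis
      by (simp flip: homologous_rel_set_eq_relboundary)
  qed
  then obtain d e where d: "singular_chain (Suc p) X d"
    and e: "singular_chain p (subtopology X (topspace X - {x})) e" and de: "chain_boundary (Suc p) d + e = a"
    unfolding singular_relboundary by blast
  define K where "K = \<Union>((\<lambda>f. f ` standard_simplex p) ` Poly_Mapping.keys e)"
  have e1: "continuous_map (subtopology (powertop_real UNIV) (standard_simplex p)) X f"
     "f ` standard_simplex p \<subseteq> topspace X - {x}" if "f \<in> Poly_Mapping.keys e" for f
  proof -
    have "singular_simplex p (subtopology X (topspace X - {x})) f"
      using e that by (auto simp: singular_chain_def)
    then have f: "continuous_map (subtopology (powertop_real UNIV) (standard_simplex p)) (subtopology X (topspace X - {x})) f"
      by (simp add: singular_simplex_def)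
    then show "continuous_map (subtopology (powertop_real UNIV) (standard_simplex p)) X f"
      using continuous_map_into_fulltopology by blast
    show "f ` standard_simplex p \<subseteq> topspace X - {x}"
      using continuous_map_image_subset_topspace[OF f] by auto
  qed
  have "compactin X K"
    unfolding K_def
  proof (rule compactin_Union)
    show "finite ((\<lambda>f. f ` standard_simplex p) ` Poly_Mapping.keys e)" by simp
    show "compactin X S" if "S \<in> (\<lambda>f. f ` standard_simplex p) ` Poly_Mapping.keys e" for S
    proof -
      have "compactin (subtopology (powertop_real UNIV) (standard_simplex p)) (standard_simplex p)"
        by (simp add: compactin_subtopology compactin_standard_simplex)
      then show ?thesis
        using that e1(1) image_compactin by blast
    qed
  qed
  then have "closedin X K"
    by (simp add: X compactin_imp_closedin)
  have "singular_chain p (subtopology X (topspace X - (U - K))) e"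
    using e e1 by (auto simp: singular_chain_subtopology K_def)
  then have "singular_relboundary p X (topspace X - (U - K)) a"
    unfolding singular_relboundary using d de by blast
  moreover have "topspace X - U \<subseteq> topspace X - (U - K)" by blast
  ultimately have "hom_induced (int p) X (topspace X - U) X (topspace X - (U - K)) id c =
      \<one>\<^bsub>relative_homology_group (int p) X (topspace X - (U - K))\<^esub>"
    by (simp add: ind homologous_rel_set_eq_relboundary)
  moreover have "openin X (U - K)" "x \<in> U - K"
    using U \<open>closedin X K\<close> e1(2) by (auto simp: K_def openin_diff)
  ultimately show ?thesis
    using that by blast
qed

lemma (in group) mult_inv_eq_one_iff:
  assumes "a \<in> carrier G" "b \<in> carrier G"
  shows "a \<otimes> inv b = \<one> \<longleftrightarrow> a = b"
  using assms inv_solve_right'[of \<one> a b] by auto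

lemma (in group) generate_singleton_cases:
  assumes "a \<in> carrier G" "generate G {a} = carrier G" "y \<in> carrier G"
  obtains k :: int where "y = a [^] k"
proof -
  have "y \<in> {a [^] k |k. k \<in> (UNIV :: int set)}"
    unfolding generate_pow[OF assms(1), symmetric] assms(2) by (rule assms(3))
  then show thesis using that by auto
qed

text \<open>Each generator is a power of the other; read in the integers, the two exponents multiply
  to 1.\<close>

lemma generators_of_integer_group:
  assumes "group G" "G \<cong> integer_group" and a: "a \<in> carrier G" "generate G {a} = carrier G"
    and b: "b \<in> carrier G" "generate G {b} = carrier G"
  shows "b = a \<or> b = inv\<^bsub>G\<^esub> a"
proof -
  interpret group G by fact
  obtain h where h: "h \<in> iso G integer_group"
    using assms(2) by (auto simp: is_iso_def)
  then have hom: "h \<in> hom G integer_group" and bij: "bij_betw h (carrier G) UNIV"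
    by (auto simp: iso_def)
  obtain m :: int where m: "b = a [^]\<^bsub>G\<^esub> m"
    by (rule generate_singleton_cases[OF a b(1)])
  obtain n :: int where n: "a = b [^]\<^bsub>G\<^esub> n"
    by (rule generate_singleton_cases[OF b a(1)])
  have pw: "h (x [^]\<^bsub>G\<^esub> k) = k * h x" if "x \<in> carrier G" for x and k :: int
    using hom_int_pow[OF hom that _ group_integer_group] assms(1) by simp
  have "h a \<noteq> 0"
  proof
    assume "h a = 0"
    have "h x = 0" if "x \<in> carrier G" for x
      using generate_singleton_cases[OF a that] pw[OF a(1)] \<open>h a = 0\<close> by (metis mult_zero_right)
    then show False
      using bij by (metis UNIV_I bij_betw_iff_bijections zero_neq_one)
  qed
  moreover have "h a = n * (m * h a)"
    using arg_cong[OF n, of h] arg_cong[OF m, of h] unfolding pw[OF a(1)] pw[OF b(1)] by simp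
  ultimately have "n * m = 1" by simp
  then have "m = 1 \<or> m = -1"
    using zmult_eq_1_iff by (metis mult.commute)
  then show ?thesis
    using m a by (auto simp: int_pow_neg)
qed

section \<open>Local homology groups of manifolds\<close>

lemma iso_local_homology_open_subspace:
  assumes X: "Hausdorff_space X" and V: "openin X V" "x \<in> V"
  shows "hom_induced p (subtopology X V) (V - {x}) X (topspace X - {x}) id
    \<in> iso (relative_homology_group p (subtopology X V) (V - {x}))
          (relative_homology_group p X (topspace X - {x}))"
proof -
  have x: "x \<in> topspace X" and sub: "V \<subseteq> topspace X"
    using V openin_subset by blast+
  \<comment> \<open>Points are closed in a Hausdorff space, so the complement of \<open>V\<close>
    can be excised from the punctured space.\<close>
  have "openin X (topspace X - {x})"
    using Hausdorff_imp_t1_space[OF X] x by (simp add: t1_space_openin_delete_alt)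
  then have "X closure_of (topspace X - V) \<subseteq> X interior_of (topspace X - {x})"
    using V x by (simp add: closure_of_closedin closedin_diff interior_of_openin) blast
  from homology_excision_axiom[OF this, of "topspace X" p]
  moreover have "topspace X - {x} - (topspace X - V) = V - {x}" "topspace X - (topspace X - V) = V"
    using sub by auto
  ultimately show ?thesis by simp
qed

text \<open>The homeomorphism onto the open image is followed by excision of the complement of that
  image. This form carries local generators through the slabs of a quotient.\<close>

lemma iso_local_homology_open_embedding:
  assumes X: "Hausdorff_space X" and e: "embedding_map Y X e" "openin X (e ` topspace Y)"
    and y: "y \<in> topspace Y"
  shows "hom_induced p Y (topspace Y - {y}) X (topspace X - {e y}) e
    \<in> iso (relative_homology_group p Y (topspace Y - {y}))
          (relative_homology_group p X (topspace X - {e y}))"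
proof -
  let ?V = "e ` topspace Y"
  have h: "homeomorphic_map Y (subtopology X ?V) e"
    using e by (simp add: embedding_map_def)
  have inj: "inj_on e (topspace Y)"
    using h homeomorphic_imp_injective_map by blast
  have sub: "?V \<subseteq> topspace X"
    using e openin_subset by blast
  have cont: "continuous_map Y (subtopology X ?V) e"
    using h homeomorphic_imp_continuous_map by blast
  have im: "e ` (topspace Y - {y}) = ?V - {e y}"
    using inj y by (auto simp: inj_on_def)
  have 1: "hom_induced p Y (topspace Y - {y}) (subtopology X ?V) (?V - {e y}) e
     \<in> iso (relative_homology_group p Y (topspace Y - {y}))
           (relative_homology_group p (subtopology X ?V) (?V - {e y}))"
    using homeomorphic_map_relative_homology_iso[OF h _ im] by auto
  have 2: "hom_induced p (subtopology X ?V) (?V - {e y}) X (topspace X - {e y}) id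
     \<in> iso (relative_homology_group p (subtopology X ?V) (?V - {e y}))
           (relative_homology_group p X (topspace X - {e y}))"
    using iso_local_homology_open_subspace[OF X e(2)] y by blast
  have "hom_induced p Y (topspace Y - {y}) X (topspace X - {e y}) (id \<circ> e) =
    hom_induced p (subtopology X ?V) (?V - {e y}) X (topspace X - {e y}) id \<circ>
    hom_induced p Y (topspace Y - {y}) (subtopology X ?V) (?V - {e y}) e"
    using cont im sub by (intro hom_induced_compose) (auto simp: continuous_map_from_subtopology)
  then show ?thesis
    using iso_set_trans[OF 1 2] by simp
qed

text \<open>Excision reduces the claim to a chart, and there to Euclidean space relative to the
  complement of a point. Degree and dimension are then shifted down together to dimension 0, where
  the group is the zeroth homology of a point.\<close>

lemma local_homology_manifold:
  assumes X: "topological_manifold n X" and x: "x \<in> topspace X"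
  shows "relative_homology_group (int n) X (topspace X - {x}) \<cong> integer_group"
proof -
  let ?E = "Euclidean_space n" and ?o = "\<lambda>i::nat. 0::real"
  have "Hausdorff_space X" using X by (simp add: topological_manifold_def)
  obtain U where U: "openin X U" "x \<in> U" "subtopology X U homeomorphic_space ?E"
    using X x by (meson topological_manifold_def)
  have sub: "U \<subseteq> topspace X" using U openin_subset by blast
  obtain h where h: "homeomorphic_map (subtopology X U) ?E h"
    using U(3) by (auto simp: homeomorphic_space)
  have hx: "h x \<in> topspace ?E"
    using h U sub homeomorphic_imp_surjective_map by fastforce
  have inj: "inj_on h U"
    using h sub homeomorphic_imp_injective_map by (metis topspace_subtopology_subset)
  have surj: "h ` U = topspace ?E"
    using h sub homeomorphic_imp_surjective_map by (metis topspace_subtopology_subset)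
  have "hom_induced (int n) (subtopology X U) (U - {x}) ?E (topspace ?E - {h x}) h
    \<in> iso (relative_homology_group (int n) (subtopology X U) (U - {x}))
          (relative_homology_group (int n) ?E (topspace ?E - {h x}))"
    using inj surj U sub by (intro homeomorphic_map_relative_homology_iso[OF h]) (auto simp: inj_on_def)
  then have 1: "relative_homology_group (int n) (subtopology X U) (U - {x}) \<cong>
       relative_homology_group (int n) ?E (topspace ?E - {h x})"
    by (rule is_isoI)
  have 2: "relative_homology_group (int n) (subtopology X U) (U - {x}) \<cong>
     relative_homology_group (int n) X (topspace X - {x})"
    using iso_local_homology_open_subspace[OF \<open>Hausdorff_space X\<close> U(1,2)] by (rule is_isoI)
  have o: "?o \<in> topspace ?E" "topspace (Euclidean_space 0) = {?o}"
    by (auto simp: topspace_Euclidean_space)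
  have "t1_space ?E"
    by (simp add: Hausdorff_Euclidean_space Hausdorff_imp_t1_space)
  then have cl: "closedin ?E {?o}" "closedin ?E {h x}"
    using hx o by (auto simp: t1_space_closedin_singleton)
  \<comment> \<open>No translation of \<open>h x\<close> to the origin is made: complements of
    homeomorphic closed subsets of Euclidean space have isomorphic relative homology, and any two
    one-point sets are homeomorphic.\<close>
  have "subtopology ?E {h x} homeomorphic_space subtopology ?E {?o}"
    using hx o unfolding homeomorphic_space_def homeomorphic_maps_def
    by (intro exI[of _ "\<lambda>_. ?o"] exI[of _ "\<lambda>_. h x"]) (auto simp: continuous_map_in_subtopology)
  then have 3: "relative_homology_group (int n) ?E (topspace ?E - {h x}) \<cong>
      relative_homology_group (int n) ?E (topspace ?E - {?o})"
    using isomorphic_relative_homology_groups_Euclidean_complements cl by blast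
  \<comment> \<open>In dimension 0 the complement of the origin is empty, so the relative group is
    the absolute one.\<close>
  have "closedin (Euclidean_space 0) {?o}"
    using o by (metis closedin_topspace)
  from relative_homology_group_Euclidean_complement_step[OF this, of 0 n]
  have 4: "homology_group 0 (Euclidean_space 0) \<cong> relative_homology_group (int n) ?E (topspace ?E - {?o})"
    using o by simp
  have 5: "homology_group 0 (Euclidean_space 0) \<cong> integer_group"
    using o by (intro isomorphic_integer_zeroth_homology_group path_connected_Euclidean_space) auto
  show ?thesis
    using 1 2 3 4 5 by (meson group.iso_sym group_relative_homology_group iso_trans)
qed

section \<open>Two orientations of a connected manifold\<close>

lemma manifold_orientation_in_carrier:
  "manifold_orientation n X \<omega> \<Longrightarrow> x \<in> topspace X \<Longrightarrow>
     \<omega> x \<in> carrier (relative_homology_group (int n) X (topspace X - {x}))"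
  by (simp add: manifold_orientation_def)

text \<open>Near \<open>x\<close> both orientations restrict from single classes d1 and d2. The
  class d2 times d1^(-m) vanishes at \<open>x\<close>, hence on a neighbourhood by the compact
  support argument. Allowing an integer \<open>m\<close> treats agreement and opposition at
  once.\<close>

lemma openin_orientations_agree:
  assumes X: "Hausdorff_space X" and \<omega>: "manifold_orientation n X \<omega>" and \<eta>: "manifold_orientation n X \<eta>"
  shows "openin X {x \<in> topspace X. \<eta> x = \<omega> x [^]\<^bsub>relative_homology_group (int n) X (topspace X - {x})\<^esub> (m::int)}"
    (is "openin X ?E")
proof (subst openin_subopen, intro ballI)
  let ?H = "\<lambda>A. relative_homology_group (int n) X A"
  fix x assume "x \<in> ?E"
  then have x: "x \<in> topspace X" and eq: "\<eta> x = \<omega> x [^]\<^bsub>?H (topspace X - {x})\<^esub> m" by auto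
  obtain U1 c1 where U1: "openin X U1" "x \<in> U1" "c1 \<in> carrier (?H (topspace X - U1))"
     "\<And>y. y \<in> U1 \<Longrightarrow> hom_induced (int n) X (topspace X - U1) X (topspace X - {y}) id c1 = \<omega> y"
    using \<omega> x unfolding manifold_orientation_def by metis
  obtain U2 c2 where U2: "openin X U2" "x \<in> U2" "c2 \<in> carrier (?H (topspace X - U2))"
     "\<And>y. y \<in> U2 \<Longrightarrow> hom_induced (int n) X (topspace X - U2) X (topspace X - {y}) id c2 = \<eta> y"
    using \<eta> x unfolding manifold_orientation_def by metis
  let ?U = "U1 \<inter> U2"
  let ?G = "?H (topspace X - ?U)"
  define d1 where "d1 = hom_induced (int n) X (topspace X - U1) X (topspace X - ?U) id c1"
  define d2 where "d2 = hom_induced (int n) X (topspace X - U2) X (topspace X - ?U) id c2"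
  define r where "r V = hom_induced (int n) X (topspace X - ?U) X (topspace X - V) id" for V
  have d: "d1 \<in> carrier ?G" "d2 \<in> carrier ?G"
    by (auto simp: d1_def d2_def hom_induced_carrier)
  have rh: "group_hom ?G (?H (topspace X - V)) (r V)" for V
    by (simp add: r_def group_hom_def group_hom_axioms_def hom_induced_hom)
  have r1: "r {y} d1 = \<omega> y" "r {y} d2 = \<eta> y" if "y \<in> ?U" for y
    using that U1(4)[of y] U2(4)[of y] unfolding r_def d1_def d2_def
    by ((subst hom_induced_compose'; auto simp: Pi_iff)+)
  define c where "c = d2 \<otimes>\<^bsub>?G\<^esub> inv\<^bsub>?G\<^esub> (d1 [^]\<^bsub>?G\<^esub> m)"
  have grp: "group ?G" "group (?H A)" for A by auto
  have c: "c \<in> carrier ?G"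
    unfolding c_def using d group.int_pow_closed[OF grp(1)] by (simp add: grp group.inv_closed group.is_monoid monoid.m_closed)
  have rc: "r V c = r V d2 \<otimes>\<^bsub>?H (topspace X - V)\<^esub> inv\<^bsub>?H (topspace X - V)\<^esub> (r V d1 [^]\<^bsub>?H (topspace X - V)\<^esub> m)" for V
  proof -
    interpret group_hom ?G "?H (topspace X - V)" "r V" by (rule rh)
    show ?thesis
      using d hom_int_pow by (simp add: c_def)
  qed
  have zero: "(r V c = \<one>\<^bsub>?H (topspace X - V)\<^esub>) = (r V d2 = r V d1 [^]\<^bsub>?H (topspace X - V)\<^esub> m)" for V
  proof -
    interpret group_hom ?G "?H (topspace X - V)" "r V" by (rule rh)
    show ?thesis
      unfolding rc using d by (intro H.mult_inv_eq_one_iff) auto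
  qed
  have "r {x} c = \<one>\<^bsub>?H (topspace X - {x})\<^esub>"
    using zero[of "{x}"] r1[of x] U1 U2 eq by auto
  then obtain V where V: "openin X V" "x \<in> V" "V \<subseteq> ?U" "r V c = \<one>\<^bsub>?H (topspace X - V)\<^esub>"
    using local_class_vanishes_nearby[OF X openin_Int[OF U1(1) U2(1)] _ c] U1(2) U2(2)
    unfolding r_def by blast
  have "\<eta> y = \<omega> y [^]\<^bsub>?H (topspace X - {y})\<^esub> m" if "y \<in> V" for y
  proof -
    have "r {y} c = hom_induced (int n) X (topspace X - V) X (topspace X - {y}) id (r V c)"
      using that V unfolding r_def by (subst hom_induced_compose') auto
    also have "\<dots> = \<one>\<^bsub>?H (topspace X - {y})\<^esub>"
      unfolding V(4) by (intro hom_one[OF hom_induced_hom]) auto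
    finally show ?thesis
      unfolding zero using r1[of y] that V(3) by (metis subsetD)
  qed
  then have "V \<subseteq> ?E" using V openin_subset by blast
  then show "\<exists>T. openin X T \<and> x \<in> T \<and> T \<subseteq> ?E" using V by blast
qed

text \<open>Generators of an infinite cyclic group differ at most by inversion, so the set of
  agreement and the set of opposition cover the space. Both are open, and they are disjoint because
  no generator equals its inverse; connectedness makes one of them empty.\<close>

lemma manifold_orientation_unique:
  assumes X: "topological_manifold n X" "connected_space X"
    and \<omega>: "manifold_orientation n X \<omega>" and \<eta>: "manifold_orientation n X \<eta>"
  shows "(\<forall>x\<in>topspace X. \<eta> x = \<omega> x) \<or>
    (\<forall>x\<in>topspace X. \<eta> x = inv\<^bsub>relative_homology_group (int n) X (topspace X - {x})\<^esub> \<omega> x)"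
proof -
  let ?H = "\<lambda>x. relative_homology_group (int n) X (topspace X - {x})"
  let ?E = "\<lambda>m. {x \<in> topspace X. \<eta> x = \<omega> x [^]\<^bsub>?H x\<^esub> (m::int)}"
  have haus: "Hausdorff_space X" using X by (simp add: topological_manifold_def)
  have car: "\<omega> x \<in> carrier (?H x)" "generate (?H x) {\<omega> x} = carrier (?H x)"
     "\<eta> x \<in> carrier (?H x)" "generate (?H x) {\<eta> x} = carrier (?H x)" if "x \<in> topspace X" for x
    using that \<omega> \<eta> by (auto simp: manifold_orientation_def)
  have gr: "group (?H x)" for x by simp
  have p1: "a [^]\<^bsub>?H x\<^esub> (1::int) = a" "a [^]\<^bsub>?H x\<^esub> (-1::int) = inv\<^bsub>?H x\<^esub> a"
    if "a \<in> carrier (?H x)" for a x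
    using that group.int_pow_neg[OF gr that, of 1] group.int_pow_1[OF gr that] by simp_all
  have cover: "\<eta> x = \<omega> x \<or> \<eta> x = inv\<^bsub>?H x\<^esub> \<omega> x" if "x \<in> topspace X" for x
    by (rule generators_of_integer_group[OF gr local_homology_manifold[OF X(1) that] car[OF that]])
  \<comment> \<open>A generator equal to its inverse would be sent to 0 by an isomorphism with the
    integers, and then the whole group would be sent to 0.\<close>
  have disj: "\<omega> x \<noteq> inv\<^bsub>?H x\<^esub> \<omega> x" if x: "x \<in> topspace X" for x
  proof
    assume eq: "\<omega> x = inv\<^bsub>?H x\<^esub> \<omega> x"
    interpret group "?H x" by simp
    obtain h where h: "h \<in> iso (?H x) integer_group"
      using local_homology_manifold[OF X(1) x] by (auto simp: is_iso_def)
    then have hom: "h \<in> hom (?H x) integer_group" and bij: "bij_betw h (carrier (?H x)) UNIV"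
      by (auto simp: iso_def)
    have pw: "h (a [^]\<^bsub>?H x\<^esub> k) = k * h a" if "a \<in> carrier (?H x)" for a and k :: int
      using hom_int_pow[OF hom that _ group_integer_group] gr by simp
    have "h (\<omega> x) = (-1) * h (\<omega> x)"
      using pw[OF car(1)[OF x], of "-1"] unfolding p1(2)[OF car(1)[OF x]] eq[symmetric] .
    then have "h (\<omega> x) = 0" by simp
    have "h y = 0" if yc: "y \<in> carrier (?H x)" for y
    proof -
      obtain k :: int where "y = \<omega> x [^]\<^bsub>?H x\<^esub> k"
        by (rule generate_singleton_cases[OF car(1,2)[OF x] yc])
      then show ?thesis using pw[OF car(1)[OF x], of k] \<open>h (\<omega> x) = 0\<close> by (simp only: mult_zero_right)
    qed
    then show False
      using bij unfolding bij_betw_def by (metis UNIV_I imageE zero_neq_one)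
  qed
  have "x \<in> ?E 1 \<longleftrightarrow> \<eta> x = \<omega> x" "x \<in> ?E (-1) \<longleftrightarrow> \<eta> x = inv\<^bsub>?H x\<^esub> \<omega> x" if "x \<in> topspace X" for x
    by (simp_all only: mem_Collect_eq that p1[OF car(1)[OF that]] simp_thms)
  note E = this
  have "?E 1 \<inter> ?E (-1) = {}"
  proof -
    have False if "x \<in> ?E 1" "x \<in> ?E (-1)" for x
    proof -
      have x: "x \<in> topspace X" using that by blast
      have "\<omega> x = inv\<^bsub>?H x\<^esub> \<omega> x"
        by (rule trans[OF sym[OF that(1)[unfolded E(1)[OF x]]] that(2)[unfolded E(2)[OF x]]])
      then show False using disj[OF x] by contradiction
    qed
    then show ?thesis by blast
  qed
  moreover have "topspace X \<subseteq> ?E 1 \<union> ?E (-1)"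
  proof
    fix x assume x: "x \<in> topspace X"
    show "x \<in> ?E 1 \<union> ?E (-1)"
      unfolding Un_iff E(1)[OF x] E(2)[OF x] by (rule cover[OF x])
  qed
  moreover have "openin X (?E 1)" "openin X (?E (-1))"
    using openin_orientations_agree[OF haus \<omega> \<eta>] by auto
  moreover have "A = {} \<or> B = {}"
    if "openin X A" "openin X B" "topspace X \<subseteq> A \<union> B" "A \<inter> B = {}" for A B
    using X(2) that unfolding connected_space_def by blast
  ultimately have "?E 1 = {} \<or> ?E (-1) = {}"
    by presburger
  then show ?thesis
  proof
    assume "?E 1 = {}"
    then have "\<eta> x \<noteq> \<omega> x" if "x \<in> topspace X" for x
      using E(1)[OF that] by (metis (lifting) empty_iff)
    then have "\<eta> x = inv\<^bsub>?H x\<^esub> \<omega> x" if "x \<in> topspace X" for x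
      using cover[OF that] that by (metis (lifting))
    then show ?thesis by (intro disjI2 ballI)
  next
    assume "?E (-1) = {}"
    then have "\<eta> x \<noteq> inv\<^bsub>?H x\<^esub> \<omega> x" if "x \<in> topspace X" for x
      using E(2)[OF that] by (metis (lifting) empty_iff)
    then have "\<eta> x = \<omega> x" if "x \<in> topspace X" for x
      using cover[OF that] that by (metis (lifting))
    then show ?thesis by (intro disjI1 ballI)
  qed
qed

text \<open>The orientation in the definition is existentially quantified; this version holds for
  any prescribed \<eta>, so that several maps can be followed on the same one. The global sign
  cancels because the induced map is a homomorphism.\<close>

lemma orientation_preserving_any:
  assumes X: "topological_manifold n X" "connected_space X"
    and f: "homeomorphic_map X X f" "orientation_preserving n X f"
    and \<eta>: "manifold_orientation n X \<eta>" and x: "x \<in> topspace X"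
  shows "hom_induced (int n) X (topspace X - {x}) X (topspace X - {f x}) f (\<eta> x) = \<eta> (f x)"
proof -
  obtain \<omega> where \<omega>: "manifold_orientation n X \<omega>"
    "\<And>x. x \<in> topspace X \<Longrightarrow>
       hom_induced (int n) X (topspace X - {x}) X (topspace X - {f x}) f (\<omega> x) = \<omega> (f x)"
    using f(2) by (auto simp: orientation_preserving_def)
  have fx: "f x \<in> topspace X"
    using f(1) x homeomorphic_imp_surjective_map by blast
  let ?h = "hom_induced (int n) X (topspace X - {x}) X (topspace X - {f x}) f"
  interpret group_hom "relative_homology_group (int n) X (topspace X - {x})"
     "relative_homology_group (int n) X (topspace X - {f x})" ?h
    by (simp add: group_hom_def group_hom_axioms_def hom_induced_hom)
  have "?h (inv\<^bsub>relative_homology_group (int n) X (topspace X - {x})\<^esub> \<omega> x) =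
     inv\<^bsub>relative_homology_group (int n) X (topspace X - {f x})\<^esub> \<omega> (f x)"
    using hom_inv[OF manifold_orientation_in_carrier[OF \<omega>(1) x]] \<omega>(2)[OF x] by simp
  note inv = this
  from manifold_orientation_unique[OF X \<omega>(1) \<eta>] show ?thesis
  proof
    assume "\<forall>x\<in>topspace X. \<eta> x = \<omega> x"
    then show ?thesis using x fx \<omega>(2) by simp
  next
    assume "\<forall>x\<in>topspace X. \<eta> x = inv\<^bsub>relative_homology_group (int n) X (topspace X - {x})\<^esub> \<omega> x"
    then show ?thesis using x fx inv by simp
  qed
qed

subsection \<open>The cross product with the line\<close>

text \<open>Every deformation in the construction of the cross product moves only the real
  coordinate, and linearly. The parameters \<open>W\<close> and \<open>P\<close> record the set in
  which the homotopy stays and the extra condition that each of its stages satisfies.\<close>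

lemma homotopic_with_second_coordinate:
  assumes f: "continuous_map Z Y f" and u: "continuous_map Z euclideanreal u"
    and v: "continuous_map Z euclideanreal v"
    and W: "\<And>z s. z \<in> topspace Z \<Longrightarrow> s \<in> {0..1} \<Longrightarrow> (f z, (1 - s) * u z + s * v z) \<in> W"
    and P: "\<And>s. s \<in> {0..1} \<Longrightarrow> P (\<lambda>z. (f z, (1 - s) * u z + s * v z))"
  shows "homotopic_with P Z (subtopology (prod_topology Y euclideanreal) W)
     (\<lambda>z. (f z, u z)) (\<lambda>z. (f z, v z))"
  unfolding homotopic_with_def
proof (intro exI[of _ "\<lambda>(s, z). (f z, (1 - s) * u z + s * v z)"] conjI allI ballI)
  let ?I = "prod_topology (top_of_set {0..1::real}) Z"
  have s: "continuous_map ?I euclideanreal fst"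
    using continuous_map_fst continuous_map_into_fulltopology by blast
  have c: "continuous_map ?I Y (\<lambda>x. f (snd x))" "continuous_map ?I euclideanreal (\<lambda>x. u (snd x))"
    "continuous_map ?I euclideanreal (\<lambda>x. v (snd x))"
    using f u v continuous_map_snd by (auto intro: continuous_map_compose[unfolded o_def])
  have "continuous_map ?I (prod_topology Y euclideanreal)
     (\<lambda>x. (f (snd x), (1 - fst x) * u (snd x) + fst x * v (snd x)))"
    by (intro continuous_map_pairedI c continuous_intros s)
  then show "continuous_map ?I (subtopology (prod_topology Y euclideanreal) W)
     (\<lambda>(s, z). (f z, (1 - s) * u z + s * v z))"
    using W by (auto simp: continuous_map_in_subtopology case_prod_unfold)
qed (use P in auto)

lemma convex_combination_le:
  fixes a b s t :: real
  assumes "s \<in> {0..1}" "a \<le> t" "b \<le> t"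
  shows "(1 - s) * a + s * b \<le> t"
  using assms convex_bound_le[of a t b "1 - s" s] by auto

lemma convex_combination_less:
  fixes a b s t :: real
  assumes "s \<in> {0..1}" "a < t" "b < t"
  shows "(1 - s) * a + s * b < t"
  using assms convex_bound_lt[of a t b "1 - s" s] by auto

lemma convex_combination_greater:
  fixes a b s t :: real
  assumes "s \<in> {0..1}" "t < a" "t < b"
  shows "t < (1 - s) * a + s * b"
  using convex_combination_less[of s "- a" "- t" "- b"] assms by (simp add: algebra_simps)

text \<open>For \<open>U \<subseteq> X\<close> and \<open>I \<subseteq> \<real>\<close>, a class in \<open>H\<^sub>n(X, X - U)\<close> is pushed into the
  slice \<open>X \<times> {b}\<close> above \<open>I\<close> and lifted along the connecting homomorphism
  \<open>H\<^sub>n\<^sub>+\<^sub>1(X \<times> \<real>, X \<times> \<real> - U \<times> I) \<rightarrow> H\<^sub>n(X \<times> \<real> - U \<times> I, lower_part X U I)\<close>, which is an isomorphism.\<close>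

definition slab_complement :: "'a topology \<Rightarrow> 'a set \<Rightarrow> real set \<Rightarrow> ('a \<times> real) set" where
  "slab_complement X U I = topspace X \<times> UNIV - U \<times> I"

definition lower_part :: "'a topology \<Rightarrow> 'a set \<Rightarrow> real set \<Rightarrow> ('a \<times> real) set" where
  "lower_part X U I = {(x, t). x \<in> topspace X \<and> (x \<in> U \<longrightarrow> (\<forall>s\<in>I. t < s))}"

text \<open>The height \<open>b\<close> of the slice is left open, so the cross product is a
  relation. As soon as \<open>I\<close> is bounded it relates each class to exactly one
  other.\<close>

definition is_cross :: "nat \<Rightarrow> 'a topology \<Rightarrow> 'a set \<Rightarrow> real set \<Rightarrow> 'a chain set \<Rightarrow> ('a \<times> real) chain set \<Rightarrow> bool" where
  "is_cross n X U I c d \<longleftrightarrow>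
     d \<in> carrier (relative_homology_group (int (Suc n)) (prod_topology X euclideanreal) (slab_complement X U I)) \<and>
     (\<exists>b. (\<forall>s\<in>I. s < b) \<and>
        hom_relboundary (int (Suc n)) (prod_topology X euclideanreal) (slab_complement X U I) (lower_part X U I) d =
        hom_induced (int n) X (topspace X - U)
          (subtopology (prod_topology X euclideanreal) (slab_complement X U I)) (lower_part X U I) (\<lambda>x. (x, b)) c)"

lemma lower_part_subset: "lower_part X U I \<subseteq> slab_complement X U I"
  by (auto simp: lower_part_def slab_complement_def)

text \<open>Lowering the real coordinate to at most \<open>t0\<close> deforms the whole product into
  the lower part. The same deformation preserves the lower part, which is closed under decreasing
  that coordinate.\<close>

lemma trivial_homology_lower_part:
  assumes "\<And>s. s \<in> I \<Longrightarrow> t0 < s"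
  shows "trivial_group (relative_homology_group p (prod_topology X euclideanreal) (lower_part X U I))"
proof (rule trivial_relative_homology_group_gen)
  let ?XR = "prod_topology X euclideanreal" and ?C = "lower_part X U I"
  let ?f = "\<lambda>z. (fst z, min (snd z) t0)"
  have snd: "continuous_map ?XR euclideanreal snd" and fst: "continuous_map ?XR X fst"
    by (auto simp: continuous_map_fst continuous_map_snd)
  have m: "continuous_map ?XR euclideanreal (\<lambda>z. min (snd z) t0)"
    by (intro continuous_map_real_min snd) auto
  show "continuous_map ?XR (subtopology ?XR ?C) ?f"
    unfolding continuous_map_in_subtopology
  proof (intro conjI continuous_map_pairedI fst m)
    have "min a t0 < s" if "s \<in> I" for a s
      using assms[OF that] by linarith
    then show "?f \<in> topspace ?XR \<rightarrow> ?C" by (auto simp: lower_part_def)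
  qed
  have "homotopic_with (\<lambda>h. True) (subtopology ?XR ?C) (subtopology ?XR ?C)
     (\<lambda>z. (fst z, min (snd z) t0)) (\<lambda>z. (fst z, snd z))"
  proof (intro homotopic_with_second_coordinate continuous_map_from_subtopology fst snd m)
    fix z s assume z: "z \<in> topspace (subtopology ?XR ?C)" and s: "s \<in> {0..1::real}"
    have "(1 - s) * min (snd z) t0 + s * snd z \<le> snd z"
      using s by (intro convex_combination_le) auto
    then show "(fst z, (1 - s) * min (snd z) t0 + s * snd z) \<in> ?C"
      using z by (force simp: lower_part_def)
  qed auto
  then show "homotopic_with (\<lambda>h. True) (subtopology ?XR ?C) (subtopology ?XR ?C) ?f id"
    by (simp add: id_def)
  have "homotopic_with (\<lambda>h. True) ?XR (subtopology ?XR UNIV)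
     (\<lambda>z. (fst z, min (snd z) t0)) (\<lambda>z. (fst z, snd z))"
    by (intro homotopic_with_second_coordinate fst snd m) auto
  then show "homotopic_with (\<lambda>h. True) ?XR ?XR ?f id"
    by (simp add: id_def)
qed

text \<open>In the long exact sequence of the triple formed by the product, the slab complement and
  the lower part, the terms on both sides of the connecting map vanish.\<close>

lemma iso_relboundary_lower_part:
  assumes "\<And>s. s \<in> I \<Longrightarrow> t0 < s"
  shows "hom_relboundary p (prod_topology X euclideanreal) (slab_complement X U I) (lower_part X U I)
    \<in> iso (relative_homology_group p (prod_topology X euclideanreal) (slab_complement X U I))
       (relative_homology_group (p - 1)
         (subtopology (prod_topology X euclideanreal) (slab_complement X U I)) (lower_part X U I))"
proof (rule very_short_exact_sequence)
  let ?X = "prod_topology X euclideanreal" and ?S = "slab_complement X U I" and ?T = "lower_part X U I"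
  show "exact_seq
         ([relative_homology_group (p - 1) ?X ?T, relative_homology_group (p - 1) (subtopology ?X ?S) ?T,
           relative_homology_group p ?X ?S, relative_homology_group p ?X ?T],
          [hom_induced (p - 1) (subtopology ?X ?S) ?T ?X ?T id, hom_relboundary p ?X ?S ?T, hom_induced p ?X ?T ?X ?S id])"
    using homology_exactness_triple_1[OF lower_part_subset, of p ?X X U I]
      homology_exactness_triple_2[OF lower_part_subset, of p ?X X U I] by simp
qed (use trivial_homology_lower_part assms in blast)+

lemma continuous_map_slice:
  assumes "\<And>s. s \<in> I \<Longrightarrow> s < b"
  shows "continuous_map X (subtopology (prod_topology X euclideanreal) (slab_complement X U I)) (\<lambda>x. (x, b))"
    and "(\<lambda>x. (x, b)) \<in> topspace X - U \<rightarrow> lower_part X U I"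
  using assms by (auto simp: continuous_map_in_subtopology slab_complement_def lower_part_def
      continuous_map_pairedI)

text \<open>The segment between two upper bounds of \<open>I\<close> consists of upper bounds, so
  the slices are homotopic within the slab complement. Hence the height in \<open>is_cross\<close>
  does not influence the class.\<close>

lemma hom_induced_slice_eq:
  assumes "\<And>s. s \<in> I \<Longrightarrow> s < b" "\<And>s. s \<in> I \<Longrightarrow> s < b'"
  shows "hom_induced p X (topspace X - U)
      (subtopology (prod_topology X euclideanreal) (slab_complement X U I)) (lower_part X U I) (\<lambda>x. (x, b)) =
    hom_induced p X (topspace X - U)
      (subtopology (prod_topology X euclideanreal) (slab_complement X U I)) (lower_part X U I) (\<lambda>x. (x, b'))"
proof (intro homology_homotopy_axiom homotopic_with_second_coordinate)
  show "continuous_map X X (\<lambda>x. x)" using continuous_map_id by (simp add: id_def)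
  fix x s assume "x \<in> topspace X" and s: "s \<in> {0..1::real}"
  moreover have "r < (1 - s) * b + s * b'" if "r \<in> I" for r
    using that s assms by (intro convex_combination_greater) auto
  ultimately show "(x, (1 - s) * b + s * b') \<in> slab_complement X U I"
    by (auto simp: slab_complement_def)
qed (auto simp: lower_part_def)

lemma is_cross_exists:
  assumes I: "\<And>s. s \<in> I \<Longrightarrow> a < s" "\<And>s. s \<in> I \<Longrightarrow> s < b"
  shows "\<exists>d. is_cross n X U I c d"
proof -
  let ?f = "hom_relboundary (int (Suc n)) (prod_topology X euclideanreal) (slab_complement X U I) (lower_part X U I)"
  let ?y = "hom_induced (int n) X (topspace X - U)
      (subtopology (prod_topology X euclideanreal) (slab_complement X U I)) (lower_part X U I) (\<lambda>x. (x, b)) c"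
  have K: "int (Suc n) - 1 = int n" by simp
  have "?y \<in> ?f ` carrier (relative_homology_group (int (Suc n)) (prod_topology X euclideanreal) (slab_complement X U I))"
    using iso_relboundary_lower_part[OF I(1), where p = "int (Suc n)" and X = X and U = U, unfolded K]
    by (simp only: iso_iff hom_induced_carrier)
  then obtain d where "?y = ?f d"
    "d \<in> carrier (relative_homology_group (int (Suc n)) (prod_topology X euclideanreal) (slab_complement X U I))"
    by (rule imageE)
  then show ?thesis
    using I(2) unfolding is_cross_def by (intro exI[of _ d] conjI exI[of _ b] ballI) simp_all
qed

lemma is_cross_unique:
  assumes I: "\<And>s. s \<in> I \<Longrightarrow> a < s" and d: "is_cross n X U I c d" and d': "is_cross n X U I c d'"
  shows "d = d'"
proof -
  let ?f = "hom_relboundary (int (Suc n)) (prod_topology X euclideanreal) (slab_complement X U I) (lower_part X U I)"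
  have "inj_on ?f (carrier (relative_homology_group (int (Suc n)) (prod_topology X euclideanreal) (slab_complement X U I)))"
    using iso_relboundary_lower_part[OF I] unfolding iso_iff by blast
  moreover have "?f d = ?f d'"
  proof -
    obtain b where b: "\<forall>s\<in>I. s < b" "?f d = hom_induced (int n) X (topspace X - U)
      (subtopology (prod_topology X euclideanreal) (slab_complement X U I)) (lower_part X U I) (\<lambda>x. (x, b)) c"
      using d unfolding is_cross_def by blast
    obtain b' where b': "\<forall>s\<in>I. s < b'" "?f d' = hom_induced (int n) X (topspace X - U)
      (subtopology (prod_topology X euclideanreal) (slab_complement X U I)) (lower_part X U I) (\<lambda>x. (x, b')) c"
      using d' unfolding is_cross_def by blast
    have "hom_induced (int n) X (topspace X - U)
        (subtopology (prod_topology X euclideanreal) (slab_complement X U I)) (lower_part X U I) (\<lambda>x. (x, b)) =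
      hom_induced (int n) X (topspace X - U)
        (subtopology (prod_topology X euclideanreal) (slab_complement X U I)) (lower_part X U I) (\<lambda>x. (x, b'))"
      using b(1) b'(1) by (intro hom_induced_slice_eq) auto
    then show ?thesis unfolding b(2) b'(2) by (rule fun_cong)
  qed
  moreover have "d \<in> carrier (relative_homology_group (int (Suc n)) (prod_topology X euclideanreal) (slab_complement X U I))"
     "d' \<in> carrier (relative_homology_group (int (Suc n)) (prod_topology X euclideanreal) (slab_complement X U I))"
    using d d' unfolding is_cross_def by blast+
  ultimately show ?thesis
    by (rule inj_onD)
qed

text \<open>Three uses are combined here: restriction to smaller \<open>U\<close> and
  \<open>I\<close>, translation along the line, and products of a self-map with an increasing map of
  the line. The conditions on \<open>u\<close> say that parameters outside, below or above
  \<open>I\<close> go to parameters outside, below or above \<open>I'\<close>.\<close>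

lemma is_cross_natural:
  assumes d: "is_cross n X U I c d" and f: "continuous_map X Y f" and u: "continuous_on UNIV u" "strict_mono u"
    and U: "\<And>x. x \<in> topspace X \<Longrightarrow> f x \<in> U' \<Longrightarrow> x \<in> U"
    and I: "\<And>t. u t \<in> I' \<Longrightarrow> t \<in> I"
      "\<And>t s. (\<forall>s\<in>I. t < s) \<Longrightarrow> s \<in> I' \<Longrightarrow> u t < s" "\<And>t s. (\<forall>s\<in>I. s < t) \<Longrightarrow> s \<in> I' \<Longrightarrow> s < u t"
  shows "is_cross n Y U' I' (hom_induced (int n) X (topspace X - U) Y (topspace Y - U') f c)
     (hom_induced (int (Suc n)) (prod_topology X euclideanreal) (slab_complement X U I)
        (prod_topology Y euclideanreal) (slab_complement Y U' I') (\<lambda>(x, t). (f x, u t)) d)"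
proof -
  let ?XR = "prod_topology X euclideanreal" and ?YR = "prod_topology Y euclideanreal"
  let ?S = "slab_complement X U I" and ?S' = "slab_complement Y U' I'"
  let ?T = "lower_part X U I" and ?T' = "lower_part Y U' I'"
  let ?F = "\<lambda>(x, t). (f x, u t)"
  obtain b where b: "\<forall>s\<in>I. s < b" and db: "hom_relboundary (int (Suc n)) ?XR ?S ?T d =
    hom_induced (int n) X (topspace X - U) (subtopology ?XR ?S) ?T (\<lambda>x. (x, b)) c"
    using d by (auto simp: is_cross_def)
  have fim: "f x \<in> topspace Y" if "x \<in> topspace X" for x
    using that f continuous_map_image_subset_topspace by blast
  have F: "continuous_map ?XR ?YR ?F"
    unfolding case_prod_unfold
  proof (intro continuous_map_pairedI)
    show "continuous_map ?XR Y (\<lambda>x. f (fst x))"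
      using continuous_map_compose[OF continuous_map_fst f] by (simp add: o_def)
    have "continuous_map euclideanreal euclideanreal u" using u by simp
    from continuous_map_compose[OF continuous_map_snd this]
    show "continuous_map ?XR euclideanreal (\<lambda>x. u (snd x))" by (simp add: o_def)
  qed
  have S: "?F \<in> ?S \<rightarrow> ?S'"
    using U I(1) fim by (auto simp: slab_complement_def)
  have T: "?F \<in> ?T \<rightarrow> ?T'"
    using U I(2) fim by (auto simp: lower_part_def)
  have FS: "continuous_map (subtopology ?XR ?S) (subtopology ?YR ?S') ?F"
    unfolding continuous_map_in_subtopology
  proof
    show "continuous_map (subtopology ?XR ?S) ?YR ?F" by (rule continuous_map_from_subtopology[OF F])
    show "?F \<in> topspace (subtopology ?XR ?S) \<rightarrow> ?S'"
    proof (rule Pi_I)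
      fix z assume "z \<in> topspace (subtopology ?XR ?S)"
      then have "z \<in> ?S" by simp
      then show "?F z \<in> ?S'" using S by (rule funcset_mem[rotated])
    qed
  qed
  have "hom_relboundary (int (Suc n)) ?YR ?S' ?T' (hom_induced (int (Suc n)) ?XR ?S ?YR ?S' ?F d) =
    hom_induced (int n) (subtopology ?XR ?S) ?T (subtopology ?YR ?S') ?T' ?F
      (hom_relboundary (int (Suc n)) ?XR ?S ?T d)"
    using fun_cong[OF naturality_hom_induced_relboundary[OF F S T, of "int (Suc n)"], of d] by simp
  also have "\<dots> = hom_induced (int n) X (topspace X - U) (subtopology ?YR ?S') ?T' (?F \<circ> (\<lambda>x. (x, b))) c"
    using b unfolding db by (intro hom_induced_compose' continuous_map_slice FS T) auto
  \<comment> \<open>The product map takes the slice at height \<open>b\<close> to the slice at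
    height \<open>u b\<close>, and this is the height that witnesses the new relation.\<close>
  also have "?F \<circ> (\<lambda>x. (x, b)) = (\<lambda>y. (y, u b)) \<circ> f"
    by auto
  also have "hom_induced (int n) X (topspace X - U) (subtopology ?YR ?S') ?T' ((\<lambda>y. (y, u b)) \<circ> f) c =
    hom_induced (int n) Y (topspace Y - U') (subtopology ?YR ?S') ?T' (\<lambda>y. (y, u b))
      (hom_induced (int n) X (topspace X - U) Y (topspace Y - U') f c)"
    using U fim b I(3) by (intro hom_induced_compose'[symmetric] continuous_map_slice f) auto
  finally show ?thesis
    unfolding is_cross_def
    using b I(3) by (intro conjI hom_induced_carrier exI[of _ "u b"]) auto
qed

lemma generate_iso_image:
  assumes "h \<in> iso G H" "group G" "group H" "a \<in> carrier G" "generate G {a} = carrier G"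
  shows "generate H {h a} = carrier H"
proof -
  interpret group_hom G H h
    using assms by (simp add: group_hom_def group_hom_axioms_def iso_def)
  show ?thesis
    using generate_img[of "{a}"] assms by (auto simp: iso_iff)
qed

text \<open>The slice is a deformation retract of the open part of the product above height
  \<open>r\<close>, also relative to the points that do not lie over \<open>x\<close>. The rest of
  the slab complement lies in the open lower part and is excised.\<close>

lemma iso_slice:
  assumes X: "Hausdorff_space X" and x: "x \<in> topspace X" and b: "r < b"
  shows "hom_induced p X (topspace X - {x})
      (subtopology (prod_topology X euclideanreal) (slab_complement X {x} {r})) (lower_part X {x} {r}) (\<lambda>x. (x, b))
    \<in> iso (relative_homology_group p X (topspace X - {x}))
       (relative_homology_group p
         (subtopology (prod_topology X euclideanreal) (slab_complement X {x} {r})) (lower_part X {x} {r}))"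
proof -
  let ?XR = "prod_topology X euclideanreal"
  let ?S = "slab_complement X {x} {r}" and ?T = "lower_part X {x} {r}"
  let ?V = "topspace X \<times> {r<..}" and ?A = "(topspace X - {x}) \<times> {r<..}"
  have openA: "openin X (topspace X - {x})"
    using Hausdorff_imp_t1_space[OF X] x by (simp add: t1_space_openin_delete_alt)
  have opens: "openin ?XR ?V" "openin ?XR ?T"
  proof -
    show "openin ?XR ?V" by (simp add: openin_prod_Times_iff)
    have "?T = (topspace X - {x}) \<times> UNIV \<union> topspace X \<times> {..<r}"
      using x by (auto simp: lower_part_def)
    then show "openin ?XR ?T" using openA by (simp add: openin_Un openin_prod_Times_iff)
  qed
  have i: "continuous_map X (subtopology ?XR ?V) (\<lambda>x. (x, b))"
    using b by (auto simp: continuous_map_in_subtopology intro!: continuous_map_pairedI)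
  have j: "continuous_map (subtopology ?XR ?V) X fst"
    by (simp add: continuous_map_fst continuous_map_from_subtopology)
  have "homotopic_with (\<lambda>h. h \<in> ?A \<rightarrow> ?A) (subtopology ?XR ?V) (subtopology ?XR ?V) (\<lambda>z. (fst z, b)) (\<lambda>z. (fst z, snd z))"
  proof (intro homotopic_with_second_coordinate j)
    show "continuous_map (subtopology ?XR ?V) euclideanreal snd"
      by (simp add: continuous_map_snd continuous_map_from_subtopology)
    fix z s assume z: "z \<in> topspace (subtopology ?XR ?V)" and s: "s \<in> {0..1::real}"
    then show "(fst z, (1 - s) * b + s * snd z) \<in> ?V"
      using b by (auto intro: convex_combination_greater)
  next
    fix s :: real assume "s \<in> {0..1}"
    then show "(\<lambda>z. (fst z, (1 - s) * b + s * snd z)) \<in> ?A \<rightarrow> ?A"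
      using b by (auto intro!: convex_combination_greater)
  qed auto
  then have "homotopic_with (\<lambda>h. h \<in> ?A \<rightarrow> ?A) (subtopology ?XR ?V) (subtopology ?XR ?V) ((\<lambda>x. (x, b)) \<circ> fst) id"
    by (simp add: o_def id_def)
  moreover have "homotopic_with (\<lambda>h. h \<in> topspace X - {x} \<rightarrow> topspace X - {x}) X X (fst \<circ> (\<lambda>x. (x, b))) id"
    by (simp add: o_def id_def)
  ultimately have 1: "hom_induced p X (topspace X - {x}) (subtopology ?XR ?V) ?A (\<lambda>x. (x, b))
    \<in> iso (relative_homology_group p X (topspace X - {x})) (relative_homology_group p (subtopology ?XR ?V) ?A)"
    using b by (intro homotopy_equivalence_relative_homology_group_isomorphism[OF i _ j]) auto
  have VS: "?V \<subseteq> ?S" by (auto simp: slab_complement_def)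
  have ST: "?S - (?S - ?V) = ?V" "?T - (?S - ?V) = ?A" "?T \<subseteq> ?S"
    using lower_part_subset by (auto simp: slab_complement_def lower_part_def)
  have SO: "openin ?XR ?S"
  proof -
    have "closedin X {x}"
      using Hausdorff_imp_t1_space[OF X] x by (simp add: t1_space_closedin_singleton)
    then have "closedin ?XR ({x} \<times> {r})"
      by (subst closedin_prod_Times_iff) auto
    then show ?thesis by (simp add: slab_complement_def closedin_def)
  qed
  let ?Y = "subtopology ?XR ?S"
  have "closedin ?Y (?S - ?V)"
  proof -
    have "openin ?Y ?V" using opens VS SO openin_open_subtopology by blast
    then have "closedin ?Y (topspace ?Y - ?V)" by blast
    moreover have "topspace ?Y = ?S" using openin_subset[OF SO] by (rule topspace_subtopology_subset)
    ultimately show ?thesis by simp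
  qed
  moreover have "openin ?Y ?T" using opens ST SO openin_open_subtopology by blast
  \<comment> \<open>A point of the slab complement at height at most \<open>r\<close> either does
    not lie over \<open>x\<close> or lies strictly below \<open>r\<close>, because the point
    \<open>(x, r)\<close> itself is missing.\<close>
  moreover have "?S - ?V \<subseteq> ?T" by (auto simp: slab_complement_def lower_part_def)
  ultimately have "?Y closure_of (?S - ?V) \<subseteq> ?Y interior_of ?T"
    by (simp add: closure_of_closedin interior_of_openin)
  from homology_excision_axiom[OF this, of ?S p]
  have 2: "hom_induced p (subtopology ?XR ?V) ?A ?Y ?T id \<in> iso (relative_homology_group p (subtopology ?XR ?V) ?A)
     (relative_homology_group p ?Y ?T)"
    using ST VS by (simp add: subtopology_subtopology Int_absorb1)
  have idY: "continuous_map (subtopology ?XR ?V) ?Y id"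
  proof -
    have "subtopology ?XR ?V = subtopology ?Y ?V"
      using VS by (simp add: subtopology_subtopology Int_absorb1)
    then show ?thesis using continuous_map_from_subtopology[OF continuous_map_id] by metis
  qed
  have AT: "?A \<subseteq> ?T" by (auto simp: lower_part_def)
  have "hom_induced p X (topspace X - {x}) ?Y ?T (id \<circ> (\<lambda>x. (x, b))) =
    hom_induced p (subtopology ?XR ?V) ?A ?Y ?T id \<circ> hom_induced p X (topspace X - {x}) (subtopology ?XR ?V) ?A (\<lambda>x. (x, b))"
    using b AT by (intro hom_induced_compose i idY) auto
  then show ?thesis using iso_set_trans[OF 1 2] by simp
qed

text \<open>At a single point both the push into the slice and the connecting map are isomorphisms,
  so a generator can be followed through both; injectivity of the connecting map brings the
  conclusion back to \<open>d\<close>.\<close>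

lemma is_cross_generates:
  assumes X: "Hausdorff_space X" and x: "x \<in> topspace X"
    and c: "c \<in> carrier (relative_homology_group (int n) X (topspace X - {x}))"
      "generate (relative_homology_group (int n) X (topspace X - {x})) {c} =
         carrier (relative_homology_group (int n) X (topspace X - {x}))"
    and d: "is_cross n X {x} {r} c d"
  shows "generate (relative_homology_group (int (Suc n)) (prod_topology X euclideanreal) (slab_complement X {x} {r})) {d} =
     carrier (relative_homology_group (int (Suc n)) (prod_topology X euclideanreal) (slab_complement X {x} {r}))"
proof -
  let ?XR = "prod_topology X euclideanreal"
  let ?S = "slab_complement X {x} {r}" and ?T = "lower_part X {x} {r}"
  let ?G = "relative_homology_group (int (Suc n)) ?XR ?S"
  let ?K = "relative_homology_group (int n) (subtopology ?XR ?S) ?T"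
  let ?f = "hom_relboundary (int (Suc n)) ?XR ?S ?T"
  obtain b where b: "r < b" and dc: "d \<in> carrier ?G" and
    db: "?f d = hom_induced (int n) X (topspace X - {x}) (subtopology ?XR ?S) ?T (\<lambda>x. (x, b)) c"
    using d by (auto simp: is_cross_def)
  have "r - 1 < s" if "s \<in> {r}" for s :: real using that by simp
  moreover have K: "int (Suc n) - 1 = int n" by simp
  ultimately have f: "?f \<in> iso ?G ?K"
    using iso_relboundary_lower_part[where p = "int (Suc n)" and X = X and U = "{x}" and I = "{r}", unfolded K] by blast
  have "generate ?K {?f d} = carrier ?K"
    unfolding db using c by (intro generate_iso_image[OF iso_slice[OF X x b]]) auto
  moreover have "group_hom ?G ?K ?f"
    using f by (simp add: group_hom_def group_hom_axioms_def iso_def)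
  ultimately have "?f ` generate ?G {d} = ?f ` carrier ?G"
    using group_hom.generate_img[of ?G ?K ?f "{d}"] dc f by (simp add: iso_iff)
  moreover have "generate ?G {d} \<subseteq> carrier ?G"
    using dc by (intro group.generate_incl) auto
  ultimately show ?thesis
    using f inj_on_image_eq_iff[of ?f "carrier ?G" "generate ?G {d}" "carrier ?G"] unfolding iso_iff by blast
qed

section \<open>Oriented products with the line\<close>

definition cross_orientation :: "nat \<Rightarrow> 'a topology \<Rightarrow> ('a \<Rightarrow> 'a chain set) \<Rightarrow> 'a \<Rightarrow> real \<Rightarrow> ('a \<times> real) chain set" where
  "cross_orientation n X \<omega> x r = (SOME d. is_cross n X {x} {r} (\<omega> x) d)"

lemma slab_complement_point:
  "slab_complement X {x} {r} = topspace (prod_topology X euclideanreal) - {(x, r)}"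
  by (auto simp: slab_complement_def)

lemma is_cross_cross_orientation: "is_cross n X {x} {r} (\<omega> x) (cross_orientation n X \<omega> x r)"
proof -
  have "\<exists>d. is_cross n X {x} {r} (\<omega> x) d"
    by (rule is_cross_exists[of "{r}" "r - 1" "r + 1"]) auto
  then show ?thesis unfolding cross_orientation_def by (rule someI_ex)
qed

lemma cross_orientation_eqI: "is_cross n X {x} {r} (\<omega> x) d \<Longrightarrow> d = cross_orientation n X \<omega> x r"
  by (rule is_cross_unique[OF _ _ is_cross_cross_orientation, of _ "r - 1"]) auto

lemma cross_orientation_carrier:
  "cross_orientation n X \<omega> x r \<in>
     carrier (relative_homology_group (int (Suc n)) (prod_topology X euclideanreal) (topspace (prod_topology X euclideanreal) - {(x, r)}))"
  using is_cross_cross_orientation[of n X x r \<omega>] unfolding is_cross_def slab_complement_point by blast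

text \<open>An increasing \<open>u\<close> keeps the direction of the line, so the effect on the
  product orientation is decided by what \<open>f\<close> does to \<omega>.\<close>

lemma cross_orientation_natural:
  assumes f: "continuous_map X X f" "inj_on f (topspace X)" and x: "x \<in> topspace X"
    and u: "continuous_on UNIV u" "strict_mono u"
    and \<omega>: "hom_induced (int n) X (topspace X - {x}) X (topspace X - {f x}) f (\<omega> x) = \<omega> (f x)"
  shows "hom_induced (int (Suc n)) (prod_topology X euclideanreal) (topspace (prod_topology X euclideanreal) - {(x, r)})
     (prod_topology X euclideanreal) (topspace (prod_topology X euclideanreal) - {(f x, u r)})
     (\<lambda>(y, t). (f y, u t)) (cross_orientation n X \<omega> x r) = cross_orientation n X \<omega> (f x) (u r)"
  unfolding slab_complement_point[symmetric]
proof (rule cross_orientation_eqI)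
  have "is_cross n X {f x} {u r} (hom_induced (int n) X (topspace X - {x}) X (topspace X - {f x}) f (\<omega> x))
     (hom_induced (int (Suc n)) (prod_topology X euclideanreal) (slab_complement X {x} {r}) (prod_topology X euclideanreal)
       (slab_complement X {f x} {u r}) (\<lambda>(y, t). (f y, u t)) (cross_orientation n X \<omega> x r))"
    using f(2) x strict_mono_less[OF u(2)] strict_mono_eq[OF u(2)]
    by (intro is_cross_natural[OF is_cross_cross_orientation f(1) u]) (auto simp: inj_on_def)
  then show "is_cross n X {f x} {u r} (\<omega> (f x))
     (hom_induced (int (Suc n)) (prod_topology X euclideanreal) (slab_complement X {x} {r}) (prod_topology X euclideanreal)
       (slab_complement X {f x} {u r}) (\<lambda>(y, t). (f y, u t)) (cross_orientation n X \<omega> x r))"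
    unfolding \<omega> .
qed

lemma cross_orientation_shift:
  assumes \<omega>: "manifold_orientation n X \<omega>" and x: "x \<in> topspace X"
  shows "hom_induced (int (Suc n)) (prod_topology X euclideanreal) (topspace (prod_topology X euclideanreal) - {(x, r)})
     (prod_topology X euclideanreal) (topspace (prod_topology X euclideanreal) - {(x, r + s)})
     (\<lambda>(y, t). (y, t + s)) (cross_orientation n X \<omega> x r) = cross_orientation n X \<omega> x (r + s)"
proof -
  have "hom_induced (int (Suc n)) (prod_topology X euclideanreal) (topspace (prod_topology X euclideanreal) - {(x, r)})
     (prod_topology X euclideanreal) (topspace (prod_topology X euclideanreal) - {(id x, r + s)})
     (\<lambda>(y, t). (id y, t + s)) (cross_orientation n X \<omega> x r) = cross_orientation n X \<omega> (id x) (r + s)"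
  proof (rule cross_orientation_natural[OF continuous_map_id _ x])
    show "continuous_on UNIV (\<lambda>t::real. t + s)" by (intro continuous_intros)
    show "hom_induced (int n) X (topspace X - {x}) X (topspace X - {id x}) id (\<omega> x) = \<omega> (id x)"
      using hom_induced_id[OF manifold_orientation_in_carrier[OF \<omega> x]] by simp
  qed (auto simp: strict_mono_def)
  then show ?thesis by simp
qed

text \<open>This supplies the local constancy of the product orientation: one class over a box
  induces the chosen generator at each point of the box.\<close>

lemma is_cross_restrict:
  assumes C: "is_cross n X U I c C" and xt: "x \<in> U" "r \<in> I"
    and \<omega>: "hom_induced (int n) X (topspace X - U) X (topspace X - {x}) id c = \<omega> x"
  shows "hom_induced (int (Suc n)) (prod_topology X euclideanreal) (slab_complement X U I)
     (prod_topology X euclideanreal) (slab_complement X {x} {r}) id C = cross_orientation n X \<omega> x r"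
proof (rule cross_orientation_eqI)
  have "is_cross n X {x} {r} (hom_induced (int n) X (topspace X - U) X (topspace X - {x}) id c)
     (hom_induced (int (Suc n)) (prod_topology X euclideanreal) (slab_complement X U I) (prod_topology X euclideanreal)
       (slab_complement X {x} {r}) (\<lambda>(y, t). (id y, id t)) C)"
    using xt by (intro is_cross_natural[OF C]) (auto simp: strict_mono_def)
  moreover have "(\<lambda>(y, t). (id y, id t)) = id" by auto
  ultimately show "is_cross n X {x} {r} (\<omega> x)
     (hom_induced (int (Suc n)) (prod_topology X euclideanreal) (slab_complement X U I) (prod_topology X euclideanreal)
       (slab_complement X {x} {r}) id C)"
    unfolding \<omega> by simp
qed

section \<open>Descent of the product orientation to a quotient\<close>

definition short_line_map :: "(real \<Rightarrow> real) \<Rightarrow> bool" where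
  "short_line_map u \<longleftrightarrow> continuous_on UNIV u \<and> strict_mono u \<and> (\<forall>s t. \<bar>u s - u t\<bar> < 1)"

text \<open>The values fill the open interval of length one centred at \<open>r\<close>, the longest
  on which a projection that identifies heights at integer distances stays injective.\<close>

lemma short_line_map_arctan: "short_line_map (\<lambda>t. r + arctan t / pi)"
proof -
  have "\<bar>arctan s / pi - arctan t / pi\<bar> < 1" for s t
    using arctan_bounded[of s] arctan_bounded[of t] pi_gt_zero
    by (auto simp: abs_less_iff field_simps)
  then show ?thesis
    unfolding short_line_map_def strict_mono_def
    by (auto intro!: continuous_intros simp: divide_strict_right_mono arctan_less_iff)
qed

lemma short_line_map_shift: "short_line_map u \<Longrightarrow> short_line_map (\<lambda>t. u (t + s))"
  unfolding short_line_map_def strict_mono_def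
  by (auto intro!: continuous_on_compose2[of UNIV u UNIV "\<lambda>t. t + s"] continuous_intros)

text \<open>A lift of a circle map of degree one keeps two heights at distance less than one at
  distance less than one, by monotonicity. So such a lift turns short charts into short
  charts.\<close>

lemma short_line_map_equivariant:
  assumes h: "continuous_on UNIV h" "strict_mono h" "\<And>r. h (r + 1) = h r + (1::real)" and u: "short_line_map u"
  shows "short_line_map (\<lambda>t. h (u t))"
proof -
  have "\<bar>h a - h b\<bar> < 1" if "\<bar>a - b\<bar> < 1" for a b
  proof -
    have "h a < h (b + 1)" "h b < h (a + 1)"
      using that strict_mono_less[OF h(2)] by auto
    then show ?thesis using h(3) by (auto simp: abs_less_iff)
  qed
  then show ?thesis
    using u h by (auto simp: short_line_map_def strict_mono_def intro: continuous_on_compose2[of UNIV h])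
qed

text \<open>The mapping torus as far as orientations see it. Two preimages of a point are related by
  some \<open>f\<close> that keeps \<omega> and is compatible with translation along the line up to
  the shift from \<open>r\<close> to \<open>s\<close>; this makes the orientations pushed down from
  both preimages agree.\<close>

locale line_bundle_quotient =
  fixes n :: nat and X :: "'a topology" and \<omega> :: "'a \<Rightarrow> 'a chain set" and M :: "'b topology" and p :: "'a \<times> real \<Rightarrow> 'b"
  assumes X: "Hausdorff_space X" and \<omega>: "manifold_orientation n X \<omega>" and M: "Hausdorff_space M"
    and p: "continuous_map (prod_topology X euclideanreal) M p"
    and p_surj: "p ` (topspace X \<times> UNIV) = topspace M"
    and open_embedding: "\<And>u. short_line_map u \<Longrightarrow>
      embedding_map (prod_topology X euclideanreal) M (\<lambda>(x, t). p (x, u t)) \<and>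
      openin M ((\<lambda>(x, t). p (x, u t)) ` (topspace X \<times> UNIV)) "
    and p_close: "\<And>x r y s. x \<in> topspace X \<Longrightarrow> y \<in> topspace X \<Longrightarrow> p (x, r) = p (y, s) \<Longrightarrow> \<bar>r - s\<bar> < 1 \<Longrightarrow> x = y \<and> r = s"
    and deck: "\<And>x r y s. x \<in> topspace X \<Longrightarrow> y \<in> topspace X \<Longrightarrow> p (x, r) = p (y, s) \<Longrightarrow>
      \<exists>f. continuous_map X X f \<and> inj_on f (topspace X) \<and> y = f x \<and>
        hom_induced (int n) X (topspace X - {x}) X (topspace X - {f x}) f (\<omega> x) = \<omega> (f x) \<and>
        (\<forall>z\<in>topspace X. \<forall>t. p (f z, s + t) = p (z, r + t))"
begin

abbreviation "XR \<equiv> prod_topology X euclideanreal"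

definition pushed :: "(real \<Rightarrow> real) \<Rightarrow> 'a \<Rightarrow> 'b chain set" where
  "pushed u x = hom_induced (int (Suc n)) XR (topspace XR - {(x, 0)}) M (topspace M - {p (x, u 0)})
     (\<lambda>(y, t). p (y, u t)) (cross_orientation n X \<omega> x 0)"

text \<open>The preimage is arbitrary. By \<open>orient_eq_pushed\<close> neither it nor the short
  parametrization of the line affects the value.\<close>

definition orient :: "'b \<Rightarrow> 'b chain set" where
  "orient w = (let (x, r) = (SOME (x, r). x \<in> topspace X \<and> p (x, r) = w) in pushed (\<lambda>t. r + arctan t / pi) x)"

lemma p_in_M: "x \<in> topspace X \<Longrightarrow> p (x, r) \<in> topspace M"
  using p_surj by auto

lemma continuous_map_lift:
  assumes "short_line_map u"
  shows "continuous_map XR M (\<lambda>(x, t). p (x, u t))"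
  using open_embedding[OF assms] homeomorphic_imp_continuous_map continuous_map_into_fulltopology
  unfolding embedding_map_def by blast

lemma inj_lift:
  assumes "short_line_map u" "x \<in> topspace X" "y \<in> topspace X" "p (x, u t) = p (y, u s)"
  shows "x = y \<and> t = s"
  using p_close[OF assms(2-4)] assms(1) by (auto simp: short_line_map_def strict_mono_eq)

lemma lift_punctured:
  assumes "short_line_map u" "x \<in> topspace X"
  shows "(\<lambda>(y, t). p (y, u t)) \<in> topspace XR - {(x, t0)} \<rightarrow> topspace M - {p (x, u t0)}"
  using inj_lift[OF assms(1) _ assms(2)] p_in_M by auto

text \<open>The straight homotopy between the two parametrizations joins the charts. Strict
  monotonicity lets each stage hit the base height only at 0, and shortness keeps its image off the
  other sheets over the base point.\<close>

lemma pushed_homotopic: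
  assumes u: "short_line_map u" and v: "short_line_map v" and uv: "u 0 = v 0" and x: "x \<in> topspace X"
  shows "pushed u x = pushed v x"
proof -
  let ?A = "topspace XR - {(x, 0)}"
  have cont: "continuous_map XR euclideanreal (\<lambda>z. w (snd z))" if "short_line_map w" for w
  proof -
    have "continuous_map euclideanreal euclideanreal w" using that by (simp add: short_line_map_def)
    from continuous_map_compose[OF continuous_map_snd this] show ?thesis by (simp add: o_def)
  qed
  have "homotopic_with (\<lambda>j. j \<in> ?A \<rightarrow> {z \<in> topspace XR. p z \<noteq> p (x, u 0)}) XR (subtopology XR UNIV)
     (\<lambda>z. (fst z, u (snd z))) (\<lambda>z. (fst z, v (snd z)))"
  proof (intro homotopic_with_second_coordinate cont u v continuous_map_fst)
    fix s :: real assume s: "s \<in> {0..1}"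
    show "(\<lambda>z. (fst z, (1 - s) * u (snd z) + s * v (snd z))) \<in> ?A \<rightarrow> {z \<in> topspace XR. p z \<noteq> p (x, u 0)}"
    proof (rule Pi_I)
      fix z assume z: "z \<in> ?A"
      obtain y t where zy: "z = (y, t)" by (cases z)
      have y: "y \<in> topspace X" using z zy by auto
      let ?w = "(1 - s) * u t + s * v t"
      have "\<bar>u t - u 0\<bar> < 1" "\<bar>v t - u 0\<bar> < 1"
        using u v uv unfolding short_line_map_def by metis+
      then have "?w < u 0 + 1" "u 0 - 1 < ?w"
        using s by (auto intro!: convex_combination_less convex_combination_greater simp: abs_less_iff)
      then have close: "\<bar>?w - u 0\<bar> < 1" by (simp add: abs_less_iff)
      have "t = 0" if "?w = u 0"
      proof (rule ccontr)
        assume "t \<noteq> 0"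
        then consider "t < 0" | "t > 0" by linarith
        then show False
        proof cases
          case 1
          then have "u t < u 0" using u by (simp add: short_line_map_def strict_monoD)
          moreover have "v t < u 0" using v 1 uv by (simp add: short_line_map_def strict_monoD)
          ultimately have "u t < u 0" "v t < u 0" by blast+
          from convex_combination_less[OF s this] show False using that by simp
        next
          case 2
          then have "u 0 < u t" using u by (simp add: short_line_map_def strict_monoD)
          moreover have "u 0 < v t" using v 2 uv by (simp add: short_line_map_def strict_monoD)
          ultimately have "u 0 < u t" "u 0 < v t" by blast+
          from convex_combination_greater[OF s this] show False using that by simp
        qed
      qed
      then have "p (y, ?w) \<noteq> p (x, u 0)"
        using p_close[OF y x _ close] z zy by auto
      then show "(fst z, (1 - s) * u (snd z) + s * v (snd z)) \<in> {z \<in> topspace XR. p z \<noteq> p (x, u 0)}"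
        using zy y by simp
    qed
  qed auto
  then have h: "homotopic_with (\<lambda>j. j \<in> ?A \<rightarrow> {z \<in> topspace XR. p z \<noteq> p (x, u 0)}) XR XR
     (\<lambda>z. (fst z, u (snd z))) (\<lambda>z. (fst z, v (snd z)))"
    by (simp only: subtopology_UNIV)
  have "homotopic_with (\<lambda>j. j \<in> ?A \<rightarrow> topspace M - {p (x, u 0)}) XR M
     (p \<circ> (\<lambda>z. (fst z, u (snd z)))) (p \<circ> (\<lambda>z. (fst z, v (snd z))))"
  proof (rule homotopic_with_compose_continuous_map_left[OF h p], rule Pi_I)
    fix j z assume j: "j \<in> ?A \<rightarrow> {z \<in> topspace XR. p z \<noteq> p (x, u 0)}" and z: "z \<in> ?A"
    have "j z \<in> {z \<in> topspace XR. p z \<noteq> p (x, u 0)}" by (rule funcset_mem[OF j z])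
    then show "(p \<circ> j) z \<in> topspace M - {p (x, u 0)}"
      using continuous_map_image_subset_topspace[OF p] by auto
  qed
  from homology_homotopy_axiom[OF this] show ?thesis
    unfolding pushed_def uv by (simp add: o_def case_prod_unfold)
qed

lemma hom_induced_lift:
  assumes u: "short_line_map u" and x: "x \<in> topspace X"
  shows "hom_induced (int (Suc n)) XR (topspace XR - {(x, r)}) M (topspace M - {p (x, u r)})
     (\<lambda>(y, t). p (y, u t)) (cross_orientation n X \<omega> x r) = pushed (\<lambda>t. u (t + r)) x"
proof -
  have c: "continuous_map XR XR (\<lambda>(y, t). (y, t + r))"
    unfolding case_prod_unfold
    by (intro continuous_map_pairedI continuous_map_fst continuous_map_add continuous_map_snd) auto
  have "cross_orientation n X \<omega> x r = hom_induced (int (Suc n)) XR (topspace XR - {(x, 0)}) XR (topspace XR - {(x, r)})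
     (\<lambda>(y, t). (y, t + r)) (cross_orientation n X \<omega> x 0)"
    using cross_orientation_shift[OF \<omega> x, of 0 r] by simp
  then have "hom_induced (int (Suc n)) XR (topspace XR - {(x, r)}) M (topspace M - {p (x, u r)})
     (\<lambda>(y, t). p (y, u t)) (cross_orientation n X \<omega> x r) =
     hom_induced (int (Suc n)) XR (topspace XR - {(x, 0)}) M (topspace M - {p (x, u r)})
     ((\<lambda>(y, t). p (y, u t)) \<circ> (\<lambda>(y, t). (y, t + r))) (cross_orientation n X \<omega> x 0)"
    using lift_punctured[OF u x] by (simp only:) (intro hom_induced_compose' c continuous_map_lift u, auto)
  then show ?thesis
    by (simp add: pushed_def o_def case_prod_unfold)
qed

text \<open>The generator at \<open>f x\<close> can be pushed down by way of \<open>x\<close>, since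
  the product of \<open>f\<close> with the identity carries the cross orientation at
  \<open>x\<close> to the one at \<open>f x\<close>.\<close>

lemma pushed_natural:
  assumes f: "continuous_map X X f" "inj_on f (topspace X)" and x: "x \<in> topspace X"
    and \<omega>f: "hom_induced (int n) X (topspace X - {x}) X (topspace X - {f x}) f (\<omega> x) = \<omega> (f x)"
    and u: "short_line_map u"
  shows "pushed u (f x) = hom_induced (int (Suc n)) XR (topspace XR - {(x, 0)}) M (topspace M - {p (f x, u 0)})
     (\<lambda>(y, t). p (f y, u t)) (cross_orientation n X \<omega> x 0)"
proof -
  have fx: "f z \<in> topspace X" if "z \<in> topspace X" for z
    using f x that continuous_map_image_subset_topspace by blast
  have c: "continuous_map XR XR (\<lambda>(y, t). (f y, id t))"
    unfolding case_prod_unfold id_def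
    using continuous_map_compose[OF continuous_map_fst f(1)]
    by (intro continuous_map_pairedI continuous_map_snd) (simp add: o_def)
  have "hom_induced (int (Suc n)) XR (topspace XR - {(x, 0)}) XR (topspace XR - {(f x, id 0)})
     (\<lambda>(y, t). (f y, id t)) (cross_orientation n X \<omega> x 0) = cross_orientation n X \<omega> (f x) (id 0)"
    by (rule cross_orientation_natural[OF f x _ _ \<omega>f]) (auto simp: strict_mono_def)
  then have "pushed u (f x) = hom_induced (int (Suc n)) XR (topspace XR - {(f x, 0)}) M (topspace M - {p (f x, u 0)})
     (\<lambda>(y, t). p (y, u t)) (hom_induced (int (Suc n)) XR (topspace XR - {(x, 0)}) XR (topspace XR - {(f x, 0)})
     (\<lambda>(y, t). (f y, id t)) (cross_orientation n X \<omega> x 0))"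
    by (simp add: pushed_def)
  also have "\<dots> = hom_induced (int (Suc n)) XR (topspace XR - {(x, 0)}) M (topspace M - {p (f x, u 0)})
     ((\<lambda>(y, t). p (y, u t)) \<circ> (\<lambda>(y, t). (f y, id t))) (cross_orientation n X \<omega> x 0)"
  proof (intro hom_induced_compose' c continuous_map_lift u lift_punctured fx x)
    show "(\<lambda>(y, t). (f y, id t)) \<in> topspace XR - {(x, 0)} \<rightarrow> topspace XR - {(f x, 0)}"
      using f(2) x fx by (auto simp: inj_on_def)
  qed
  finally show ?thesis by (simp add: o_def case_prod_unfold)
qed

text \<open>The preimage picked by \<open>SOME\<close> differs from \<open>x\<close> by a deck map
  \<open>f\<close>. Naturality moves the computation back to \<open>x\<close>, the deck identity
  replaces the height \<open>s\<close> by \<open>u 0\<close>, and a homotopy replaces the arctan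
  chart by \<open>u\<close>.\<close>

lemma orient_eq_pushed:
  assumes x: "x \<in> topspace X" and u: "short_line_map u"
  shows "orient (p (x, u 0)) = pushed u x"
proof -
  obtain y s where ys: "(SOME (y, s). y \<in> topspace X \<and> p (y, s) = p (x, u 0)) = (y, s)"
    by (meson surj_pair)
  have "case (SOME (y, s). y \<in> topspace X \<and> p (y, s) = p (x, u 0)) of (y, s) \<Rightarrow> y \<in> topspace X \<and> p (y, s) = p (x, u 0)"
    by (rule someI[of _ "(x, u 0)"]) (use x in auto)
  then have y: "y \<in> topspace X" "p (y, s) = p (x, u 0)"
    by (auto simp: ys)
  obtain f where f: "continuous_map X X f" "inj_on f (topspace X)" "y = f x"
     "hom_induced (int n) X (topspace X - {x}) X (topspace X - {f x}) f (\<omega> x) = \<omega> (f x)"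
     "\<And>z t. z \<in> topspace X \<Longrightarrow> p (f z, s + t) = p (z, u 0 + t)"
    using deck[OF x y(1) y(2)[symmetric]] by blast
  have "orient (p (x, u 0)) = pushed (\<lambda>t. s + arctan t / pi) (f x)"
    by (simp add: orient_def ys f(3))
  also have "\<dots> = hom_induced (int (Suc n)) XR (topspace XR - {(x, 0)}) M (topspace M - {p (f x, s)})
     (\<lambda>(y, t). p (f y, s + arctan t / pi)) (cross_orientation n X \<omega> x 0)"
    using pushed_natural[OF f(1,2) x f(4) short_line_map_arctan[of s]] by simp
  also have "hom_induced (int (Suc n)) XR (topspace XR - {(x, 0)}) M (topspace M - {p (f x, s)})
     (\<lambda>(y, t). p (f y, s + arctan t / pi)) =
     hom_induced (int (Suc n)) XR (topspace XR - {(x, 0)}) M (topspace M - {p (f x, s)})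
     (\<lambda>(y, t). p (y, u 0 + arctan t / pi))"
    by (rule hom_induced_eq) (auto simp: f(5))
  also have "hom_induced (int (Suc n)) XR (topspace XR - {(x, 0)}) M (topspace M - {p (f x, s)})
     (\<lambda>(y, t). p (y, u 0 + arctan t / pi)) (cross_orientation n X \<omega> x 0) = pushed (\<lambda>t. u 0 + arctan t / pi) x"
    using y f(3) by (simp add: pushed_def)
  also have "\<dots> = pushed u x"
    by (rule pushed_homotopic[OF short_line_map_arctan u _ x]) simp
  finally show ?thesis .
qed

lemma orient_point: "x \<in> topspace X \<Longrightarrow> orient (p (x, r)) = pushed (\<lambda>t. r + arctan t / pi) x"
  using orient_eq_pushed[OF _ short_line_map_arctan[of r]] by simp

lemma manifold_orientation_orient: "manifold_orientation (Suc n) M orient"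
  unfolding manifold_orientation_def
proof (intro conjI ballI)
  fix w assume "w \<in> topspace M"
  then obtain x r where x: "x \<in> topspace X" and w: "w = p (x, r)"
    using p_surj by force
  let ?u = "\<lambda>t. r + arctan t / pi"
  let ?e = "\<lambda>(y, t). p (y, ?u t)"
  have e: "embedding_map XR M ?e" "openin M (?e ` topspace XR)"
    using open_embedding[OF short_line_map_arctan[of r]] by auto
  have ow: "orient w = hom_induced (int (Suc n)) XR (topspace XR - {(x, 0)}) M (topspace M - {w}) ?e (cross_orientation n X \<omega> x 0)"
    using orient_point[OF x] w by (simp add: pushed_def)
  show "orient w \<in> carrier (relative_homology_group (int (Suc n)) M (topspace M - {w}))"
    unfolding ow by (rule hom_induced_carrier)
  have "generate (relative_homology_group (int n) X (topspace X - {x})) {\<omega> x} =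
         carrier (relative_homology_group (int n) X (topspace X - {x}))"
    using \<omega> x by (simp add: manifold_orientation_def)
  from is_cross_generates[OF X x manifold_orientation_in_carrier[OF \<omega> x] this is_cross_cross_orientation[of n X x 0 \<omega>]]
  have g: "generate (relative_homology_group (int (Suc n)) XR (topspace XR - {(x, 0)})) {cross_orientation n X \<omega> x 0} =
     carrier (relative_homology_group (int (Suc n)) XR (topspace XR - {(x, 0)}))"
    unfolding slab_complement_point .
  have "hom_induced (int (Suc n)) XR (topspace XR - {(x, 0)}) M (topspace M - {?e (x, 0)}) ?e \<in>
     iso (relative_homology_group (int (Suc n)) XR (topspace XR - {(x, 0)}))
         (relative_homology_group (int (Suc n)) M (topspace M - {?e (x, 0)}))"
    using x by (intro iso_local_homology_open_embedding[OF M e]) simp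
  then have i: "hom_induced (int (Suc n)) XR (topspace XR - {(x, 0)}) M (topspace M - {w}) ?e \<in>
     iso (relative_homology_group (int (Suc n)) XR (topspace XR - {(x, 0)}))
         (relative_homology_group (int (Suc n)) M (topspace M - {w}))"
    by (simp add: w)
  show "generate (relative_homology_group (int (Suc n)) M (topspace M - {w})) {orient w} =
     carrier (relative_homology_group (int (Suc n)) M (topspace M - {w}))"
    unfolding ow by (rule generate_iso_image[OF i _ _ cross_orientation_carrier g]) auto
  obtain U c where U: "openin X U" "x \<in> U" "c \<in> carrier (relative_homology_group (int n) X (topspace X - U))"
     "\<And>y. y \<in> U \<Longrightarrow> hom_induced (int n) X (topspace X - U) X (topspace X - {y}) id c = \<omega> y"
    using \<omega> x unfolding manifold_orientation_def by metis
  \<comment> \<open>The chart \<open>?e\<close> sends the parameter 0 to the height of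
    \<open>w\<close>. A bounded interval is taken because the cross product of \<open>c\<close> over
    \<open>U\<close> and \<open>?I\<close> exists for bounded intervals.\<close>
  let ?I = "{-1<..<1::real}"
  have "\<exists>C. is_cross n X U ?I c C"
    by (rule is_cross_exists[of ?I "-1" 1]) auto
  then obtain C where C: "is_cross n X U ?I c C" by (rule exE)
  let ?V = "?e ` (U \<times> ?I)"
  have UX: "U \<subseteq> topspace X" using U openin_subset by blast
  have "openin XR (U \<times> ?I)"
    using U by (simp add: openin_prod_Times_iff)
  then have V: "openin M ?V"
    using e embedding_map_def homeomorphic_imp_open_map open_map_def openin_trans_full by metis
  have wV: "w \<in> ?V"
    using U w by (force intro!: image_eqI[of _ _ "(x, 0)"])
  have eS: "?e \<in> slab_complement X U ?I \<rightarrow> topspace M - ?V"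
    using inj_lift[OF short_line_map_arctan[of r]] UX p_in_M
    by (fastforce simp: slab_complement_def)
  have ce: "continuous_map XR M ?e" by (rule continuous_map_lift[OF short_line_map_arctan])
  show "\<exists>V. openin M V \<and> w \<in> V \<and>
     (\<exists>c\<in>carrier (relative_homology_group (int (Suc n)) M (topspace M - V)).
       \<forall>v\<in>V. hom_induced (int (Suc n)) M (topspace M - V) M (topspace M - {v}) id c = orient v)"
  proof (intro exI[of _ ?V] conjI bexI ballI)
    show "openin M ?V" "w \<in> ?V" by (rule V wV)+
    show "hom_induced (int (Suc n)) XR (slab_complement X U ?I) M (topspace M - ?V) ?e C \<in>
        carrier (relative_homology_group (int (Suc n)) M (topspace M - ?V))"
      by (rule hom_induced_carrier)
    fix v assume v: "v \<in> ?V"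
    then obtain y t where y: "y \<in> U" "t \<in> ?I" "v = p (y, ?u t)" by auto
    have yX: "y \<in> topspace X" using y UX by blast
    have "hom_induced (int (Suc n)) M (topspace M - ?V) M (topspace M - {v}) id
       (hom_induced (int (Suc n)) XR (slab_complement X U ?I) M (topspace M - ?V) ?e C) =
       hom_induced (int (Suc n)) XR (slab_complement X U ?I) M (topspace M - {v}) (id \<circ> ?e) C"
    proof (intro hom_induced_compose' ce eS continuous_map_id Pi_I)
      fix z assume "z \<in> topspace M - ?V"
      then show "id z \<in> topspace M - {v}" using v by (metis DiffD1 DiffD2 DiffI id_apply singletonD)
    qed
    also have "\<dots> = hom_induced (int (Suc n)) XR (slab_complement X U ?I) M (topspace M - {v}) (?e \<circ> id) C"
      by simp
    also have "\<dots> = hom_induced (int (Suc n)) XR (slab_complement X {y} {t}) M (topspace M - {v}) ?e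
       (hom_induced (int (Suc n)) XR (slab_complement X U ?I) XR (slab_complement X {y} {t}) id C)"
    proof (intro hom_induced_compose'[symmetric] ce continuous_map_id)
      show "id \<in> slab_complement X U ?I \<rightarrow> slab_complement X {y} {t}"
        using y by (auto simp: slab_complement_def)
      show "?e \<in> slab_complement X {y} {t} \<rightarrow> topspace M - {v}"
        unfolding slab_complement_point y(3) by (rule lift_punctured[OF short_line_map_arctan yX])
    qed
    also have "hom_induced (int (Suc n)) XR (slab_complement X U ?I) XR (slab_complement X {y} {t}) id C =
       cross_orientation n X \<omega> y t"
      by (rule is_cross_restrict[where \<omega> = \<omega>, OF C y(1,2) U(4)[OF y(1)]])
    also have "hom_induced (int (Suc n)) XR (slab_complement X {y} {t}) M (topspace M - {v}) ?e (cross_orientation n X \<omega> y t) =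
       pushed (\<lambda>s. ?u (s + t)) y"
      unfolding slab_complement_point y(3) by (rule hom_induced_lift[OF short_line_map_arctan yX])
    also have "\<dots> = orient v"
      using orient_eq_pushed[OF yX short_line_map_shift[OF short_line_map_arctan[of r], of t]] y(3) by simp
    finally show "hom_induced (int (Suc n)) M (topspace M - ?V) M (topspace M - {v}) id
       (hom_induced (int (Suc n)) XR (slab_complement X U ?I) M (topspace M - ?V) ?e C) = orient v" .
  qed
qed

text \<open>\<open>F\<close> is covered by the product of \<open>g\<close> and \<open>h\<close>, and
  \<open>h\<close> after a short chart is again a short chart. So \<open>F\<close> takes the chart
  that orients \<open>w\<close> to one that orients \<open>F w\<close>.\<close>

lemma orientation_preserving_quotient_map:
  assumes F: "homeomorphic_map M M F" and Fp: "\<And>x r. x \<in> topspace X \<Longrightarrow> F (p (x, r)) = p (g x, h r)"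
    and g: "continuous_map X X g" "inj_on g (topspace X)"
    and g\<omega>: "\<And>x. x \<in> topspace X \<Longrightarrow> hom_induced (int n) X (topspace X - {x}) X (topspace X - {g x}) g (\<omega> x) = \<omega> (g x)"
    and h: "continuous_on UNIV h" "strict_mono h" "\<And>r. h (r + 1) = h r + (1::real)"
  shows "orientation_preserving (Suc n) M F"
  unfolding orientation_preserving_def
proof (intro exI[of _ orient] conjI ballI manifold_orientation_orient)
  fix w assume wM: "w \<in> topspace M"
  then obtain x r where x: "x \<in> topspace X" and w: "w = p (x, r)"
    using p_surj by force
  let ?u = "\<lambda>t. r + arctan t / pi"
  let ?e = "\<lambda>(y, t). p (y, ?u t)"
  have gx: "g x \<in> topspace X" using g x continuous_map_image_subset_topspace by blast
  have Fw: "F w = p (g x, h r)" using Fp[OF x] w by simp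
  have FM: "F \<in> topspace M - {w} \<rightarrow> topspace M - {F w}"
    using homeomorphic_imp_injective_map[OF F] homeomorphic_imp_surjective_map[OF F] wM by (auto simp: inj_on_def)
  have "hom_induced (int (Suc n)) M (topspace M - {w}) M (topspace M - {F w}) F (orient w) =
    hom_induced (int (Suc n)) M (topspace M - {w}) M (topspace M - {F w}) F
      (hom_induced (int (Suc n)) XR (topspace XR - {(x, 0)}) M (topspace M - {w}) ?e (cross_orientation n X \<omega> x 0))"
    using orient_point[OF x] w by (simp add: pushed_def)
  also have "\<dots> = hom_induced (int (Suc n)) XR (topspace XR - {(x, 0)}) M (topspace M - {F w}) (F \<circ> ?e) (cross_orientation n X \<omega> x 0)"
    using lift_punctured[OF short_line_map_arctan[of r] x, of 0] w
    by (intro hom_induced_compose' FM homeomorphic_imp_continuous_map[OF F] continuous_map_lift short_line_map_arctan) simp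
  also have "hom_induced (int (Suc n)) XR (topspace XR - {(x, 0)}) M (topspace M - {F w}) (F \<circ> ?e) =
     hom_induced (int (Suc n)) XR (topspace XR - {(x, 0)}) M (topspace M - {p (g x, h (?u 0))}) (\<lambda>(y, t). p (g y, h (?u t)))"
    unfolding Fw by (simp, rule hom_induced_eq) (auto simp: Fp)
  also have "\<dots> (cross_orientation n X \<omega> x 0) = pushed (\<lambda>t. h (?u t)) (g x)"
    by (rule pushed_natural[OF g x g\<omega>[OF x] short_line_map_equivariant[OF h short_line_map_arctan], symmetric])
  also have "\<dots> = orient (F w)"
    using orient_eq_pushed[OF gx short_line_map_equivariant[OF h short_line_map_arctan[of r]]] Fw by simp
  finally show "hom_induced (int (Suc n)) M (topspace M - {w}) M (topspace M - {F w}) F (orient w) = orient (F w)" .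
qed

end

section \<open>Invariance under homeomorphisms\<close>

lemma topological_manifold_homeomorphic:
  assumes "topological_manifold n X" "X homeomorphic_space Y"
  shows "topological_manifold n Y"
  unfolding topological_manifold_def
proof (intro conjI ballI)
  show "Hausdorff_space Y" "second_countable Y"
    using assms homeomorphic_Hausdorff_space homeomorphic_space_second_countability
    unfolding topological_manifold_def by blast+
  obtain h where h: "homeomorphic_map X Y h" using assms(2) homeomorphic_space by blast
  fix y assume "y \<in> topspace Y"
  then obtain x where x: "x \<in> topspace X" "y = h x"
    using homeomorphic_imp_surjective_map[OF h] by blast
  obtain U where U: "openin X U" "x \<in> U" "subtopology X U homeomorphic_space Euclidean_space n"
    using assms(1) x unfolding topological_manifold_def by blast
  have sub: "U \<subseteq> topspace X" using U openin_subset by blast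
  have "homeomorphic_map (subtopology X U) (subtopology Y (h ` U)) h"
    using h sub homeomorphic_imp_injective_map[OF h] homeomorphic_imp_surjective_map[OF h]
    by (intro homeomorphic_map_subtopologies) (auto simp: Int_absorb1)
  then have "subtopology Y (h ` U) homeomorphic_space subtopology X U"
    using homeomorphic_map_imp_homeomorphic_space homeomorphic_space_sym by blast
  then have "subtopology Y (h ` U) homeomorphic_space Euclidean_space n"
    using U(3) homeomorphic_space_trans by blast
  moreover have "openin Y (h ` U)" using homeomorphic_imp_open_map[OF h] U(1) by (simp add: open_map_def)
  ultimately show "\<exists>V. openin Y V \<and> y \<in> V \<and> subtopology Y V homeomorphic_space Euclidean_space n"
    using U(2) x(2) by blast
qed

text \<open>The surfaces in \<open>class_G\<close> live on the type of points of the 3-manifold,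
  hence all structure on \<open>S\<close> has to be moved to a level of the quotient. The inverse is
  carried along explicitly so that charts, arcs and measures on \<open>Y\<close> can be written
  down.\<close>

locale homeomorphism_pair =
  fixes X :: "'a topology" and Y :: "'b topology" and h :: "'a \<Rightarrow> 'b" and h' :: "'b \<Rightarrow> 'a"
  assumes hh: "homeomorphic_maps X Y h h'"
begin

lemma cont: "continuous_map X Y h" "continuous_map Y X h'"
  using hh by (auto simp: homeomorphic_maps_def)

lemma inv [simp]: "x \<in> topspace X \<Longrightarrow> h' (h x) = x" "y \<in> topspace Y \<Longrightarrow> h (h' y) = y"
  using hh by (auto simp: homeomorphic_maps_def)

lemma in_space [simp]: "x \<in> topspace X \<Longrightarrow> h x \<in> topspace Y" "y \<in> topspace Y \<Longrightarrow> h' y \<in> topspace X"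
  by (erule subsetD[OF continuous_map_image_subset_topspace[OF cont(1)] imageI]
      subsetD[OF continuous_map_image_subset_topspace[OF cont(2)] imageI])+

lemma map: "homeomorphic_map X Y h" "homeomorphic_map Y X h'"
  using conjunct1[OF hh[unfolded homeomorphic_maps_map]] conjunct1[OF conjunct2[OF hh[unfolded homeomorphic_maps_map]]] .

lemma swap: "homeomorphism_pair Y X h' h"
  by unfold_locales (rule homeomorphic_maps_sym[THEN iffD1, OF hh])

lemma image_inv [simp]: "A \<subseteq> topspace X \<Longrightarrow> h' ` h ` A = A"
  unfolding image_image by (auto simp: subset_iff image_iff)

lemma inv_image [simp]: "B \<subseteq> topspace Y \<Longrightarrow> h ` h' ` B = B"
  unfolding image_image by (auto simp: subset_iff image_iff)

lemma surj: "h ` topspace X = topspace Y"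
  using map homeomorphic_imp_surjective_map by blast

lemma inj: "inj_on h (topspace X)"
  using map homeomorphic_imp_injective_map by blast

lemma eq_iff: "x \<in> topspace X \<Longrightarrow> y \<in> topspace X \<Longrightarrow> h x = h y \<longleftrightarrow> x = y"
  using inj by (auto dest: inj_onD)

lemma mem_image: "x \<in> topspace X \<Longrightarrow> A \<subseteq> topspace X \<Longrightarrow> h x \<in> h ` A \<longleftrightarrow> x \<in> A"
  using inj by (auto dest: inj_onD)

lemma openin_image: "A \<subseteq> topspace X \<Longrightarrow> openin Y (h ` A) \<longleftrightarrow> openin X A"
  using map homeomorphic_map_openness_eq homeomorphic_map_openness by metis

lemma image_sub: "A \<subseteq> topspace X \<Longrightarrow> h ` A \<subseteq> topspace Y"
  using in_space by blast

lemma image_Diff: "A \<subseteq> topspace X \<Longrightarrow> B \<subseteq> topspace X \<Longrightarrow> h ` (A - B) = h ` A - h ` B"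
  using inj by (intro inj_on_image_set_diff) auto

lemma subtopology_pair: "A \<subseteq> topspace X \<Longrightarrow> homeomorphism_pair (subtopology X A) (subtopology Y (h ` A)) h h'"
  unfolding homeomorphism_pair_def
  by (rule homeomorphic_maps_subtopologies[OF hh]) (auto simp: Int_absorb1 subset_iff)

definition transported :: "nat \<Rightarrow> ('a \<Rightarrow> 'a chain set) \<Rightarrow> 'b \<Rightarrow> 'b chain set" where
  "transported n \<omega> y = hom_induced (int n) X (topspace X - {h' y}) Y (topspace Y - {y}) h (\<omega> (h' y))"

lemma iso_local: "x \<in> topspace X \<Longrightarrow> hom_induced p X (topspace X - {x}) Y (topspace Y - {h x}) h \<in>
   iso (relative_homology_group p X (topspace X - {x})) (relative_homology_group p Y (topspace Y - {h x}))"
  using surj by (intro homeomorphic_map_relative_homology_iso[OF map(1)]) (auto simp: image_Diff)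

lemma manifold_orientation_transported:
  assumes \<omega>: "manifold_orientation n X \<omega>"
  shows "manifold_orientation n Y (transported n \<omega>)"
  unfolding manifold_orientation_def
proof (intro conjI ballI)
  fix y assume y: "y \<in> topspace Y"
  let ?x = "h' y"
  have x: "?x \<in> topspace X" "h ?x = y" using y by simp_all
  have car: "\<omega> ?x \<in> carrier (relative_homology_group (int n) X (topspace X - {?x}))"
    "generate (relative_homology_group (int n) X (topspace X - {?x})) {\<omega> ?x} =
       carrier (relative_homology_group (int n) X (topspace X - {?x}))"
    using \<omega> x(1) unfolding manifold_orientation_def by blast+
  show "transported n \<omega> y \<in> carrier (relative_homology_group (int n) Y (topspace Y - {y}))"
    by (simp add: transported_def hom_induced_carrier)
  show "generate (relative_homology_group (int n) Y (topspace Y - {y})) {transported n \<omega> y} =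
     carrier (relative_homology_group (int n) Y (topspace Y - {y}))"
    using generate_iso_image[OF iso_local[OF x(1)] _ _ car] x(2) by (simp add: transported_def)
  obtain U c where U: "openin X U" "?x \<in> U" "c \<in> carrier (relative_homology_group (int n) X (topspace X - U))"
    "\<And>z. z \<in> U \<Longrightarrow> hom_induced (int n) X (topspace X - U) X (topspace X - {z}) id c = \<omega> z"
    using \<omega> x(1) unfolding manifold_orientation_def by metis
  have sub: "U \<subseteq> topspace X" using U(1) openin_subset by blast
  have hU: "h \<in> topspace X - U \<rightarrow> topspace Y - h ` U" using mem_image[OF _ sub] by auto
  show "\<exists>V. openin Y V \<and> y \<in> V \<and> (\<exists>c\<in>carrier (relative_homology_group (int n) Y (topspace Y - V)).
      \<forall>z\<in>V. hom_induced (int n) Y (topspace Y - V) Y (topspace Y - {z}) id c = transported n \<omega> z)"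
  proof (intro exI[of _ "h ` U"] conjI bexI ballI)
    show "openin Y (h ` U)" using openin_image[OF sub] U(1) by simp
    show "y \<in> h ` U" using U(2) x(2) by (metis imageI)
    show "hom_induced (int n) X (topspace X - U) Y (topspace Y - h ` U) h c \<in>
        carrier (relative_homology_group (int n) Y (topspace Y - h ` U))" by (rule hom_induced_carrier)
    fix z assume "z \<in> h ` U"
    then obtain w where w: "w \<in> U" "z = h w" by blast
    have wX: "w \<in> topspace X" using w sub by blast
    have hw: "h \<in> topspace X - {w} \<rightarrow> topspace Y - {z}" using wX w(2) by (auto simp: eq_iff)
    have "hom_induced (int n) Y (topspace Y - h ` U) Y (topspace Y - {z}) id
       (hom_induced (int n) X (topspace X - U) Y (topspace Y - h ` U) h c) =
       hom_induced (int n) X (topspace X - U) Y (topspace Y - {z}) (id \<circ> h) c"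
      using w by (intro hom_induced_compose' cont hU continuous_map_id) auto
    also have "\<dots> = hom_induced (int n) X (topspace X - U) Y (topspace Y - {z}) (h \<circ> id) c" by simp
    also have "\<dots> = hom_induced (int n) X (topspace X - {w}) Y (topspace Y - {z}) h
       (hom_induced (int n) X (topspace X - U) X (topspace X - {w}) id c)"
      using w by (intro hom_induced_compose'[symmetric] cont hw continuous_map_id) auto
    also have "\<dots> = transported n \<omega> z" using U(4)[OF w(1)] wX w(2) by (simp add: transported_def)
    finally show "hom_induced (int n) Y (topspace Y - h ` U) Y (topspace Y - {z}) id
       (hom_induced (int n) X (topspace X - U) Y (topspace Y - h ` U) h c) = transported n \<omega> z" .
  qed
qed

lemma orientation_preserving_transported:
  assumes f: "orientation_preserving n X f" "homeomorphic_map X X f"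
  shows "orientation_preserving n Y (h \<circ> f \<circ> h')"
proof -
  obtain \<omega> where \<omega>: "manifold_orientation n X \<omega>"
    "\<And>x. x \<in> topspace X \<Longrightarrow> hom_induced (int n) X (topspace X - {x}) X (topspace X - {f x}) f (\<omega> x) = \<omega> (f x)"
    using f(1) unfolding orientation_preserving_def by blast
  have fX: "f x \<in> topspace X" if "x \<in> topspace X" for x
    using that homeomorphic_imp_surjective_map[OF f(2)] by blast
  have fc: "continuous_map X X f" by (rule homeomorphic_imp_continuous_map[OF f(2)])
  have finj: "f \<in> topspace X - {x} \<rightarrow> topspace X - {f x}" if "x \<in> topspace X" for x
    using that fX homeomorphic_imp_injective_map[OF f(2)] by (auto dest: inj_onD)
  show ?thesis
    unfolding orientation_preserving_def
  proof (intro exI[of _ "transported n \<omega>"] conjI ballI manifold_orientation_transported[OF \<omega>(1)])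
    fix y assume y: "y \<in> topspace Y"
    let ?x = "h' y" and ?g = "h \<circ> f \<circ> h'"
    have x: "?x \<in> topspace X" using y by simp
    have g: "continuous_map Y Y ?g"
      by (rule continuous_map_compose[OF cont(2) continuous_map_compose[OF fc cont(1)]])
    have h1: "h \<in> topspace X - {?x} \<rightarrow> topspace Y - {y}" using x y eq_iff[OF _ x] by auto
    have h2: "h \<in> topspace X - {f ?x} \<rightarrow> topspace Y - {?g y}" using eq_iff[OF _ fX[OF x]] by auto
    have g1: "?g \<in> topspace Y - {y} \<rightarrow> topspace Y - {?g y}"
    proof (rule Pi_I)
      fix z assume z: "z \<in> topspace Y - {y}"
      then have "h' z \<in> topspace X - {?x}" using y inv(2) by (metis Diff_iff in_space(2) insert_iff empty_iff)
      then have "f (h' z) \<in> topspace X - {f ?x}" using finj[OF x] by blast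
      then show "?g z \<in> topspace Y - {?g y}" using h2 by auto
    qed
    have "hom_induced (int n) Y (topspace Y - {y}) Y (topspace Y - {?g y}) ?g (transported n \<omega> y) =
       hom_induced (int n) X (topspace X - {?x}) Y (topspace Y - {?g y}) (?g \<circ> h) (\<omega> ?x)"
      unfolding transported_def by (intro hom_induced_compose' cont(1) h1 g g1)
    also have "hom_induced (int n) X (topspace X - {?x}) Y (topspace Y - {?g y}) (?g \<circ> h) =
       hom_induced (int n) X (topspace X - {?x}) Y (topspace Y - {?g y}) (h \<circ> f)"
      by (rule hom_induced_eq) simp
    also have "hom_induced (int n) X (topspace X - {?x}) Y (topspace Y - {?g y}) (h \<circ> f) (\<omega> ?x) =
       hom_induced (int n) X (topspace X - {f ?x}) Y (topspace Y - {?g y}) h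
         (hom_induced (int n) X (topspace X - {?x}) X (topspace X - {f ?x}) f (\<omega> ?x))"
      by (intro hom_induced_compose'[symmetric] fc finj[OF x] cont(1) h2)
    also have "\<dots> = transported n \<omega> (?g y)"
      using \<omega>(2)[OF x] x fX by (simp add: transported_def)
    finally show "hom_induced (int n) Y (topspace Y - {y}) Y (topspace Y - {?g y}) ?g (transported n \<omega> y) =
      transported n \<omega> (?g y)" .
  qed
qed

lemma simple_closed_curve_image:
  assumes "simple_closed_curve_in X C"
  shows "simple_closed_curve_in Y (h ` C) \<and> C \<subseteq> topspace X"
proof -
  obtain \<gamma> where \<gamma>: "embedding_map (top_of_set (sphere (0::complex) 1)) X \<gamma>" "C = \<gamma> ` sphere 0 1"
    using assms unfolding simple_closed_curve_in_def by blast
  have "embedding_map X Y h" using map(1) surj by (simp add: embedding_map_def)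
  then have "embedding_map (top_of_set (sphere (0::complex) 1)) Y (h \<circ> \<gamma>)"
    using \<gamma>(1) embedding_map_compose by blast
  moreover have "h ` C = (h \<circ> \<gamma>) ` sphere 0 1" using \<gamma>(2) by (simp add: image_comp)
  moreover have "C \<subseteq> topspace X"
  proof -
    have "continuous_map (top_of_set (sphere (0::complex) 1)) X \<gamma>"
      using \<gamma>(1) homeomorphic_imp_continuous_map continuous_map_into_fulltopology unfolding embedding_map_def by blast
    from continuous_map_image_subset_topspace[OF this] show ?thesis using \<gamma>(2) by simp
  qed
  ultimately show ?thesis unfolding simple_closed_curve_in_def by blast
qed

lemma curve_system_image:
  assumes "nonseparating_curve_system X \<C>"
  shows "nonseparating_curve_system Y ((`) h ` \<C>) \<and> card ((`) h ` \<C>) = card \<C>"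
proof -
  have \<C>: "finite \<C>" "\<And>C. C \<in> \<C> \<Longrightarrow> simple_closed_curve_in X C" "disjoint \<C>"
    "connected_space (subtopology X (topspace X - \<Union>\<C>))"
    using assms by (auto simp: nonseparating_curve_system_def)
  have sub: "C \<subseteq> topspace X" if "C \<in> \<C>" for C
    using simple_closed_curve_image[OF \<C>(2)[OF that]] by blast
  have "inj_on ((`) h) \<C>"
    using sub image_inv by (intro inj_on_inverseI[of _ "(`) h'"]) auto
  then have card: "card ((`) h ` \<C>) = card \<C>" by (rule card_image)
  have disj: "disjoint ((`) h ` \<C>)"
    unfolding pairwise_def disjnt_def
  proof (intro ballI impI)
    fix A B assume "A \<in> (`) h ` \<C>" "B \<in> (`) h ` \<C>" "A \<noteq> B"
    then obtain C D where CD: "C \<in> \<C>" "D \<in> \<C>" "A = h ` C" "B = h ` D" "C \<noteq> D" by blast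
    then have "C \<inter> D = {}" using \<C>(3) by (auto simp: pairwise_def disjnt_def)
    then show "A \<inter> B = {}"
      unfolding CD using inj_on_image_Int[OF inj sub[OF CD(1)] sub[OF CD(2)]] by simp
  qed
  have Un: "\<Union>\<C> \<subseteq> topspace X" using sub by blast
  have "h ` (topspace X - \<Union>\<C>) = topspace Y - \<Union>((`) h ` \<C>)"
    using image_Diff[OF subset_refl Un] surj by (simp add: image_Union)
  moreover have "homeomorphism_pair (subtopology X (topspace X - \<Union>\<C>)) (subtopology Y (h ` (topspace X - \<Union>\<C>))) h h'"
    by (rule subtopology_pair) blast
  then have "subtopology X (topspace X - \<Union>\<C>) homeomorphic_space subtopology Y (h ` (topspace X - \<Union>\<C>))"
    unfolding homeomorphism_pair_def homeomorphic_space_def by blast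
  ultimately have "connected_space (subtopology Y (topspace Y - \<Union>((`) h ` \<C>)))"
    using \<C>(4) homeomorphic_connected_space by metis
  then show ?thesis
    using \<C>(1,2) disj card simple_closed_curve_image unfolding nonseparating_curve_system_def by blast
qed

text \<open>A maximal system of curves maps to a system of the same size, and the inverse
  homeomorphism bounds all systems on \<open>Y\<close>.\<close>

lemma surface_genus_transported:
  assumes "surface_genus X g"
  shows "surface_genus Y g"
proof -
  interpret s: homeomorphism_pair Y X h' h by (rule swap)
  obtain \<C> where \<C>: "nonseparating_curve_system X \<C>" "card \<C> = g"
    and max: "\<And>\<D>. nonseparating_curve_system X \<D> \<Longrightarrow> card \<D> \<le> g"
    using assms unfolding surface_genus_def by blast
  show ?thesis
    unfolding surface_genus_def
  proof (intro conjI allI impI exI)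
    show "nonseparating_curve_system Y ((`) h ` \<C>)" "card ((`) h ` \<C>) = g"
      using curve_system_image[OF \<C>(1)] \<C>(2) by auto
    show "card \<D> \<le> g" if "nonseparating_curve_system Y \<D>" for \<D>
      using s.curve_system_image[OF that] max by metis
  qed
qed

lemma closed_orientable_surface_transported:
  assumes "closed_orientable_surface X g"
  shows "closed_orientable_surface Y g"
proof -
  have hs: "X homeomorphic_space Y" using hh homeomorphic_space_def by blast
  have X: "topological_manifold 2 X" "compact_space X" "connected_space X" "topspace X \<noteq> {}" "orientable_manifold 2 X" "surface_genus X g"
    using assms by (auto simp: closed_orientable_surface_def closed_connected_orientable_manifold_def)
  have "orientable_manifold 2 Y"
    using X(5) manifold_orientation_transported unfolding orientable_manifold_def by blast
  moreover have "compact_space Y" "connected_space Y"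
    using X(2,3) hs homeomorphic_compact_space homeomorphic_connected_space by blast+
  moreover have "topspace Y \<noteq> {}" using X(4) surj by blast
  ultimately show ?thesis
    using topological_manifold_homeomorphic[OF X(1) hs] surface_genus_transported[OF X(6)]
    by (simp add: closed_orientable_surface_def closed_connected_orientable_manifold_def)
qed

end

section \<open>Transport of foliations, transversal measures and pseudo-Anosov maps\<close>

context homeomorphism_pair
begin

abbreviation (input) "him \<equiv> (`) ((`) h)"

lemma regular_part_pair:
  "S \<subseteq> topspace X \<Longrightarrow> homeomorphism_pair (regular_part X S) (regular_part Y (h ` S)) h h'"
  unfolding regular_part_def
  using subtopology_pair[of "topspace X - S"] image_Diff[of "topspace X" S] surj by simp

lemma restricted_leaves_transported:
  assumes U: "U \<subseteq> topspace X" and F: "\<And>L. L \<in> F \<Longrightarrow> L \<subseteq> topspace X"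
  shows "restricted_leaves Y (him F) (h ` U) = him (restricted_leaves X F U)"
proof -
  have "path_components_of (subtopology Y (h ` L \<inter> h ` U)) = him (path_components_of (subtopology X (L \<inter> U)))"
    if "L \<in> F" for L
  proof -
    have LU: "L \<inter> U \<subseteq> topspace X" using U by blast
    have "h ` L \<inter> h ` U = h ` (L \<inter> U)" using inj_on_image_Int[OF inj F[OF that] U] by simp
    moreover have "homeomorphic_map (subtopology X (L \<inter> U)) (subtopology Y (h ` (L \<inter> U))) h"
      using homeomorphism_pair.map(1)[OF subtopology_pair[OF LU]] .
    ultimately show ?thesis using homeomorphic_map_path_components_of by metis
  qed
  then show ?thesis
    unfolding restricted_leaves_def by (simp add: image_UN)
qed

lemma restricted_leaf_subset: "K \<in> restricted_leaves X F U \<Longrightarrow> K \<subseteq> topspace X"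
  using path_components_of_subset unfolding restricted_leaves_def by fastforce

text \<open>Composing a chart with \<open>h'\<close> cancels \<open>h\<close> on each restricted
  leaf, so a chart condition on \<open>Y\<close> refers to literally the same family of curves in
  the plane as on \<open>X\<close>.\<close>

lemma chart_image_transported:
  "(`) (\<phi> \<circ> h') ` him (restricted_leaves X F U) = (`) \<phi> ` restricted_leaves X F U"
proof -
  have "(\<phi> \<circ> h') ` h ` K = \<phi> ` K" if "K \<in> restricted_leaves X F U" for K
    using restricted_leaf_subset[OF that] by (simp only: image_comp[symmetric] image_inv)
  then have "(\<lambda>K. (\<phi> \<circ> h') ` h ` K) ` restricted_leaves X F U = (`) \<phi> ` restricted_leaves X F U"
    by (rule image_cong[OF refl])
  then show ?thesis by (simp only: image_image[of "(`) (\<phi> \<circ> h')"])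
qed

lemma plane_chart_transported:
  assumes "plane_chart X U \<phi>"
  shows "plane_chart Y (h ` U) (\<phi> \<circ> h')"
proof -
  have U: "openin X U" "homeomorphic_map (subtopology X U) euclidean \<phi>" and sub: "U \<subseteq> topspace X"
    using assms openin_subset by (auto simp: plane_chart_def)
  have "homeomorphic_map (subtopology Y (h ` U)) (subtopology X U) h'"
    by (rule homeomorphism_pair.map(2)[OF subtopology_pair[OF sub]])
  then show ?thesis
    using openin_image[OF sub] U homeomorphic_map_compose unfolding plane_chart_def by blast
qed

lemma plane_chart_subset: "plane_chart X U \<phi> \<Longrightarrow> U \<subseteq> topspace X"
  using openin_subset by (auto simp: plane_chart_def)

lemma foliation_chart_transported:
  assumes "foliation_chart X F U \<phi>" and F: "\<And>L. L \<in> F \<Longrightarrow> L \<subseteq> topspace X"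
  shows "foliation_chart Y (him F) (h ` U) (\<phi> \<circ> h')"
proof -
  have U: "plane_chart X U \<phi>" "(`) \<phi> ` restricted_leaves X F U = horizontal_lines"
    using assms(1) by (simp_all add: foliation_chart_def)
  have eq: "restricted_leaves Y (him F) (h ` U) = him (restricted_leaves X F U)"
    by (rule restricted_leaves_transported[OF plane_chart_subset[OF U(1)]]) (rule F)
  show ?thesis
    unfolding foliation_chart_def eq chart_image_transported
    by (rule conjI[OF plane_chart_transported[OF U(1)] U(2)])
qed

lemma saddle_chart_transported:
  assumes "saddle_chart component X F s q U \<psi>" and F: "\<And>L. L \<in> F \<Longrightarrow> L \<subseteq> topspace X"
  shows "saddle_chart component Y (him F) (h s) q (h ` U) (\<psi> \<circ> h')"
proof -
  have U: "plane_chart X U \<psi>" "s \<in> U" "\<psi> s = 0" "(`) \<psi> ` restricted_leaves X F (U - {s}) = saddle_leaves component q"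
    using assms(1) by (simp_all add: saddle_chart_def)
  have sub: "U \<subseteq> topspace X" by (rule plane_chart_subset[OF U(1)])
  have "h ` U - {h s} = h ` (U - {s})" using image_Diff[OF sub, of "{s}"] U(2) sub by auto
  then have eq: "restricted_leaves Y (him F) (h ` U - {h s}) = him (restricted_leaves X F (U - {s}))"
    using restricted_leaves_transported[of "U - {s}" F] sub F by (metis Diff_subset subset_trans)
  have "(\<psi> \<circ> h') (h s) = 0" using U(2,3) sub by (simp add: subset_iff)
  then show ?thesis
    unfolding saddle_chart_def eq chart_image_transported using plane_chart_transported[OF U(1)] U(2,4)
    by (intro conjI imageI)
qed

lemma saddle_singularity_transported:
  assumes "saddle_singularity X F s q" and F: "\<And>L. L \<in> F \<Longrightarrow> L \<subseteq> topspace X"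
  shows "saddle_singularity Y (him F) (h s) q"
  using assms(1) saddle_chart_transported[OF _ F] unfolding saddle_singularity_def by blast

lemma foliation_transported:
  assumes "foliation X F"
  shows "foliation Y (him F)"
proof -
  have F: "\<Union>F = topspace X" "disjoint F" "\<And>L. L \<in> F \<Longrightarrow> L \<noteq> {} \<and> path_connectedin X L"
    and ch: "\<And>x. x \<in> topspace X \<Longrightarrow> \<exists>U \<phi>. x \<in> U \<and> foliation_chart X F U \<phi>"
    using assms by (simp_all add: foliation_def)
  have sub: "L \<subseteq> topspace X" if "L \<in> F" for L using F(1) that by blast
  show ?thesis
    unfolding foliation_def
  proof (intro conjI ballI)
    show "\<Union>(him F) = topspace Y" using F(1) surj by (metis image_Union)
    show "disjoint (him F)"
      unfolding pairwise_def disjnt_def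
    proof (intro ballI impI)
      fix A B assume "A \<in> him F" "B \<in> him F" "A \<noteq> B"
      then obtain C D where CD: "C \<in> F" "D \<in> F" "A = h ` C" "B = h ` D" "C \<noteq> D" by blast
      then have "C \<inter> D = {}" using F(2) by (auto simp: pairwise_def disjnt_def)
      then show "A \<inter> B = {}"
        unfolding CD using inj_on_image_Int[OF inj sub[OF CD(1)] sub[OF CD(2)]] by simp
    qed
    fix A assume "A \<in> him F"
    then obtain L where L: "L \<in> F" "A = h ` L" by blast
    show "A \<noteq> {}" using F(3)[OF L(1)] L(2) by simp
    show "path_connectedin Y A" using F(3)[OF L(1)] L(2) path_connectedin_continuous_map_image[OF cont(1)] by blast
  next
    fix y assume y: "y \<in> topspace Y"
    then obtain U \<phi> where U: "h' y \<in> U" "foliation_chart X F U \<phi>" using ch[of "h' y"] by auto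
    have "y \<in> h ` U" using U(1) y by (metis imageI inv(2))
    then show "\<exists>U \<phi>. y \<in> U \<and> foliation_chart Y (him F) U \<phi>"
      using foliation_chart_transported[OF U(2) sub] by (intro exI conjI)
  qed
qed

lemma saddle_foliation_leaf_subset: "saddle_foliation X S F \<Longrightarrow> L \<in> F \<Longrightarrow> L \<subseteq> topspace X - S"
  by (auto simp: saddle_foliation_def foliation_def regular_part_def)

lemma saddle_foliation_transported:
  assumes "saddle_foliation X S F"
  shows "saddle_foliation Y (h ` S) (him F)"
proof -
  have S: "finite S" "S \<subseteq> topspace X" "foliation (regular_part X S) F" "\<And>s. s \<in> S \<Longrightarrow> \<exists>q. saddle_singularity X F s q"
    using assms by (simp_all add: saddle_foliation_def)
  have sub: "L \<subseteq> topspace X" if "L \<in> F" for L using saddle_foliation_leaf_subset[OF assms that] by blast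
  show ?thesis
    unfolding saddle_foliation_def
  proof (intro conjI ballI)
    show "finite (h ` S)" "h ` S \<subseteq> topspace Y" using S(1) image_sub[OF S(2)] by auto
    show "foliation (regular_part Y (h ` S)) (him F)"
      by (rule homeomorphism_pair.foliation_transported[OF regular_part_pair[OF S(2)] S(3)])
    fix t assume "t \<in> h ` S"
    then show "\<exists>q. saddle_singularity Y (him F) t q"
      using S(4) saddle_singularity_transported[OF _ sub] by blast
  qed
qed

lemma transversal_foliations_transported:
  assumes F: "saddle_foliation X S F" and G: "saddle_foliation X S G" and tr: "transversal_foliations X S F G"
  shows "transversal_foliations Y (h ` S) (him F) (him G)"
proof -
  have S: "S \<subseteq> topspace X" using F by (simp add: saddle_foliation_def)
  have sub: "L \<subseteq> topspace X" if "L \<in> F \<or> L \<in> G" for L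
    using that saddle_foliation_leaf_subset[OF F] saddle_foliation_leaf_subset[OF G] by blast
  show ?thesis
    unfolding transversal_foliations_def
  proof (intro conjI ballI)
    fix y assume y: "y \<in> topspace Y - h ` S"
    then have "h' y \<in> topspace X - S" by (metis Diff_iff imageI in_space(2) inv(2))
    then obtain U \<phi> where U: "h' y \<in> U" "plane_chart (regular_part X S) U \<phi>"
      "(`) \<phi> ` restricted_leaves X F U = horizontal_lines" "(`) \<phi> ` restricted_leaves X G U = vertical_lines"
      using bspec[OF conjunct1[OF tr[unfolded transversal_foliations_def]]] by (metis (no_types, lifting))
    have UX: "U \<subseteq> topspace X"
      using U(2) openin_subset[of "regular_part X S" U] by (auto simp: plane_chart_def regular_part_def)
    show "\<exists>U \<phi>. y \<in> U \<and> plane_chart (regular_part Y (h ` S)) U \<phi> \<and>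
        (`) \<phi> ` restricted_leaves Y (him F) U = horizontal_lines \<and>
        (`) \<phi> ` restricted_leaves Y (him G) U = vertical_lines"
    proof (intro exI conjI)
      show "y \<in> h ` U" using U(1) y by (metis Diff_iff imageI inv(2))
      show "plane_chart (regular_part Y (h ` S)) (h ` U) (\<phi> \<circ> h')"
        by (rule homeomorphism_pair.plane_chart_transported[OF regular_part_pair[OF S] U(2)])
      show "(`) (\<phi> \<circ> h') ` restricted_leaves Y (him F) (h ` U) = horizontal_lines"
        "(`) (\<phi> \<circ> h') ` restricted_leaves Y (him G) (h ` U) = vertical_lines"
      proof -
        have eq: "restricted_leaves Y (him E) (h ` U) = him (restricted_leaves X E U)" if "E = F \<or> E = G" for E
          by (rule restricted_leaves_transported[OF UX]) (use sub that in blast)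
        show "(`) (\<phi> \<circ> h') ` restricted_leaves Y (him F) (h ` U) = horizontal_lines"
          unfolding eq[OF disjI1[OF refl]] chart_image_transported by (rule U(3))
        show "(`) (\<phi> \<circ> h') ` restricted_leaves Y (him G) (h ` U) = vertical_lines"
          unfolding eq[OF disjI2[OF refl]] chart_image_transported by (rule U(4))
      qed
    qed
  next
    fix t assume "t \<in> h ` S"
    then obtain s where s: "s \<in> S" "t = h s" by blast
    obtain q U \<psi> where U: "q > 0" "saddle_chart Im X F s q U \<psi>" "saddle_chart Re X G s q U \<psi>"
      using bspec[OF conjunct2[OF tr[unfolded transversal_foliations_def]] s(1)] by (elim exE conjE)
    show "\<exists>q U \<psi>. q > 0 \<and> saddle_chart Im Y (him F) t q U \<psi> \<and> saddle_chart Re Y (him G) t q U \<psi>"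
      unfolding s(2) using U(1) saddle_chart_transported[OF U(2) sub] saddle_chart_transported[OF U(3) sub]
      by (intro exI conjI) auto
  qed
qed

lemma transversal_path_transported:
  assumes S: "S \<subseteq> topspace X" and F: "\<And>L. L \<in> F \<Longrightarrow> L \<subseteq> topspace X - S" and \<gamma>: "transversal_path X S F \<gamma>"
  shows "transversal_path Y (h ` S) (him F) (h \<circ> \<gamma>)"
proof -
  interpret r: homeomorphism_pair "regular_part X S" "regular_part Y (h ` S)" h h' by (rule regular_part_pair[OF S])
  have emb: "embedding_map (top_of_set {0..1}) (regular_part X S) \<gamma>"
    and ch: "\<And>t. t \<in> {0..1} \<Longrightarrow> \<exists>U \<phi> T. foliation_chart (regular_part X S) F U \<phi> \<and>
        openin (top_of_set {0..1}) T \<and> t \<in> T \<and> \<gamma> ` T \<subseteq> U \<and> inj_on (Im \<circ> \<phi> \<circ> \<gamma>) T"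
    using \<gamma> unfolding transversal_path_def by blast+
  have F': "L \<subseteq> topspace (regular_part X S)" if "L \<in> F" for L using F[OF that] by (auto simp: regular_part_def)
  have embh: "embedding_map (regular_part X S) (regular_part Y (h ` S)) h"
    using r.map(1) r.surj by (simp add: embedding_map_def)
  show ?thesis
    unfolding transversal_path_def
  proof (intro conjI ballI)
    show "embedding_map (top_of_set {0..1}) (regular_part Y (h ` S)) (h \<circ> \<gamma>)"
      by (rule embedding_map_compose[OF emb embh])
    fix t :: real assume "t \<in> {0..1}"
    from ch[OF this] obtain U \<phi> T where U: "foliation_chart (regular_part X S) F U \<phi>"
        "openin (top_of_set {0..1}) T" "t \<in> T" "\<gamma> ` T \<subseteq> U" "inj_on (Im \<circ> \<phi> \<circ> \<gamma>) T"
      by (elim exE conjE)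
    have UX: "U \<subseteq> topspace (regular_part X S)"
      using U(1) openin_subset by (auto simp: foliation_chart_def plane_chart_def)
    show "\<exists>U \<phi> T. foliation_chart (regular_part Y (h ` S)) (him F) U \<phi> \<and>
        openin (top_of_set {0..1}) T \<and> t \<in> T \<and> (h \<circ> \<gamma>) ` T \<subseteq> U \<and> inj_on (Im \<circ> \<phi> \<circ> (h \<circ> \<gamma>)) T"
    proof (intro exI conjI)
      show "foliation_chart (regular_part Y (h ` S)) (him F) (h ` U) (\<phi> \<circ> h')"
        by (rule r.foliation_chart_transported[OF U(1) F'])
      show "openin (top_of_set {0..1}) T" "t \<in> T" by (rule U(2,3))+
      show "(h \<circ> \<gamma>) ` T \<subseteq> h ` U" using U(4) by auto
      have eq: "(Im \<circ> (\<phi> \<circ> h') \<circ> (h \<circ> \<gamma>)) x = (Im \<circ> \<phi> \<circ> \<gamma>) x" if "x \<in> T" for x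
      proof -
        have "\<gamma> x \<in> topspace (regular_part X S)" using that U(4) UX by blast
        then show ?thesis by (simp add: r.inv)
      qed
      show "inj_on (Im \<circ> (\<phi> \<circ> h') \<circ> (h \<circ> \<gamma>)) T"
      proof (rule inj_onI)
        fix x y assume xy: "x \<in> T" "y \<in> T" "(Im \<circ> (\<phi> \<circ> h') \<circ> (h \<circ> \<gamma>)) x = (Im \<circ> (\<phi> \<circ> h') \<circ> (h \<circ> \<gamma>)) y"
        show "x = y" by (rule inj_onD[OF U(5) xy(3)[unfolded eq[OF xy(1)] eq[OF xy(2)]] xy(1,2)])
      qed
    qed
  qed
qed

lemma transversal_arc_transported:
  assumes "S \<subseteq> topspace X" "\<And>L. L \<in> F \<Longrightarrow> L \<subseteq> topspace X - S" "transversal_arc X S F A"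
  shows "transversal_arc Y (h ` S) (him F) (h ` A)"
proof -
  obtain \<gamma> where "transversal_path X S F \<gamma>" "A = \<gamma> ` {0..1}" using assms(3) unfolding transversal_arc_def by blast
  then show ?thesis
    using transversal_path_transported[OF assms(1,2)] unfolding transversal_arc_def by (metis image_comp)
qed

lemma transversal_arc_subset: "transversal_arc X S F A \<Longrightarrow> A \<subseteq> topspace X - S"
proof -
  assume "transversal_arc X S F A"
  then obtain \<gamma> where "embedding_map (top_of_set {0..1::real}) (regular_part X S) \<gamma>" "A = \<gamma> ` {0..1}"
    unfolding transversal_arc_def transversal_path_def by blast
  then show ?thesis
    using continuous_map_image_subset_topspace[of "top_of_set {0..1::real}" "regular_part X S" \<gamma>]
      homeomorphic_imp_continuous_map[of "top_of_set {0..1::real}" "subtopology (regular_part X S) (\<gamma> ` {0..1})" \<gamma>]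
      continuous_map_into_fulltopology
    unfolding embedding_map_def by (fastforce simp: regular_part_def)
qed

text \<open>A push-forward. Its sigma-algebra is the one generated by the relatively open subsets of
  the arc, since \<open>transversal_measure\<close> prescribes exactly these measurable
  sets.\<close>

definition transported_measure :: "('a set \<Rightarrow> 'a measure) \<Rightarrow> 'b set \<Rightarrow> 'b measure" where
  "transported_measure \<mu> B = distr (\<mu> (h' ` B)) (sigma B {U. openin (subtopology Y B) U}) h"

lemma sets_sigma_opens:
  "sets (sigma B {U. openin (subtopology Z B) U}) = sigma_sets B {U. openin (subtopology Z B) U}"
  "space (sigma B {U. openin (subtopology Z B) U}) = B"
proof -
  have "{U. openin (subtopology Z B) U} \<subseteq> Pow B" by (auto simp: openin_subtopology)
  then show "sets (sigma B {U. openin (subtopology Z B) U}) = sigma_sets B {U. openin (subtopology Z B) U}"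
    "space (sigma B {U. openin (subtopology Z B) U}) = B" by (simp_all add: space_measure_of_conv)
qed

lemma measurable_homeomorphism:
  assumes A: "A \<subseteq> topspace X" and N: "space N = A" "sets N = sigma_sets A {U. openin (subtopology X A) U}"
  shows "h \<in> measurable N (sigma (h ` A) {U. openin (subtopology Y (h ` A)) U})"
proof (rule measurable_measure_of)
  interpret s: homeomorphism_pair "subtopology X A" "subtopology Y (h ` A)" h h' by (rule subtopology_pair[OF A])
  show "{U. openin (subtopology Y (h ` A)) U} \<subseteq> Pow (h ` A)" by (auto simp: openin_subtopology)
  show "h \<in> space N \<rightarrow> h ` A" using N(1) by auto
  fix U assume "U \<in> {U. openin (subtopology Y (h ` A)) U}"
  then have "openin (subtopology X A) {x \<in> topspace (subtopology X A). h x \<in> U}"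
    using openin_continuous_map_preimage[OF s.cont(1)] by blast
  moreover have "{x \<in> topspace (subtopology X A). h x \<in> U} = h -` U \<inter> space N" using A N(1) by auto
  ultimately show "h -` U \<inter> space N \<in> sets N" unfolding N(2) by (auto intro: sigma_sets.Basic)
qed

lemma transported_measure_space:
  "space (transported_measure \<mu> B) = B"
  "sets (transported_measure \<mu> B) = sigma_sets B {U. openin (subtopology Y B) U}"
  by (simp_all add: transported_measure_def sets_sigma_opens)

lemma vimage_image: "E \<subseteq> A \<Longrightarrow> A \<subseteq> topspace X \<Longrightarrow> h -` h ` E \<inter> A = E"
  using inj by (fastforce dest: inj_onD)

text \<open>Both \<open>h\<close> and \<open>h'\<close> are measurable, so measurability passes in
  both directions. The backward direction matters because a non-measurable set has mass 0 by
  convention.\<close>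

lemma transported_measure_sets_iff:
  assumes A: "A \<subseteq> topspace X" and N: "space (\<mu> A) = A" "sets (\<mu> A) = sigma_sets A {U. openin (subtopology X A) U}"
    and E: "E \<subseteq> A"
  shows "h ` E \<in> sets (transported_measure \<mu> (h ` A)) \<longleftrightarrow> E \<in> sets (\<mu> A)"
proof -
  interpret s: homeomorphism_pair Y X h' h by (rule swap)
  have hA: "h' ` h ` A = A" by (rule image_inv[OF A])
  have m1: "h \<in> measurable (\<mu> A) (transported_measure \<mu> (h ` A))"
    using measurable_homeomorphism[OF A N]
    by (simp add: transported_measure_def)
  have m2: "h' \<in> measurable (transported_measure \<mu> (h ` A)) (\<mu> A)"
  proof -
    have "h' \<in> measurable (transported_measure \<mu> (h ` A)) (sigma (h' ` h ` A) {U. openin (subtopology X (h' ` h ` A)) U})"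
      by (rule s.measurable_homeomorphism[OF image_sub[OF A] transported_measure_space])
    moreover have "sets (sigma A {U. openin (subtopology X A) U}) = sets (\<mu> A)" unfolding sets_sigma_opens N(2) ..
    ultimately show ?thesis unfolding hA using measurable_cong_sets by blast
  qed
  have e1: "h -` h ` E \<inter> space (\<mu> A) = E"
    unfolding N(1) by (rule vimage_image[OF E A])
  have e2: "h' -` E \<inter> space (transported_measure \<mu> (h ` A)) = h ` E"
    unfolding transported_measure_space using E A by auto
  show ?thesis
    using measurable_sets[OF m1, of "h ` E"] measurable_sets[OF m2, of E] unfolding e1 e2 by (rule iffI)
qed

text \<open>The set \<open>E\<close> is arbitrary: if it is not measurable, both sides take the
  default value 0. Masses can therefore be rewritten without measurability conditions.\<close>

lemma emeasure_transported:
  assumes A: "A \<subseteq> topspace X" and N: "space (\<mu> A) = A" "sets (\<mu> A) = sigma_sets A {U. openin (subtopology X A) U}"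
    and E: "E \<subseteq> A"
  shows "emeasure (transported_measure \<mu> (h ` A)) (h ` E) = emeasure (\<mu> A) E"
proof (cases "E \<in> sets (\<mu> A)")
  case True
  have "h ` E \<in> sets (sigma (h ` A) {U. openin (subtopology Y (h ` A)) U})"
    using transported_measure_sets_iff[of A \<mu> E, OF A N E] True by (simp add: transported_measure_space sets_sigma_opens)
  then have "emeasure (transported_measure \<mu> (h ` A)) (h ` E) = emeasure (\<mu> A) (h -` h ` E \<inter> space (\<mu> A))"
    unfolding transported_measure_def image_inv[OF A] by (intro emeasure_distr measurable_homeomorphism[OF A N])
  also have "h -` h ` E \<inter> space (\<mu> A) = E"
    unfolding N(1) by (rule vimage_image[OF E A])
  finally show ?thesis .
next
  case False
  then show ?thesis
    using transported_measure_sets_iff[of A \<mu> E, OF A N E] by (simp add: emeasure_notin_sets)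
qed

lemma sets_transported_measure:
  assumes A: "A \<subseteq> topspace X" and N: "space (\<mu> A) = A" "sets (\<mu> A) = sigma_sets A {U. openin (subtopology X A) U}"
  shows "sets (transported_measure \<mu> (h ` A)) = (`) h ` sets (\<mu> A)"
proof
  show "sets (transported_measure \<mu> (h ` A)) \<subseteq> (`) h ` sets (\<mu> A)"
  proof
    fix E assume E: "E \<in> sets (transported_measure \<mu> (h ` A))"
    then have "E \<subseteq> h ` A" using sets.sets_into_space transported_measure_space(1) by metis
    then obtain D where D: "D \<subseteq> A" "E = h ` D" by (rule subset_imageE)
    then show "E \<in> (`) h ` sets (\<mu> A)"
      using E transported_measure_sets_iff[of A \<mu> D, OF A N D(1)] by blast
  qed
  show "(`) h ` sets (\<mu> A) \<subseteq> sets (transported_measure \<mu> (h ` A))"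
  proof
    fix E assume "E \<in> (`) h ` sets (\<mu> A)"
    then obtain D where D: "D \<in> sets (\<mu> A)" "E = h ` D" by blast
    have "D \<subseteq> A" using sets.sets_into_space[OF D(1)] N(1) by simp
    then show "E \<in> sets (transported_measure \<mu> (h ` A))"
      using D transported_measure_sets_iff[of A \<mu> D, OF A N] by blast
  qed
qed

text \<open>Arcs, paths and homotopies on \<open>Y\<close> are pulled back to \<open>X\<close>,
  where the given measure satisfies the conditions; the resulting identities of masses are then
  pushed forward again.\<close>

lemma transversal_measure_transported:
  assumes S: "S \<subseteq> topspace X" and F: "\<And>L. L \<in> F \<Longrightarrow> L \<subseteq> topspace X - S" and \<mu>: "transversal_measure X S F \<mu>"
  shows "transversal_measure Y (h ` S) (him F) (transported_measure \<mu>)"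
proof -
  interpret s: homeomorphism_pair Y X h' h by (rule swap)
  have FX: "L \<subseteq> topspace X" if "L \<in> F" for L using F[OF that] by blast
  have back_eq: "h' ` h ` S = S" "(`) h' ` him F = F"
  proof -
    show "h' ` h ` S = S" by (rule image_inv[OF S])
    have "(\<lambda>L. h' ` h ` L) ` F = (\<lambda>L. L) ` F" by (rule image_cong[OF refl image_inv[OF FX]])
    then show "(`) h' ` him F = F" by (simp only: image_image[of "(`) h'"] image_ident)
  qed
  have F': "L \<subseteq> topspace Y - h ` S" if L: "L \<in> him F" for L
  proof -
    obtain K where "K \<in> F" "L = h ` K" using L by blast
    moreover have "h ` (topspace X - S) = topspace Y - h ` S" using image_Diff[OF subset_refl S] surj by simp
    ultimately show ?thesis using F by (metis image_mono)
  qed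
  have arc_back: "transversal_arc X S F (h' ` B)" if "transversal_arc Y (h ` S) (him F) B" for B
    using s.transversal_arc_transported[OF image_sub[OF S] F' that] unfolding back_eq .
  have path_back: "transversal_path X S F (h' \<circ> \<gamma>)" if "transversal_path Y (h ` S) (him F) \<gamma>" for \<gamma>
    using s.transversal_path_transported[OF image_sub[OF S] F' that] unfolding back_eq .
  have arcs: "space (\<mu> A) = A" "sets (\<mu> A) = sigma_sets A {U. openin (subtopology X A) U}" "finite_measure (\<mu> A)"
    "\<And>x. x \<in> A \<Longrightarrow> emeasure (\<mu> A) {x} = 0" "A \<subseteq> topspace X"
    if "transversal_arc X S F A" for A
    using \<mu>[unfolded transversal_measure_def, THEN conjunct1, rule_format, OF that] transversal_arc_subset[OF that] by blast+
  have sub: "emeasure (\<mu> A) B > 0" "\<mu> B = restrict_space (\<mu> A) B"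
    if "transversal_arc X S F A" "transversal_arc X S F B" "B \<subseteq> A" for A B
    using \<mu>[unfolded transversal_measure_def, THEN conjunct1, rule_format, OF that(1)] that(2,3) by blast+
  let ?\<mu> = "transported_measure \<mu>"
  have em: "emeasure (?\<mu> B) E = emeasure (\<mu> (h' ` B)) (h' ` E)"
    if B: "transversal_arc Y (h ` S) (him F) B" and E: "E \<subseteq> B" for B E
  proof -
    have BY: "B \<subseteq> topspace Y" using s.transversal_arc_subset[OF B] by blast
    note A = arcs[OF arc_back[OF B]]
    have "emeasure (?\<mu> (h ` h' ` B)) (h ` h' ` E) = emeasure (\<mu> (h' ` B)) (h' ` E)"
      by (rule emeasure_transported[of "h' ` B" \<mu> "h' ` E", OF A(5,1,2) image_mono[OF E]])
    then show ?thesis unfolding inv_image[OF BY] inv_image[OF subset_trans[OF E BY]] .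
  qed
  show ?thesis
    unfolding transversal_measure_def
  proof (intro conjI allI impI; (elim conjE)?)
    fix B assume B: "transversal_arc Y (h ` S) (him F) B"
    have BY: "B \<subseteq> topspace Y" using s.transversal_arc_subset[OF B] by blast
    note A = arcs[OF arc_back[OF B]]
    show "space (?\<mu> B) = B" "sets (?\<mu> B) = sigma_sets B {U. openin (subtopology Y B) U}"
      by (rule transported_measure_space)+
    show "finite_measure (?\<mu> B)"
    proof (rule finite_measureI)
      have "emeasure (?\<mu> B) (space (?\<mu> B)) = emeasure (\<mu> (h' ` B)) (space (\<mu> (h' ` B)))"
        unfolding transported_measure_space A(1) by (rule em[OF B subset_refl])
      then show "emeasure (?\<mu> B) (space (?\<mu> B)) \<noteq> \<infinity>" using finite_measure.emeasure_finite[OF A(3)] by simp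
    qed
    show "\<forall>x\<in>B. emeasure (?\<mu> B) {x} = 0"
    proof
      fix x assume "x \<in> B"
      then show "emeasure (?\<mu> B) {x} = 0" using em[OF B, of "{x}"] A(4)[of "h' x"] by simp
    qed
    fix D assume D: "transversal_arc Y (h ` S) (him F) D" and DB: "D \<subseteq> B"
    have DY: "D \<subseteq> topspace Y" using DB BY by blast
    note C = arcs[OF arc_back[OF D]]
    note CA = sub[OF arc_back[OF B] arc_back[OF D] image_mono[OF DB]]
    show pos: "emeasure (?\<mu> B) D > 0" unfolding em[OF B DB] by (rule CA(1))
    \<comment> \<open>A set of positive mass is measurable, because the default value outside the
      sigma-algebra is 0.\<close>
    have DB': "D \<in> sets (?\<mu> B)" using pos emeasure_notin_sets[of D "?\<mu> B"] by (cases "D \<in> sets (?\<mu> B)") auto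
    have CA': "h' ` D \<in> sets (\<mu> (h' ` B))"
      using CA(1) emeasure_notin_sets[of "h' ` D" "\<mu> (h' ` B)"] by (cases "h' ` D \<in> sets (\<mu> (h' ` B))") auto
    show "?\<mu> D = restrict_space (?\<mu> B) D"
    proof (rule measure_eqI)
      have sB: "sets (?\<mu> B) = (`) h ` sets (\<mu> (h' ` B))"
        using sets_transported_measure[of "h' ` B" \<mu>, OF A(5,1,2)] unfolding inv_image[OF BY] .
      have sD: "sets (?\<mu> D) = (`) h ` sets (\<mu> (h' ` D))"
        using sets_transported_measure[of "h' ` D" \<mu>, OF C(5,1,2)] unfolding inv_image[OF DY] .
      have "h ` (h' ` D \<inter> E) = D \<inter> h ` E" if "E \<in> sets (\<mu> (h' ` B))" for E
      proof -
        have "E \<subseteq> topspace X" using sets.sets_into_space[OF that] A(1,5) by blast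
        then show ?thesis using inj_on_image_Int[OF inj C(5)] inv_image[OF DY] by simp
      qed
      then have "(\<lambda>E. h ` (h' ` D \<inter> E)) ` sets (\<mu> (h' ` B)) = (\<lambda>E. D \<inter> h ` E) ` sets (\<mu> (h' ` B))"
        by (rule image_cong[OF refl])
      then show "sets (?\<mu> D) = sets (restrict_space (?\<mu> B) D)"
        unfolding sD CA(2) sets_restrict_space sB by (simp only: image_image)
      fix E assume "E \<in> sets (?\<mu> D)"
      then have E: "E \<subseteq> D" using sets.sets_into_space transported_measure_space(1) by metis
      have "emeasure (?\<mu> D) E = emeasure (restrict_space (\<mu> (h' ` B)) (h' ` D)) (h' ` E)"
        unfolding em[OF D E] CA(2) ..
      also have "\<dots> = emeasure (\<mu> (h' ` B)) (h' ` E)"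
        using CA' image_mono[OF E] by (intro emeasure_restrict_space) (simp_all add: sets.Int_space_eq2)
      also have "\<dots> = emeasure (?\<mu> B) E" using em[OF B] E DB by (metis subset_trans)
      also have "\<dots> = emeasure (restrict_space (?\<mu> B) D) E"
        using DB' E by (intro emeasure_restrict_space[symmetric]) (simp_all add: sets.Int_space_eq2)
      finally show "emeasure (?\<mu> D) E = emeasure (restrict_space (?\<mu> B) D) E" .
    qed
  next
    fix H \<gamma>\<^sub>0 \<gamma>\<^sub>1
    assume \<gamma>: "transversal_path Y (h ` S) (him F) \<gamma>\<^sub>0" "transversal_path Y (h ` S) (him F) \<gamma>\<^sub>1"
      and H: "continuous_map (prod_topology (top_of_set {0..1::real}) (top_of_set {0..1::real})) Y H"
        "\<forall>t\<in>{0..1}. H (t, 0) = \<gamma>\<^sub>0 t \<and> H (t, 1) = \<gamma>\<^sub>1 t"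
        "\<forall>t\<in>{0..1}. \<exists>L\<in>him F. \<forall>s\<in>{0..1}. H (t, s) \<in> L"
    have arc: "transversal_arc Y (h ` S) (him F) (\<gamma>\<^sub>0 ` {0..1})" "transversal_arc Y (h ` S) (him F) (\<gamma>\<^sub>1 ` {0..1})"
      using \<gamma> unfolding transversal_arc_def by blast+
    have leaf: "\<forall>t\<in>{0..1}. \<exists>L\<in>F. \<forall>s\<in>{0..1}. (h' \<circ> H) (t, s) \<in> L"
    proof
      fix t :: real assume "t \<in> {0..1}"
      then obtain L where L: "L \<in> him F" "\<forall>s\<in>{0..1}. H (t, s) \<in> L" using bspec[OF H(3) \<open>t \<in> {0..1}\<close>] by (elim bexE)
      then obtain K where K: "K \<in> F" "L = h ` K" by blast
      have "(h' \<circ> H) (t, s) \<in> K" if "s \<in> {0..1}" for s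
      proof -
        have "h' (H (t, s)) \<in> h' ` h ` K" using L(2) that K(2) by blast
        then show ?thesis unfolding image_inv[OF FX[OF K(1)]] by simp
      qed
      then show "\<exists>L\<in>F. \<forall>s\<in>{0..1}. (h' \<circ> H) (t, s) \<in> L" using K(1) by (intro bexI[of _ K] ballI)
    qed
    \<comment> \<open>The leafwise homotopy is pulled back by \<open>h'\<close>, and the holonomy
      invariance of \<mu> on \<open>X\<close> is applied to it.\<close>
    have "\<forall>E\<in>sets borel. E \<subseteq> {0..1} \<longrightarrow> emeasure (\<mu> ((h' \<circ> \<gamma>\<^sub>0) ` {0..1})) ((h' \<circ> \<gamma>\<^sub>0) ` E) =
        emeasure (\<mu> ((h' \<circ> \<gamma>\<^sub>1) ` {0..1})) ((h' \<circ> \<gamma>\<^sub>1) ` E)"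
    proof (rule \<mu>[unfolded transversal_measure_def, THEN conjunct2, THEN spec[of _ "h' \<circ> H"], THEN spec[of _ "h' \<circ> \<gamma>\<^sub>0"],
        THEN spec[of _ "h' \<circ> \<gamma>\<^sub>1"], THEN mp], intro conjI path_back \<gamma> leaf continuous_map_compose[OF H(1) cont(2)])
      show "\<forall>t\<in>{0..1}. (h' \<circ> H) (t, 0) = (h' \<circ> \<gamma>\<^sub>0) t \<and> (h' \<circ> H) (t, 1) = (h' \<circ> \<gamma>\<^sub>1) t"
        using H(2) by simp
    qed
    then show "\<forall>E\<in>sets borel. E \<subseteq> {0..1} \<longrightarrow> emeasure (?\<mu> (\<gamma>\<^sub>0 ` {0..1})) (\<gamma>\<^sub>0 ` E) = emeasure (?\<mu> (\<gamma>\<^sub>1 ` {0..1})) (\<gamma>\<^sub>1 ` E)"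
      using em[OF arc(1) image_mono] em[OF arc(2) image_mono] by (simp add: image_comp)
  qed
qed

end

text \<open>The same dilatation serves for the conjugate, since the transport leaves the masses of
  arcs unchanged.\<close>

theorem pseudo_anosov_transported:
  assumes hh: "homeomorphism_pair X Y h h'" and pA: "pseudo_anosov X Q"
  shows "pseudo_anosov Y (h \<circ> Q \<circ> h')"
proof -
  interpret homeomorphism_pair X Y h h' by fact
  obtain k where k: "pseudo_anosov_with_dilatation X k Q" using pA unfolding pseudo_anosov_def by blast
  have Q: "homeomorphic_map X X Q" and k1: "k > 1"
    using k unfolding pseudo_anosov_with_dilatation_def by blast+
  obtain S F G \<mu> \<nu> where sF: "saddle_foliation X S F" and sG: "saddle_foliation X S G"
    and tr: "transversal_foliations X S F G" and QF: "(`) Q ` F = F" and QG: "(`) Q ` G = G"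
    and sing: "\<forall>s\<in>S. (\<exists>q\<ge>3. saddle_singularity X F s q) \<and> (\<exists>q\<ge>3. saddle_singularity X G s q)"
    and \<mu>: "transversal_measure X S F \<mu>" and \<nu>: "transversal_measure X S G \<nu>"
    and scale_\<mu>: "\<forall>A. transversal_arc X S F A \<longrightarrow> measure (\<mu> (Q ` A)) (Q ` A) = k * measure (\<mu> A) A"
    and scale_\<nu>: "\<forall>A. transversal_arc X S G A \<longrightarrow> measure (\<nu> (Q ` A)) (Q ` A) = inverse k * measure (\<nu> A) A"
    using k[unfolded pseudo_anosov_with_dilatation_def] by (elim conjE exE)
  have S: "S \<subseteq> topspace X" and UF: "\<Union>F = topspace X - S" and UG: "\<Union>G = topspace X - S"
    using sF sG by (auto simp: saddle_foliation_def foliation_def regular_part_def)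
  have FS: "L \<subseteq> topspace X - S" if "L \<in> F" for L using UF that by blast
  have GS: "L \<subseteq> topspace X - S" if "L \<in> G" for L using UG that by blast
  have FX: "L \<subseteq> topspace X" if "L \<in> F" for L using FS[OF that] by blast
  have GX: "L \<subseteq> topspace X" if "L \<in> G" for L using GS[OF that] by blast
  let ?Q = "h \<circ> Q \<circ> h'"
  have invariant: "(`) ?Q ` him E = him E" if E: "(`) Q ` E = E" "\<And>L. L \<in> E \<Longrightarrow> L \<subseteq> topspace X" for E
  proof -
    have "?Q ` h ` L = h ` Q ` L" if "L \<in> E" for L
    proof -
      have "?Q ` h ` L = h ` Q ` h' ` h ` L" by (simp only: image_comp comp_assoc)
      then show ?thesis unfolding image_inv[OF E(2)[OF that]] .
    qed
    then have "(\<lambda>L. ?Q ` h ` L) ` E = (\<lambda>L. h ` Q ` L) ` E" by (rule image_cong[OF refl])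
    then have "(`) ?Q ` him E = him ((`) Q ` E)" by (simp only: image_image[of "(`) ?Q"] image_image[of "(`) h"])
    then show ?thesis unfolding E(1) .
  qed
  \<comment> \<open>Since \<open>Q\<close> permutes the leaves, it preserves their union, which is
    the complement of \<open>S\<close>. Hence \<open>Q\<close> takes transversal arcs of the regular
    part to transversal arcs of the same regular part.\<close>
  have QS: "Q ` S = S"
  proof -
    have "Q ` (topspace X - S) = topspace X - S"
    proof -
      have "Q ` \<Union>F = \<Union>((`) Q ` F)" by blast
      then show ?thesis unfolding QF UF .
    qed
    moreover have "Q ` topspace X = topspace X" "inj_on Q (topspace X)"
      using homeomorphic_imp_surjective_map[OF Q] homeomorphic_imp_injective_map[OF Q] .
    ultimately have "topspace X - Q ` S = topspace X - S"
      using inj_on_image_set_diff[of Q "topspace X" "topspace X" S] S by simp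
    moreover have "Q ` S \<subseteq> topspace X" using S \<open>Q ` topspace X = topspace X\<close> by blast
    ultimately show ?thesis using S by blast
  qed
  obtain Q' where "homeomorphic_maps X X Q Q'" using Q homeomorphic_map_maps by blast
  then interpret q: homeomorphism_pair X X Q Q' by unfold_locales
  have Qarc: "transversal_arc X S E (Q ` A)"
    if "transversal_arc X S E A" "(`) Q ` E = E" "\<And>L. L \<in> E \<Longrightarrow> L \<subseteq> topspace X - S" for E A
    using q.transversal_arc_transported[OF S that(3,1)] unfolding QS that(2) .
  interpret s: homeomorphism_pair Y X h' h by (rule swap)
  have scale: "measure (transported_measure \<rho> (?Q ` B)) (?Q ` B) = c * measure (transported_measure \<rho> B) B"
    if E: "\<And>L. L \<in> E \<Longrightarrow> L \<subseteq> topspace X - S" "(`) Q ` E = E" and \<rho>: "transversal_measure X S E \<rho>"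
      and sc: "\<forall>A. transversal_arc X S E A \<longrightarrow> measure (\<rho> (Q ` A)) (Q ` A) = c * measure (\<rho> A) A"
      and B: "transversal_arc Y (h ` S) (him E) B" for E \<rho> c B
  proof -
    have EX: "L \<subseteq> topspace X" if "L \<in> E" for L using E(1)[OF that] by blast
    have "h ` (topspace X - S) = topspace Y - h ` S" using image_Diff[OF subset_refl S] surj by simp
    then have E': "L \<subseteq> topspace Y - h ` S" if "L \<in> him E" for L using that E(1) by blast
    have "(\<lambda>L. h' ` h ` L) ` E = (\<lambda>L. L) ` E" by (rule image_cong[OF refl image_inv[OF EX]])
    then have back_eq: "(`) h' ` him E = E" by (simp only: image_image[of "(`) h'"] image_ident)
    have A: "transversal_arc X S E (h' ` B)"
      using s.transversal_arc_transported[OF image_sub[OF S] E' B] unfolding back_eq image_inv[OF S] .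
    have em: "measure (transported_measure \<rho> (h ` A)) (h ` A) = measure (\<rho> A) A" if A: "transversal_arc X S E A" for A
    proof -
      have "space (\<rho> A) = A" "sets (\<rho> A) = sigma_sets A {U. openin (subtopology X A) U}" "A \<subseteq> topspace X"
        using \<rho>[unfolded transversal_measure_def, THEN conjunct1, rule_format, OF A] transversal_arc_subset[OF A] by blast+
      then show ?thesis using emeasure_transported[of A \<rho> A] by (simp add: Sigma_Algebra.measure_def)
    qed
    have BY: "B \<subseteq> topspace Y" using s.transversal_arc_subset[OF B] by blast
    have "?Q ` B = h ` Q ` h' ` B" by (simp only: image_comp comp_assoc)
    then have "measure (transported_measure \<rho> (?Q ` B)) (?Q ` B) = measure (\<rho> (Q ` h' ` B)) (Q ` h' ` B)"
      using em[OF Qarc[OF A E(2,1)]] by simp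
    also have "\<dots> = c * measure (\<rho> (h' ` B)) (h' ` B)" using sc A by blast
    also have "measure (\<rho> (h' ` B)) (h' ` B) = measure (transported_measure \<rho> B) B"
      using em[OF A] unfolding inv_image[OF BY] by simp
    finally show ?thesis .
  qed
  have homeo: "homeomorphic_map Y Y ?Q"
    by (rule homeomorphic_map_compose[OF map(2) homeomorphic_map_compose[OF Q map(1)]])
  have "pseudo_anosov_with_dilatation Y k ?Q"
    unfolding pseudo_anosov_with_dilatation_def
  proof (rule conjI[OF homeo conjI[OF k1]], rule exI[of _ "h ` S"], rule exI[of _ "him F"], rule exI[of _ "him G"],
      rule exI[of _ "transported_measure \<mu>"], rule exI[of _ "transported_measure \<nu>"], intro conjI)
    show "\<forall>t\<in>h ` S. (\<exists>q\<ge>3. saddle_singularity Y (him F) t q) \<and> (\<exists>q\<ge>3. saddle_singularity Y (him G) t q)"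
    proof
      fix t assume "t \<in> h ` S"
      then obtain s where s: "s \<in> S" "t = h s" by blast
      from bspec[OF sing s(1)] obtain p q where pq: "p \<ge> 3" "saddle_singularity X F s p" "q \<ge> 3" "saddle_singularity X G s q"
        by (elim conjE exE)
      show "(\<exists>q\<ge>3. saddle_singularity Y (him F) t q) \<and> (\<exists>q\<ge>3. saddle_singularity Y (him G) t q)"
        unfolding s(2) using pq(1,3) saddle_singularity_transported[OF pq(2) FX] saddle_singularity_transported[OF pq(4) GX]
        by (intro conjI exI[of _ p] exI[of _ q])
    qed
    show "\<forall>A. transversal_arc Y (h ` S) (him F) A \<longrightarrow>
        measure (transported_measure \<mu> (?Q ` A)) (?Q ` A) = k * measure (transported_measure \<mu> A) A"
      by (intro allI impI scale[OF FS QF \<mu> scale_\<mu>])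
    show "\<forall>A. transversal_arc Y (h ` S) (him G) A \<longrightarrow>
        measure (transported_measure \<nu> (?Q ` A)) (?Q ` A) = inverse k * measure (transported_measure \<nu> A) A"
      by (intro allI impI scale[OF GS QG \<nu> scale_\<nu>])
    show "(`) ?Q ` him F = him F" by (rule invariant[OF QF FX])
    show "(`) ?Q ` him G = him G" by (rule invariant[OF QG GX])
    show "transversal_measure Y (h ` S) (him F) (transported_measure \<mu>)" by (rule transversal_measure_transported[OF S FS \<mu>])
    show "transversal_measure Y (h ` S) (him G) (transported_measure \<nu>)" by (rule transversal_measure_transported[OF S GS \<nu>])
  qed (rule saddle_foliation_transported[OF sF] saddle_foliation_transported[OF sG]
      transversal_foliations_transported[OF sF sG tr])+
  then show ?thesis unfolding pseudo_anosov_def by blast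
qed

section \<open>Recurrence of pseudo-Anosov homeomorphisms\<close>

text \<open>The condition of \<open>transversal_foliations\<close> away from the saddles, with
  restricted leaves taken in the regular part itself. In this form it is symmetric in the two
  foliations.\<close>

definition transversal_regular :: "'a topology \<Rightarrow> 'a set set \<Rightarrow> 'a set set \<Rightarrow> bool" where
  "transversal_regular Y F G \<longleftrightarrow>
     (\<forall>x\<in>topspace Y. \<exists>U \<phi>. x \<in> U \<and> plane_chart Y U \<phi> \<and>
        (`) \<phi> ` restricted_leaves Y F U = horizontal_lines \<and>
        (`) \<phi> ` restricted_leaves Y G U = vertical_lines)"

lemma topspace_regular_part [simp]: "topspace (regular_part X S) = topspace X - S"
  by (auto simp: regular_part_def)

lemma homeomorphic_map_swap: "homeomorphic_map euclidean euclidean (\<lambda>z. Complex (Im z) (Re z))"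
proof -
  have "continuous_on UNIV (\<lambda>z. Complex (Im z) (Re z))"
    unfolding Complex_eq by (intro continuous_intros)
  then have "homeomorphic_maps euclidean euclidean (\<lambda>z. Complex (Im z) (Re z)) (\<lambda>z. Complex (Im z) (Re z))"
    by (simp add: homeomorphic_maps_def)
  then show ?thesis
    using homeomorphic_maps_map by blast
qed

text \<open>Exchanging real and imaginary parts swaps horizontal and vertical lines. Every result
  about \<mu> on vertical segments thus gives one about \<nu> on horizontal segments.\<close>

lemma transversal_regular_sym:
  assumes "transversal_regular Y F G"
  shows "transversal_regular Y G F"
  unfolding transversal_regular_def
proof
  let ?w = "\<lambda>z. Complex (Im z) (Re z)"
  have w: "?w ` {z. Im z = c} = {z. Re z = c}" "?w ` {z. Re z = c} = {z. Im z = c}" for c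
  proof -
    have "?w (?w z) = z" for z by (simp add: complex_eq_iff)
    then have *: "z \<in> ?w ` A \<longleftrightarrow> ?w z \<in> A" for z A by (metis (no_types, lifting) image_iff)
    show "?w ` {z. Im z = c} = {z. Re z = c}"
      unfolding set_eq_iff * mem_Collect_eq complex.sel by simp
    show "?w ` {z. Re z = c} = {z. Im z = c}"
      unfolding set_eq_iff * mem_Collect_eq complex.sel by simp
  qed
  fix x assume x: "x \<in> topspace Y"
  obtain U \<phi> where U: "x \<in> U" "plane_chart Y U \<phi>"
    "(`) \<phi> ` restricted_leaves Y F U = horizontal_lines" "(`) \<phi> ` restricted_leaves Y G U = vertical_lines"
    using bspec[OF assms[unfolded transversal_regular_def] x] by (elim exE conjE)
  have "plane_chart Y U (?w \<circ> \<phi>)"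
    using U(2) homeomorphic_map_compose[OF _ homeomorphic_map_swap] by (auto simp: plane_chart_def)
  moreover have "(`) (?w \<circ> \<phi>) ` A = (`) ?w ` (`) \<phi> ` A" for A
    by (auto simp: image_comp o_def image_image)
  moreover have "(`) ?w ` horizontal_lines = vertical_lines" "(`) ?w ` vertical_lines = horizontal_lines"
    unfolding horizontal_lines_def vertical_lines_def image_image w by (rule refl)+
  ultimately show "\<exists>U \<phi>. x \<in> U \<and> plane_chart Y U \<phi> \<and>
        (`) \<phi> ` restricted_leaves Y G U = horizontal_lines \<and> (`) \<phi> ` restricted_leaves Y F U = vertical_lines"
    using U by (intro exI[of _ U] exI[of _ "?w \<circ> \<phi>"] conjI) simp_all
qed

lemma path_connected_subset_restricted_leaf:
  assumes "path_connectedin Y C" "C \<subseteq> U" "C \<subseteq> L" "L \<in> F" "C \<noteq> {}"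
  obtains K where "K \<in> restricted_leaves Y F U" "C \<subseteq> K"
proof -
  have "path_connectedin (subtopology Y (L \<inter> U)) C"
    using assms by (simp add: path_connectedin_subtopology)
  then obtain K where "K \<in> path_components_of (subtopology Y (L \<inter> U))" "C \<subseteq> K"
    using exists_path_component_of_superset assms(5)
    by (metis path_connectedin_empty path_connectedin_subset_topspace subset_empty)
  then show ?thesis using that assms(4) unfolding restricted_leaves_def by blast
qed

lemma restricted_leafE:
  assumes "K \<in> restricted_leaves Y F U"
  obtains L where "L \<in> F" "K \<subseteq> L" "K \<subseteq> U"
  using assms path_components_of_subset unfolding restricted_leaves_def by fastforce

text \<open>A path-connected piece of a leaf that stays inside the chart lies in a single plaque,
  and plaques are carried onto whole lines.\<close>

lemma horizontal_level_constant:
  assumes "(`) \<phi> ` restricted_leaves Y F U = horizontal_lines"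
    and "path_connectedin Y C" "C \<subseteq> U" "C \<subseteq> L" "L \<in> F" "x \<in> C" "y \<in> C"
  shows "Im (\<phi> x) = Im (\<phi> y)"
proof -
  obtain K where K: "K \<in> restricted_leaves Y F U" "C \<subseteq> K"
    using path_connected_subset_restricted_leaf assms(2-6) by (metis empty_iff)
  then have "\<phi> ` K \<in> horizontal_lines" using assms(1) by blast
  then obtain c where "\<phi> ` K = {z. Im z = c}" unfolding horizontal_lines_def by blast
  moreover have "\<phi> x \<in> \<phi> ` K" "\<phi> y \<in> \<phi> ` K" using K(2) assms(6,7) by blast+
  ultimately show ?thesis by simp
qed

lemma vertical_level_constant:
  assumes "(`) \<phi> ` restricted_leaves Y F U = vertical_lines"
    and "path_connectedin Y C" "C \<subseteq> U" "C \<subseteq> L" "L \<in> F" "x \<in> C" "y \<in> C"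
  shows "Re (\<phi> x) = Re (\<phi> y)"
proof -
  obtain K where K: "K \<in> restricted_leaves Y F U" "C \<subseteq> K"
    using path_connected_subset_restricted_leaf assms(2-6) by (metis empty_iff)
  then have "\<phi> ` K \<in> vertical_lines" using assms(1) by blast
  then obtain c where "\<phi> ` K = {z. Re z = c}" unfolding vertical_lines_def by blast
  moreover have "\<phi> x \<in> \<phi> ` K" "\<phi> y \<in> \<phi> ` K" using K(2) assms(6,7) by blast+
  ultimately show ?thesis by simp
qed

lemma level_set_in_leaf:
  assumes "inj_on \<phi> U" "(`) \<phi> ` restricted_leaves Y F U = \<L>" "l \<in> \<L>"
  obtains L where "L \<in> F" "{x \<in> U. \<phi> x \<in> l} \<subseteq> L"
proof -
  obtain K where K: "K \<in> restricted_leaves Y F U" "\<phi> ` K = l"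
    using assms(2,3) by blast
  obtain L where L: "L \<in> F" "K \<subseteq> L" "K \<subseteq> U" using restricted_leafE[OF K(1)] .
  have "{x \<in> U. \<phi> x \<in> l} \<subseteq> L"
    using assms(1) K(2) L by (fastforce dest: inj_onD)
  then show ?thesis using that L by blast
qed

lemma path_connectedin_interval_image:
  assumes "continuous_map (top_of_set I) Y \<gamma>" "J \<subseteq> I" "is_interval (J :: real set)"
  shows "path_connectedin Y (\<gamma> ` J)"
proof -
  have "path_connectedin (top_of_set I) J"
    using assms(2,3) by (simp add: path_connectedin_subtopology is_interval_path_connected)
  then show ?thesis using assms(1) path_connectedin_continuous_map_image by blast
qed

lemma embedding_map_interval:
  assumes "Hausdorff_space Y" "continuous_map (top_of_set {s..t::real}) Y \<gamma>" "inj_on \<gamma> {s..t}"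
  shows "embedding_map (top_of_set {s..t}) Y \<gamma>"
proof -
  have "compact_space (top_of_set {s..t})"
    by (simp add: compact_space_subtopology)
  then have "closed_map (top_of_set {s..t}) Y \<gamma>"
    using assms by (intro continuous_imp_closed_map) auto
  then show ?thesis
    using assms by (intro injective_closed_imp_embedding_map) auto
qed

text \<open>In a chart straightening both foliations, a connected piece of a \<open>G\<close>-leaf
  has constant real part. As the chart and the path are injective, the imaginary part is then
  injective along the path, and this is transversality to \<open>F\<close>.\<close>

lemma leaf_path_transversal:
  assumes haus: "Hausdorff_space X" and tr: "transversal_regular (regular_part X S) F G"
    and \<gamma>: "continuous_map (top_of_set {s..t}) (regular_part X S) \<gamma>" "inj_on \<gamma> {s..t}"
    and L: "\<gamma> ` {s..t} \<subseteq> L" "L \<in> G" and st: "s < t"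
  shows "transversal_path X S F (\<lambda>r. \<gamma> (s + r * (t - s)))"
  unfolding transversal_path_def
proof (intro conjI ballI)
  let ?Y = "regular_part X S"
  let ?\<delta> = "\<lambda>r. \<gamma> (s + r * (t - s))"
  have hY: "Hausdorff_space ?Y"
    using haus by (simp add: regular_part_def Hausdorff_space_subtopology)
  have aff: "s + r * (t - s) \<in> {s..t}" if "r \<in> {0..1}" for r
  proof -
    have "0 \<le> r * (t - s)" "r * (t - s) \<le> 1 * (t - s)"
      using that st by (auto intro: mult_right_mono simp del: mult_1_left)
    then show ?thesis by simp
  qed
  have "continuous_map (top_of_set {0..1}) (top_of_set {s..t}) (\<lambda>r. s + r * (t - s))"
    using aff by (auto simp: continuous_map_in_subtopology intro!: continuous_intros)
  from continuous_map_compose[OF this \<gamma>(1)]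
  have \<delta>: "continuous_map (top_of_set {0..1}) ?Y ?\<delta>" by (simp add: o_def)
  have inj: "inj_on ?\<delta> {0..1}"
  proof (rule inj_onI)
    fix p q assume "p \<in> {0..1}" "q \<in> {0..1}" "?\<delta> p = ?\<delta> q"
    then have "s + p * (t - s) = s + q * (t - s)"
      using inj_onD[OF \<gamma>(2)] aff by blast
    then show "p = q" using st by simp
  qed
  show "embedding_map (top_of_set {0..1}) ?Y ?\<delta>"
    by (rule embedding_map_interval[OF hY \<delta> inj])
  fix r :: real assume r: "r \<in> {0..1}"
  have "?\<delta> r \<in> topspace ?Y"
  proof -
    have "?\<delta> ` {0..1} \<subseteq> topspace ?Y"
      using continuous_map_image_subset_topspace[OF \<delta>] by (simp only: topspace_euclidean_subtopology)
    then show ?thesis using r by (rule subsetD[OF _ imageI])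
  qed
  then obtain U \<phi> where U: "?\<delta> r \<in> U" "plane_chart ?Y U \<phi>"
    "(`) \<phi> ` restricted_leaves ?Y F U = horizontal_lines" "(`) \<phi> ` restricted_leaves ?Y G U = vertical_lines"
    using bspec[OF tr[unfolded transversal_regular_def] \<open>?\<delta> r \<in> topspace ?Y\<close>] by (elim exE conjE)
  have oU: "openin ?Y U" using U by (simp add: plane_chart_def)
  have "openin (top_of_set {0..1}) {q \<in> topspace (top_of_set {0..1}). ?\<delta> q \<in> U}"
    using \<delta> oU by (rule openin_continuous_map_preimage)
  then have "openin (top_of_set {0..1}) {q \<in> {0..1}. ?\<delta> q \<in> U}" by simp
  then obtain W where W: "open W" "{q \<in> {0..1}. ?\<delta> q \<in> U} = {0..1} \<inter> W"
    by (meson openin_open)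
  then obtain \<epsilon> where \<epsilon>: "\<epsilon> > 0" "ball r \<epsilon> \<subseteq> W"
    using r U(1) open_contains_ball by (metis (mono_tags, lifting) IntD2 mem_Collect_eq)
  let ?T = "{0..1} \<inter> ball r \<epsilon>"
  have T: "openin (top_of_set {0..1}) ?T" "r \<in> ?T" "?\<delta> ` ?T \<subseteq> U"
    using r \<epsilon> W by (auto simp: openin_open)
  \<comment> \<open>An interval of parameters has a path-connected image, which therefore lies in
    one plaque of \<open>G\<close> and not merely in one leaf.\<close>
  have int: "is_interval ?T"
    by (intro is_interval_Int) (simp_all add: ball_eq_greaterThanLessThan is_interval_cc is_interval_oo)
  have pc: "path_connectedin ?Y (?\<delta> ` ?T)"
    by (rule path_connectedin_interval_image[OF \<delta> _ int]) auto
  have sub: "?\<delta> ` ?T \<subseteq> L" using L aff by blast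
  have injU: "inj_on \<phi> U"
    using U(2) oU homeomorphic_imp_injective_map openin_subset
    by (metis plane_chart_def topspace_subtopology_subset)
  have "inj_on (Im \<circ> \<phi> \<circ> ?\<delta>) ?T"
  proof (rule inj_onI)
    fix p q assume p: "p \<in> ?T" and q: "q \<in> ?T" and eq: "(Im \<circ> \<phi> \<circ> ?\<delta>) p = (Im \<circ> \<phi> \<circ> ?\<delta>) q"
    have "Re (\<phi> (?\<delta> p)) = Re (\<phi> (?\<delta> q))"
      using vertical_level_constant[OF U(4) pc T(3) sub L(2)] p q by blast
    then have "\<phi> (?\<delta> p) = \<phi> (?\<delta> q)" using eq by (simp add: complex_eq_iff)
    then have "?\<delta> p = ?\<delta> q" using injU T(3) p q by (meson image_subset_iff inj_onD)
    then show "p = q" using inj p q by (auto dest: inj_onD)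
  qed
  then show "\<exists>U \<phi> T. foliation_chart ?Y F U \<phi> \<and> openin (top_of_set {0..1}) T \<and> r \<in> T \<and>
     ?\<delta> ` T \<subseteq> U \<and> inj_on (Im \<circ> \<phi> \<circ> ?\<delta>) T"
    using T U by (intro exI[of _ U] exI[of _ \<phi>] exI[of _ ?T] conjI) (simp_all add: foliation_chart_def)
qed

lemma affine_image_unit_interval:
  assumes "s < (t::real)"
  shows "(\<lambda>r. s + r * (t - s)) ` {0..1} = {s..t}"
proof -
  have "(\<lambda>r. (t - s) * r + s) ` {0..1} = {s..t}"
    using assms by (simp add: image_affinity_atLeastAtMost)
  moreover have "(\<lambda>r. (t - s) * r + s) = (\<lambda>r. s + r * (t - s))"
    by (auto simp: algebra_simps)
  ultimately show ?thesis by metis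
qed

lemma leaf_arc_transversal:
  assumes "Hausdorff_space X" "transversal_regular (regular_part X S) F G"
    "continuous_map (top_of_set {s..t}) (regular_part X S) \<gamma>" "inj_on \<gamma> {s..t}"
    "\<gamma> ` {s..t} \<subseteq> L" "L \<in> G" "s < (t::real)"
  shows "transversal_arc X S F (\<gamma> ` {s..t})"
proof -
  have "(\<lambda>r. \<gamma> (s + r * (t - s))) ` {0..1} = \<gamma> ` {s..t}"
    using affine_image_unit_interval[OF assms(7)] by (metis image_image)
  then show ?thesis
    using leaf_path_transversal[OF assms] unfolding transversal_arc_def by blast
qed

text \<open>The function is the distribution function of the measure pulled back to the parameter
  interval. Absence of atoms makes it continuous, and positivity on subarcs makes it strictly
  increasing.\<close>

lemma arc_length_function:
  assumes haus: "Hausdorff_space X" and tr: "transversal_regular (regular_part X S) F G"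
    and \<mu>: "transversal_measure X S F \<mu>"
    and \<gamma>: "continuous_map (top_of_set {a..b}) (regular_part X S) \<gamma>" "inj_on \<gamma> {a..b}"
    and L: "\<gamma> ` {a..b} \<subseteq> L" "L \<in> G" and ab: "a < b"
  obtains f :: "real \<Rightarrow> real" where "continuous_on UNIV f" "strict_mono_on {a..b} f"
    "\<And>s t. a \<le> s \<Longrightarrow> s < t \<Longrightarrow> t \<le> b \<Longrightarrow> measure (\<mu> (\<gamma> ` {s..t})) (\<gamma> ` {s..t}) = f t - f s"
proof -
  let ?Y = "regular_part X S"
  let ?A = "\<gamma> ` {a..b}"
  have arc: "transversal_arc X S F (\<gamma> ` {s..t})" if "a \<le> s" "s < t" "t \<le> b" for s t
  proof (rule leaf_arc_transversal[OF haus tr _ _ _ L(2) that(2)])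
    have sub: "{s..t} \<subseteq> {a..b}" using that by auto
    show "continuous_map (top_of_set {s..t}) ?Y \<gamma>"
      using continuous_map_from_subtopology_mono[OF \<gamma>(1) sub] .
    show "inj_on \<gamma> {s..t}" "\<gamma> ` {s..t} \<subseteq> L"
      using \<gamma>(2) L(1) sub by (auto intro: inj_on_subset)
  qed
  have A: "transversal_arc X S F ?A" using arc[of a b] ab by simp
  have \<mu>A: "space (\<mu> ?A) = ?A" "sets (\<mu> ?A) = sigma_sets ?A {U. openin (subtopology X ?A) U}"
    "finite_measure (\<mu> ?A)" "\<And>x. x \<in> ?A \<Longrightarrow> emeasure (\<mu> ?A) {x} = 0"
    "\<And>B. transversal_arc X S F B \<Longrightarrow> B \<subseteq> ?A \<Longrightarrow> emeasure (\<mu> ?A) B > 0 \<and> \<mu> B = restrict_space (\<mu> ?A) B"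
    using \<mu> A unfolding transversal_measure_def by blast+
  interpret A: finite_measure "\<mu> ?A" by (rule \<mu>A(3))
  let ?g = "inv_into {a..b} \<gamma>"
  have hY: "Hausdorff_space ?Y"
    using haus by (simp add: regular_part_def Hausdorff_space_subtopology)
  have subY: "?A \<subseteq> topspace ?Y"
    using continuous_map_image_subset_topspace[OF \<gamma>(1)] by simp
  have "homeomorphic_map (top_of_set {a..b}) (subtopology ?Y ?A) \<gamma>"
    using embedding_map_interval[OF hY \<gamma>] by (simp add: embedding_map_def)
  moreover have "subtopology ?Y ?A = subtopology X ?A"
    using subY by (simp add: regular_part_def subtopology_subtopology Int_absorb1)
  ultimately have om: "open_map (top_of_set {a..b}) (subtopology X ?A) \<gamma>"
    using homeomorphic_imp_open_map by simp
  have meas: "?g \<in> borel_measurable (\<mu> ?A)"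
  proof (rule borel_measurableI)
    fix W :: "real set" assume "open W"
    have "?g -` W \<inter> space (\<mu> ?A) = \<gamma> ` ({a..b} \<inter> W)"
      using \<gamma>(2) by (auto simp: \<mu>A(1))
    also have "openin (subtopology X ?A) \<dots>"
      using om \<open>open W\<close> by (auto simp: open_map_def openin_open)
    finally show "?g -` W \<inter> space (\<mu> ?A) \<in> sets (\<mu> ?A)"
      unfolding \<mu>A(2) by (auto intro: sigma_sets.Basic)
  qed
  \<comment> \<open>The inverse of \<gamma> is measurable since \<gamma> is a homeomorphism onto the
    arc. The measure \<open>N\<close> on the line is concentrated on \<open>{a..b}\<close>.\<close>
  define N where "N = distr (\<mu> ?A) borel ?g"
  interpret N: finite_borel_measure N
    unfolding finite_borel_measure_def finite_borel_measure_axioms_def N_def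
    using A.finite_measure_distr[OF meas] by simp
  have Nset: "measure N E = measure (\<mu> ?A) (\<gamma> ` (E \<inter> {a..b}))" if "E \<in> sets borel" for E
  proof -
    have "?g -` E \<inter> space (\<mu> ?A) = \<gamma> ` (E \<inter> {a..b})"
      using \<gamma>(2) by (auto simp: \<mu>A(1))
    then show ?thesis using that meas by (simp add: N_def measure_distr)
  qed
  have Npt: "measure N {t} = 0" for t
  proof (cases "t \<in> {a..b}")
    case True
    then show ?thesis using Nset[of "{t}"] \<mu>A(4)[of "\<gamma> t"] by (simp add: Sigma_Algebra.measure_def)
  next
    case False
    then have "{t} \<inter> {a..b} = {}" by auto
    then show ?thesis using Nset[of "{t}"] by simp
  qed
  \<comment> \<open>The distribution function measures half-open intervals; the missing endpoint is
    a null set.\<close>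
  have interval: "measure N {s..t} = cdf N t - cdf N s" if "s < t" for s t
  proof -
    have "measure N {s..t} = measure N {s} + measure N {s<..t}"
      using that by (subst N.finite_measure_Union[symmetric])
        (auto simp: N.M_is_borel intro!: arg_cong[where f = "measure N"])
    then show ?thesis using N.cdf_diff_eq[OF that] Npt by simp
  qed
  have sub: "emeasure (\<mu> ?A) (\<gamma> ` {s..t}) > 0" "measure (\<mu> (\<gamma> ` {s..t})) (\<gamma> ` {s..t}) = measure N {s..t}"
    if st: "a \<le> s" "s < t" "t \<le> b" for s t
  proof -
    have sb: "\<gamma> ` {s..t} \<subseteq> ?A" using st by auto
    have "{s..t} \<inter> {a..b} = {s..t}" using st by auto
    then have m: "measure N {s..t} = measure (\<mu> ?A) (\<gamma> ` {s..t})" using Nset[of "{s..t}"] unfolding \<open>{s..t} \<inter> {a..b} = {s..t}\<close> by simp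
    have "?g -` {s..t} \<inter> space (\<mu> ?A) = \<gamma> ` {s..t}"
      using \<gamma>(2) st by (auto simp: \<mu>A(1) intro!: image_eqI)
    then have B: "\<gamma> ` {s..t} \<in> sets (\<mu> ?A)"
      using measurable_sets[OF meas, of "{s..t}"] by simp
    show "emeasure (\<mu> ?A) (\<gamma> ` {s..t}) > 0"
      using \<mu>A(5)[OF arc[OF st] sb] by simp
    show "measure (\<mu> (\<gamma> ` {s..t})) (\<gamma> ` {s..t}) = measure N {s..t}"
      using \<mu>A(5)[OF arc[OF st] sb] B m sb \<mu>A(1)
      by (simp add: measure_restrict_space Int_absorb2)
  qed
  show ?thesis
  proof (rule that[of "cdf N"])
    show "continuous_on UNIV (cdf N)"
      using N.isCont_cdf Npt by (simp add: continuous_at_imp_continuous_on)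
    show "strict_mono_on {a..b} (cdf N)"
    proof (rule strict_mono_onI)
      fix s t assume "s \<in> {a..b}" "t \<in> {a..b}" "s < t"
      then have st: "a \<le> s" "s < t" "t \<le> b" by auto
      have "{s..t} \<inter> {a..b} = {s..t}" using st by auto
      then have "measure N {s..t} = measure (\<mu> ?A) (\<gamma> ` {s..t})" using Nset[of "{s..t}"] unfolding \<open>{s..t} \<inter> {a..b} = {s..t}\<close> by simp
      also have "\<dots> > 0" using sub(1)[OF st] by (simp add: A.emeasure_eq_measure)
      finally show "cdf N s < cdf N t" using interval[OF st(2)] by simp
    qed
    show "measure (\<mu> (\<gamma> ` {s..t})) (\<gamma> ` {s..t}) = cdf N t - cdf N s" if "a \<le> s" "s < t" "t \<le> b" for s t
      using sub(2)[OF that] interval[OF that(2)] by simp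
  qed
qed

subsection \<open>Charts by rectangles\<close>

abbreviation (input) rectangle :: "real \<Rightarrow> real \<Rightarrow> real \<Rightarrow> real \<Rightarrow> (real \<times> real) set" where
  "rectangle a b c d \<equiv> {a<..<b} \<times> {c<..<d}"

text \<open>Horizontal segments lie in leaves of \<open>F\<close> and vertical segments in leaves of \<open>G\<close>;
  the last two conditions say that plaques are path components of leaves.\<close>

locale box_chart =
  fixes Y :: "'a topology" and F G :: "'a set set" and a b c d :: real and \<sigma> :: "real \<times> real \<Rightarrow> 'a"
  assumes ab: "a < b" and cd: "c < d"
    and cont: "continuous_map (top_of_set (rectangle a b c d)) Y \<sigma>"
    and inj: "inj_on \<sigma> (rectangle a b c d)"
    and open_image: "\<And>W. open W \<Longrightarrow> W \<subseteq> rectangle a b c d \<Longrightarrow> openin Y (\<sigma> ` W)"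
    and horizontal: "\<And>y. y \<in> {c<..<d} \<Longrightarrow> \<exists>L\<in>F. \<forall>x\<in>{a<..<b}. \<sigma> (x, y) \<in> L"
    and vertical: "\<And>x. x \<in> {a<..<b} \<Longrightarrow> \<exists>L\<in>G. \<forall>y\<in>{c<..<d}. \<sigma> (x, y) \<in> L"
    and horizontal_plaque: "\<And>C L u v. L \<in> F \<Longrightarrow> path_connectedin Y C \<Longrightarrow> C \<subseteq> L \<Longrightarrow> C \<subseteq> \<sigma> ` rectangle a b c d \<Longrightarrow>
        u \<in> rectangle a b c d \<Longrightarrow> v \<in> rectangle a b c d \<Longrightarrow> \<sigma> u \<in> C \<Longrightarrow> \<sigma> v \<in> C \<Longrightarrow> snd u = snd v"
    and vertical_plaque: "\<And>C L u v. L \<in> G \<Longrightarrow> path_connectedin Y C \<Longrightarrow> C \<subseteq> L \<Longrightarrow> C \<subseteq> \<sigma> ` rectangle a b c d \<Longrightarrow>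
        u \<in> rectangle a b c d \<Longrightarrow> v \<in> rectangle a b c d \<Longrightarrow> \<sigma> u \<in> C \<Longrightarrow> \<sigma> v \<in> C \<Longrightarrow> fst u = fst v"

text \<open>These are the natural flat coordinates of a pair of measured foliations: heights measure
  \<mu>-mass and widths measure \<nu>-mass. Only closed segments inside the open rectangle are
  measured.\<close>

definition measured_box_chart ::
  "'a topology \<Rightarrow> 'a set set \<Rightarrow> 'a set set \<Rightarrow> ('a set \<Rightarrow> 'a measure) \<Rightarrow> ('a set \<Rightarrow> 'a measure) \<Rightarrow>
     real \<Rightarrow> real \<Rightarrow> real \<Rightarrow> real \<Rightarrow> (real \<times> real \<Rightarrow> 'a) \<Rightarrow> bool" where
  "measured_box_chart Y F G \<mu> \<nu> a b c d \<sigma> \<longleftrightarrow>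
     box_chart Y F G a b c d \<sigma> \<and>
     (\<forall>x s t. x \<in> {a<..<b} \<and> c < s \<and> s < t \<and> t < d \<longrightarrow>
        measure (\<mu> (\<sigma> ` ({x} \<times> {s..t}))) (\<sigma> ` ({x} \<times> {s..t})) = t - s) \<and>
     (\<forall>y s t. y \<in> {c<..<d} \<and> a < s \<and> s < t \<and> t < b \<longrightarrow>
        measure (\<nu> (\<sigma> ` ({s..t} \<times> {y}))) (\<sigma> ` ({s..t} \<times> {y})) = t - s)"

text \<open>Exchanging the foliations together with the coordinates is a symmetry of the definition,
  by which statements about vertical segments also cover horizontal ones.\<close>

lemma box_chart_swap:
  assumes "box_chart Y F G a b c d \<sigma>"
  shows "box_chart Y G F c d a b (\<sigma> \<circ> prod.swap)"
proof -
  have sw: "prod.swap ` (A \<times> B) = B \<times> A" for A B :: "real set" by (auto simp: image_iff)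
  have cs: "continuous_on A (prod.swap :: real \<times> real \<Rightarrow> real \<times> real)" for A
    unfolding prod.swap_def by (intro continuous_intros)
  have im: "(\<sigma> \<circ> prod.swap) ` rectangle c d a b = \<sigma> ` rectangle a b c d"
    by (simp only: image_comp[symmetric] sw)
  interpret box_chart Y F G a b c d \<sigma> by fact
  show ?thesis
  proof (rule box_chart.intro, goal_cases)
    case 1 show ?case by (rule cd)
  next
    case 2 show ?case by (rule ab)
  next
    case 3
    have "continuous_map (top_of_set (rectangle c d a b)) (top_of_set (rectangle a b c d)) prod.swap"
      using cs by (auto simp: continuous_map_in_subtopology)
    then show ?case using cont by (rule continuous_map_compose)
  next
    case 4
    show ?case
      using inj by (intro comp_inj_on) (simp_all only: sw inj_swap)
  next
    case (5 W)
    have "prod.swap ` W = prod.swap -` W" by (auto simp: image_iff) (metis swap_simp)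
    then have "open (prod.swap ` W)"
      using 5 by (simp add: open_vimage cs)
    moreover have "prod.swap ` W \<subseteq> rectangle a b c d" using 5 by auto
    ultimately have "openin Y (\<sigma> ` prod.swap ` W)" by (rule open_image)
    then show ?case by (simp only: image_comp)
  next
    case (6 y) then show ?case using vertical by simp
  next
    case (7 x) then show ?case using horizontal by simp
  next
    case (8 C L u v)
    from 8 vertical_plaque[of L C "prod.swap u" "prod.swap v"] show ?case
      unfolding im by auto
  next
    case (9 C L u v)
    from 9 horizontal_plaque[of L C "prod.swap u" "prod.swap v"] show ?case
      unfolding im by auto
  qed
qed

lemma open_parametrization_inverse:
  assumes h: "continuous_map (top_of_set (rectangle a b c d)) Y \<sigma>" "inj_on \<sigma> (rectangle a b c d)"
    "\<And>W. open W \<Longrightarrow> W \<subseteq> rectangle a b c d \<Longrightarrow> openin Y (\<sigma> ` W)"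
  obtains g where "continuous_map (subtopology Y (\<sigma> ` rectangle a b c d)) (top_of_set (rectangle a b c d)) g"
    "\<And>v. v \<in> rectangle a b c d \<Longrightarrow> g (\<sigma> v) = v" "\<And>x. x \<in> \<sigma> ` rectangle a b c d \<Longrightarrow> \<sigma> (g x) = x"
proof -
  let ?B = "rectangle a b c d"
  have oB: "open ?B" by (simp add: open_Times)
  have sub: "\<sigma> ` ?B \<subseteq> topspace Y" using continuous_map_image_subset_topspace[OF h(1)] by simp
  have "homeomorphic_map (top_of_set ?B) (subtopology Y (\<sigma> ` ?B)) \<sigma>"
  proof (rule bijective_open_imp_homeomorphic_map)
    show "continuous_map (top_of_set ?B) (subtopology Y (\<sigma> ` ?B)) \<sigma>"
      using h(1) by (auto simp: continuous_map_in_subtopology)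
    show "open_map (top_of_set ?B) (subtopology Y (\<sigma> ` ?B)) \<sigma>"
      unfolding open_map_def
    proof (intro allI impI)
      fix W assume "openin (top_of_set ?B) W"
      then have "open W" "W \<subseteq> ?B" using oB openin_open_eq by auto
      then show "openin (subtopology Y (\<sigma> ` ?B)) (\<sigma> ` W)"
        unfolding openin_subtopology using h(3)[of W] by (intro exI[of _ "\<sigma> ` W"]) auto
    qed
  qed (use h sub in auto)
  then obtain g where g: "homeomorphic_maps (top_of_set ?B) (subtopology Y (\<sigma> ` ?B)) \<sigma> g"
    using homeomorphic_map_maps by blast
  then show ?thesis
    using that[of g] unfolding homeomorphic_maps_def topspace_subtopology_subset[OF sub] topspace_euclidean_subtopology
    by blast
qed

lemmas (in box_chart) chart_inverse = open_parametrization_inverse[OF cont inj open_image]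

lemma box_chart_vertical:
  assumes "box_chart Y F G a b c d \<sigma>" and x: "x \<in> {a<..<b}" and I: "I \<subseteq> {c<..<d}"
  shows "continuous_map (top_of_set I) Y (\<lambda>y. \<sigma> (x, y))" "inj_on (\<lambda>y. \<sigma> (x, y)) I"
    "\<exists>L\<in>G. (\<lambda>y. \<sigma> (x, y)) ` I \<subseteq> L" "(\<lambda>y. \<sigma> (x, y)) ` I = \<sigma> ` ({x} \<times> I)"
proof -
  interpret box_chart Y F G a b c d \<sigma> by fact
  note h = cont inj vertical[OF x]
  have "continuous_map (top_of_set I) (top_of_set (rectangle a b c d)) (\<lambda>y. (x, y))"
    using x I by (auto simp: continuous_map_in_subtopology intro!: continuous_intros)
  from continuous_map_compose[OF this h(1)]
  show "continuous_map (top_of_set I) Y (\<lambda>y. \<sigma> (x, y))" by (simp add: o_def)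
  show "inj_on (\<lambda>y. \<sigma> (x, y)) I"
  proof (rule inj_onI)
    fix s t assume "s \<in> I" "t \<in> I" "\<sigma> (x, s) = \<sigma> (x, t)"
    then have "(x, s) = (x, t)" using x I by (intro inj_onD[OF h(2)]) auto
    then show "s = t" by simp
  qed
  show "\<exists>L\<in>G. (\<lambda>y. \<sigma> (x, y)) ` I \<subseteq> L" using h(3) I by blast
  show "(\<lambda>y. \<sigma> (x, y)) ` I = \<sigma> ` ({x} \<times> I)" by auto
qed

lemma box_chart_holonomy:
  assumes haus: "Hausdorff_space X" and tr: "transversal_regular (regular_part X S) F G"
    and \<mu>: "transversal_measure X S F \<mu>" and \<sigma>: "box_chart (regular_part X S) F G a b c d \<sigma>"
    and x: "x \<in> {a<..<b}" "x' \<in> {a<..<b}" and st: "c < s" "s < t" "t < d"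
  shows "measure (\<mu> (\<sigma> ` ({x} \<times> {s..t}))) (\<sigma> ` ({x} \<times> {s..t})) =
         measure (\<mu> (\<sigma> ` ({x'} \<times> {s..t}))) (\<sigma> ` ({x'} \<times> {s..t}))"
proof -
  let ?Y = "regular_part X S"
  let ?p = "\<lambda>x r. \<sigma> (x, s + r * (t - s))"
  have I: "{s..t} \<subseteq> {c<..<d}" using st by auto
  have tp: "transversal_path X S F (?p z)" if z: "z \<in> {a<..<b}" for z
  proof -
    obtain L where L: "L \<in> G" "(\<lambda>y. \<sigma> (z, y)) ` {s..t} \<subseteq> L"
      using box_chart_vertical(3)[OF \<sigma> z I] by blast
    show ?thesis
      using leaf_path_transversal[OF haus tr box_chart_vertical(1,2)[OF \<sigma> z I] L(2,1) st(2)] .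
  qed
  have aff: "s + r * (t - s) \<in> {s..t}" if "r \<in> {0..1}" for r
    using affine_image_unit_interval[OF st(2)] that by blast
  have im: "?p z ` {0..1} = \<sigma> ` ({z} \<times> {s..t})" for z
  proof -
    have "?p z ` {0..1} = (\<lambda>y. \<sigma> (z, y)) ` (\<lambda>r. s + r * (t - s)) ` {0..1}" by (simp only: image_image)
    then show ?thesis unfolding affine_image_unit_interval[OF st(2)] by auto
  qed
  let ?II = "prod_topology (top_of_set {0..1::real}) (top_of_set {0..1::real})"
  let ?H = "\<lambda>(r, q). \<sigma> ((1 - q) * x + q * x', s + r * (t - s))"
  have ms: "(1 - q) * x + q * x' \<in> {a<..<b}" if "q \<in> {0..1}" for q
    using that x convex_bound_lt[of x b x' "1 - q" q] convex_bound_lt[of "-x" "-a" "-x'" "1 - q" q]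
    by (auto simp: algebra_simps)
  have "continuous_map (top_of_set ({0..1} \<times> {0..1})) (top_of_set (rectangle a b c d))
     (\<lambda>(r, q). ((1 - q) * x + q * x', s + r * (t - s)))"
    using ms aff I by (force simp: continuous_map_in_subtopology case_prod_unfold intro!: continuous_intros)
  moreover have "continuous_map (top_of_set (rectangle a b c d)) X \<sigma>"
    using box_chart.cont[OF \<sigma>] continuous_map_into_fulltopology unfolding regular_part_def by blast
  ultimately have "continuous_map (top_of_set ({0..1} \<times> {0..1})) X
     (\<sigma> \<circ> (\<lambda>(r, q). ((1 - q) * x + q * x', s + r * (t - s))))"
    by (rule continuous_map_compose)
  moreover have "?II = top_of_set ({0..1} \<times> {0..1})"
    by (simp add: prod_topology_subtopology_eu)
  ultimately have H: "continuous_map ?II X ?H"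
    by (simp add: o_def case_prod_unfold)
  have leaf: "\<forall>r\<in>{0..1}. \<exists>L\<in>F. \<forall>q\<in>{0..1}. ?H (r, q) \<in> L"
  proof
    fix r :: real assume r: "r \<in> {0..1}"
    then have "s + r * (t - s) \<in> {c<..<d}" using aff I by blast
    from box_chart.horizontal[OF \<sigma> this]
    obtain L where "L \<in> F" "\<forall>x\<in>{a<..<b}. \<sigma> (x, s + r * (t - s)) \<in> L" by (elim bexE)
    then show "\<exists>L\<in>F. \<forall>q\<in>{0..1}. ?H (r, q) \<in> L"
      using ms by (intro bexI[of _ L] ballI) simp_all
  qed
  have "\<forall>E\<in>sets borel. E \<subseteq> {0..1} \<longrightarrow>
           emeasure (\<mu> (?p x ` {0..1})) (?p x ` E) = emeasure (\<mu> (?p x' ` {0..1})) (?p x' ` E)"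
  proof (rule \<mu>[unfolded transversal_measure_def, THEN conjunct2, THEN spec[of _ ?H], THEN spec[of _ "?p x"],
        THEN spec[of _ "?p x'"], THEN mp], intro conjI tp x H leaf ballI)
    show "?H (r, 0) = ?p x r" "?H (r, 1) = ?p x' r" for r by simp_all
  qed
  then have "emeasure (\<mu> (?p x ` {0..1})) (?p x ` {0..1}) = emeasure (\<mu> (?p x' ` {0..1})) (?p x' ` {0..1})"
    by simp
  then show ?thesis unfolding im by (simp add: Sigma_Algebra.measure_def)
qed

text \<open>The chart is an open rectangle, so its vertical segments might have infinite mass
  towards their ends. One of them is therefore assumed to extend to a closed arc \<gamma> in a leaf,
  whose length function is finite up to both ends; holonomy spreads this function over the whole
  chart.\<close>

lemma box_chart_length_function:
  assumes haus: "Hausdorff_space X" and tr: "transversal_regular (regular_part X S) F G"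
    and \<mu>: "transversal_measure X S F \<mu>" and \<sigma>: "box_chart (regular_part X S) F G a b c d \<sigma>"
    and x0: "x0 \<in> {a<..<b}"
    and \<gamma>: "continuous_map (top_of_set {c..d}) (regular_part X S) \<gamma>" "inj_on \<gamma> {c..d}" "\<gamma> ` {c..d} \<subseteq> L" "L \<in> G"
    and eq: "\<And>y. y \<in> {c<..<d} \<Longrightarrow> \<sigma> (x0, y) = \<gamma> y"
  obtains f :: "real \<Rightarrow> real" where "continuous_on UNIV f" "strict_mono_on {c..d} f"
    "\<And>x s t. x \<in> {a<..<b} \<Longrightarrow> c < s \<Longrightarrow> s < t \<Longrightarrow> t < d \<Longrightarrow>
       measure (\<mu> (\<sigma> ` ({x} \<times> {s..t}))) (\<sigma> ` ({x} \<times> {s..t})) = f t - f s"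
proof -
  have cd: "c < d" by (rule box_chart.cd[OF \<sigma>])
  obtain f :: "real \<Rightarrow> real" where f: "continuous_on UNIV f" "strict_mono_on {c..d} f"
    "\<And>s t. c \<le> s \<Longrightarrow> s < t \<Longrightarrow> t \<le> d \<Longrightarrow> measure (\<mu> (\<gamma> ` {s..t})) (\<gamma> ` {s..t}) = f t - f s"
    using arc_length_function[OF haus tr \<mu> \<gamma> cd] by blast
  show ?thesis
  proof (rule that[OF f(1,2)])
    fix x s t assume x: "x \<in> {a<..<b}" and st: "c < s" "s < t" "t < d"
    have "\<sigma> ` ({x0} \<times> {s..t}) = \<gamma> ` {s..t}"
    proof -
      have "\<sigma> ` ({x0} \<times> {s..t}) = (\<lambda>y. \<sigma> (x0, y)) ` {s..t}" by auto
      also have "\<dots> = \<gamma> ` {s..t}" using st eq by (intro image_cong) auto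
      finally show ?thesis .
    qed
    then show "measure (\<mu> (\<sigma> ` ({x} \<times> {s..t}))) (\<sigma> ` ({x} \<times> {s..t})) = f t - f s"
      using box_chart_holonomy[OF haus tr \<mu> \<sigma> x x0 st] f(3)[of s t] st by simp
  qed
qed

lemma strict_mono_inverse:
  fixes f :: "real \<Rightarrow> real"
  assumes ab: "a < b" and f: "continuous_on UNIV f" "strict_mono_on {a..b} f"
  obtains g where "continuous_on {f a<..<f b} g" "\<And>x. x \<in> {a<..<b} \<Longrightarrow> f x \<in> {f a<..<f b} \<and> g (f x) = x"
    "\<And>y. y \<in> {f a<..<f b} \<Longrightarrow> g y \<in> {a<..<b} \<and> f (g y) = y" "strict_mono_on {f a<..<f b} g"
proof -
  let ?g = "inv_into {a..b} f"
  have inj: "inj_on f {a..b}" using f(2) strict_mono_on_imp_inj_on by blast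
  have gf: "?g (f x) = x" if "x \<in> {a..b}" for x using inj that by simp
  have lt: "f x < f y" if "x \<in> {a..b}" "y \<in> {a..b}" "x < y" for x y
    using strict_mono_onD[OF f(2)] that by blast
  have fim: "f ` {a..b} = {f a..f b}"
  proof
    show "f ` {a..b} \<subseteq> {f a..f b}"
    proof
      fix y assume "y \<in> f ` {a..b}"
      then obtain x where x: "x \<in> {a..b}" "y = f x" by blast
      have "f a \<le> f x" using lt[of a x] x ab by (cases "a = x") auto
      moreover have "f x \<le> f b" using lt[of x b] x ab by (cases "x = b") auto
      ultimately show "y \<in> {f a..f b}" using x by simp
    qed
    show "{f a..f b} \<subseteq> f ` {a..b}"
    proof
      fix y assume "y \<in> {f a..f b}"
      then obtain x where "a \<le> x" "x \<le> b" "f x = y"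
        using IVT'[of f a y b] ab continuous_on_subset[OF f(1), of "{a..b}"] by auto
      then show "y \<in> f ` {a..b}" by auto
    qed
  qed
  have fg: "?g y \<in> {a..b}" "f (?g y) = y" if "y \<in> {f a..f b}" for y
    using that inv_into_into[of y f "{a..b}"] f_inv_into_f[of y f "{a..b}"] unfolding fim by auto
  have "continuous_on (f ` {a..b}) ?g"
    using gf f(1) by (intro continuous_on_inv) (auto intro: continuous_on_subset)
  then have c: "continuous_on {f a<..<f b} ?g"
    unfolding fim by (rule continuous_on_subset) auto
  have g: "?g y \<in> {a<..<b} \<and> f (?g y) = y" if "y \<in> {f a<..<f b}" for y
  proof -
    have y: "y \<in> {f a..f b}" using that by auto
    have "?g y \<noteq> a" "?g y \<noteq> b" using fg[OF y] that by auto
    then show ?thesis using fg[OF y] by auto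
  qed
  have m: "strict_mono_on {f a<..<f b} ?g"
  proof (rule strict_mono_onI)
    fix y z assume yz: "y \<in> {f a<..<f b}" "z \<in> {f a<..<f b}" "y < z"
    show "?g y < ?g z"
    proof (rule ccontr)
      assume "\<not> ?g y < ?g z"
      then consider "?g z < ?g y" | "?g z = ?g y" by linarith
      then have "f (?g z) \<le> f (?g y)"
      proof cases
        case 1
        then show ?thesis using lt[of "?g z" "?g y"] g[OF yz(1)] g[OF yz(2)] by auto
      qed auto
      then show False using g[OF yz(1)] g[OF yz(2)] yz(3) by simp
    qed
  qed
  show ?thesis
    by (rule that[OF c _ g m]) (use lt ab gf in auto)
qed

lemma strict_mono_on_image_interval:
  fixes g :: "real \<Rightarrow> real"
  assumes g: "continuous_on {p<..<q} g" "strict_mono_on {p<..<q} g" and st: "p < s" "s < t" "t < q"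
  shows "g ` {s..t} = {g s..g t}"
proof -
  have sub: "{s..t} \<subseteq> {p<..<q}" using st by auto
  have cl: "closed_segment s t = {s..t}" using st by (simp add: closed_segment_eq_real_ivl)
  have "g s < g t" using strict_mono_onD[OF g(2)] st by auto
  moreover have "inj_on g {s..t}" using strict_mono_on_imp_inj_on[OF g(2)] sub inj_on_subset by blast
  ultimately show ?thesis
    using continuous_injective_image_segment_1[of s t g] continuous_on_subset[OF g(1) sub] cl
    by (simp add: closed_segment_eq_real_ivl)
qed

lemma box_chart_reparametrize:
  assumes \<sigma>: "box_chart Y F G a b c d \<sigma>" and ab': "a' < b'" "c' < d'"
    and g: "continuous_on {a'<..<b'} g" "strict_mono_on {a'<..<b'} g" "g ` {a'<..<b'} = {a<..<b}"
    and h: "continuous_on {c'<..<d'} h" "strict_mono_on {c'<..<d'} h" "h ` {c'<..<d'} = {c<..<d}"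
  shows "box_chart Y F G a' b' c' d' (\<sigma> \<circ> map_prod g h)"
    "(\<sigma> \<circ> map_prod g h) ` rectangle a' b' c' d' = \<sigma> ` rectangle a b c d"
proof -
  let ?m = "map_prod g h" and ?R = "rectangle a b c d" and ?R' = "rectangle a' b' c' d'"
  have mim: "?m ` ?R' = ?R" using g(3) h(3) by (simp add: map_prod_surj_on)
  show im: "(\<sigma> \<circ> ?m) ` ?R' = \<sigma> ` ?R" by (simp only: image_comp[symmetric] mim)
  have minj: "inj_on ?m ?R'"
    using strict_mono_on_imp_inj_on g(2) h(2) by (intro map_prod_inj_on) blast+
  have mc: "continuous_on ?R' ?m"
    unfolding map_prod_def case_prod_unfold
    by (intro continuous_intros continuous_on_compose2[OF g(1)] continuous_on_compose2[OF h(1)]) auto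
  have m: "?m v \<in> ?R" if "v \<in> ?R'" for v using that mim by blast
  have gx: "g x \<in> {a<..<b}" if "x \<in> {a'<..<b'}" for x using that g(3) by blast
  have hy: "h y \<in> {c<..<d}" if "y \<in> {c'<..<d'}" for y using that h(3) by blast
  interpret box_chart Y F G a b c d \<sigma> by fact
  show "box_chart Y F G a' b' c' d' (\<sigma> \<circ> ?m)"
  proof (rule box_chart.intro, goal_cases)
    case 1 show ?case by (rule ab'(1))
  next
    case 2 show ?case by (rule ab'(2))
  next
    case 3
    have "continuous_map (top_of_set ?R') (top_of_set ?R) ?m"
      using mc m by (auto simp: continuous_map_in_subtopology)
    then show ?case using cont by (rule continuous_map_compose)
  next
    case 4
    show ?case by (rule comp_inj_on[OF minj]) (simp only: mim inj)
  next
    case (5 W)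
    \<comment> \<open>The reparametrization is an injective continuous map between open subsets of
      the plane, so invariance of domain makes it open.\<close>
    have "open (?m ` W)"
      by (rule invariance_of_domain[OF continuous_on_subset[OF mc 5(2)] 5(1) inj_on_subset[OF minj 5(2)]])
    moreover have "?m ` W \<subseteq> ?R" using image_mono[OF 5(2), of ?m] unfolding mim .
    ultimately have "openin Y (\<sigma> ` ?m ` W)" by (rule open_image)
    then show ?case by (simp only: image_comp)
  next
    case (6 y)
    obtain L where "L \<in> F" "\<forall>x\<in>{a<..<b}. \<sigma> (x, h y) \<in> L" using horizontal[OF hy[OF 6]] by (elim bexE)
    then show ?case using gx by (intro bexI[of _ L] ballI) simp_all
  next
    case (7 x)
    obtain L where "L \<in> G" "\<forall>y\<in>{c<..<d}. \<sigma> (g x, y) \<in> L" using vertical[OF gx[OF 7]] by (elim bexE)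
    then show ?case using hy by (intro bexI[of _ L] ballI) simp_all
  next
    case (8 C L u v)
    have "snd (?m u) = snd (?m v)"
      using 8 by (intro horizontal_plaque[of L C "?m u" "?m v"] m) (auto simp only: im o_apply)
    then have "h (snd u) = h (snd v)" by (simp add: map_prod_def case_prod_unfold)
    then show ?case
      using inj_onD[OF strict_mono_on_imp_inj_on[OF h(2)]] 8(5,6) by (auto simp: mem_Times_iff)
  next
    case (9 C L u v)
    have "fst (?m u) = fst (?m v)"
      using 9 by (intro vertical_plaque[of L C "?m u" "?m v"] m) (auto simp only: im o_apply)
    then have "g (fst u) = g (fst v)" by (simp add: map_prod_def case_prod_unfold)
    then show ?case
      using inj_onD[OF strict_mono_on_imp_inj_on[OF g(2)]] 9(5,6) by (auto simp: mem_Times_iff)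
  qed
qed

text \<open>The new coordinates are the accumulated masses \<open>e\<close> and \<open>f\<close>
  along the two sides; composing the chart with their inverses turns masses of segments into
  coordinate differences. The two closed arcs keep the new rectangle bounded.\<close>

lemma measured_box_chart_exists:
  assumes haus: "Hausdorff_space X" and tr: "transversal_regular (regular_part X S) F G"
    and \<mu>: "transversal_measure X S F \<mu>" and \<nu>: "transversal_measure X S G \<nu>"
    and \<sigma>: "box_chart (regular_part X S) F G a b c d \<sigma>"
    and x0: "x0 \<in> {a<..<b}"
    and \<gamma>: "continuous_map (top_of_set {c..d}) (regular_part X S) \<gamma>" "inj_on \<gamma> {c..d}" "\<gamma> ` {c..d} \<subseteq> L" "L \<in> G"
      "\<And>y. y \<in> {c<..<d} \<Longrightarrow> \<sigma> (x0, y) = \<gamma> y"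
    and y0: "y0 \<in> {c<..<d}"
    and \<delta>: "continuous_map (top_of_set {a..b}) (regular_part X S) \<delta>" "inj_on \<delta> {a..b}" "\<delta> ` {a..b} \<subseteq> K" "K \<in> F"
      "\<And>x. x \<in> {a<..<b} \<Longrightarrow> \<sigma> (x, y0) = \<delta> x"
  shows "\<exists>a' b' c' d' \<sigma>'. measured_box_chart (regular_part X S) F G \<mu> \<nu> a' b' c' d' \<sigma>' \<and>
    \<sigma>' ` rectangle a' b' c' d' = \<sigma> ` rectangle a b c d"
proof -
  have ab: "a < b" "c < d" by (rule box_chart.ab[OF \<sigma>] box_chart.cd[OF \<sigma>])+
  obtain f where f: "continuous_on UNIV f" "strict_mono_on {c..d} f"
    "\<And>x s t. x \<in> {a<..<b} \<Longrightarrow> c < s \<Longrightarrow> s < t \<Longrightarrow> t < d \<Longrightarrow>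
       measure (\<mu> (\<sigma> ` ({x} \<times> {s..t}))) (\<sigma> ` ({x} \<times> {s..t})) = f t - f s"
    using box_chart_length_function[OF haus tr \<mu> \<sigma> x0 \<gamma>] by blast
  have \<delta>': "(\<sigma> \<circ> prod.swap) (y0, x) = \<delta> x" if "x \<in> {a<..<b}" for x using \<delta>(5)[OF that] by simp
  obtain e where e: "continuous_on UNIV e" "strict_mono_on {a..b} e"
    "\<And>y s t. y \<in> {c<..<d} \<Longrightarrow> a < s \<Longrightarrow> s < t \<Longrightarrow> t < b \<Longrightarrow>
       measure (\<nu> ((\<sigma> \<circ> prod.swap) ` ({y} \<times> {s..t}))) ((\<sigma> \<circ> prod.swap) ` ({y} \<times> {s..t})) = e t - e s"
    using box_chart_length_function[OF haus transversal_regular_sym[OF tr] \<nu> box_chart_swap[OF \<sigma>] y0 \<delta>(1-4) \<delta>'] by blast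
  have sw: "(\<sigma> \<circ> prod.swap) ` ({y} \<times> I) = \<sigma> ` (I \<times> {y})" for y I by (force simp: image_iff)
  obtain g where g: "continuous_on {e a<..<e b} g" "\<And>x. x \<in> {a<..<b} \<Longrightarrow> e x \<in> {e a<..<e b} \<and> g (e x) = x"
    "\<And>y. y \<in> {e a<..<e b} \<Longrightarrow> g y \<in> {a<..<b} \<and> e (g y) = y" "strict_mono_on {e a<..<e b} g"
    using strict_mono_inverse[OF ab(1) e(1,2)] by blast
  obtain h where h: "continuous_on {f c<..<f d} h" "\<And>x. x \<in> {c<..<d} \<Longrightarrow> f x \<in> {f c<..<f d} \<and> h (f x) = x"
    "\<And>y. y \<in> {f c<..<f d} \<Longrightarrow> h y \<in> {c<..<d} \<and> f (h y) = y" "strict_mono_on {f c<..<f d} h"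
    using strict_mono_inverse[OF ab(2) f(1,2)] by blast
  have gi: "g ` {e a<..<e b} = {a<..<b}" using g(2,3) by (metis (no_types, lifting) image_eqI subsetI subset_antisym image_subsetI)
  have hi: "h ` {f c<..<f d} = {c<..<d}" using h(2,3) by (metis (no_types, lifting) image_eqI subsetI subset_antisym image_subsetI)
  have lt: "e a < e b" "f c < f d"
    using strict_mono_onD[OF e(2)] strict_mono_onD[OF f(2)] ab by auto
  let ?\<sigma> = "\<sigma> \<circ> map_prod g h"
  note chart = box_chart_reparametrize[OF \<sigma> lt g(1,4) gi h(1,4) hi]
  have "measured_box_chart (regular_part X S) F G \<mu> \<nu> (e a) (e b) (f c) (f d) ?\<sigma>"
    unfolding measured_box_chart_def
  proof (intro conjI allI impI chart(1); elim conjE)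
    fix x s t assume x: "x \<in> {e a<..<e b}" and st: "f c < s" "s < t" "t < f d"
    have hs: "h s \<in> {c<..<d}" "h t \<in> {c<..<d}" "f (h s) = s" "f (h t) = t" "h s < h t"
      using h(3) st strict_mono_onD[OF h(4)] by auto
    have "?\<sigma> ` ({x} \<times> {s..t}) = \<sigma> ` ({g x} \<times> h ` {s..t})" by force
    also have "h ` {s..t} = {h s..h t}" using strict_mono_on_image_interval[OF h(1,4) st] .
    finally show "measure (\<mu> (?\<sigma> ` ({x} \<times> {s..t}))) (?\<sigma> ` ({x} \<times> {s..t})) = t - s"
      using f(3)[of "g x" "h s" "h t"] g(3)[OF x] hs by simp
  next
    fix y s t assume y: "y \<in> {f c<..<f d}" and st: "e a < s" "s < t" "t < e b"
    have gs: "g s \<in> {a<..<b}" "g t \<in> {a<..<b}" "e (g s) = s" "e (g t) = t" "g s < g t"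
      using g(3) st strict_mono_onD[OF g(4)] by auto
    have "?\<sigma> ` ({s..t} \<times> {y}) = \<sigma> ` (g ` {s..t} \<times> {h y})" by force
    also have "g ` {s..t} = {g s..g t}" using strict_mono_on_image_interval[OF g(1,4) st] .
    finally show "measure (\<nu> (?\<sigma> ` ({s..t} \<times> {y}))) (?\<sigma> ` ({s..t} \<times> {y})) = t - s"
      using e(3)[of "h y" "g s" "g t", unfolded sw] h(3)[OF y] gs by simp
  qed
  then show ?thesis using chart(2) by blast
qed

section \<open>Lebesgue area in the plane\<close>

definition vec2 :: "real \<times> real \<Rightarrow> real^2" where
  "vec2 v = vector [fst v, snd v]"

lemma vec2_nth [simp]: "vec2 v $ 1 = fst v" "vec2 v $ 2 = snd v"
  by (simp_all add: vec2_def)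

lemma vec2_inverse: "vec2 (v $ 1, v $ 2) = v"
  by (simp add: vec_eq_iff forall_2)

lemma inj_vec2: "inj vec2"
  by (rule injI) (metis vec2_nth prod.expand)

lemma vec2_image: "vec2 ` A = {v. (v $ 1, v $ 2) \<in> A}"
  by (auto simp: image_iff) (metis vec2_inverse)

lemma open_vec2_image: "open A \<Longrightarrow> open (vec2 ` A)"
proof -
  assume "open A"
  have "vec2 ` A = (\<lambda>v. (v $ 1, v $ 2)) -` A" by (auto simp: vec2_image)
  moreover have "continuous_on UNIV (\<lambda>v :: real^2. (v $ 1, v $ 2))" by (intro continuous_intros)
  ultimately show ?thesis using \<open>open A\<close> by (simp add: open_vimage)
qed

text \<open>The measure is taken on \<open>real^2\<close>, where the change of variables formula is
  stated with matrices and determinants.\<close>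

definition area :: "(real \<times> real) set \<Rightarrow> real" where
  "area A = measure lebesgue (vec2 ` A)"

lemma lmeasurable_vec2:
  assumes "open A" "bounded A"
  shows "vec2 ` A \<in> lmeasurable"
proof (intro lmeasurable_open open_vec2_image assms)
  obtain B where B: "\<And>v. v \<in> A \<Longrightarrow> norm v \<le> B" using assms by (auto simp: bounded_iff)
  have "norm (vec2 v) \<le> 2 * B" if "v \<in> A" for v
  proof -
    have "norm (vec2 v) \<le> (\<Sum>i\<in>UNIV. \<bar>vec2 v $ i\<bar>)" by (rule norm_le_l1_cart)
    also have "\<dots> = \<bar>fst v\<bar> + \<bar>snd v\<bar>" by (simp add: UNIV_2)
    also have "\<dots> \<le> 2 * B"
      using B[OF that] norm_fst_le[of "fst v" "snd v"] norm_snd_le[of "snd v" "fst v"] by simp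
    finally show ?thesis .
  qed
  then show "bounded (vec2 ` A)" unfolding bounded_iff by blast
qed

text \<open>The linear part may change from point to point, as \<open>D\<close> may be disconnected.
  Its matrix is always diagonal with entries of absolute value 1, so the Jacobian is 1 in absolute
  value and the change of variables formula applies.\<close>

lemma area_local_isometry:
  fixes \<theta> :: "real \<times> real \<Rightarrow> real \<times> real"
  assumes D: "open D" "bounded D" and inj: "inj_on \<theta> D"
    and loc: "\<And>v. v \<in> D \<Longrightarrow> \<exists>W \<alpha> \<beta> \<epsilon> \<delta>. open W \<and> v \<in> W \<and> \<bar>\<epsilon>\<bar> = (1::real) \<and> \<bar>\<delta>\<bar> = (1::real) \<and>
        (\<forall>w\<in>W. \<theta> w = (\<alpha> + \<epsilon> * fst w, \<beta> + \<delta> * snd w))"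
  shows "area (\<theta> ` D) = area D"
proof -
  let ?p = "\<lambda>v :: real^2. (v $ 1, v $ 2)"
  let ?T = "\<lambda>v. vec2 (\<theta> (?p v))"
  have img: "vec2 ` \<theta> ` D = ?T ` vec2 ` D"
    by (simp add: image_image)
  have "\<forall>x\<in>vec2 ` D. \<exists>f'. (?T has_derivative f') (at x within vec2 ` D) \<and> \<bar>det (matrix f')\<bar> = 1"
  proof
    fix x assume x: "x \<in> vec2 ` D"
    then have "?p x \<in> D" by (simp add: vec2_image)
    then obtain W \<alpha> \<beta> \<epsilon> \<delta> where W: "open W" "?p x \<in> W" "\<bar>\<epsilon>\<bar> = (1::real)" "\<bar>\<delta>\<bar> = (1::real)"
       "\<And>w. w \<in> W \<Longrightarrow> \<theta> w = (\<alpha> + \<epsilon> * fst w, \<beta> + \<delta> * snd w)"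
      using loc by metis
    let ?M = "vector [vector [\<epsilon>, 0], vector [0, \<delta>]] :: real^2^2"
    let ?a = "\<lambda>v. vec2 (\<alpha>, \<beta>) + ?M *v v"
    have aff: "?T v = ?a v" if "v \<in> vec2 ` W" for v
    proof -
      have "\<theta> (?p v) = (\<alpha> + \<epsilon> * v $ 1, \<beta> + \<delta> * v $ 2)" using that W(5)[of "?p v"] by (simp add: vec2_image)
      then show ?thesis by (simp add: vec_eq_iff forall_2 matrix_vector_mult_def sum_2)
    qed
    have "(?a has_derivative (\<lambda>v. ?M *v v)) (at x)"
      using has_derivative_add[OF has_derivative_const bounded_linear_imp_has_derivative[OF matrix_vector_mul_bounded_linear[of ?M]]]
      by simp
    moreover have "x \<in> vec2 ` W" using W(2) by (simp add: vec2_image)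
    ultimately have "(?T has_derivative (\<lambda>v. ?M *v v)) (at x)"
      using has_derivative_transform_within_open[OF _ open_vec2_image[OF W(1)], of ?a "\<lambda>v. ?M *v v" x UNIV ?T] aff by simp
    then have "(?T has_derivative (\<lambda>v. ?M *v v)) (at x within vec2 ` D)"
      by (rule has_derivative_at_withinI)
    moreover have "\<bar>det (matrix (\<lambda>v. ?M *v v))\<bar> = 1"
      using W(3,4) by (simp add: det_2 abs_mult)
    ultimately show "\<exists>f'. (?T has_derivative f') (at x within vec2 ` D) \<and> \<bar>det (matrix f')\<bar> = 1" by blast
  qed
  from bchoice[OF this] obtain f' where
    f: "\<forall>x\<in>vec2 ` D. (?T has_derivative f' x) (at x within vec2 ` D) \<and> \<bar>det (matrix (f' x))\<bar> = 1"
    by (elim exE)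
  have f': "(?T has_derivative f' x) (at x within vec2 ` D)" "\<bar>det (matrix (f' x))\<bar> = 1"
    if "x \<in> vec2 ` D" for x
    using conjunct1[OF bspec[OF f that]] conjunct2[OF bspec[OF f that]] .
  have m: "vec2 ` D \<in> lmeasurable" by (rule lmeasurable_vec2[OF D])
  have ints: "(\<lambda>x. \<bar>det (matrix (f' x))\<bar>) integrable_on vec2 ` D"
    by (rule integrable_eq[of "\<lambda>_. 1"]) (use m f'(2) in \<open>auto simp: lmeasurable_iff_integrable_on\<close>)
  have "measure lebesgue (?T ` vec2 ` D) = integral (vec2 ` D) (\<lambda>x. \<bar>det (matrix (f' x))\<bar>)"
  proof (rule measure_differentiable_image_eq[OF _ f'(1) _ ints])
    show "vec2 ` D \<in> sets lebesgue" using m by blast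
    show "inj_on ?T (vec2 ` D)"
    proof (rule inj_onI)
      fix x y assume xy: "x \<in> vec2 ` D" "y \<in> vec2 ` D" "?T x = ?T y"
      then have "\<theta> (?p x) = \<theta> (?p y)" using inj_vec2 by (auto dest: injD)
      moreover have "?p x \<in> D" "?p y \<in> D" using xy by (simp_all add: vec2_image)
      ultimately have "?p x = ?p y" by (rule inj_onD[OF inj])
      then show "x = y" by (metis vec2_inverse)
    qed
  qed
  also have "\<dots> = integral (vec2 ` D) (\<lambda>x. 1)"
    by (rule integral_cong) (simp add: f'(2))
  also have "\<dots> = measure lebesgue (vec2 ` D)"
    using m by (simp add: lmeasure_integral)
  finally show ?thesis unfolding area_def img .
qed

section \<open>Coordinate changes between measured charts\<close>

lemma isometry_on_interval:
  fixes p :: "real \<Rightarrow> real"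
  assumes x0: "x0 \<in> {a<..<b}" and iso: "\<And>x y. x \<in> {a<..<b} \<Longrightarrow> y \<in> {a<..<b} \<Longrightarrow> \<bar>p x - p y\<bar> = \<bar>x - y\<bar>"
  obtains \<alpha> \<epsilon> where "\<bar>\<epsilon>\<bar> = 1" "\<And>x. x \<in> {a<..<b} \<Longrightarrow> p x = \<alpha> + \<epsilon> * x"
proof -
  \<comment> \<open>A second reference point fixes the sign; the distances to the images of
    \<open>x0\<close> and \<open>x1\<close> then determine every value.\<close>
  define x1 where "x1 = (x0 + b) / 2"
  have x1: "x1 \<in> {a<..<b}" "x1 > x0" using x0 by (auto simp: x1_def)
  define \<epsilon> where "\<epsilon> = (p x1 - p x0) / (x1 - x0)"
  have \<epsilon>: "\<bar>\<epsilon>\<bar> = 1" "p x1 - p x0 = \<epsilon> * (x1 - x0)" using iso[OF x1(1) x0] x1(2) by (auto simp: \<epsilon>_def)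
  have "p x = (p x0 - \<epsilon> * x0) + \<epsilon> * x" if x: "x \<in> {a<..<b}" for x
  proof -
    have 1: "\<bar>p x - p x0\<bar> = \<bar>x - x0\<bar>" "\<bar>p x - p x1\<bar> = \<bar>x - x1\<bar>" using iso x x0 x1 by auto
    have "\<epsilon> = 1 \<or> \<epsilon> = -1" using \<epsilon>(1) by linarith
    then show ?thesis
    proof
      assume "\<epsilon> = 1"
      then show ?thesis using 1 \<epsilon>(2) x1(2) by (simp add: abs_if split: if_splits)
    next
      assume "\<epsilon> = -1"
      then show ?thesis using 1 \<epsilon>(2) x1(2) by (simp add: abs_if split: if_splits)
    qed
  qed
  then show ?thesis using that[of \<epsilon> "p x0 - \<epsilon> * x0"] \<epsilon>(1) by blast
qed

text \<open>A vertical segment of the first chart is a connected piece of a \<open>G\<close>-leaf,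
  so in the second chart its first coordinate is constant and its second runs injectively through an
  interval. Its \<mu>-mass is the length read off in either chart.\<close>

lemma box_chart_vertical_transition:
  assumes \<sigma>: "box_chart Y F G a b c d \<sigma>" and \<sigma>': "box_chart Y F G a' b' c' d' \<sigma>'"
    and len: "\<And>x s t. x \<in> {a<..<b} \<Longrightarrow> c < s \<Longrightarrow> s < t \<Longrightarrow> t < d \<Longrightarrow>
        measure (\<mu> (\<sigma> ` ({x} \<times> {s..t}))) (\<sigma> ` ({x} \<times> {s..t})) = t - s"
    and len': "\<And>x s t. x \<in> {a'<..<b'} \<Longrightarrow> c' < s \<Longrightarrow> s < t \<Longrightarrow> t < d' \<Longrightarrow>
        measure (\<mu> (\<sigma>' ` ({x} \<times> {s..t}))) (\<sigma>' ` ({x} \<times> {s..t})) = t - s"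
    and g: "continuous_map (subtopology Y (\<sigma>' ` rectangle a' b' c' d')) (top_of_set (rectangle a' b' c' d')) g"
      "\<And>v. v \<in> rectangle a' b' c' d' \<Longrightarrow> g (\<sigma>' v) = v" "\<And>x. x \<in> \<sigma>' ` rectangle a' b' c' d' \<Longrightarrow> \<sigma>' (g x) = x"
    and x: "x \<in> {a<..<b}" and st: "c < s" "s < t" "t < d"
    and sub: "\<sigma> ` ({x} \<times> {s..t}) \<subseteq> \<sigma>' ` rectangle a' b' c' d'"
  shows "fst (g (\<sigma> (x, s))) = fst (g (\<sigma> (x, t)))"
    "\<bar>snd (g (\<sigma> (x, t))) - snd (g (\<sigma> (x, s)))\<bar> = t - s"
proof -
  interpret box_chart Y F G a b c d \<sigma> by fact
  interpret \<sigma>': box_chart Y F G a' b' c' d' \<sigma>' by fact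
  let ?R' = "rectangle a' b' c' d'" and ?C = "\<sigma> ` ({x} \<times> {s..t})" and ?\<gamma> = "\<lambda>y. \<sigma> (x, y)"
  let ?\<theta> = "\<lambda>y. g (\<sigma> (x, y))"
  have I: "{s..t} \<subseteq> {c<..<d}" using st by auto
  note v = box_chart_vertical[OF \<sigma> x I]
  obtain L where L: "L \<in> G" "?C \<subseteq> L" using v(3,4) by auto
  have pc: "path_connectedin Y ?C"
    using path_connectedin_interval_image[OF v(1), of "{s..t}"] v(4) by (simp add: is_interval_cc)
  have in': "\<sigma> (x, y) \<in> \<sigma>' ` ?R'" "\<sigma> (x, y) \<in> ?C" if "y \<in> {s..t}" for y using that sub by auto
  have gR: "?\<theta> y \<in> ?R'" "\<sigma>' (?\<theta> y) = \<sigma> (x, y)" if y: "y \<in> {s..t}" for y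
  proof -
    show "\<sigma>' (?\<theta> y) = \<sigma> (x, y)" using g(3) in'(1)[OF y] by blast
    obtain v where "v \<in> ?R'" "\<sigma> (x, y) = \<sigma>' v" using in'(1)[OF y] by blast
    then show "?\<theta> y \<in> ?R'" using g(2) by metis
  qed
  have fc: "fst (?\<theta> y) = fst (?\<theta> s)" if y: "y \<in> {s..t}" for y
  proof -
    have s: "s \<in> {s..t}" using st by simp
    show ?thesis
      using \<sigma>'.vertical_plaque[OF L(1) pc L(2) sub gR(1)[OF y] gR(1)[OF s]] gR(2) in'(2) y s by simp
  qed
  show "fst (g (\<sigma> (x, s))) = fst (g (\<sigma> (x, t)))" using fc[of t] st by simp
  define q where "q y = snd (?\<theta> y)" for y
  have \<theta>q: "?\<theta> y = (fst (?\<theta> s), q y)" if "y \<in> {s..t}" for y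
    using fc[OF that] by (simp add: q_def prod_eq_iff)
  have cont\<theta>: "continuous_map (top_of_set {s..t}) (top_of_set ?R') ?\<theta>"
  proof -
    have "continuous_map (top_of_set {s..t}) (subtopology Y (\<sigma>' ` ?R')) ?\<gamma>"
      unfolding continuous_map_in_subtopology using v(1) in'(1) by auto
    from continuous_map_compose[OF this g(1)] show ?thesis by (simp add: o_def)
  qed
  then have "continuous_on {s..t} ?\<theta>"
    by (simp add: continuous_map_in_subtopology)
  then have qc: "continuous_on {s..t} q" unfolding q_def by (intro continuous_intros)
  have qi: "inj_on q {s..t}"
  proof (rule inj_onI)
    fix y z assume yz: "y \<in> {s..t}" "z \<in> {s..t}" "q y = q z"
    then have "?\<theta> y = ?\<theta> z" using \<theta>q by metis
    then have "\<sigma> (x, y) = \<sigma> (x, z)" using gR(2) yz by metis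
    then show "y = z" using inj_onD[OF v(2)] yz by blast
  qed
  have cl: "closed_segment s t = {s..t}" using st by (simp add: closed_segment_eq_real_ivl)
  have qim: "q ` {s..t} = closed_segment (q s) (q t)"
    using continuous_injective_image_segment_1[of s t q] qc qi unfolding cl by blast
  have C: "?C = \<sigma>' ` ({fst (?\<theta> s)} \<times> q ` {s..t})"
  proof -
    have "?C = ?\<gamma> ` {s..t}" by (simp only: v(4))
    also have "\<dots> = (\<lambda>y. \<sigma>' (fst (?\<theta> s), q y)) ` {s..t}"
    proof (intro image_cong refl)
      fix y assume y: "y \<in> {s..t}"
      show "\<sigma> (x, y) = \<sigma>' (fst (?\<theta> s), q y)"
        using gR(2)[OF y] unfolding \<theta>q[OF y] by simp
    qed
    also have "\<dots> = \<sigma>' ` ({fst (?\<theta> s)} \<times> q ` {s..t})" by force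
    finally show ?thesis .
  qed
  have x': "fst (?\<theta> s) \<in> {a'<..<b'}" and qst: "q s \<in> {c'<..<d'}" "q t \<in> {c'<..<d'}"
    using gR(1)[of s] gR(1)[of t] st by (auto simp: q_def mem_Times_iff)
  have "q s \<noteq> q t" using inj_onD[OF qi, of s t] st by auto
  \<comment> \<open>The two charts may traverse the leaf in opposite directions, whence the absolute
    value.\<close>
  then consider "q s < q t" | "q t < q s" by linarith
  then have "measure (\<mu> ?C) ?C = \<bar>q t - q s\<bar>"
  proof cases
    case 1
    then show ?thesis
      using len'[OF x', of "q s" "q t"] qst unfolding C qim by (simp add: closed_segment_eq_real_ivl)
  next
    case 2
    then show ?thesis
      using len'[OF x', of "q t" "q s"] qst unfolding C qim by (simp add: closed_segment_eq_real_ivl)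
  qed
  then show "\<bar>snd (g (\<sigma> (x, t))) - snd (g (\<sigma> (x, s)))\<bar> = t - s"
    using len[OF x st] by (simp add: q_def)
qed

lemma measured_box_chart_swap:
  assumes "measured_box_chart Y F G \<mu> \<nu> a b c d \<sigma>"
  shows "measured_box_chart Y G F \<nu> \<mu> c d a b (\<sigma> \<circ> prod.swap)"
proof -
  have sw: "(\<sigma> \<circ> prod.swap) ` (A \<times> B) = \<sigma> ` (B \<times> A)" for A B by (force simp: image_iff)
  show ?thesis
    using assms box_chart_swap unfolding measured_box_chart_def sw by blast
qed

lemma open_contains_rectangle:
  assumes "open W" "(x, y) \<in> W"
  obtains a b c d where "x \<in> {a<..<b}" "y \<in> {c<..<d}" "rectangle a b c d \<subseteq> W"
proof -
  obtain A B where AB: "open A" "open B" "x \<in> A" "y \<in> B" "A \<times> B \<subseteq> W"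
    using assms by (metis open_prod_elim mem_Times_iff fst_conv snd_conv)
  obtain e where e: "e > 0" "ball x e \<subseteq> A" using AB open_contains_ball by blast
  obtain f where f: "f > 0" "ball y f \<subseteq> B" using AB open_contains_ball by blast
  show ?thesis
    by (rule that[of "x - e" "x + e" "y - f" "y + f"])
       (use e f AB in \<open>auto simp: ball_eq_greaterThanLessThan\<close>)
qed

text \<open>The comparison of segments, used vertically and after a swap horizontally, shows that
  the coordinate change is locally a product of two isometries of intervals. This is the
  half-translation structure of the surface, up to independent reflections of the two axes.\<close>

lemma measured_box_chart_transition:
  assumes \<sigma>: "measured_box_chart Y F G \<mu> \<nu> a b c d \<sigma>" and \<sigma>': "measured_box_chart Y F G \<mu> \<nu> a' b' c' d' \<sigma>'"
    and g: "continuous_map (subtopology Y (\<sigma>' ` rectangle a' b' c' d')) (top_of_set (rectangle a' b' c' d')) g"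
      "\<And>v. v \<in> rectangle a' b' c' d' \<Longrightarrow> g (\<sigma>' v) = v" "\<And>x. x \<in> \<sigma>' ` rectangle a' b' c' d' \<Longrightarrow> \<sigma>' (g x) = x"
    and v: "v \<in> rectangle a b c d" "\<sigma> v \<in> \<sigma>' ` rectangle a' b' c' d'"
  shows "\<exists>W \<alpha> \<beta> \<epsilon> \<delta>. open W \<and> v \<in> W \<and> \<bar>\<epsilon>\<bar> = (1::real) \<and> \<bar>\<delta>\<bar> = (1::real) \<and>
        (\<forall>w\<in>W. g (\<sigma> w) = (\<alpha> + \<epsilon> * fst w, \<beta> + \<delta> * snd w))"
proof -
  let ?R = "rectangle a b c d" and ?R' = "rectangle a' b' c' d'"
  have bc: "box_chart Y F G a b c d \<sigma>" "box_chart Y F G a' b' c' d' \<sigma>'"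
    using \<sigma> \<sigma>' by (simp_all only: measured_box_chart_def)
  interpret box_chart Y F G a b c d \<sigma> by (rule bc)
  interpret \<sigma>': box_chart Y F G a' b' c' d' \<sigma>' by (rule bc)
  have "openin Y (\<sigma>' ` ?R')" by (rule \<sigma>'.open_image) (simp_all add: open_Times)
  from openin_continuous_map_preimage[OF cont this]
  have "openin (top_of_set ?R) {w \<in> ?R. \<sigma> w \<in> \<sigma>' ` ?R'}" by simp
  moreover have "open ?R" by (simp add: open_Times)
  ultimately have "open {w \<in> ?R. \<sigma> w \<in> \<sigma>' ` ?R'}" by (simp only: openin_open_eq)
  moreover have "(fst v, snd v) \<in> {w \<in> ?R. \<sigma> w \<in> \<sigma>' ` ?R'}" using v by simp
  ultimately obtain x1 x2 y1 y2 where xy: "fst v \<in> {x1<..<x2}" "snd v \<in> {y1<..<y2}"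
    and sub: "rectangle x1 x2 y1 y2 \<subseteq> {w \<in> ?R. \<sigma> w \<in> \<sigma>' ` ?R'}"
    by (rule open_contains_rectangle)
  let ?W = "rectangle x1 x2 y1 y2"
  define x0 where "x0 = fst v"
  define y0 where "y0 = snd v"
  have x0: "x0 \<in> {x1<..<x2}" and y0: "y0 \<in> {y1<..<y2}" using xy by (simp_all add: x0_def y0_def)
  have inR: "x \<in> {a<..<b}" "y \<in> {c<..<d}" "\<sigma> (x, y) \<in> \<sigma>' ` ?R'" if "x \<in> {x1<..<x2}" "y \<in> {y1<..<y2}" for x y
    using subsetD[OF sub, of "(x, y)"] that by simp_all
  have vert: "fst (g (\<sigma> (x, s))) = fst (g (\<sigma> (x, t))) \<and> \<bar>snd (g (\<sigma> (x, t))) - snd (g (\<sigma> (x, s)))\<bar> = t - s"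
    if x: "x \<in> {x1<..<x2}" and st: "s \<in> {y1<..<y2}" "t \<in> {y1<..<y2}" "s < t" for x s t
  proof -
    have "\<sigma> ` ({x} \<times> {s..t}) \<subseteq> \<sigma>' ` ?R'" using inR(3)[OF x] st by force
    moreover have "c < s" "t < d" "x \<in> {a<..<b}" using inR[OF x st(1)] inR[OF x st(2)] by auto
    ultimately show ?thesis
      using box_chart_vertical_transition[OF bc _ _ g, of \<mu> x s t] \<sigma> \<sigma>' st(3)
      unfolding measured_box_chart_def by blast
  qed
  have sw: "(\<sigma>'' \<circ> prod.swap) ` (A \<times> B) = \<sigma>'' ` (B \<times> A)" for A B and \<sigma>'' :: "real \<times> real \<Rightarrow> 'a" by (force simp: image_iff)
  let ?g = "prod.swap \<circ> g"
  have gs: "continuous_map (subtopology Y ((\<sigma>' \<circ> prod.swap) ` rectangle c' d' a' b')) (top_of_set (rectangle c' d' a' b')) ?g"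
      "\<And>v. v \<in> rectangle c' d' a' b' \<Longrightarrow> ?g ((\<sigma>' \<circ> prod.swap) v) = v"
      "\<And>x. x \<in> (\<sigma>' \<circ> prod.swap) ` rectangle c' d' a' b' \<Longrightarrow> (\<sigma>' \<circ> prod.swap) (?g x) = x"
  proof -
    have "continuous_on ?R' (prod.swap :: real \<times> real \<Rightarrow> real \<times> real)"
      unfolding prod.swap_def by (intro continuous_intros)
    then have "continuous_map (top_of_set ?R') (top_of_set (rectangle c' d' a' b')) prod.swap"
      by (auto simp: continuous_map_in_subtopology)
    from continuous_map_compose[OF g(1) this]
    show "continuous_map (subtopology Y ((\<sigma>' \<circ> prod.swap) ` rectangle c' d' a' b')) (top_of_set (rectangle c' d' a' b')) ?g"
      unfolding sw .
    show "?g ((\<sigma>' \<circ> prod.swap) v) = v" if "v \<in> rectangle c' d' a' b'" for v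
      using g(2)[of "prod.swap v"] that by auto
    show "(\<sigma>' \<circ> prod.swap) (?g x) = x" if "x \<in> (\<sigma>' \<circ> prod.swap) ` rectangle c' d' a' b'" for x
      using g(3)[of x] that unfolding sw by simp
  qed
  have horiz: "snd (g (\<sigma> (s, y))) = snd (g (\<sigma> (t, y))) \<and> \<bar>fst (g (\<sigma> (t, y))) - fst (g (\<sigma> (s, y)))\<bar> = t - s"
    if y: "y \<in> {y1<..<y2}" and st: "s \<in> {x1<..<x2}" "t \<in> {x1<..<x2}" "s < t" for y s t
  proof -
    have "(\<sigma> \<circ> prod.swap) ` ({y} \<times> {s..t}) \<subseteq> (\<sigma>' \<circ> prod.swap) ` rectangle c' d' a' b'"
      unfolding sw using inR(3)[OF _ y] st by force
    moreover have "a < s" "t < b" "y \<in> {c<..<d}" using inR[OF st(1) y] inR[OF st(2) y] by auto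
    ultimately have "fst (?g ((\<sigma> \<circ> prod.swap) (y, s))) = fst (?g ((\<sigma> \<circ> prod.swap) (y, t))) \<and>
       \<bar>snd (?g ((\<sigma> \<circ> prod.swap) (y, t))) - snd (?g ((\<sigma> \<circ> prod.swap) (y, s)))\<bar> = t - s"
      using box_chart_vertical_transition[OF box_chart_swap[OF bc(1)] box_chart_swap[OF bc(2)] _ _ gs, of \<nu> y s t]
        measured_box_chart_swap[OF \<sigma>] measured_box_chart_swap[OF \<sigma>'] st(3)
      unfolding measured_box_chart_def by blast
    then show ?thesis by simp
  qed
  define p where "p x = fst (g (\<sigma> (x, y0)))" for x
  define q where "q y = snd (g (\<sigma> (x0, y)))" for y
  \<comment> \<open>Motion along a vertical segment does not change the first new coordinate, and
    motion along a horizontal one does not change the second, so the map splits.\<close>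
  have pq: "g (\<sigma> (x, y)) = (p x, q y)" if "x \<in> {x1<..<x2}" "y \<in> {y1<..<y2}" for x y
  proof -
    have "fst (g (\<sigma> (x, y))) = fst (g (\<sigma> (x, y0)))"
    proof (cases y y0 rule: linorder_cases)
      case less then show ?thesis using vert[OF that(1) that(2) y0] by simp
    next
      case greater then show ?thesis using vert[OF that(1) y0 that(2)] by simp
    qed simp
    moreover have "snd (g (\<sigma> (x, y))) = snd (g (\<sigma> (x0, y)))"
    proof (cases x x0 rule: linorder_cases)
      case less then show ?thesis using horiz[OF that(2) that(1) x0] by simp
    next
      case greater then show ?thesis using horiz[OF that(2) x0 that(1)] by simp
    qed simp
    ultimately show ?thesis by (simp add: p_def q_def prod_eq_iff)
  qed
  have "\<bar>p x - p y\<bar> = \<bar>x - y\<bar>" if "x \<in> {x1<..<x2}" "y \<in> {x1<..<x2}" for x y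
  proof (cases x y rule: linorder_cases)
    case less then show ?thesis using horiz[OF y0 that] by (simp add: p_def abs_minus_commute)
  next
    case greater then show ?thesis using horiz[OF y0 that(2,1)] by (simp add: p_def)
  qed simp
  then obtain \<alpha> \<epsilon> where \<alpha>: "\<bar>\<epsilon>\<bar> = 1" "\<And>x. x \<in> {x1<..<x2} \<Longrightarrow> p x = \<alpha> + \<epsilon> * x"
    using isometry_on_interval[OF x0] by blast
  have "\<bar>q x - q y\<bar> = \<bar>x - y\<bar>" if "x \<in> {y1<..<y2}" "y \<in> {y1<..<y2}" for x y
  proof (cases x y rule: linorder_cases)
    case less then show ?thesis using vert[OF x0 that] by (simp add: q_def abs_minus_commute)
  next
    case greater then show ?thesis using vert[OF x0 that(2,1)] by (simp add: q_def)
  qed simp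
  then obtain \<beta> \<delta> where \<beta>: "\<bar>\<delta>\<bar> = 1" "\<And>x. x \<in> {y1<..<y2} \<Longrightarrow> q x = \<beta> + \<delta> * x"
    using isometry_on_interval[OF y0] by blast
  have "open ?W" by (simp add: open_Times)
  moreover have "v \<in> ?W" using xy by (simp add: mem_Times_iff)
  moreover have "\<forall>w\<in>?W. g (\<sigma> w) = (\<alpha> + \<epsilon> * fst w, \<beta> + \<delta> * snd w)"
    using pq \<alpha>(2) \<beta>(2) by auto
  ultimately show ?thesis using \<alpha>(1) \<beta>(1) by blast
qed

text \<open>The coordinate change is a local isometry, whose signs may differ between components of
  the overlap; it is injective as well, so areas agree globally. Hence the area of an open set does
  not depend on the chart in which it is computed.\<close>

lemma measured_box_chart_area_eq:
  assumes \<sigma>: "measured_box_chart Y F G \<mu> \<nu> a b c d \<sigma>" and \<sigma>': "measured_box_chart Y F G \<mu> \<nu> a' b' c' d' \<sigma>'"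
    and E: "openin Y E" "E \<subseteq> \<sigma> ` rectangle a b c d" "E \<subseteq> \<sigma>' ` rectangle a' b' c' d'"
  shows "area {v \<in> rectangle a b c d. \<sigma> v \<in> E} = area {v \<in> rectangle a' b' c' d'. \<sigma>' v \<in> E}"
proof -
  let ?R = "rectangle a b c d" and ?R' = "rectangle a' b' c' d'"
  have bc: "box_chart Y F G a b c d \<sigma>" "box_chart Y F G a' b' c' d' \<sigma>'"
    using \<sigma> \<sigma>' by (simp_all only: measured_box_chart_def)
  obtain g where g: "continuous_map (subtopology Y (\<sigma>' ` ?R')) (top_of_set ?R') g"
      "\<And>v. v \<in> ?R' \<Longrightarrow> g (\<sigma>' v) = v" "\<And>x. x \<in> \<sigma>' ` ?R' \<Longrightarrow> \<sigma>' (g x) = x"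
    using box_chart.chart_inverse[OF bc(2)] by blast
  let ?D = "{v \<in> ?R. \<sigma> v \<in> E}"
  have "openin (top_of_set ?R) ?D"
    using openin_continuous_map_preimage[OF box_chart.cont[OF bc(1)] E(1)] by simp
  moreover have "open ?R" by (simp add: open_Times)
  ultimately have oO: "open ?D" by (simp only: openin_open_eq)
  have bO: "bounded ?D"
    by (rule bounded_subset[of "{a..b} \<times> {c..d}"]) (auto intro!: bounded_Times)
  have gE: "\<sigma>' (g (\<sigma> v)) = \<sigma> v" if "v \<in> ?D" for v using that g(3) E(3) by blast
  have inj: "inj_on (g \<circ> \<sigma>) ?D"
  proof (rule inj_onI)
    fix v w assume vw: "v \<in> ?D" "w \<in> ?D" "(g \<circ> \<sigma>) v = (g \<circ> \<sigma>) w"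
    then have "\<sigma>' (g (\<sigma> v)) = \<sigma>' (g (\<sigma> w))" by simp
    then have "\<sigma> v = \<sigma> w" using gE[OF vw(1)] gE[OF vw(2)] by simp
    then show "v = w" using inj_onD[OF box_chart.inj[OF bc(1)]] vw by blast
  qed
  have "area ((g \<circ> \<sigma>) ` ?D) = area ?D"
  proof (rule area_local_isometry[OF oO bO inj])
    fix v assume v: "v \<in> ?D"
    then have "v \<in> ?R" "\<sigma> v \<in> \<sigma>' ` ?R'" using E(3) by blast+
    from measured_box_chart_transition[OF \<sigma> \<sigma>' g this]
    show "\<exists>W \<alpha> \<beta> \<epsilon> \<delta>. open W \<and> v \<in> W \<and> \<bar>\<epsilon>\<bar> = (1::real) \<and> \<bar>\<delta>\<bar> = (1::real) \<and>
        (\<forall>w\<in>W. (g \<circ> \<sigma>) w = (\<alpha> + \<epsilon> * fst w, \<beta> + \<delta> * snd w))" by simp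
  qed
  moreover have "(g \<circ> \<sigma>) ` ?D = {v \<in> ?R'. \<sigma>' v \<in> E}"
  proof
    show "(g \<circ> \<sigma>) ` ?D \<subseteq> {v \<in> ?R'. \<sigma>' v \<in> E}"
    proof
      fix w assume "w \<in> (g \<circ> \<sigma>) ` ?D"
      then obtain v where v: "v \<in> ?D" "w = g (\<sigma> v)" by auto
      obtain u where "u \<in> ?R'" "\<sigma> v = \<sigma>' u" using v(1) E(3) by blast
      then have "w \<in> ?R'" using v g(2) by metis
      then show "w \<in> {v \<in> ?R'. \<sigma>' v \<in> E}" using gE[OF v(1)] v by simp
    qed
    show "{v \<in> ?R'. \<sigma>' v \<in> E} \<subseteq> (g \<circ> \<sigma>) ` ?D"
    proof
      fix w assume w: "w \<in> {v \<in> ?R'. \<sigma>' v \<in> E}"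
      then obtain v where v: "v \<in> ?R" "\<sigma>' w = \<sigma> v" using E(2) by blast
      then have "v \<in> ?D" "w = (g \<circ> \<sigma>) v" using w g(2)[of w] by auto
      then show "w \<in> (g \<circ> \<sigma>) ` ?D" by blast
    qed
  qed
  ultimately show ?thesis by simp
qed

lemma box_chart_restrict:
  assumes "box_chart Y F G a b c d \<sigma>" and sub: "a \<le> a'" "a' < b'" "b' \<le> b" "c \<le> c'" "c' < d'" "d' \<le> d"
  shows "box_chart Y F G a' b' c' d' \<sigma>"
proof -
  interpret box_chart Y F G a b c d \<sigma> by fact
  have R: "rectangle a' b' c' d' \<subseteq> rectangle a b c d" using sub by auto
  have im: "\<sigma> ` rectangle a' b' c' d' \<subseteq> \<sigma> ` rectangle a b c d" by (rule image_mono[OF R])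
  show ?thesis
  proof (rule box_chart.intro, goal_cases)
    case 3 show ?case by (rule continuous_map_from_subtopology_mono[OF cont R])
  next
    case 4 show ?case by (rule inj_on_subset[OF inj R])
  next
    case (5 W) then show ?case using R by (intro open_image) auto
  next
    case (6 y)
    then have "y \<in> {c<..<d}" using sub by auto
    from horizontal[OF this] obtain L where "L \<in> F" "\<forall>x\<in>{a<..<b}. \<sigma> (x, y) \<in> L" by (elim bexE)
    then show ?case using sub by (intro bexI[of _ L] ballI) simp_all
  next
    case (7 x)
    then have "x \<in> {a<..<b}" using sub by auto
    from vertical[OF this] obtain L where "L \<in> G" "\<forall>y\<in>{c<..<d}. \<sigma> (x, y) \<in> L" by (elim bexE)
    then show ?case using sub by (intro bexI[of _ L] ballI) simp_all
  next
    case (8 C L u v)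
    show ?case
      by (rule horizontal_plaque[OF 8(1-3) subset_trans[OF 8(4) im] subsetD[OF R 8(5)] subsetD[OF R 8(6)] 8(7,8)])
  next
    case (9 C L u v)
    show ?case
      by (rule vertical_plaque[OF 9(1-3) subset_trans[OF 9(4) im] subsetD[OF R 9(5)] subsetD[OF R 9(6)] 9(7,8)])
  qed (use sub in auto)
qed

lemma measured_box_chart_restrict:
  assumes \<sigma>: "measured_box_chart Y F G \<mu> \<nu> a b c d \<sigma>"
    and sub: "a \<le> a'" "a' < b'" "b' \<le> b" "c \<le> c'" "c' < d'" "d' \<le> d"
  shows "measured_box_chart Y F G \<mu> \<nu> a' b' c' d' \<sigma>"
  unfolding measured_box_chart_def
proof (intro conjI allI impI)
  show "box_chart Y F G a' b' c' d' \<sigma>"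
    by (rule box_chart_restrict[OF _ sub]) (use \<sigma> in \<open>simp only: measured_box_chart_def\<close>)
  fix x s t
  show "measure (\<mu> (\<sigma> ` ({x} \<times> {s..t}))) (\<sigma> ` ({x} \<times> {s..t})) = t - s"
    if "x \<in> {a'<..<b'} \<and> c' < s \<and> s < t \<and> t < d'"
  proof -
    have "x \<in> {a<..<b} \<and> c < s \<and> s < t \<and> t < d" using that sub by auto
    then show ?thesis using \<sigma> unfolding measured_box_chart_def by blast
  qed
  show "measure (\<nu> (\<sigma> ` ({s..t} \<times> {x}))) (\<sigma> ` ({s..t} \<times> {x})) = t - s"
    if "x \<in> {c'<..<d'} \<and> a' < s \<and> s < t \<and> t < b'"
  proof -
    have "x \<in> {c<..<d} \<and> a < s \<and> s < t \<and> t < b" using that sub by auto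
    then show ?thesis using \<sigma> unfolding measured_box_chart_def by blast
  qed
qed

text \<open>A homeomorphism permuting the leaves of both foliations moves plaques to plaques: a
  connected piece of a leaf in the image chart is pulled back by the inverse and examined in the
  original chart.\<close>

lemma box_chart_homeomorphic_image:
  assumes \<sigma>: "box_chart Y F G a b c d \<sigma>" and Q: "homeomorphic_map Y Y Q"
    and F: "(`) Q ` F = F" and G: "(`) Q ` G = G" and FY: "\<Union>F \<subseteq> topspace Y" and GY: "\<Union>G \<subseteq> topspace Y"
  shows "box_chart Y F G a b c d (Q \<circ> \<sigma>)"
proof -
  interpret box_chart Y F G a b c d \<sigma> by fact
  let ?R = "rectangle a b c d"
  obtain Q' where Q': "homeomorphic_maps Y Y Q Q'" using Q homeomorphic_map_maps by blast
  then have cQ': "continuous_map Y Y Q'" and Q'Q: "\<And>x. x \<in> topspace Y \<Longrightarrow> Q' (Q x) = x"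
    by (auto simp: homeomorphic_maps_def)
  have sub: "\<sigma> ` ?R \<subseteq> topspace Y" using continuous_map_image_subset_topspace[OF cont] by simp
  have pre: "\<exists>L'\<in>H. Q' ` C \<subseteq> L' \<and> path_connectedin Y (Q' ` C) \<and> Q' ` C \<subseteq> \<sigma> ` ?R \<and> (\<forall>v\<in>?R. Q (\<sigma> v) \<in> C \<longrightarrow> \<sigma> v \<in> Q' ` C)"
    if H: "(`) Q ` H = H" "\<Union>H \<subseteq> topspace Y" and C: "L \<in> H" "path_connectedin Y C" "C \<subseteq> L" "C \<subseteq> (Q \<circ> \<sigma>) ` ?R" for H C L
  proof -
    obtain L' where L': "L' \<in> H" "L = Q ` L'" using H(1) C(1) by blast
    have "L' \<subseteq> topspace Y" using L'(1) H(2) by blast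
    then have "Q' ` L = L'" unfolding L'(2) image_image using Q'Q by (auto simp: subset_iff image_iff)
    then have "Q' ` C \<subseteq> L'" using C(3) by blast
    moreover have "path_connectedin Y (Q' ` C)" by (rule path_connectedin_continuous_map_image[OF cQ' C(2)])
    moreover have "Q' ` C \<subseteq> \<sigma> ` ?R"
    proof -
      have "Q' ` C \<subseteq> Q' ` (Q \<circ> \<sigma>) ` ?R" using C(4) by (rule image_mono)
      also have "\<dots> = \<sigma> ` ?R" unfolding image_image using sub Q'Q by (intro image_cong) auto
      finally show ?thesis .
    qed
    moreover have "\<forall>v\<in>?R. Q (\<sigma> v) \<in> C \<longrightarrow> \<sigma> v \<in> Q' ` C"
      using sub Q'Q by (metis image_eqI image_subset_iff)
    ultimately show ?thesis using L'(1) by blast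
  qed
  show ?thesis
  proof (rule box_chart.intro, goal_cases)
    case 1 show ?case by (rule ab)
  next
    case 2 show ?case by (rule cd)
  next
    case 3 show ?case by (rule continuous_map_compose[OF cont homeomorphic_imp_continuous_map[OF Q]])
  next
    case 4 show ?case
      by (rule comp_inj_on[OF inj inj_on_subset[OF homeomorphic_imp_injective_map[OF Q] sub]])
  next
    case (5 W)
    from open_image[OF 5] have "openin Y (Q ` \<sigma> ` W)"
      using homeomorphic_imp_open_map[OF Q] unfolding open_map_def by simp
    then show ?case by (simp only: image_comp)
  next
    case (6 y)
    obtain L where "L \<in> F" "\<forall>x\<in>{a<..<b}. \<sigma> (x, y) \<in> L" using horizontal[OF 6] by (elim bexE)
    moreover from this have "Q ` L \<in> F" using F by blast
    ultimately show ?case by (intro bexI[of _ "Q ` L"] ballI) simp_all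
  next
    case (7 x)
    obtain L where "L \<in> G" "\<forall>y\<in>{c<..<d}. \<sigma> (x, y) \<in> L" using vertical[OF 7] by (elim bexE)
    moreover from this have "Q ` L \<in> G" using G by blast
    ultimately show ?case by (intro bexI[of _ "Q ` L"] ballI) simp_all
  next
    case (8 C L u v)
    obtain L' where L': "L' \<in> F" "Q' ` C \<subseteq> L'" "path_connectedin Y (Q' ` C)" "Q' ` C \<subseteq> \<sigma> ` ?R"
      "\<And>v. v \<in> ?R \<Longrightarrow> Q (\<sigma> v) \<in> C \<Longrightarrow> \<sigma> v \<in> Q' ` C"
      using pre[OF F FY 8(1-4)] by (elim bexE conjE) blast
    show ?case
      by (rule horizontal_plaque[OF L'(1,3,2,4) 8(5,6) L'(5)[OF 8(5)] L'(5)[OF 8(6)]]) (use 8(7,8) in simp_all)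
  next
    case (9 C L u v)
    obtain L' where L': "L' \<in> G" "Q' ` C \<subseteq> L'" "path_connectedin Y (Q' ` C)" "Q' ` C \<subseteq> \<sigma> ` ?R"
      "\<And>v. v \<in> ?R \<Longrightarrow> Q (\<sigma> v) \<in> C \<Longrightarrow> \<sigma> v \<in> Q' ` C"
      using pre[OF G GY 9(1-4)] by (elim bexE conjE) blast
    show ?case
      by (rule vertical_plaque[OF L'(1,3,2,4) 9(5,6) L'(5)[OF 9(5)] L'(5)[OF 9(6)]]) (use 9(7,8) in simp_all)
  qed
qed

text \<open>Since \<mu>-masses are multiplied and \<nu>-masses divided by \<open>k\<close>, the
  image chart becomes normalized when heights are stretched and widths compressed by this factor.
  The product of the side lengths is unchanged.\<close>

lemma measured_box_chart_image:
  assumes haus: "Hausdorff_space X" and tr: "transversal_regular (regular_part X S) F G"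
    and \<sigma>: "measured_box_chart (regular_part X S) F G \<mu> \<nu> a b c d \<sigma>"
    and Q: "homeomorphic_map (regular_part X S) (regular_part X S) Q"
    and F: "(`) Q ` F = F" and G: "(`) Q ` G = G" and FY: "\<Union>F \<subseteq> topspace X - S" and GY: "\<Union>G \<subseteq> topspace X - S"
    and k: "k > 0"
    and \<mu>: "\<And>A. transversal_arc X S F A \<Longrightarrow> measure (\<mu> (Q ` A)) (Q ` A) = k * measure (\<mu> A) A"
    and \<nu>: "\<And>A. transversal_arc X S G A \<Longrightarrow> measure (\<nu> (Q ` A)) (Q ` A) = inverse k * measure (\<nu> A) A"
  shows "\<exists>\<sigma>'. measured_box_chart (regular_part X S) F G \<mu> \<nu> (a / k) (b / k) (k * c) (k * d) \<sigma>' \<and>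
     \<sigma>' ` rectangle (a / k) (b / k) (k * c) (k * d) = Q ` \<sigma> ` rectangle a b c d"
proof -
  let ?Y = "regular_part X S"
  have bc: "box_chart ?Y F G a b c d \<sigma>" using \<sigma> by (simp only: measured_box_chart_def)
  have len: "measure (\<mu> (\<sigma> ` ({x} \<times> {s..t}))) (\<sigma> ` ({x} \<times> {s..t})) = t - s"
    if "x \<in> {a<..<b}" "c < s" "s < t" "t < d" for x s t
    using \<sigma> that unfolding measured_box_chart_def by blast
  have len': "measure (\<nu> (\<sigma> ` ({s..t} \<times> {y}))) (\<sigma> ` ({s..t} \<times> {y})) = t - s"
    if "y \<in> {c<..<d}" "a < s" "s < t" "t < b" for y s t
    using \<sigma> that unfolding measured_box_chart_def by blast
  have bQ: "box_chart ?Y F G a b c d (Q \<circ> \<sigma>)"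
    using FY GY by (intro box_chart_homeomorphic_image[OF bc Q F G]) simp_all
  interpret box_chart ?Y F G a b c d \<sigma> by (rule bc)
  let ?g = "\<lambda>x. k * x" and ?h = "\<lambda>y. y / k"
  have gi: "?g ` {a / k<..<b / k} = {a<..<b}"
  proof
    show "{a<..<b} \<subseteq> ?g ` {a / k<..<b / k}"
      using k by (auto simp: divide_strict_right_mono intro!: image_eqI[of _ _ "_ / k"])
  qed (use k in \<open>auto simp: field_simps\<close>)
  have hi: "?h ` {k * c<..<k * d} = {c<..<d}"
  proof
    show "{c<..<d} \<subseteq> ?h ` {k * c<..<k * d}"
      using k by (auto intro!: image_eqI[of _ _ "k * _"])
  qed (use k in \<open>auto simp: field_simps\<close>)
  let ?\<sigma> = "(Q \<circ> \<sigma>) \<circ> map_prod ?g ?h"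
  have chart: "box_chart ?Y F G (a / k) (b / k) (k * c) (k * d) ?\<sigma>"
    "?\<sigma> ` rectangle (a / k) (b / k) (k * c) (k * d) = (Q \<circ> \<sigma>) ` rectangle a b c d"
    using k ab cd
    by (intro box_chart_reparametrize[OF bQ] gi hi;
      auto intro!: continuous_intros strict_mono_onI simp: divide_strict_right_mono)+
  have "measured_box_chart ?Y F G \<mu> \<nu> (a / k) (b / k) (k * c) (k * d) ?\<sigma>"
    unfolding measured_box_chart_def
  proof (intro conjI allI impI chart(1); elim conjE)
    fix x s t assume x: "x \<in> {a / k<..<b / k}" and st: "k * c < s" "s < t" "t < k * d"
    have x': "k * x \<in> {a<..<b}" using gi x by blast
    have st': "c < s / k" "s / k < t / k" "t / k < d" using st k by (auto simp: field_simps)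
    have him: "?h ` {s..t} = {s / k..t / k}" using k by simp
    have "?\<sigma> ` ({x} \<times> {s..t}) = Q ` \<sigma> ` ({k * x} \<times> ?h ` {s..t})" by force
    then have im: "?\<sigma> ` ({x} \<times> {s..t}) = Q ` \<sigma> ` ({k * x} \<times> {s / k..t / k})" unfolding him .
    have I: "{s / k..t / k} \<subseteq> {c<..<d}" using st' by auto
    obtain L where L: "L \<in> G" "(\<lambda>y. \<sigma> (k * x, y)) ` {s / k..t / k} \<subseteq> L"
      using box_chart_vertical(3)[OF bc x' I] by (elim bexE)
    have "transversal_arc X S F (\<sigma> ` ({k * x} \<times> {s / k..t / k}))"
      using leaf_arc_transversal[OF haus tr box_chart_vertical(1,2)[OF bc x' I] L(2,1) st'(2)]
      unfolding box_chart_vertical(4)[OF bc x' I] .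
    then show "measure (\<mu> (?\<sigma> ` ({x} \<times> {s..t}))) (?\<sigma> ` ({x} \<times> {s..t})) = t - s"
      unfolding im using \<mu> len[OF x' st'] k by (simp add: field_simps)
  next
    fix y s t assume y: "y \<in> {k * c<..<k * d}" and st: "a / k < s" "s < t" "t < b / k"
    have y': "y / k \<in> {c<..<d}" using hi y by blast
    have st': "a < k * s" "k * s < k * t" "k * t < b" using st k by (auto simp: field_simps)
    have gim: "?g ` {s..t} = {k * s..k * t}" using k by simp
    have "?\<sigma> ` ({s..t} \<times> {y}) = Q ` \<sigma> ` (?g ` {s..t} \<times> {y / k})" by force
    then have im: "?\<sigma> ` ({s..t} \<times> {y}) = Q ` \<sigma> ` ({k * s..k * t} \<times> {y / k})" unfolding gim .
    have I: "{k * s..k * t} \<subseteq> {a<..<b}" using st' by auto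
    have sw: "(\<sigma> \<circ> prod.swap) ` ({z} \<times> I) = \<sigma> ` (I \<times> {z})" for z I by (force simp: image_iff)
    note v = box_chart_vertical[OF box_chart_swap[OF bc] y' I]
    obtain L where L: "L \<in> F" "(\<lambda>x. (\<sigma> \<circ> prod.swap) (y / k, x)) ` {k * s..k * t} \<subseteq> L"
      using v(3) by (elim bexE)
    have arc: "transversal_arc X S G (\<sigma> ` ({k * s..k * t} \<times> {y / k}))"
      using leaf_arc_transversal[OF haus transversal_regular_sym[OF tr] v(1,2) L(2,1) st'(2)]
      unfolding v(4) sw .
    have "inverse k * (k * t - k * s) = t - s" using k by (simp add: field_simps)
    then show "measure (\<nu> (?\<sigma> ` ({s..t} \<times> {y}))) (?\<sigma> ` ({s..t} \<times> {y})) = t - s"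
      unfolding im \<nu>[OF arc] len'[OF y' st'] .
  qed
  moreover have "?\<sigma> ` rectangle (a / k) (b / k) (k * c) (k * d) = Q ` \<sigma> ` rectangle a b c d"
    unfolding chart(2) by (simp only: image_comp)
  ultimately show ?thesis by (intro exI[of _ ?\<sigma>] conjI)
qed

lemma area_rectangle:
  assumes "a < b" "c < d"
  shows "area (rectangle a b c d) = (b - a) * (d - c)"
proof -
  have "vec2 ` rectangle a b c d = box (vec2 (a, c)) (vec2 (b, d))"
    by (auto simp: vec2_image mem_box_cart forall_2)
  then have "area (rectangle a b c d) = measure lborel (cbox (vec2 (a, c)) (vec2 (b, d)))"
    by (simp add: area_def measure_completion measure_lborel_box_eq measure_lborel_cbox_eq)
  moreover have "cbox (vec2 (a, c)) (vec2 (b, d)) \<noteq> {}"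
    using assms by (simp add: interval_ne_empty_cart forall_2)
  ultimately show ?thesis
    by (simp add: content_cbox_cart prod_2 UNIV_2)
qed

lemma sum_area_disjoint_le:
  assumes "finite I" "\<And>i. i \<in> I \<Longrightarrow> open (A i)" "disjoint_family_on A I" "\<And>i. i \<in> I \<Longrightarrow> A i \<subseteq> B" "open B" "bounded B"
  shows "(\<Sum>i\<in>I. area (A i)) \<le> area B"
proof -
  have m: "vec2 ` A i \<in> lmeasurable" if "i \<in> I" for i
    using assms that by (intro lmeasurable_vec2) (auto intro: bounded_subset)
  have "(\<Sum>i\<in>I. measure lebesgue (vec2 ` A i)) = measure lebesgue (\<Union>i\<in>I. vec2 ` A i)"
  proof (rule measure_finite_Union[symmetric, OF assms(1)])
    show "(\<lambda>i. vec2 ` A i) ` I \<subseteq> sets lebesgue" using m by blast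
    show "disjoint_family_on (\<lambda>i. vec2 ` A i) I"
      unfolding disjoint_family_on_def
    proof (intro ballI impI)
      fix i j assume "i \<in> I" "j \<in> I" "i \<noteq> j"
      then have "A i \<inter> A j = {}" using disjoint_family_onD[OF assms(3)] by blast
      then show "vec2 ` A i \<inter> vec2 ` A j = {}" by (simp add: image_Int[OF inj_vec2, symmetric])
    qed
    show "emeasure lebesgue (vec2 ` A i) \<noteq> \<infinity>" if "i \<in> I" for i
      using fmeasurableD2[OF m[OF that]] by simp
  qed
  also have "\<dots> \<le> measure lebesgue (vec2 ` B)"
  proof (rule measure_mono_fmeasurable)
    show "(\<Union>i\<in>I. vec2 ` A i) \<subseteq> vec2 ` B" using assms(4) by blast
    show "(\<Union>i\<in>I. vec2 ` A i) \<in> sets lebesgue" using m assms(1) by blast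
    show "vec2 ` B \<in> lmeasurable" by (rule lmeasurable_vec2[OF assms(5,6)])
  qed
  finally show ?thesis by (simp add: area_def)
qed

lemma area_cover_le:
  assumes "finite I" "\<And>i. i \<in> I \<Longrightarrow> open (A i)" "\<And>i. i \<in> I \<Longrightarrow> bounded (A i)" "B = (\<Union>i\<in>I. A i)"
  shows "area B \<le> (\<Sum>i\<in>I. area (A i))"
  unfolding area_def assms(4) image_UN
  using lmeasurable_vec2 assms(2,3) by (intro measure_UNION_le[OF assms(1)]) blast

lemma bounded_rectangle: "bounded (rectangle a b c d)"
  by (rule bounded_subset[of "{a..b} \<times> {c..d}"]) (auto intro!: bounded_Times)

section \<open>Areas of open sets in charts and the counting argument\<close>

locale measured_foliations =
  fixes X :: "'a topology" and S :: "'a set" and F G :: "'a set set" and \<mu> \<nu> :: "'a set \<Rightarrow> 'a measure"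
  assumes haus: "Hausdorff_space X" and tr: "transversal_regular (regular_part X S) F G"
    and \<mu>: "transversal_measure X S F \<mu>" and \<nu>: "transversal_measure X S G \<nu>"
begin

abbreviation "mchart \<equiv> measured_box_chart (regular_part X S) F G \<mu> \<nu>"

definition chart_domain :: "'a set \<Rightarrow> bool" where
  "chart_domain D \<longleftrightarrow> (\<exists>a b c d \<sigma>. mchart a b c d \<sigma> \<and> D = \<sigma> ` rectangle a b c d)"

text \<open>A chart containing \<open>E\<close> is chosen; for open \<open>E\<close> the value is
  independent of it by \<open>measured_box_chart_area_eq\<close>. All sets measured below are open
  and lie in one chart, so no countably additive measure on the surface has to be assembled.\<close>

definition leaf_area :: "'a set \<Rightarrow> real" where
  "leaf_area E = (SOME r. \<exists>a b c d \<sigma>. mchart a b c d \<sigma> \<and> E \<subseteq> \<sigma> ` rectangle a b c d \<and>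
      r = area {v \<in> rectangle a b c d. \<sigma> v \<in> E})"

lemma leaf_area_eq:
  assumes \<sigma>: "mchart a b c d \<sigma>" and E: "openin (regular_part X S) E" "E \<subseteq> \<sigma> ` rectangle a b c d"
  shows "leaf_area E = area {v \<in> rectangle a b c d. \<sigma> v \<in> E}"
proof -
  have "\<exists>r. \<exists>a b c d \<sigma>. mchart a b c d \<sigma> \<and> E \<subseteq> \<sigma> ` rectangle a b c d \<and> r = area {v \<in> rectangle a b c d. \<sigma> v \<in> E}"
    using \<sigma> E(2) by blast
  from someI_ex[OF this] obtain a' b' c' d' \<sigma>' where "mchart a' b' c' d' \<sigma>'" "E \<subseteq> \<sigma>' ` rectangle a' b' c' d'"
     "leaf_area E = area {v \<in> rectangle a' b' c' d'. \<sigma>' v \<in> E}"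
    unfolding leaf_area_def[symmetric] by (elim exE conjE)
  then show ?thesis
    using measured_box_chart_area_eq[OF _ \<sigma> E(1) _ E(2)] by simp
qed

lemma mchart_box: "mchart a b c d \<sigma> \<Longrightarrow> box_chart (regular_part X S) F G a b c d \<sigma>"
  by (simp only: measured_box_chart_def)

lemma openin_chart_domain:
  assumes "chart_domain D"
  shows "openin (regular_part X S) D"
proof -
  obtain a b c d \<sigma> where \<sigma>: "mchart a b c d \<sigma>" "D = \<sigma> ` rectangle a b c d"
    using assms unfolding chart_domain_def by (elim exE conjE)
  show ?thesis
    unfolding \<sigma>(2) by (rule box_chart.open_image[OF mchart_box[OF \<sigma>(1)]]) (simp_all add: open_Times)
qed

lemma open_chart_preimage:
  assumes \<sigma>: "mchart a b c d \<sigma>" and E: "openin (regular_part X S) E"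
  shows "open {v \<in> rectangle a b c d. \<sigma> v \<in> E}"
proof -
  have "openin (top_of_set (rectangle a b c d)) {v \<in> rectangle a b c d. \<sigma> v \<in> E}"
    using openin_continuous_map_preimage[OF box_chart.cont[OF mchart_box[OF \<sigma>]] E] by simp
  moreover have "open (rectangle a b c d)" by (simp add: open_Times)
  ultimately show ?thesis by (simp only: openin_open_eq)
qed

lemma leaf_area_chart:
  assumes \<sigma>: "mchart a b c d \<sigma>"
  shows "leaf_area (\<sigma> ` rectangle a b c d) = (b - a) * (d - c)"
proof -
  have "chart_domain (\<sigma> ` rectangle a b c d)" using \<sigma> unfolding chart_domain_def by blast
  then have "leaf_area (\<sigma> ` rectangle a b c d) = area {v \<in> rectangle a b c d. \<sigma> v \<in> \<sigma> ` rectangle a b c d}"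
    using leaf_area_eq[OF \<sigma> openin_chart_domain] by blast
  also have "{v \<in> rectangle a b c d. \<sigma> v \<in> \<sigma> ` rectangle a b c d} = rectangle a b c d" by blast
  finally show ?thesis
    using area_rectangle box_chart.ab[OF mchart_box[OF \<sigma>]] box_chart.cd[OF mchart_box[OF \<sigma>]] by simp
qed

lemma leaf_area_disjoint:
  assumes D: "chart_domain D" and I: "finite I" "\<And>i. i \<in> I \<Longrightarrow> openin (regular_part X S) (E i)" "disjoint_family_on E I"
    "\<And>i. i \<in> I \<Longrightarrow> E i \<subseteq> D"
  shows "(\<Sum>i\<in>I. leaf_area (E i)) \<le> leaf_area D"
proof -
  obtain a b c d \<sigma> where \<sigma>: "mchart a b c d \<sigma>" and D_eq: "D = \<sigma> ` rectangle a b c d"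
    using D unfolding chart_domain_def by (elim exE conjE)
  let ?R = "rectangle a b c d"
  have "(\<Sum>i\<in>I. leaf_area (E i)) = (\<Sum>i\<in>I. area {v \<in> ?R. \<sigma> v \<in> E i})"
    using I(2,4) by (intro sum.cong refl leaf_area_eq[OF \<sigma>]) (simp_all add: D_eq)
  also have "\<dots> \<le> area ?R"
  proof (rule sum_area_disjoint_le[OF I(1)])
    show "disjoint_family_on (\<lambda>i. {v \<in> ?R. \<sigma> v \<in> E i}) I"
      using I(3) unfolding disjoint_family_on_def by blast
  qed (use I(2) open_chart_preimage[OF \<sigma>] bounded_rectangle in \<open>auto simp: open_Times\<close>)
  also have "\<dots> = leaf_area D"
    unfolding D_eq leaf_area_chart[OF \<sigma>]
    using area_rectangle box_chart.ab[OF mchart_box[OF \<sigma>]] box_chart.cd[OF mchart_box[OF \<sigma>]] by simp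
  finally show ?thesis .
qed

text \<open>All pieces lie in the one chart with domain \<open>R\<close>, so their areas are
  computed there and ordinary subadditivity in the plane applies.\<close>

lemma leaf_area_cover:
  assumes R: "chart_domain R" and I: "finite I" "\<And>D. D \<in> I \<Longrightarrow> openin (regular_part X S) D" "R \<subseteq> \<Union>I"
  shows "leaf_area R \<le> (\<Sum>D\<in>I. leaf_area (R \<inter> D))"
proof -
  obtain a b c d \<sigma> where \<sigma>: "mchart a b c d \<sigma>" and R_eq: "R = \<sigma> ` rectangle a b c d"
    using R unfolding chart_domain_def by (elim exE conjE)
  let ?R = "rectangle a b c d"
  have oR: "openin (regular_part X S) (R \<inter> D)" if "D \<in> I" for D
    using openin_chart_domain[OF R] I(2)[OF that] by (rule openin_Int)
  have "leaf_area R = area ?R"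
    unfolding R_eq leaf_area_chart[OF \<sigma>]
    using area_rectangle box_chart.ab[OF mchart_box[OF \<sigma>]] box_chart.cd[OF mchart_box[OF \<sigma>]] by simp
  also have "\<dots> \<le> (\<Sum>D\<in>I. area {v \<in> ?R. \<sigma> v \<in> R \<inter> D})"
  proof (rule area_cover_le[OF I(1)])
    show "bounded {v \<in> ?R. \<sigma> v \<in> R \<inter> D}" for D
      by (rule bounded_subset[OF bounded_rectangle]) auto
    show "?R = (\<Union>D\<in>I. {v \<in> ?R. \<sigma> v \<in> R \<inter> D})"
    proof
      show "?R \<subseteq> (\<Union>D\<in>I. {v \<in> ?R. \<sigma> v \<in> R \<inter> D})"
      proof
        fix v assume v: "v \<in> ?R"
        then have vR: "\<sigma> v \<in> R" unfolding R_eq by (rule imageI)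
        then obtain D where "D \<in> I" "\<sigma> v \<in> D" using I(3) by blast
        then show "v \<in> (\<Union>D\<in>I. {v \<in> ?R. \<sigma> v \<in> R \<inter> D})" using v vR by blast
      qed
    qed blast
  qed (rule open_chart_preimage[OF \<sigma> oR])
  also have "\<dots> = (\<Sum>D\<in>I. leaf_area (R \<inter> D))"
  proof (rule sum.cong[OF refl])
    fix D assume "D \<in> I"
    then show "area {v \<in> ?R. \<sigma> v \<in> R \<inter> D} = leaf_area (R \<inter> D)"
      using leaf_area_eq[OF \<sigma> oR] by (simp add: R_eq)
  qed
  finally show ?thesis .
qed

text \<open>A finite total area forces recurrence: the images of a wandering rectangle would be
  pairwise disjoint and all have the same area.\<close>

lemma wandering_rectangle_impossible:
  assumes Q: "homeomorphic_map (regular_part X S) (regular_part X S) Q"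
    and F: "(`) Q ` F = F" and G: "(`) Q ` G = G" and FY: "\<Union>F \<subseteq> topspace X - S" and GY: "\<Union>G \<subseteq> topspace X - S"
    and k: "k > 0"
    and scale_\<mu>: "\<And>A. transversal_arc X S F A \<Longrightarrow> measure (\<mu> (Q ` A)) (Q ` A) = k * measure (\<mu> A) A"
    and scale_\<nu>: "\<And>A. transversal_arc X S G A \<Longrightarrow> measure (\<nu> (Q ` A)) (Q ` A) = inverse k * measure (\<nu> A) A"
    and cover: "finite I" "\<And>D. D \<in> I \<Longrightarrow> chart_domain D" "topspace X - S \<subseteq> \<Union>I"
    and R: "chart_domain R"
  shows "\<exists>n>0. (Q ^^ n) ` R \<inter> R \<noteq> {}"
proof (rule ccontr)
  let ?Y = "regular_part X S"
  assume "\<not> (\<exists>n>0. (Q ^^ n) ` R \<inter> R \<noteq> {})"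
  then have wander: "(Q ^^ n) ` R \<inter> R = {}" if "n > 0" for n using that by blast
  \<comment> \<open>The stretching and the compressing factor of the image chart cancel in the
    product of its side lengths.\<close>
  have step: "chart_domain (Q ` E) \<and> leaf_area (Q ` E) = leaf_area E" if E: "chart_domain E" for E
  proof -
    obtain a b c d \<sigma> where \<sigma>: "mchart a b c d \<sigma>" "E = \<sigma> ` rectangle a b c d"
      using E unfolding chart_domain_def by (elim exE conjE)
    have "\<exists>\<sigma>'. mchart (a / k) (b / k) (k * c) (k * d) \<sigma>' \<and>
       \<sigma>' ` rectangle (a / k) (b / k) (k * c) (k * d) = Q ` \<sigma> ` rectangle a b c d"
      by (rule measured_box_chart_image[OF haus tr \<sigma>(1) Q F G FY GY k]) (fact scale_\<mu> scale_\<nu>)+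
    then obtain \<sigma>' where \<sigma>': "mchart (a / k) (b / k) (k * c) (k * d) \<sigma>'"
      "\<sigma>' ` rectangle (a / k) (b / k) (k * c) (k * d) = Q ` E"
      unfolding \<sigma>(2) by (elim exE conjE)
    have "leaf_area (Q ` E) = (b / k - a / k) * (k * d - k * c)"
      unfolding \<sigma>'(2)[symmetric] by (rule leaf_area_chart[OF \<sigma>'(1)])
    also have "\<dots> = (b - a) * (d - c)" using k by (simp add: field_simps)
    also have "\<dots> = leaf_area E" unfolding \<sigma>(2) by (rule leaf_area_chart[OF \<sigma>(1), symmetric])
    finally show ?thesis using \<sigma>' unfolding chart_domain_def by blast
  qed
  define E where "E n = (Q ^^ n) ` R" for n
  have E: "chart_domain (E n) \<and> leaf_area (E n) = leaf_area R" for n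
  proof (induction n)
    case 0 then show ?case using R by (simp add: E_def)
  next
    case (Suc n)
    have "E (Suc n) = Q ` E n" by (simp add: E_def image_comp)
    then show ?case using step Suc by simp
  qed
  have ER: "E n \<subseteq> topspace X - S" for n
    using openin_subset[OF openin_chart_domain[OF conjunct1[OF E[of n]]]] by simp
  have "inj_on Q (topspace X - S)" using homeomorphic_imp_injective_map[OF Q] by simp
  \<comment> \<open>Injectivity of \<open>Q\<close> reduces disjointness of two iterates to
    disjointness of one iterate from \<open>R\<close> itself.\<close>
  then have shift: "E m \<inter> E (m + j) = {} \<longleftrightarrow> E 0 \<inter> E j = {}" for m j
  proof (induction m)
    case (Suc m)
    have "E (Suc m) \<inter> E (Suc m + j) = Q ` E m \<inter> Q ` E (m + j)" by (simp add: E_def image_comp)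
    also have "\<dots> = Q ` (E m \<inter> E (m + j))"
      using inj_on_image_Int[OF Suc.prems ER ER] by simp
    finally show ?case using Suc by simp
  qed simp
  have disj: "E m \<inter> E n = {}" if "m < n" for m n
  proof -
    have "E 0 \<inter> E (n - m) = {}" using wander[of "n - m"] that by (auto simp: E_def)
    then show ?thesis using shift[of m "n - m"] that by simp
  qed
  \<comment> \<open>Each iterate is cut up by the finitely many covering charts, and within one
    chart the pieces of different iterates are disjoint. So \<open>N\<close> equal areas fit into a
    total that does not depend on \<open>N\<close>.\<close>
  have bound: "real N * leaf_area R \<le> (\<Sum>D\<in>I. leaf_area D)" for N
  proof -
    have "real N * leaf_area R = (\<Sum>n<N. leaf_area (E n))" using E by simp
    also have "\<dots> \<le> (\<Sum>n<N. \<Sum>D\<in>I. leaf_area (E n \<inter> D))"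
    proof (rule sum_mono)
      fix n
      show "leaf_area (E n) \<le> (\<Sum>D\<in>I. leaf_area (E n \<inter> D))"
        by (rule leaf_area_cover[OF conjunct1[OF E] cover(1) openin_chart_domain[OF cover(2)] subset_trans[OF ER cover(3)]])
    qed
    also have "\<dots> = (\<Sum>D\<in>I. \<Sum>n<N. leaf_area (E n \<inter> D))" by (rule sum.swap)
    also have "\<dots> \<le> (\<Sum>D\<in>I. leaf_area D)"
    proof (rule sum_mono)
      fix D assume D: "D \<in> I"
      show "(\<Sum>n<N. leaf_area (E n \<inter> D)) \<le> leaf_area D"
      proof (rule leaf_area_disjoint[OF cover(2)[OF D]])
        show "openin ?Y (E n \<inter> D)" for n
          by (rule openin_Int[OF openin_chart_domain[OF conjunct1[OF E]] openin_chart_domain[OF cover(2)[OF D]]])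
        show "disjoint_family_on (\<lambda>n. E n \<inter> D) {..<N}"
          unfolding disjoint_family_on_def
        proof (intro ballI impI)
          fix m n :: nat assume "m \<noteq> n"
          then have "m < n \<or> n < m" by linarith
          then show "E m \<inter> D \<inter> (E n \<inter> D) = {}" using disj[of m n] disj[of n m] by blast
        qed
      qed auto
    qed
    finally show ?thesis .
  qed
  obtain a b c d \<sigma> where \<sigma>: "mchart a b c d \<sigma>" "R = \<sigma> ` rectangle a b c d"
    using R unfolding chart_domain_def by (elim exE conjE)
  have "leaf_area R > 0"
    unfolding \<sigma>(2) leaf_area_chart[OF \<sigma>(1)]
    using box_chart.ab[OF mchart_box[OF \<sigma>(1)]] box_chart.cd[OF mchart_box[OF \<sigma>(1)]] by simp
  then obtain N :: nat where "(\<Sum>D\<in>I. leaf_area D) < real N * leaf_area R"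
    using reals_Archimedean3 by blast
  then show False using bound[of N] by simp
qed

lemma chart_domain_within:
  assumes D: "chart_domain D" and U: "openin (regular_part X S) U" and x: "x \<in> D" "x \<in> U"
  obtains R where "chart_domain R" "R \<subseteq> U"
proof -
  obtain a b c d \<sigma> where \<sigma>: "mchart a b c d \<sigma>" "D = \<sigma> ` rectangle a b c d"
    using D unfolding chart_domain_def by (elim exE conjE)
  obtain v where v: "v \<in> rectangle a b c d" "\<sigma> v = x" using x(1) \<sigma>(2) by blast
  let ?D = "{v \<in> rectangle a b c d. \<sigma> v \<in> U}"
  have "(fst v, snd v) \<in> ?D" using v x by simp
  then obtain a' b' c' d' where R: "fst v \<in> {a'<..<b'}" "snd v \<in> {c'<..<d'}" "rectangle a' b' c' d' \<subseteq> ?D"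
    by (rule open_contains_rectangle[OF open_chart_preimage[OF \<sigma>(1) U]])
  define p where "p = max a a'"
  define q where "q = min b b'"
  define r where "r = max c c'"
  define s where "s = min d d'"
  have "mchart p q r s \<sigma>"
    using v(1) R(1,2) by (intro measured_box_chart_restrict[OF \<sigma>(1)]) (auto simp: p_def q_def r_def s_def mem_Times_iff)
  moreover have "rectangle p q r s \<subseteq> rectangle a' b' c' d'" by (auto simp: p_def q_def r_def s_def)
  then have "\<sigma> ` rectangle p q r s \<subseteq> U" using R(3) by blast
  ultimately show ?thesis using that[of "\<sigma> ` rectangle p q r s"] unfolding chart_domain_def by blast
qed

end

subsection \<open>Charts near regular points and near saddles\<close>

lemma plane_chart_inverse:
  assumes "plane_chart Y U \<phi>"
  obtains \<psi> where "continuous_map euclidean Y \<psi>" "\<And>z. \<psi> z \<in> U" "\<And>z. \<phi> (\<psi> z) = z" "\<And>x. x \<in> U \<Longrightarrow> \<psi> (\<phi> x) = x"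
    "\<And>W. open W \<Longrightarrow> openin Y (\<psi> ` W)"
proof -
  have U: "openin Y U" "U \<subseteq> topspace Y" and h: "homeomorphic_map (subtopology Y U) euclidean \<phi>"
    using assms openin_subset by (auto simp: plane_chart_def)
  obtain \<psi> where \<psi>: "homeomorphic_maps (subtopology Y U) euclidean \<phi> \<psi>"
    using h homeomorphic_map_maps by blast
  have tU: "topspace (subtopology Y U) = U" by (rule topspace_subtopology_subset[OF U(2)])
  have c: "continuous_map euclidean (subtopology Y U) \<psi>" and i: "\<And>z. \<phi> (\<psi> z) = z" "\<And>x. x \<in> U \<Longrightarrow> \<psi> (\<phi> x) = x"
    using \<psi> unfolding homeomorphic_maps_def tU by auto
  have inU: "\<psi> z \<in> U" for z
    using continuous_map_image_subset_topspace[OF c] unfolding tU by auto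
  have "homeomorphic_map euclidean (subtopology Y U) \<psi>"
    using \<psi> homeomorphic_maps_map homeomorphic_maps_sym by blast
  then have "open_map euclidean (subtopology Y U) \<psi>" by (rule homeomorphic_imp_open_map)
  then have "openin Y (\<psi> ` W)" if "open W" for W
    using that openin_trans_full[OF _ U(1)] unfolding open_map_def by simp
  then show ?thesis
    using that[of \<psi>] continuous_map_into_fulltopology[OF c] inU i by blast
qed

lemma plane_chart_inj: "plane_chart Y U \<phi> \<Longrightarrow> inj_on \<phi> U"
  using plane_chart_inverse by (metis inj_on_inverseI)

context measured_foliations
begin

text \<open>The domain \<open>V\<close> of the parametrization may omit parts of the boundary of the
  rectangle: one closed vertical and one closed horizontal segment inside \<open>V\<close> already
  give sides of finite mass. In this way a saddle may sit at a boundary point.\<close>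

lemma chart_domainI:
  assumes \<kappa>: "continuous_map (top_of_set V) (regular_part X S) \<kappa>" and inj: "inj_on \<kappa> (rectangle a b c d)"
    and ab: "a < b" "c < d" and R: "rectangle a b c d \<subseteq> V"
    and open_im: "\<And>W. open W \<Longrightarrow> W \<subseteq> rectangle a b c d \<Longrightarrow> openin (regular_part X S) (\<kappa> ` W)"
    and hor: "\<And>I y. I \<noteq> {} \<Longrightarrow> I \<times> {y} \<subseteq> V \<Longrightarrow> \<exists>L\<in>F. \<kappa> ` (I \<times> {y}) \<subseteq> L"
    and ver: "\<And>I x. I \<noteq> {} \<Longrightarrow> {x} \<times> I \<subseteq> V \<Longrightarrow> \<exists>L\<in>G. \<kappa> ` ({x} \<times> I) \<subseteq> L"
    and plaque: "\<And>C L u v. L \<in> F \<Longrightarrow> path_connectedin (regular_part X S) C \<Longrightarrow> C \<subseteq> L \<Longrightarrow> C \<subseteq> \<kappa> ` rectangle a b c d \<Longrightarrow>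
        u \<in> rectangle a b c d \<Longrightarrow> v \<in> rectangle a b c d \<Longrightarrow> \<kappa> u \<in> C \<Longrightarrow> \<kappa> v \<in> C \<Longrightarrow> snd u = snd v"
      "\<And>C L u v. L \<in> G \<Longrightarrow> path_connectedin (regular_part X S) C \<Longrightarrow> C \<subseteq> L \<Longrightarrow> C \<subseteq> \<kappa> ` rectangle a b c d \<Longrightarrow>
        u \<in> rectangle a b c d \<Longrightarrow> v \<in> rectangle a b c d \<Longrightarrow> \<kappa> u \<in> C \<Longrightarrow> \<kappa> v \<in> C \<Longrightarrow> fst u = fst v"
    and x0: "x0 \<in> {a<..<b}" "{x0} \<times> {c..d} \<subseteq> V" "inj_on \<kappa> ({x0} \<times> {c..d})"
    and y0: "y0 \<in> {c<..<d}" "{a..b} \<times> {y0} \<subseteq> V" "inj_on \<kappa> ({a..b} \<times> {y0})"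
  shows "chart_domain (\<kappa> ` rectangle a b c d)"
proof -
  let ?Y = "regular_part X S"
  have bc: "box_chart ?Y F G a b c d \<kappa>"
  proof (rule box_chart.intro, goal_cases)
    case 1 show ?case by (rule ab)
  next
    case 2 show ?case by (rule ab)
  next
    case 3 show ?case by (rule continuous_map_from_subtopology_mono[OF \<kappa> R])
  next
    case 4 show ?case by (rule inj)
  next
    case (5 W) then show ?case by (rule open_im)
  next
    case (6 y)
    have "{a<..<b} \<noteq> {}" "{a<..<b} \<times> {y} \<subseteq> V" using 6 ab R by auto
    from hor[OF this] show ?case by blast
  next
    case (7 x)
    have "{c<..<d} \<noteq> {}" "{x} \<times> {c<..<d} \<subseteq> V" using 7 ab R by auto
    from ver[OF this] show ?case by blast
  next
    case (8 C L u v) then show ?case by (rule plaque(1))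
  next
    case (9 C L u v) then show ?case by (rule plaque(2))
  qed
  have "{c..d} \<noteq> {}" using ab by simp
  from ver[OF this x0(2)] obtain L where L: "L \<in> G" "\<kappa> ` ({x0} \<times> {c..d}) \<subseteq> L" by (elim bexE)
  have "{a..b} \<noteq> {}" using ab by simp
  from hor[OF this y0(2)] obtain K where K: "K \<in> F" "\<kappa> ` ({a..b} \<times> {y0}) \<subseteq> K" by (elim bexE)
  have "continuous_map (top_of_set {c..d}) (top_of_set V) (\<lambda>y. (x0, y))"
    using x0(2) by (auto simp: continuous_map_in_subtopology intro!: continuous_intros)
  from continuous_map_compose[OF this \<kappa>]
  have c1: "continuous_map (top_of_set {c..d}) ?Y (\<lambda>y. \<kappa> (x0, y))" by (simp add: o_def)
  have "continuous_map (top_of_set {a..b}) (top_of_set V) (\<lambda>x. (x, y0))"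
    using y0(2) by (auto simp: continuous_map_in_subtopology intro!: continuous_intros)
  from continuous_map_compose[OF this \<kappa>]
  have c2: "continuous_map (top_of_set {a..b}) ?Y (\<lambda>x. \<kappa> (x, y0))" by (simp add: o_def)
  have i1: "inj_on (\<lambda>y. \<kappa> (x0, y)) {c..d}"
    by (rule inj_onI) (use inj_onD[OF x0(3)] in fastforce)
  have i2: "inj_on (\<lambda>x. \<kappa> (x, y0)) {a..b}"
    by (rule inj_onI) (use inj_onD[OF y0(3)] in fastforce)
  have s1: "(\<lambda>y. \<kappa> (x0, y)) ` {c..d} \<subseteq> L" and s2: "(\<lambda>x. \<kappa> (x, y0)) ` {a..b} \<subseteq> K"
    using L(2) K(2) by auto
  have "\<exists>a' b' c' d' \<sigma>'. mchart a' b' c' d' \<sigma>' \<and> \<sigma>' ` rectangle a' b' c' d' = \<kappa> ` rectangle a b c d"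
    by (rule measured_box_chart_exists[OF haus tr \<mu> \<nu> bc x0(1) c1 i1 s1 L(1) refl y0(1) c2 i2 s2 K(1) refl])
  then show ?thesis unfolding chart_domain_def by (elim exE conjE) (intro exI conjI, assumption, erule sym)
qed

lemma regular_point_chart:
  assumes x: "x \<in> topspace X - S"
  obtains D where "chart_domain D" "x \<in> D"
proof -
  let ?Y = "regular_part X S"
  have "x \<in> topspace ?Y" using x by simp
  from bspec[OF tr[unfolded transversal_regular_def] this]
  obtain U \<phi> where U: "x \<in> U" "plane_chart ?Y U \<phi>"
    and Fl: "(`) \<phi> ` restricted_leaves ?Y F U = horizontal_lines"
    and Gl: "(`) \<phi> ` restricted_leaves ?Y G U = vertical_lines"
    by (elim exE conjE)
  obtain \<psi> where \<psi>: "continuous_map euclidean ?Y \<psi>" "\<And>z. \<psi> z \<in> U" "\<And>z. \<phi> (\<psi> z) = z" "\<And>x. x \<in> U \<Longrightarrow> \<psi> (\<phi> x) = x"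
    "\<And>W. open W \<Longrightarrow> openin ?Y (\<psi> ` W)"
    using plane_chart_inverse[OF U(2)] by blast
  \<comment> \<open>Chart coordinates are translated so that \<open>x\<close> becomes the centre of
    the square.\<close>
  let ?e = "\<lambda>v. \<phi> x + Complex (fst v) (snd v)"
  let ?\<kappa> = "\<psi> \<circ> ?e"
  have ec: "continuous_on A ?e" for A
    unfolding Complex_eq by (intro continuous_intros)
  have \<kappa>: "continuous_map (top_of_set UNIV) ?Y ?\<kappa>"
    using ec \<psi>(1) by (intro continuous_map_compose[of _ euclidean]) auto
  have \<phi>\<kappa>: "\<phi> (?\<kappa> v) = ?e v" for v by (simp add: \<psi>(3))
  have \<kappa>U: "?\<kappa> v \<in> U" for v by (simp add: \<psi>(2))
  have inj: "inj_on ?\<kappa> A" for A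
  proof (rule inj_onI)
    fix u v assume "?\<kappa> u = ?\<kappa> v"
    then have "?e u = ?e v" using \<phi>\<kappa> by metis
    then show "u = v" by (simp add: prod_eq_iff)
  qed
  have injU: "inj_on \<phi> U" by (rule plane_chart_inj[OF U(2)])
  have "chart_domain (?\<kappa> ` rectangle (- 1) 1 (- 1) 1)"
  proof (rule chart_domainI[OF \<kappa> inj, of "- 1" 1 "- 1" 1 0 0], goal_cases)
    case (4 W)
    have "?e ` W = (\<lambda>z. (Re (z - \<phi> x), Im (z - \<phi> x))) -` W"
      by (auto simp: image_iff complex_eq_iff) (metis add.commute complex.sel diff_add_cancel fst_conv snd_conv)
    moreover have "continuous_on UNIV (\<lambda>z. (Re (z - \<phi> x), Im (z - \<phi> x)))" by (intro continuous_intros)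
    ultimately have "open (?e ` W)" using 4(1) by (simp add: open_vimage)
    from \<psi>(5)[OF this] show ?case by (simp only: image_comp)
  next
    case (5 I y)
    have "{z. Im z = Im (\<phi> x) + y} \<in> horizontal_lines" by (auto simp: horizontal_lines_def)
    from level_set_in_leaf[OF injU Fl this] obtain L where L: "L \<in> F" "{p \<in> U. \<phi> p \<in> {z. Im z = Im (\<phi> x) + y}} \<subseteq> L" .
    have "?\<kappa> ` (I \<times> {y}) \<subseteq> L" using L(2) \<kappa>U \<phi>\<kappa> by (auto simp: subset_iff)
    then show ?case using L(1) by blast
  next
    case (6 I y)
    have "{z. Re z = Re (\<phi> x) + y} \<in> vertical_lines" by (auto simp: vertical_lines_def)
    from level_set_in_leaf[OF injU Gl this] obtain L where L: "L \<in> G" "{p \<in> U. \<phi> p \<in> {z. Re z = Re (\<phi> x) + y}} \<subseteq> L" .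
    have "?\<kappa> ` ({y} \<times> I) \<subseteq> L" using L(2) \<kappa>U \<phi>\<kappa> by (auto simp: subset_iff)
    then show ?case using L(1) by blast
  next
    case (7 C L u v)
    have "C \<subseteq> U" using 7(4) \<kappa>U by blast
    from horizontal_level_constant[OF Fl 7(2) this 7(3,1,7,8)] show ?case unfolding \<phi>\<kappa> by simp
  next
    case (8 C L u v)
    have "C \<subseteq> U" using 8(4) \<kappa>U by blast
    from vertical_level_constant[OF Gl 8(2) this 8(3,1,7,8)] show ?case unfolding \<phi>\<kappa> by simp
  qed (simp_all add: inj)
  moreover have "x \<in> ?\<kappa> ` rectangle (- 1) 1 (- 1) 1"
    by (rule image_eqI[of _ _ "(0, 0)"]) (simp_all add: \<psi>(4)[OF U(1)] Complex_eq)
  ultimately show ?thesis by (rule that)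
qed

end

section \<open>Branches of fractional powers on a half-plane\<close>

definition right_half :: "complex set" where
  "right_half = {u. Re u > 0 \<or> (Re u = 0 \<and> Im u > 0)}"

text \<open>On \<open>right_half\<close>, which contains exactly one of u and -u for each nonzero u
  and avoids the cut of \<open>Ln\<close>, this is a branch of c * u^(2/q). If c^q = \<beta>^2, then
  the q-th power of its value at b / \<beta> is b^2, so b is a value of z^(q/2) there: the map
  inverts the function whose level sets are the saddle leaves.\<close>

definition sector_map :: "nat \<Rightarrow> complex \<Rightarrow> complex \<Rightarrow> complex" where
  "sector_map q c u = c * exp (of_real (2 / real q) * Ln u)"

lemma right_half_Ln:
  assumes "u \<in> right_half"
  shows "u \<noteq> 0" "- pi / 2 < Im (Ln u)" "Im (Ln u) \<le> pi / 2" "u \<notin> \<real>\<^sub>\<le>\<^sub>0"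
proof -
  show u0: "u \<noteq> 0" using assms by (auto simp: right_half_def)
  have "\<bar>Im (Ln u)\<bar> \<le> pi / 2" using assms Re_Ln_pos_le[OF u0] by (auto simp: right_half_def)
  moreover have "0 < Im (Ln u)" if "Im u > 0" using Im_Ln_pos_lt[OF u0] that by blast
  moreover have "\<bar>Im (Ln u)\<bar> < pi / 2" if "Re u > 0" using Re_Ln_pos_lt[OF u0] that by blast
  ultimately show "- pi / 2 < Im (Ln u)" "Im (Ln u) \<le> pi / 2"
    using assms pi_gt_zero by (auto simp: right_half_def abs_le_iff abs_less_iff)
  show "u \<notin> \<real>\<^sub>\<le>\<^sub>0" using assms by (auto simp: right_half_def complex_nonpos_Reals_iff)
qed

text \<open>Convexity, including the half of the boundary line that belongs to the set, keeps
  straight paths in the domain of the branch.\<close>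

lemma right_half_segment:
  assumes "u \<in> right_half" "v \<in> right_half" "t \<in> {0..1}"
  shows "u + of_real t * (v - u) \<in> right_half"
proof -
  have *: "Re (u + of_real t * (v - u)) = (1 - t) * Re u + t * Re v"
    "Im (u + of_real t * (v - u)) = (1 - t) * Im u + t * Im v"
    by (simp_all add: algebra_simps)
  have uv: "Re u \<ge> 0" "Re v \<ge> 0" using assms by (auto simp: right_half_def)
  have nn: "(1 - t) * Re u \<ge> 0" "t * Re v \<ge> 0" using uv assms(3) by auto
  show ?thesis
  proof (cases "t = 0 \<or> t = 1")
    case True then show ?thesis using assms by auto
  next
    case False
    then have t: "0 < t" "t < 1" using assms(3) by auto
    show ?thesis
    proof (cases "Re u > 0 \<or> Re v > 0")
      case True
      then have "(1 - t) * Re u + t * Re v > 0"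
        using t nn by (auto intro: add_pos_nonneg add_nonneg_pos)
      then show ?thesis unfolding right_half_def mem_Collect_eq * by blast
    next
      case False
      then have "Im u > 0" "Im v > 0" "Re u = 0" "Re v = 0" using assms uv by (auto simp: right_half_def)
      then have "(1 - t) * Im u + t * Im v > 0" "(1 - t) * Re u + t * Re v = 0" using t by (auto intro: add_pos_pos)
      then show ?thesis unfolding right_half_def mem_Collect_eq * by blast
    qed
  qed
qed

lemma continuous_on_sector_map: "continuous_on right_half (sector_map q c)"
  unfolding sector_map_def using right_half_Ln(4) by (intro continuous_intros) auto

lemma sector_map_nonzero: "c \<noteq> 0 \<Longrightarrow> sector_map q c u \<noteq> 0"
  by (simp add: sector_map_def)

lemma sector_map_power:
  assumes "q > 0" "u \<noteq> 0"
  shows "sector_map q c u ^ q = c ^ q * u\<^sup>2"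
proof -
  have "exp (of_real (2 / real q) * Ln u) ^ q = exp (of_nat q * (of_real (2 / real q) * Ln u))"
    by (rule exp_of_nat_mult[symmetric])
  also have "of_nat q * (of_real (2 / real q) * Ln u) = 2 * Ln u"
    using assms(1) by simp
  also have "exp (2 * Ln u) = u\<^sup>2"
    using assms(2) by (simp add: exp_double)
  finally show ?thesis by (simp add: sector_map_def power_mult_distrib)
qed

text \<open>Arguments in \<open>right_half\<close> differ by less than \<pi>. Multiplied by 2/q,
  which is at most 2, they differ by less than 2 \<pi>, so equal exponentials force equal
  logarithms.\<close>

lemma inj_on_sector_map:
  assumes q: "q > 0" and c: "c \<noteq> 0"
  shows "inj_on (sector_map q c) right_half"
proof (rule inj_onI)
  fix u v assume u: "u \<in> right_half" and v: "v \<in> right_half" and eq: "sector_map q c u = sector_map q c v"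
  let ?a = "2 / real q"
  have a: "0 < ?a" "?a \<le> 2" using q by (auto simp: field_simps)
  have "exp (of_real ?a * Ln u) = exp (of_real ?a * Ln v)"
    using eq c by (simp add: sector_map_def)
  then obtain n :: int where n: "of_real ?a * Ln u = of_real ?a * Ln v + (of_int (2 * n) * pi) * \<i>"
    unfolding exp_eq by blast
  then have "Im (of_real ?a * Ln u) = Im (of_real ?a * Ln v + (of_int (2 * n) * pi) * \<i>)" by simp
  then have im: "?a * (Im (Ln u) - Im (Ln v)) = 2 * of_int n * pi"
    by (simp add: algebra_simps)
  have "\<bar>Im (Ln u) - Im (Ln v)\<bar> < pi"
    using right_half_Ln[OF u] right_half_Ln[OF v] by (simp add: abs_less_iff)
  then have "?a * \<bar>Im (Ln u) - Im (Ln v)\<bar> < ?a * pi" by (rule mult_strict_left_mono[OF _ a(1)])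
  also have "\<dots> \<le> 2 * pi" by (rule mult_right_mono[OF a(2)]) simp
  finally have "?a * \<bar>Im (Ln u) - Im (Ln v)\<bar> < 2 * pi" .
  then have "\<bar>2 * of_int n * pi\<bar> < 2 * pi"
    using im a(1) by (metis abs_mult abs_of_pos)
  then have "\<bar>of_int n\<bar> < (1::real)" using pi_gt_zero by (simp add: abs_mult)
  then have "n = 0" by linarith
  then have "Ln u = Ln v" using n a by simp
  then show "u = v" using right_half_Ln(1)[OF u] right_half_Ln(1)[OF v] by (metis exp_Ln)
qed

text \<open>A straight segment on which the component is constant is itself a continuous branch of
  z^(q/2) along its image path, and this pair of paths is what the definition of a saddle leaf asks
  for.\<close>

lemma sector_map_same_leaf:
  assumes q: "q > 0" and c: "c \<noteq> 0" "c ^ q = \<beta>\<^sup>2" "\<beta> \<noteq> 0"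
    and u: "b / \<beta> \<in> right_half" "b' / \<beta> \<in> right_half"
    and comp: "\<And>t. t \<in> {0..1} \<Longrightarrow> component (b + of_real t * (b' - b)) = component b"
  shows "sector_map q c (b' / \<beta>) \<in> saddle_leaf component q (sector_map q c (b / \<beta>))"
proof -
  let ?b = "\<lambda>t. b + of_real t * (b' - b)"
  let ?\<gamma> = "\<lambda>t. sector_map q c (?b t / \<beta>)"
  have seg: "?b t / \<beta> \<in> right_half" if "t \<in> {0..1}" for t
    using right_half_segment[OF u that] c(3) by (simp add: field_simps)
  have "path ?b" unfolding path_def by (intro continuous_intros)
  moreover have "path ?\<gamma>"
    unfolding path_def
    by (rule continuous_on_compose2[OF continuous_on_sector_map]) (use seg c(3) in \<open>auto intro!: continuous_intros\<close>)
  moreover have "(?b t)\<^sup>2 = ?\<gamma> t ^ q" if "t \<in> {0..1}" for t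
    using sector_map_power[OF q right_half_Ln(1)[OF seg[OF that]], of c] c by (simp add: power_divide)
  moreover have "component (?b t) = component (?b 0)" if "t \<in> {0..1}" for t
    using comp[OF that] by simp
  ultimately show ?thesis
    unfolding saddle_leaf_def
    by (intro CollectI exI[of _ ?\<gamma>] exI[of _ ?b])
       (auto simp: pathstart_def pathfinish_def sector_map_nonzero[OF c(1)])
qed

text \<open>A change of sign would pass through 0 and force the common absolute value to be 0. This
  removes the sign ambiguity of square roots on connected pieces of leaves.\<close>

lemma connected_abs_constant:
  fixes f :: "'a \<Rightarrow> real"
  assumes "connected (f ` A)" "\<And>x. x \<in> A \<Longrightarrow> \<bar>f x\<bar> = m" "x \<in> A" "y \<in> A"
  shows "f x = f y"
proof (rule ccontr)
  assume ne: "f x \<noteq> f y"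
  have m: "\<bar>f x\<bar> = m" "\<bar>f y\<bar> = m" using assms by auto
  then have "(f x \<le> 0 \<and> 0 \<le> f y) \<or> (f y \<le> 0 \<and> 0 \<le> f x)" "m \<noteq> 0" using ne by auto
  then have "0 \<in> f ` A"
    using connectedD_interval[OF assms(1)] assms(3,4) by blast
  then show False using assms(2) \<open>m \<noteq> 0\<close> by force
qed

text \<open>Two square roots of the same number differ by a sign, so a leaf determines the component
  of z^(q/2) only up to sign.\<close>

lemma saddle_leaf_component_abs:
  assumes "w \<in> saddle_leaf component q z" "b\<^sup>2 = w ^ q" "b0\<^sup>2 = z ^ q" "\<And>x. component (- x) = - component x"
  shows "\<bar>component b\<bar> = \<bar>component b0 :: real\<bar>"
proof -
  obtain \<gamma> B where B: "pathstart \<gamma> = z" "pathfinish \<gamma> = w"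
    "\<And>t. t \<in> {0..1} \<Longrightarrow> (B t)\<^sup>2 = \<gamma> t ^ q \<and> component (B t) = component (B 0)"
    using assms(1) unfolding saddle_leaf_def by blast
  have "b\<^sup>2 = (B 1)\<^sup>2" "b0\<^sup>2 = (B 0)\<^sup>2" "component (B 1) = component (B 0)"
    using B(3)[of 1] B(3)[of 0] assms(2,3) B(1,2) by (auto simp: pathstart_def pathfinish_def)
  then show ?thesis using assms(4) by (metis abs_minus_cancel power2_eq_iff)
qed

context measured_foliations
begin

text \<open>The coordinates are the real and imaginary parts of a branch of z^(q/2), so horizontal
  and vertical segments lie in leaves. For the plaque conditions, the absolute value of the
  component is constant on a leaf, and connectedness of the piece fixes its sign.\<close>

lemma sector_chart:
  assumes U: "openin X U" "s \<in> U" and US: "U - {s} \<subseteq> topspace X - S"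
    and \<psi>: "continuous_map euclidean X \<psi>" "\<And>z. \<psi> z \<in> U" "\<And>z. \<phi> (\<psi> z) = z" "\<And>x. x \<in> U \<Longrightarrow> \<psi> (\<phi> x) = x"
      "\<And>W. open W \<Longrightarrow> openin X (\<psi> ` W)" and \<phi>: "\<phi> s = 0" "inj_on \<phi> U"
    and Fl: "(`) \<phi> ` restricted_leaves X F (U - {s}) = saddle_leaves Im q"
    and Gl: "(`) \<phi> ` restricted_leaves X G (U - {s}) = saddle_leaves Re q"
    and q: "q > 0" and c: "c \<noteq> 0" "c ^ q = \<beta>\<^sup>2" "\<beta> \<noteq> 0"
    and ab: "a < b" "a' < b'"
    and R: "\<And>x y. x \<in> {a<..<b} \<Longrightarrow> y \<in> {a'<..<b'} \<Longrightarrow> Complex x y / \<beta> \<in> right_half"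
    and x0: "x0 \<in> {a<..<b}" "\<And>y. y \<in> {a'..b'} \<Longrightarrow> Complex x0 y / \<beta> \<in> right_half"
    and y0: "y0 \<in> {a'<..<b'}" "\<And>x. x \<in> {a..b} \<Longrightarrow> Complex x y0 / \<beta> \<in> right_half"
  shows "chart_domain ((\<lambda>v. \<psi> (sector_map q c (Complex (fst v) (snd v) / \<beta>))) ` rectangle a b a' b')"
proof -
  let ?Y = "regular_part X S"
  let ?B = "\<lambda>v. Complex (fst v) (snd v)"
  let ?e = "\<lambda>v. sector_map q c (?B v / \<beta>)"
  let ?\<kappa> = "\<lambda>v. \<psi> (?e v)"
  let ?V = "{v. ?B v / \<beta> \<in> right_half}"
  let ?R = "rectangle a b a' b'"
  have Bc: "continuous_on A (\<lambda>v. ?B v / \<beta>)" for A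
    unfolding Complex_eq using c(3) by (intro continuous_intros) auto
  have ec: "continuous_on ?V ?e"
    by (rule continuous_on_compose2[OF continuous_on_sector_map Bc]) auto
  have ne: "?e v \<noteq> 0" for v by (rule sector_map_nonzero[OF c(1)])
  have \<kappa>U: "?\<kappa> v \<in> U - {s}" for v
    using \<psi>(2,3) ne \<phi>(1) by (metis DiffI singletonD)
  have XY: "regular_part X S = subtopology X (topspace X - S)" by (simp add: regular_part_def)
  have "continuous_map (top_of_set ?V) X ?\<kappa>"
    using continuous_map_compose[of "top_of_set ?V" euclidean ?e X \<psi>] ec \<psi>(1) by (simp add: o_def)
  then have \<kappa>: "continuous_map (top_of_set ?V) ?Y ?\<kappa>"
    unfolding XY continuous_map_in_subtopology using \<kappa>U US by auto
  have inj: "inj_on ?\<kappa> A" if "A \<subseteq> ?V" for A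
  proof (rule inj_onI)
    fix u v assume uv: "u \<in> A" "v \<in> A" "?\<kappa> u = ?\<kappa> v"
    then have "?e u = ?e v" using \<psi>(3) by metis
    moreover have "?B u / \<beta> \<in> right_half" "?B v / \<beta> \<in> right_half" using uv that by auto
    ultimately have "?B u / \<beta> = ?B v / \<beta>" by (rule inj_onD[OF inj_on_sector_map[OF q c(1)]])
    then show "u = v" using c(3) by (simp add: prod_eq_iff)
  qed
  have pow: "(?B v)\<^sup>2 = ?e v ^ q" if "v \<in> ?V" for v
  proof -
    have "?B v / \<beta> \<in> right_half" using that by simp
    from sector_map_power[OF q right_half_Ln(1)[OF this], of c] show ?thesis
      using c by (simp add: power_divide)
  qed
  have RV: "?R \<subseteq> ?V" using R by auto
  have oR: "openin ?Y (?\<kappa> ` W)" if W: "open W" "W \<subseteq> ?R" for W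
  proof -
    have injW: "inj_on ?\<kappa> W" by (rule inj[OF subset_trans[OF W(2) RV]])
    have "inj_on ?e W"
      by (rule inj_onI) (use inj_onD[OF injW] in metis)
    then have "open (?e ` W)"
      using W RV by (intro invariance_of_domain_gen continuous_on_subset[OF ec]) auto
    from \<psi>(5)[OF this] have "openin X (?\<kappa> ` W)" by (simp only: image_image)
    moreover have "?\<kappa> ` W \<subseteq> topspace X - S" using \<kappa>U US by blast
    ultimately show ?thesis unfolding XY openin_subtopology by blast
  qed
  have leaf: "\<exists>L\<in>H. ?\<kappa> ` A \<subseteq> L"
    if H: "(`) \<phi> ` restricted_leaves X H (U - {s}) = saddle_leaves component q" and A: "A \<noteq> {}" "A \<subseteq> ?V"
      and comp: "\<And>u v t. u \<in> A \<Longrightarrow> v \<in> A \<Longrightarrow> component (?B u + of_real t * (?B v - ?B u)) = component (?B u)"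
    for H A component
  proof -
    obtain u where u: "u \<in> A" using A(1) by blast
    have "saddle_leaf component q (?e u) \<in> saddle_leaves component q"
      using ne by (auto simp: saddle_leaves_def)
    from level_set_in_leaf[OF inj_on_subset[OF \<phi>(2) Diff_subset] H this]
    obtain L where L: "L \<in> H" "{x \<in> U - {s}. \<phi> x \<in> saddle_leaf component q (?e u)} \<subseteq> L" .
    have "?\<kappa> v \<in> L" if v: "v \<in> A" for v
    proof -
      have "?e v \<in> saddle_leaf component q (?e u)"
        using A(2) u v comp[OF u v] by (intro sector_map_same_leaf[OF q c]) auto
      then have "\<phi> (?\<kappa> v) \<in> saddle_leaf component q (?e u)" unfolding \<psi>(3) .
      then show ?thesis using \<kappa>U L(2) by blast
    qed
    then show ?thesis using L(1) by blast
  qed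
  obtain g where g: "continuous_map (subtopology ?Y (?\<kappa> ` ?R)) (top_of_set ?R) g"
    "\<And>v. v \<in> ?R \<Longrightarrow> g (?\<kappa> v) = v" "\<And>x. x \<in> ?\<kappa> ` ?R \<Longrightarrow> ?\<kappa> (g x) = x"
    using open_parametrization_inverse[OF continuous_map_from_subtopology_mono[OF \<kappa> RV] inj[OF RV] oR] by blast
  have plaque: "component (?B u) = component (?B v)"
    if H: "(`) \<phi> ` restricted_leaves X H (U - {s}) = saddle_leaves component q"
      and C: "L \<in> H" "path_connectedin ?Y C" "C \<subseteq> L" "C \<subseteq> ?\<kappa> ` ?R" and uv: "u \<in> ?R" "v \<in> ?R" "?\<kappa> u \<in> C" "?\<kappa> v \<in> C"
      and comp: "\<And>x. component (- x) = - component x" "continuous_on UNIV component"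
    for H component C L u v
  proof -
    have "path_connectedin X C" using C(2) by (simp add: XY path_connectedin_subtopology)
    moreover have "C \<subseteq> U - {s}" using C(4) \<kappa>U by blast
    moreover have "C \<noteq> {}" using uv by blast
    ultimately obtain K where K: "K \<in> restricted_leaves X H (U - {s})" "C \<subseteq> K"
      using path_connected_subset_restricted_leaf[OF _ _ C(3,1)] by metis
    then have "\<phi> ` K \<in> saddle_leaves component q" using H by blast
    then obtain z where z: "\<phi> ` K = saddle_leaf component q z" unfolding saddle_leaves_def by blast
    have abs: "\<bar>component (?B (g x))\<bar> = \<bar>component (csqrt (z ^ q))\<bar>" if x: "x \<in> C" for x
    proof -
      obtain w where w: "w \<in> ?R" "x = ?\<kappa> w" using x C(4) by blast
      have "\<phi> x \<in> saddle_leaf component q z" using x K(2) z by blast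
      then have "?e w \<in> saddle_leaf component q z" unfolding w(2) \<psi>(3) .
      moreover have "(?B (g x))\<^sup>2 = ?e w ^ q" using pow w RV g(2) by auto
      ultimately show ?thesis using saddle_leaf_component_abs comp(1) power2_csqrt by blast
    qed
    have "continuous_map (subtopology ?Y C) (top_of_set ?R) g"
    proof -
      have eq: "subtopology ?Y C = subtopology (subtopology ?Y (?\<kappa> ` ?R)) C"
        using C(4) by (simp add: subtopology_subtopology Int_absorb1)
      show ?thesis by (subst eq) (rule continuous_map_from_subtopology[OF g(1)])
    qed
    moreover have "continuous_on ?R (\<lambda>v. component (?B v))"
      unfolding Complex_eq by (rule continuous_on_compose2[OF comp(2)]) (auto intro!: continuous_intros)
    ultimately have "continuous_map (subtopology ?Y C) euclideanreal (\<lambda>x. component (?B (g x)))"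
      using continuous_map_compose[of "subtopology ?Y C" "top_of_set ?R" g euclideanreal "\<lambda>v. component (?B v)"] by (simp add: o_def)
    moreover have "connectedin (subtopology ?Y C) C"
      using path_connectedin_imp_connectedin[OF C(2)] by (simp add: connectedin_subtopology)
    ultimately have "connected ((\<lambda>x. component (?B (g x))) ` C)"
      using connectedin_continuous_map_image by fastforce
    from connected_abs_constant[OF this abs uv(3,4)] show ?thesis using g(2) uv by simp
  qed
  show ?thesis
  proof (rule chart_domainI[OF \<kappa> inj[OF RV] ab RV oR, where ?x0.0 = x0 and ?y0.0 = y0], goal_cases)
    case (3 I y) show ?case by (rule leaf[OF Fl]) (use 3 in auto)
  next
    case (4 I x) show ?case by (rule leaf[OF Gl]) (use 4 in auto)
  next
    case (5 C L u v)
    have "Im (?B u) = Im (?B v)"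
      by (rule plaque[OF Fl 5(1-8)]) (auto intro!: continuous_intros)
    then show ?case by simp
  next
    case (6 C L u v)
    have "Re (?B u) = Re (?B v)"
      by (rule plaque[OF Gl 6(1-8)]) (auto intro!: continuous_intros)
    then show ?case by simp
  next
    case 7 show ?case by (rule x0(1))
  next
    case 8 show ?case using x0(2) by auto
  next
    case 9 show ?case by (rule inj) (use x0(2) in auto)
  next
    case 10 show ?case by (rule y0(1))
  next
    case 11 show ?case using y0(2) by auto
  next
    case 12 show ?case by (rule inj) (use y0(2) in auto)
  qed
qed

text \<open>The constant \<open>c\<close> is solved for from the prescribed value; the condition on
  its q-th power then follows from b^2 = z^q.\<close>

lemma sector_map_right_inverse:
  assumes "q > 0" "z \<noteq> 0" "b\<^sup>2 = z ^ q" "b / \<beta> \<in> right_half" "\<beta> \<noteq> 0"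
  obtains c where "c \<noteq> 0" "c ^ q = \<beta>\<^sup>2" "sector_map q c (b / \<beta>) = z"
proof -
  let ?E = "exp (of_real (2 / real q) * Ln (b / \<beta>))"
  let ?c = "z / ?E"
  have u0: "b / \<beta> \<noteq> 0" by (rule right_half_Ln(1)[OF assms(4)])
  have "?E ^ q = (b / \<beta>)\<^sup>2" using sector_map_power[OF assms(1) u0, of 1] by (simp add: sector_map_def)
  then have "?c ^ q = z ^ q / (b / \<beta>)\<^sup>2" by (simp add: power_divide)
  also have "\<dots> = \<beta>\<^sup>2" using u0 assms(2,3,5) by (simp add: power_divide field_simps flip: assms(3))
  finally show ?thesis
    by (intro that[of ?c]) (simp_all add: assms(2) sector_map_def)
qed

text \<open>For every nonzero z, the number z^q has a square root b either in the open right
  half-plane or on the negative imaginary axis. In each case c^q is 1 or -1, so only finitely many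
  branches occur, and each of them carries one rectangle to one chart domain.\<close>

lemma saddle_point_charts:
  assumes q: "q > 0" and Fs: "saddle_chart Im X F s q U \<phi>" and Gs: "saddle_chart Re X G s q U \<phi>" and FS: "\<Union>F \<subseteq> topspace X - S"
  obtains N I where "openin X N" "s \<in> N" "finite I" "\<And>D. D \<in> I \<Longrightarrow> chart_domain D" "N - {s} \<subseteq> \<Union>I"
proof -
  have U: "plane_chart X U \<phi>" "s \<in> U" "\<phi> s = 0"
    and Fl: "(`) \<phi> ` restricted_leaves X F (U - {s}) = saddle_leaves Im q"
    and Gl: "(`) \<phi> ` restricted_leaves X G (U - {s}) = saddle_leaves Re q"
    using Fs Gs by (auto simp: saddle_chart_def)
  have oU: "openin X U" using U(1) by (simp add: plane_chart_def)
  obtain \<psi> where \<psi>: "continuous_map euclidean X \<psi>" "\<And>z. \<psi> z \<in> U" "\<And>z. \<phi> (\<psi> z) = z" "\<And>x. x \<in> U \<Longrightarrow> \<psi> (\<phi> x) = x"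
    "\<And>W. open W \<Longrightarrow> openin X (\<psi> ` W)"
    using plane_chart_inverse[OF U(1)] by blast
  have injU: "inj_on \<phi> U" by (rule plane_chart_inj[OF U(1)])
  have US: "U - {s} \<subseteq> topspace X - S"
  proof
    fix x assume x: "x \<in> U - {s}"
    then have "\<phi> x \<noteq> 0" using inj_onD[OF injU, of x s] U by auto
    then have "saddle_leaf Im q (\<phi> x) \<in> saddle_leaves Im q" by (auto simp: saddle_leaves_def)
    from level_set_in_leaf[OF inj_on_subset[OF injU Diff_subset] Fl this]
    obtain L where L: "L \<in> F" "{p \<in> U - {s}. \<phi> p \<in> saddle_leaf Im q (\<phi> x)} \<subseteq> L" .
    have "\<phi> x \<in> saddle_leaf Im q (\<phi> x)"
      unfolding saddle_leaf_def
      by (intro CollectI exI[of _ "\<lambda>_. \<phi> x"] exI[of _ "\<lambda>_. csqrt (\<phi> x ^ q)"])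
         (use \<open>\<phi> x \<noteq> 0\<close> in \<open>auto simp: path_def pathstart_def pathfinish_def\<close>)
    then have "x \<in> L" using L(2) x by blast
    then show "x \<in> topspace X - S" using L(1) FS by blast
  qed
  note chart = sector_chart[OF oU U(2) US \<psi> U(3) injU Fl Gl q]
  let ?\<kappa> = "\<lambda>\<beta> c v. \<psi> (sector_map q c (Complex (fst v) (snd v) / \<beta>))"
  \<comment> \<open>Half squares that touch the saddle at a boundary point: the right half for
    \<beta> = 1 and the lower half for \<beta> = - \<i>. The second family serves the points whose
    square root is purely imaginary; there c^q = (- \<i>)^2 = -1.\<close>
  let ?I1 = "(\<lambda>c. ?\<kappa> 1 c ` rectangle 0 1 (- 1) 1) ` {c. c ^ q = 1}"
  let ?I2 = "(\<lambda>c. ?\<kappa> (- \<i>) c ` rectangle (- 1) 1 (- 1) 0) ` {c. c ^ q = - 1}"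
  have fin: "finite (?I1 \<union> ?I2)"
    using q by (intro finite_UnI finite_imageI finite_nth_roots) auto
  have nz: "c \<noteq> 0" if "c ^ q = 1 \<or> c ^ q = - 1" for c :: complex
    using that q by (cases "c = 0") (auto simp: power_0_left)
  \<comment> \<open>The two closed reference segments through (1/2, 1/2) avoid the origin and meet
    the boundary axis only in the half that \<open>right_half\<close> contains.\<close>
  have d1: "chart_domain (?\<kappa> 1 c ` rectangle 0 1 (- 1) 1)" if "c ^ q = 1" for c
    by (rule chart[where ?x0.0 = "1/2" and ?y0.0 = "1/2"]) (use that nz in \<open>auto simp: right_half_def\<close>)
  have quot: "Complex x y / (- \<i>) = Complex (- y) x" for x y by (simp add: complex_eq_iff)
  have d2: "chart_domain (?\<kappa> (- \<i>) c ` rectangle (- 1) 1 (- 1) 0)" if "c ^ q = - 1" for c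
    by (rule chart[where ?x0.0 = "1/2" and ?y0.0 = "- 1/2"]) (use that nz in \<open>auto simp: right_half_def quot\<close>)
  let ?N = "\<psi> ` ball 0 1"
  have N: "openin X ?N" "s \<in> ?N"
    using \<psi>(5)[OF open_ball] \<psi>(4)[OF U(2)] U(3) by (auto intro!: image_eqI[of _ _ 0])
  have cover: "?N - {s} \<subseteq> \<Union>(?I1 \<union> ?I2)"
  proof
    fix x assume x: "x \<in> ?N - {s}"
    then obtain z where z: "norm z < 1" "x = \<psi> z" by (auto simp: dist_norm)
    have z0: "z \<noteq> 0" using x z(2) \<psi>(4)[OF U(2)] U(3) by auto
    define w where "w = csqrt (z ^ q)"
    have w2: "w\<^sup>2 = z ^ q" by (simp add: w_def)
    have "w \<noteq> 0" using z0 q by (simp add: w_def)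
    have "norm w < 1"
    proof -
      have "norm w ^ 2 = norm z ^ q" using arg_cong[OF w2, of norm] by (simp add: norm_power)
      also have "\<dots> < 1" using z(1) q by (simp add: power_less_one_iff)
      finally show ?thesis by (simp add: power_less_one_iff)
    qed
    then have bd: "\<bar>Re w\<bar> < 1" "\<bar>Im w\<bar> < 1"
      using abs_Re_le_cmod[of w] abs_Im_le_cmod[of w] by linarith+
    show "x \<in> \<Union>(?I1 \<union> ?I2)"
    proof (cases "Re w = 0")
      case False
      define b where "b = (if Re w > 0 then w else - w)"
      have b: "b\<^sup>2 = z ^ q" "Re b > 0" "Re b < 1" "\<bar>Im b\<bar> < 1"
        using False bd w2 by (auto simp: b_def abs_less_iff)
      obtain c where c: "c \<noteq> 0" "c ^ q = 1\<^sup>2" "sector_map q c (b / 1) = z"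
        using sector_map_right_inverse[OF q z0 b(1), of 1] b(2) by (auto simp: right_half_def)
      have "x = ?\<kappa> 1 c (Re b, Im b)" using c(3) z(2) by simp
      moreover have "(Re b, Im b) \<in> rectangle 0 1 (- 1) 1" using b by (auto simp: abs_less_iff)
      ultimately have xin: "x \<in> ?\<kappa> 1 c ` rectangle 0 1 (- 1) 1" by (rule image_eqI)
      have "?\<kappa> 1 c ` rectangle 0 1 (- 1) 1 \<in> ?I1" using c(2) by (intro imageI) simp
      then show ?thesis using xin by (intro UnionI[OF UnI1])
    next
      case True
      then have "Im w \<noteq> 0" using \<open>w \<noteq> 0\<close> by (simp add: complex_eq_iff)
      define b where "b = (if Im w < 0 then w else - w)"
      have b: "b\<^sup>2 = z ^ q" "Im b < 0" "- 1 < Im b" "Re b = 0"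
        using True \<open>Im w \<noteq> 0\<close> bd w2 by (auto simp: b_def abs_less_iff)
      have qb: "b / (- \<i>) = Complex (- Im b) (Re b)" using quot[of "Re b" "Im b"] by simp
      have "b / (- \<i>) \<in> right_half" unfolding qb using b by (simp add: right_half_def)
      then obtain c where c: "c \<noteq> 0" "c ^ q = (- \<i>)\<^sup>2" "sector_map q c (b / (- \<i>)) = z"
        using sector_map_right_inverse[OF q z0 b(1), of "- \<i>"] by auto
      have "x = ?\<kappa> (- \<i>) c (Re b, Im b)" using c(3) z(2) by simp
      moreover have "(Re b, Im b) \<in> rectangle (- 1) 1 (- 1) 0" using b by auto
      ultimately have xin: "x \<in> ?\<kappa> (- \<i>) c ` rectangle (- 1) 1 (- 1) 0" by (rule image_eqI)
      have "?\<kappa> (- \<i>) c ` rectangle (- 1) 1 (- 1) 0 \<in> ?I2" using c(2) by (intro imageI) simp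
      then show ?thesis using xin by (intro UnionI[OF UnI2])
    qed
  qed
  show ?thesis
    by (rule that[OF N fin _ cover]) (use d1 d2 in blast)
qed

end

lemma restricted_leaves_regular_part:
  assumes "U \<subseteq> topspace X - S"
  shows "restricted_leaves (regular_part X S) F U = restricted_leaves X F U"
proof -
  have "(topspace X - S) \<inter> (L \<inter> U) = L \<inter> U" for L using assms by blast
  then show ?thesis by (simp add: restricted_leaves_def regular_part_def subtopology_subtopology)
qed

text \<open>Compactness turns the local charts, at regular points and around saddles, into a finite
  cover of the regular part. A nonempty open set contains a whole chart domain, and such a domain
  cannot wander.\<close>

theorem pseudo_anosov_nonwandering:
  assumes X: "Hausdorff_space X" "compact_space X" and pA: "pseudo_anosov X Q"
    and U: "openin X U" "U \<noteq> {}"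
  shows "\<exists>n>0. (Q ^^ n) ` U \<inter> U \<noteq> {}"
proof -
  obtain k where k: "pseudo_anosov_with_dilatation X k Q" using pA unfolding pseudo_anosov_def by blast
  have Q: "homeomorphic_map X X Q" and k1: "k > 1"
    using k unfolding pseudo_anosov_with_dilatation_def by blast+
  obtain S F G \<mu> \<nu> where sF: "saddle_foliation X S F" and sG: "saddle_foliation X S G"
    and trf: "transversal_foliations X S F G" and QF: "(`) Q ` F = F" and QG: "(`) Q ` G = G"
    and \<mu>: "transversal_measure X S F \<mu>" and \<nu>: "transversal_measure X S G \<nu>"
    and scale_\<mu>: "\<forall>A. transversal_arc X S F A \<longrightarrow> measure (\<mu> (Q ` A)) (Q ` A) = k * measure (\<mu> A) A"
    and scale_\<nu>: "\<forall>A. transversal_arc X S G A \<longrightarrow> measure (\<nu> (Q ` A)) (Q ` A) = inverse k * measure (\<nu> A) A"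
    using k[unfolded pseudo_anosov_with_dilatation_def] by (elim conjE exE)
  have S: "finite S" "S \<subseteq> topspace X" and UF: "\<Union>F = topspace X - S" and UG: "\<Union>G = topspace X - S"
    using sF sG by (simp_all add: saddle_foliation_def foliation_def)
  have trr: "transversal_regular (regular_part X S) F G"
    unfolding transversal_regular_def topspace_regular_part
  proof
    fix x assume x: "x \<in> topspace X - S"
    obtain U \<phi> where U: "x \<in> U" "plane_chart (regular_part X S) U \<phi>"
      "(`) \<phi> ` restricted_leaves X F U = horizontal_lines" "(`) \<phi> ` restricted_leaves X G U = vertical_lines"
      using bspec[OF conjunct1[OF trf[unfolded transversal_foliations_def]] x] by (elim exE conjE)
    have "U \<subseteq> topspace X - S"
      using U(2) openin_subset[of "regular_part X S" U] by (simp add: plane_chart_def)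
    note r = restricted_leaves_regular_part[OF this]
    show "\<exists>U \<phi>. x \<in> U \<and> plane_chart (regular_part X S) U \<phi> \<and>
        (`) \<phi> ` restricted_leaves (regular_part X S) F U = horizontal_lines \<and>
        (`) \<phi> ` restricted_leaves (regular_part X S) G U = vertical_lines"
      using U by (intro exI[of _ U] exI[of _ \<phi>]) (simp add: r)
  qed
  interpret measured_foliations X S F G \<mu> \<nu>
    by unfold_locales (fact X(1) trr \<mu> \<nu>)+
  have saddles: "\<exists>q V \<psi>. q > 0 \<and> saddle_chart Im X F s q V \<psi> \<and> saddle_chart Re X G s q V \<psi>" if "s \<in> S" for s
    by (rule bspec[OF conjunct2[OF trf[unfolded transversal_foliations_def]] that])
  have QS: "Q ` (topspace X - S) = topspace X - S"
  proof -
    have "Q ` \<Union>F = \<Union>((`) Q ` F)" by blast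
    then show ?thesis unfolding QF UF .
  qed
  have Qreg: "homeomorphic_map (regular_part X S) (regular_part X S) Q"
    unfolding regular_part_def
  proof (rule homeomorphic_map_subtopologies_alt[OF Q])
    fix x assume x: "x \<in> topspace X"
    show "Q x \<in> topspace X - S \<longleftrightarrow> x \<in> topspace X - S"
    proof
      assume "Q x \<in> topspace X - S"
      then obtain y where y: "y \<in> topspace X - S" "Q x = Q y" using QS by blast
      then have "x = y" using inj_onD[OF homeomorphic_imp_injective_map[OF Q]] x by blast
      then show "x \<in> topspace X - S" using y by simp
    qed (use QS in blast)
  qed
  have near: "\<exists>N. openin X N \<and> x \<in> N \<and> (\<exists>I. finite I \<and> (\<forall>D\<in>I. chart_domain D) \<and> N - S \<subseteq> \<Union>I)" if x: "x \<in> topspace X" for x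
  proof (cases "x \<in> S")
    case True
    obtain q V \<psi> where "q > 0" "saddle_chart Im X F x q V \<psi>" "saddle_chart Re X G x q V \<psi>"
      using saddles[OF True] by (elim exE conjE)
    from saddle_point_charts[OF this] obtain N I where N: "openin X N" "x \<in> N" "finite I" "\<And>D. D \<in> I \<Longrightarrow> chart_domain D" "N - {x} \<subseteq> \<Union>I"
      using UF by blast
    then show ?thesis using True by (intro exI[of _ N] conjI exI[of _ I]) auto
  next
    case False
    then obtain D where D: "chart_domain D" "x \<in> D" using regular_point_chart[of x] x by blast
    have "openin X (topspace X - S)"
      using S X(1) by (intro openin_diff) (auto simp: closedin_Hausdorff_finite)
    then have "openin X D" using openin_chart_domain[OF D(1)] unfolding regular_part_def
      by (rule openin_trans_full[rotated])
    then show ?thesis using D by (intro exI[of _ D] conjI exI[of _ "{D}"]) auto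
  qed
  define \<N> where "\<N> = {N. openin X N \<and> (\<exists>I. finite I \<and> (\<forall>D\<in>I. chart_domain D) \<and> N - S \<subseteq> \<Union>I)}"
  have "\<exists>\<F>. finite \<F> \<and> \<F> \<subseteq> \<N> \<and> topspace X \<subseteq> \<Union>\<F>"
    using X(2) unfolding compact_space_alt
  proof (elim allE impE)
    show "Ball \<N> (openin X) \<and> topspace X \<subseteq> \<Union>\<N>"
    proof (intro conjI ballI subsetI)
      show "openin X N" if "N \<in> \<N>" for N using that by (simp add: \<N>_def)
      fix x assume "x \<in> topspace X"
      from near[OF this] obtain N where N: "openin X N" "x \<in> N"
        "\<exists>I. finite I \<and> (\<forall>D\<in>I. chart_domain D) \<and> N - S \<subseteq> \<Union>I"
        by (erule_tac exE) (elim conjE, rule that; assumption)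
      have "N \<in> \<N>" unfolding \<N>_def mem_Collect_eq by (rule conjI[OF N(1,3)])
      then show "x \<in> \<Union>\<N>" using N(2) by (rule UnionI)
    qed
  qed
  then obtain \<F> where \<F>: "finite \<F>" "\<F> \<subseteq> \<N>" "topspace X \<subseteq> \<Union>\<F>" by (elim exE conjE)
  have "\<forall>N\<in>\<F>. \<exists>I. finite I \<and> (\<forall>D\<in>I. chart_domain D) \<and> N - S \<subseteq> \<Union>I"
  proof
    fix N assume "N \<in> \<F>"
    then have "N \<in> \<N>" using \<F>(2) by (rule subsetD[rotated])
    then show "\<exists>I. finite I \<and> (\<forall>D\<in>I. chart_domain D) \<and> N - S \<subseteq> \<Union>I" unfolding \<N>_def by simp
  qed
  from bchoice[OF this] obtain J where J: "\<forall>N\<in>\<F>. finite (J N) \<and> (\<forall>D\<in>J N. chart_domain D) \<and> N - S \<subseteq> \<Union>(J N)" by (elim exE)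
  let ?I = "\<Union>(J ` \<F>)"
  have I: "finite ?I" "\<And>D. D \<in> ?I \<Longrightarrow> chart_domain D" "topspace X - S \<subseteq> \<Union>?I"
  proof -
    show "finite ?I" using \<F>(1) J by blast
    show "chart_domain D" if "D \<in> ?I" for D using that J by blast
    show "topspace X - S \<subseteq> \<Union>?I"
    proof
      fix x assume x: "x \<in> topspace X - S"
      then obtain N where N: "N \<in> \<F>" "x \<in> N" using \<F>(3) by blast
      then have "x \<in> \<Union>(J N)" using J x by blast
      then show "x \<in> \<Union>?I" using N by blast
    qed
  qed
  \<comment> \<open>A plane chart at a point of \<open>U\<close> would make the finite set
    \<open>S\<close> contain a nonempty open subset of the plane.\<close>
  have "\<not> U \<subseteq> S"
  proof
    assume US: "U \<subseteq> S"
    then obtain s where s: "s \<in> U" "s \<in> S" using U(2) by blast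
    obtain q V \<phi> where V: "saddle_chart Im X F s q V \<phi>" using saddles[OF s(2)] by (elim exE conjE)
    have pc: "plane_chart X V \<phi>" "s \<in> V" using V by (simp_all add: saddle_chart_def)
    have h: "homeomorphic_map (subtopology X V) euclidean \<phi>" and oV: "openin X V" using pc by (simp_all add: plane_chart_def)
    have "openin (subtopology X V) (U \<inter> V)" using U(1) by (auto simp: openin_subtopology)
    then have "open (\<phi> ` (U \<inter> V))" using homeomorphic_imp_open_map[OF h] by (simp add: open_map_def)
    moreover have "finite (\<phi> ` (U \<inter> V))" using S(1) US finite_subset by blast
    moreover have "\<phi> s \<in> \<phi> ` (U \<inter> V)" using s pc by blast
    ultimately show False using finite_imp_not_open by blast
  qed
  then obtain x where x: "x \<in> U" "x \<in> topspace X - S" using openin_subset[OF U(1)] by blast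
  obtain D where D: "chart_domain D" "x \<in> D" using regular_point_chart[OF x(2)] .
  have "openin (regular_part X S) (U - S)"
    unfolding regular_part_def openin_subtopology using U(1) openin_subset[OF U(1)] by (intro exI[of _ U]) auto
  then obtain R where R: "chart_domain R" "R \<subseteq> U - S"
    using chart_domain_within[OF D(1) _ D(2)] x by blast
  have k0: "k > 0" using k1 by simp
  have "\<exists>n>0. (Q ^^ n) ` R \<inter> R \<noteq> {}"
    by (rule wandering_rectangle_impossible[OF Qreg QF QG _ _ k0 _ _ I R(1)]) (use UF UG scale_\<mu> scale_\<nu> in simp_all)
  then show ?thesis using R(2) by blast
qed

section \<open>Mapping tori\<close>

lemma funpow_image: "(f ^^ m) ` A = A" if "f ` A = A"
  using that by (induction m) (simp_all only: funpow.simps image_id image_comp[symmetric] id_apply)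

section \<open>Integer iterates and preserved orientations\<close>

lemma int_iterate_step:
  assumes f: "bij_betw f A A" and x: "x \<in> A"
  shows "int_iterate A f i x \<in> A" "int_iterate A f (i + 1) x = f (int_iterate A f i x)"
    "int_iterate A f (i - 1) x = inv_into A f (int_iterate A f i x)"
proof -
  have fA: "f ` A = A" "inv_into A f ` A = A" and inj: "inj_on f A"
    using f bij_betw_inv_into[OF f] by (simp_all add: bij_betw_def)
  have fi: "f (inv_into A f y) = y" "inv_into A f (f y) = y" if "y \<in> A" for y
    using that fA(1) inj by (simp_all add: f_inv_into_f)
  have mem: "(f ^^ m) x \<in> A" "(inv_into A f ^^ m) x \<in> A" for m
    using funpow_image[OF fA(1), of m] funpow_image[OF fA(2), of m] x by blast+
  show "int_iterate A f i x \<in> A" using mem by (simp add: int_iterate_def)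
  show "int_iterate A f (i + 1) x = f (int_iterate A f i x)"
  proof (cases "i \<ge> 0")
    case True
    then have "nat (i + 1) = Suc (nat i)" by simp
    then show ?thesis using True by (simp add: int_iterate_def)
  next
    case False
    then obtain m where m: "nat (- i) = Suc m" using not0_implies_Suc[of "nat (- i)"] by auto
    then have i: "i = - int m - 1" by linarith
    have "f ((inv_into A f ^^ nat (- i)) x) = (inv_into A f ^^ m) x" unfolding m using fi(1)[OF mem(2)] by simp
    moreover have "int_iterate A f (i + 1) x = (inv_into A f ^^ m) x"
    proof (cases "i + 1 = 0")
      case True
      then show ?thesis using i by (simp only: int_iterate_def) simp
    next
      case False
      then have "\<not> i + 1 \<ge> 0" "nat (- (i + 1)) = m" using i by linarith+
      then show ?thesis by (simp only: int_iterate_def if_False)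
    qed
    ultimately show ?thesis using False by (simp only: int_iterate_def if_False)
  qed
  show "int_iterate A f (i - 1) x = inv_into A f (int_iterate A f i x)"
  proof (cases "i > 0")
    case True
    then obtain m where m: "nat i = Suc m" using not0_implies_Suc[of "nat i"] by auto
    then have i: "i = int m + 1" by linarith
    have "inv_into A f ((f ^^ nat i) x) = (f ^^ m) x" unfolding m using fi(2)[OF mem(1)] by simp
    then show ?thesis using i by (simp add: int_iterate_def)
  next
    case False
    then have "nat (- (i - 1)) = Suc (nat (- i))" by simp
    then show ?thesis using False by (cases "i = 0") (simp_all add: int_iterate_def)
  qed
qed

lemma int_iterate_0 [simp]: "int_iterate A f 0 x = x"
  by (simp add: int_iterate_def)

lemma int_iterate_add:
  assumes f: "bij_betw f A A" and x: "x \<in> A"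
  shows "int_iterate A f (i + j) x = int_iterate A f i (int_iterate A f j x)"
proof (induction i rule: int_induct[of _ 0])
  case base
  then show ?case by simp
next
  case (step1 i)
  have "int_iterate A f (i + 1 + j) x = f (int_iterate A f (i + j) x)"
    using int_iterate_step(2)[OF f x, of "i + j"] by (simp add: ac_simps)
  then show ?case using step1 int_iterate_step(2)[OF f int_iterate_step(1)[OF f x]] by simp
next
  case (step2 i)
  have "int_iterate A f (i - 1 + j) x = inv_into A f (int_iterate A f (i + j) x)"
    using int_iterate_step(3)[OF f x, of "i + j"] by (simp add: algebra_simps)
  then show ?case using step2 int_iterate_step(3)[OF f int_iterate_step(1)[OF f x]] by simp
qed

text \<open>Every integer iterate is a composition of copies of \<open>f\<close> or of copies of its
  inverse, so properties closed under both compositions are inherited.\<close>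

lemma int_iterate_induct:
  assumes id: "Pr id" and f: "\<And>g. Pr g \<Longrightarrow> Pr (f \<circ> g)" and f': "\<And>g. Pr g \<Longrightarrow> Pr (inv_into A f \<circ> g)"
  shows "Pr (int_iterate A f i)"
proof -
  have "Pr (f ^^ m)" "Pr (inv_into A f ^^ m)" for m
    by (induction m) (simp_all add: id f f' funpow.simps del: comp_apply)
  then show ?thesis unfolding int_iterate_def by simp
qed

lemma homeomorphic_map_inv_into:
  assumes f: "homeomorphic_map X X f"
  shows "homeomorphic_map X X (inv_into (topspace X) f)"
proof -
  obtain g where g: "homeomorphic_maps X X f g" using f homeomorphic_map_maps by blast
  have "g y = inv_into (topspace X) f y" if y: "y \<in> topspace X" for y
  proof (rule inv_into_f_eq[symmetric])
    show "inj_on f (topspace X)" using f homeomorphic_imp_injective_map by blast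
    show "g y \<in> topspace X" "f (g y) = y"
      using g y continuous_map_image_subset_topspace[of X X g] by (auto simp: homeomorphic_maps_def)
  qed
  moreover have "homeomorphic_map X X g" using g homeomorphic_maps_map by blast
  ultimately show ?thesis by (rule homeomorphic_map_eq[rotated])
qed

lemma homeomorphic_map_int_iterate:
  "homeomorphic_map X X f \<Longrightarrow> homeomorphic_map X X (int_iterate (topspace X) f i)"
proof (rule int_iterate_induct)
  show "homeomorphic_map X X id" by (rule homeomorphic_map_id[THEN iffD2, OF refl])
  fix g assume "homeomorphic_map X X f" "homeomorphic_map X X g"
  then show "homeomorphic_map X X (f \<circ> g)" "homeomorphic_map X X (inv_into (topspace X) f \<circ> g)"
    by (auto intro: homeomorphic_map_compose homeomorphic_map_inv_into simp del: comp_apply)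
qed

lemma homeomorphic_map_funpow: "homeomorphic_map X X f \<Longrightarrow> homeomorphic_map X X (f ^^ m)"
  by (induction m) (auto intro: homeomorphic_map_compose simp: homeomorphic_map_id simp del: comp_apply)

text \<open>With the orientation as a parameter the condition is visibly closed under composition
  and inverses, as required for powers of \<open>J\<close> and for the return map.\<close>

definition preserves_orientation :: "nat \<Rightarrow> 'a topology \<Rightarrow> ('a \<Rightarrow> 'a chain set) \<Rightarrow> ('a \<Rightarrow> 'a) \<Rightarrow> bool" where
  "preserves_orientation n X \<omega> f \<longleftrightarrow> homeomorphic_map X X f \<and>
     (\<forall>x\<in>topspace X. hom_induced (int n) X (topspace X - {x}) X (topspace X - {f x}) f (\<omega> x) = \<omega> (f x))"

lemma preserves_orientation_id: "manifold_orientation n X \<omega> \<Longrightarrow> preserves_orientation n X \<omega> id"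
  unfolding preserves_orientation_def
proof (intro conjI ballI)
  assume \<omega>: "manifold_orientation n X \<omega>"
  show "homeomorphic_map X X id" by simp
  fix x assume "x \<in> topspace X"
  then show "hom_induced (int n) X (topspace X - {x}) X (topspace X - {id x}) id (\<omega> x) = \<omega> (id x)"
    using hom_induced_id[OF manifold_orientation_in_carrier[OF \<omega>]] by (simp only: id_apply)
qed

lemma homeomorphic_map_punctured:
  assumes f: "homeomorphic_map X Y f" and x: "x \<in> topspace X"
  shows "f \<in> topspace X - {x} \<rightarrow> topspace Y - {f x}" "f x \<in> topspace Y"
  using homeomorphic_imp_surjective_map[OF f] homeomorphic_imp_injective_map[OF f] x by (auto dest: inj_onD)

lemma preserves_orientation_compose:
  assumes f: "preserves_orientation n X \<omega> f" and g: "preserves_orientation n X \<omega> g"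
  shows "preserves_orientation n X \<omega> (f \<circ> g)"
  unfolding preserves_orientation_def
proof (intro conjI ballI)
  have fg: "homeomorphic_map X X f" "homeomorphic_map X X g" using f g by (auto simp: preserves_orientation_def)
  then show "homeomorphic_map X X (f \<circ> g)" using homeomorphic_map_compose by blast
  fix x assume x: "x \<in> topspace X"
  note gx = homeomorphic_map_punctured[OF fg(2) x]
  note fgx = homeomorphic_map_punctured[OF fg(1) gx(2)]
  have "hom_induced (int n) X (topspace X - {x}) X (topspace X - {(f \<circ> g) x}) (f \<circ> g) (\<omega> x) =
     hom_induced (int n) X (topspace X - {g x}) X (topspace X - {f (g x)}) f
       (hom_induced (int n) X (topspace X - {x}) X (topspace X - {g x}) g (\<omega> x))"
    unfolding comp_apply[of f g x] using gx fgx
    by (intro hom_induced_compose'[symmetric] homeomorphic_imp_continuous_map fg) auto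
  also have "\<dots> = \<omega> ((f \<circ> g) x)"
    using f g x gx by (simp add: preserves_orientation_def)
  finally show "hom_induced (int n) X (topspace X - {x}) X (topspace X - {(f \<circ> g) x}) (f \<circ> g) (\<omega> x) = \<omega> ((f \<circ> g) x)" .
qed

text \<open>The generator at \<open>y\<close> is the image of the generator at its preimage;
  applying the inverse cancels the two induced maps.\<close>

lemma preserves_orientation_inv_into:
  assumes \<omega>: "manifold_orientation n X \<omega>" and f: "preserves_orientation n X \<omega> f"
  shows "preserves_orientation n X \<omega> (inv_into (topspace X) f)"
  unfolding preserves_orientation_def
proof (intro conjI ballI)
  let ?f' = "inv_into (topspace X) f"
  have hf: "homeomorphic_map X X f" using f by (auto simp: preserves_orientation_def)
  then show hf': "homeomorphic_map X X ?f'" by (rule homeomorphic_map_inv_into)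
  fix y assume y: "y \<in> topspace X"
  have fy: "f (?f' y) = y" using y homeomorphic_imp_surjective_map[OF hf] by (simp add: f_inv_into_f)
  note f'y = homeomorphic_map_punctured[OF hf' y]
  have f'f: "?f' (f x) = x" if "x \<in> topspace X" for x
    using that homeomorphic_imp_injective_map[OF hf] by simp
  have "hom_induced (int n) X (topspace X - {y}) X (topspace X - {?f' y}) ?f' (\<omega> y) =
     hom_induced (int n) X (topspace X - {y}) X (topspace X - {?f' y}) ?f'
       (hom_induced (int n) X (topspace X - {?f' y}) X (topspace X - {y}) f (\<omega> (?f' y)))"
    using f f'y(2) fy by (auto simp: preserves_orientation_def)
  also have "\<dots> = hom_induced (int n) X (topspace X - {?f' y}) X (topspace X - {?f' y}) (?f' \<circ> f) (\<omega> (?f' y))"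
    using f'y homeomorphic_map_punctured[OF hf f'y(2)] fy
    by (intro hom_induced_compose' homeomorphic_imp_continuous_map hf hf') auto
  also have "\<dots> = hom_induced (int n) X (topspace X - {?f' y}) X (topspace X - {?f' y}) id (\<omega> (?f' y))"
    by (rule fun_cong[OF hom_induced_eq]) (simp add: f'f)
  also have "\<dots> = \<omega> (?f' y)" by (rule hom_induced_id[OF manifold_orientation_in_carrier[OF \<omega> f'y(2)]])
  finally show "hom_induced (int n) X (topspace X - {y}) X (topspace X - {?f' y}) ?f' (\<omega> y) = \<omega> (?f' y)" .
qed

lemma preserves_orientation_int_iterate:
  assumes \<omega>: "manifold_orientation n X \<omega>" and f: "preserves_orientation n X \<omega> f"
  shows "preserves_orientation n X \<omega> (int_iterate (topspace X) f i)"
  by (rule int_iterate_induct) (intro preserves_orientation_id[OF \<omega>] preserves_orientation_compose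
      preserves_orientation_inv_into[OF \<omega> f] f; assumption)+

lemma preserves_orientation_funpow:
  assumes \<omega>: "manifold_orientation n X \<omega>" and f: "preserves_orientation n X \<omega> f"
  shows "preserves_orientation n X \<omega> (f ^^ m)"
proof -
  have "f ^^ m = int_iterate (topspace X) f (int m)" by (simp add: int_iterate_def)
  then show ?thesis using preserves_orientation_int_iterate[OF \<omega> f] by simp
qed

section \<open>Products with the line\<close>

lemma open_map_prod:
  assumes "open_map X X' f" "open_map Y Y' g"
  shows "open_map (prod_topology X Y) (prod_topology X' Y') (\<lambda>(x, y). (f x, g y))"
  unfolding open_map_def
proof (intro allI impI)
  fix W assume W: "openin (prod_topology X Y) W"
  show "openin (prod_topology X' Y') ((\<lambda>(x, y). (f x, g y)) ` W)"
    unfolding openin_prod_topology_alt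
  proof (intro allI impI)
    fix a b assume "(a, b) \<in> (\<lambda>(x, y). (f x, g y)) ` W"
    then obtain x y where xy: "(x, y) \<in> W" "a = f x" "b = g y" by auto
    obtain U V where "openin X U" "openin Y V" "x \<in> U" "y \<in> V" "U \<times> V \<subseteq> W"
      using W xy(1) unfolding openin_prod_topology_alt by meson
    then show "\<exists>U V. openin X' U \<and> openin Y' V \<and> a \<in> U \<and> b \<in> V \<and> U \<times> V \<subseteq> (\<lambda>(x, y). (f x, g y)) ` W"
      using assms xy by (intro exI[of _ "f ` U"] exI[of _ "g ` V"]) (auto simp: open_map_def image_iff; force)
  qed
qed

lemma open_map_line:
  fixes u :: "real \<Rightarrow> real"
  assumes "continuous_on UNIV u" "strict_mono u"
  shows "open_map euclideanreal euclideanreal u"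
  unfolding open_map_def
proof (intro allI impI)
  fix V :: "real set" assume "openin euclideanreal V"
  then show "openin euclideanreal (u ` V)"
    using assms invariance_of_domain[of V u] strict_mono_imp_inj_on[OF assms(2)]
    by (auto intro: continuous_on_subset inj_on_subset)
qed

lemma second_countable_prod:
  assumes "second_countable X" "second_countable Y"
  shows "second_countable (prod_topology X Y)"
proof -
  obtain B where B: "countable B" "\<forall>V\<in>B. openin X V"
    and B_base: "\<forall>U x. openin X U \<and> x \<in> U \<longrightarrow> (\<exists>V\<in>B. x \<in> V \<and> V \<subseteq> U)"
    using assms(1) unfolding second_countable_def by (elim exE conjE)
  obtain C where C: "countable C" "\<forall>V\<in>C. openin Y V"
    and C_base: "\<forall>U x. openin Y U \<and> x \<in> U \<longrightarrow> (\<exists>V\<in>C. x \<in> V \<and> V \<subseteq> U)"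
    using assms(2) unfolding second_countable_def by (elim exE conjE)
  show ?thesis
    unfolding second_countable_def
  proof (intro exI[of _ "(\<lambda>(U, V). U \<times> V) ` (B \<times> C)"] conjI ballI allI impI)
    show "countable ((\<lambda>(U, V). U \<times> V) ` (B \<times> C))" using B(1) C(1) by simp
    fix W assume "W \<in> (\<lambda>(U, V). U \<times> V) ` (B \<times> C)"
    then show "openin (prod_topology X Y) W" using B(2) C(2) by (auto simp: openin_prod_Times_iff)
  next
    fix W z assume W: "openin (prod_topology X Y) W \<and> z \<in> W"
    obtain x y where z: "z = (x, y)" by (cases z)
    obtain U V where UV: "openin X U" "openin Y V" "x \<in> U" "y \<in> V" "U \<times> V \<subseteq> W"
      using W unfolding openin_prod_topology_alt z by meson
    obtain U' where U': "U' \<in> B" "x \<in> U'" "U' \<subseteq> U" using B_base UV(1,3) by meson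
    obtain V' where V': "V' \<in> C" "y \<in> V'" "V' \<subseteq> V" using C_base UV(2,4) by meson
    show "\<exists>V\<in>(\<lambda>(U, V). U \<times> V) ` (B \<times> C). z \<in> V \<and> V \<subseteq> W"
    proof (rule bexI[of _ "U' \<times> V'"])
      show "z \<in> U' \<times> V' \<and> U' \<times> V' \<subseteq> W" using U' V' UV(5) z by blast
      show "U' \<times> V' \<in> (\<lambda>(U, V). U \<times> V) ` (B \<times> C)" using U'(1) V'(1) by force
    qed
  qed
qed

lemma second_countable_real: "second_countable euclideanreal"
proof -
  have "\<exists>B :: real set set. countable B \<and> (\<forall>C\<in>B. open C) \<and> (\<forall>S. open S \<longrightarrow> (\<exists>U\<subseteq>B. S = \<Union>U))"
    by (rule univ_second_countable[where 'a = real], rule exI, intro conjI ballI allI impI) simp_all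
  then obtain B :: "real set set" where B: "countable B" "\<forall>C\<in>B. open C" "\<forall>S. open S \<longrightarrow> (\<exists>U\<subseteq>B. S = \<Union>U)"
    by (elim exE conjE)
  show ?thesis
    unfolding second_countable_def
  proof (intro exI[of _ B] conjI ballI allI impI B(1))
    show "openin euclideanreal V" if "V \<in> B" for V using B(2) that by simp
    fix U :: "real set" and x assume "openin euclideanreal U \<and> x \<in> U"
    then obtain K where "K \<subseteq> B" "U = \<Union>K" "x \<in> U" using B(3) by auto
    then show "\<exists>V\<in>B. x \<in> V \<and> V \<subseteq> U" by blast
  qed
qed

lemma Euclidean_space_Suc:
  "prod_topology (Euclidean_space n) euclideanreal homeomorphic_space Euclidean_space (Suc n)"
proof -
  let ?k = "\<lambda>(x, t) i. if i < Suc n then if i < n then x i else t else (0::real)"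
  let ?h = "\<lambda>x. ((\<lambda>i. if i < n then x i else 0), x n)"
  have "homeomorphic_maps (prod_topology (Euclidean_space n) euclideanreal) (Euclidean_space (Suc n)) ?k ?h"
    unfolding homeomorphic_maps_def
  proof (intro conjI ballI)
    have coord: "continuous_map (Euclidean_space m) euclideanreal (\<lambda>x. x i)" for m i
      unfolding Euclidean_space_def
      by (metis (mono_tags) UNIV_I continuous_map_from_subtopology continuous_map_product_projection)
    have "continuous_map (prod_topology (Euclidean_space n) euclideanreal) euclideanreal (\<lambda>p. fst p i)" for i
      using continuous_map_compose[OF continuous_map_fst coord] by (simp add: o_def)
    then show "continuous_map (prod_topology (Euclidean_space n) euclideanreal) (Euclidean_space (Suc n)) ?k"
      by (simp add: case_prod_unfold continuous_map_componentwise_Euclidean_space continuous_map_snd)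
    show "continuous_map (Euclidean_space (Suc n)) (prod_topology (Euclidean_space n) euclideanreal) ?h"
      by (simp add: continuous_map_pairwise o_def continuous_map_componentwise_Euclidean_space coord)
  qed (auto simp: fun_eq_iff topspace_Euclidean_space less_Suc_eq not_less_eq)
  then show ?thesis unfolding homeomorphic_space_def by blast
qed

section \<open>Topology of the mapping torus\<close>

locale torus_bundle =
  fixes S :: "'a topology" and J :: "'a \<Rightarrow> 'a"
  assumes J: "homeomorphic_map S S J"
begin

abbreviation A where "A \<equiv> topspace S"
abbreviation XR where "XR \<equiv> prod_topology S euclideanreal"
abbreviation p where "p \<equiv> torus_proj S J"
abbreviation M where "M \<equiv> mapping_torus S J"
abbreviation Ji where "Ji \<equiv> int_iterate A J"

lemma bij: "bij_betw J A A"
  using homeomorphic_imp_injective_map[OF J] homeomorphic_imp_surjective_map[OF J] by (simp add: bij_betw_def)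

lemma bij_deck: "bij_betw (deck_map J) (A \<times> UNIV) (A \<times> UNIV)"
  unfolding bij_betw_def
proof
  show "inj_on (deck_map J) (A \<times> UNIV)"
    using bij by (auto simp: inj_on_def deck_map_def bij_betw_def)
  have "(z, r) \<in> deck_map J ` (A \<times> UNIV)" if "z \<in> A" for z r
  proof -
    have "z \<in> J ` A" unfolding homeomorphic_imp_surjective_map[OF J] by (rule that)
    then obtain y where "y \<in> A" "z = J y" by (elim imageE)
    then show ?thesis by (intro image_eqI[of _ _ "(y, r + 1)"]) (auto simp: deck_map_def)
  qed
  moreover have "deck_map J x \<in> A \<times> UNIV" if "x \<in> A \<times> UNIV" for x
    using that bij by (auto simp: deck_map_def bij_betw_def)
  ultimately show "deck_map J ` (A \<times> UNIV) = A \<times> UNIV"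
    by (intro equalityI image_subsetI subsetI) (simp, elim SigmaE, simp)
qed

lemma deck_iterate:
  assumes z: "z \<in> A"
  shows "int_iterate (A \<times> UNIV) (deck_map J) i (z, r) = (Ji i z, r - real_of_int i)"
proof -
  have zr: "(z, r) \<in> A \<times> UNIV" using z by simp
  note d = int_iterate_step[OF bij_deck zr] and j = int_iterate_step[OF bij z]
  show ?thesis
  proof (induction i rule: int_induct[of _ 0])
    case base
    then show ?case by simp
  next
    case (step1 i)
    then show ?case using d(2) j(2) by (simp add: deck_map_def)
  next
    case (step2 i)
    have "inv_into (A \<times> UNIV) (deck_map J) (Ji i z, r - real_of_int i) = (Ji (i - 1) z, r - real_of_int (i - 1))"
    proof (rule inv_into_f_eq)
      show "inj_on (deck_map J) (A \<times> UNIV)" using bij_deck by (rule bij_betw_imp_inj_on)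
      show "(Ji (i - 1) z, r - real_of_int (i - 1)) \<in> A \<times> UNIV" using j(1) by simp
      show "deck_map J (Ji (i - 1) z, r - real_of_int (i - 1)) = (Ji i z, r - real_of_int i)"
        using j(2)[of "i - 1"] by (simp add: deck_map_def)
    qed
    then show ?case using d(3) step2 by simp
  qed
qed

lemma Ji_in [simp]: "z \<in> A \<Longrightarrow> Ji i z \<in> A"
  by (rule int_iterate_step(1)[OF bij])

lemma Ji_add: "z \<in> A \<Longrightarrow> Ji i (Ji j z) = Ji (i + j) z"
  by (rule int_iterate_add[OF bij, symmetric])

lemma Ji_inverse [simp]: "z \<in> A \<Longrightarrow> Ji (- i) (Ji i z) = z" "z \<in> A \<Longrightarrow> Ji i (Ji (- i) z) = z"
  by (simp_all add: Ji_add)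

lemma Ji_homeo: "homeomorphic_map S S (Ji i)"
  by (rule homeomorphic_map_int_iterate[OF J])

lemma p_eq: "z \<in> A \<Longrightarrow> p (z, r) = range (\<lambda>i. (Ji i z, r - real_of_int i))"
  by (simp add: torus_proj_def deck_iterate)

lemma p_shift: "z \<in> A \<Longrightarrow> p (Ji i z, r - real_of_int i) = p (z, r)"
proof -
  assume z: "z \<in> A"
  have "range (\<lambda>j. (Ji (j + i) z, r - real_of_int (j + i))) = range (\<lambda>j. (Ji j z, r - real_of_int j))"
    (is "range (\<lambda>j. ?f (j + i)) = _")
  proof -
    have "range (\<lambda>j. ?f (j + i)) = ?f ` range (\<lambda>j. j + i)" by (simp only: image_image)
    also have "range (\<lambda>j. j + i) = UNIV" by (rule surjI[of _ "\<lambda>j. j - i"]) simp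
    finally show ?thesis .
  qed
  then show ?thesis using z by (simp add: p_eq Ji_add algebra_simps)
qed

lemma p_eq_iff:
  assumes "z \<in> A" "w \<in> A"
  shows "p (z, r) = p (w, s) \<longleftrightarrow> (\<exists>i. w = Ji i z \<and> s = r - real_of_int i)"
proof
  assume "p (z, r) = p (w, s)"
  moreover have "(w, s) \<in> p (w, s)" unfolding p_eq[OF assms(2)] by (rule range_eqI[of _ _ 0]) simp
  ultimately have "(w, s) \<in> p (z, r)" by simp
  then show "\<exists>i. w = Ji i z \<and> s = r - real_of_int i" unfolding p_eq[OF assms(1)] by blast
next
  assume "\<exists>i. w = Ji i z \<and> s = r - real_of_int i"
  then show "p (z, r) = p (w, s)" using p_shift[OF assms(1)] by auto
qed

text \<open>The heights of two representatives differ by the exponent of the deck map relating them,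
  so closeness forces the exponent 0.\<close>

lemma p_close:
  assumes "z \<in> A" "w \<in> A" "p (z, r) = p (w, s)" "\<bar>r - s\<bar> < 1"
  shows "z = w \<and> r = s"
proof -
  obtain i where i: "w = Ji i z" "s = r - real_of_int i" using assms p_eq_iff by blast
  then have "i = 0" using assms(4) by simp
  then show ?thesis using i by simp
qed

lemma p_quotient: "quotient_map XR M p"
  unfolding mapping_torus_def by (rule quotient_map_quotient_topology)

lemma p_cont: "continuous_map XR M p"
  using p_quotient quotient_imp_continuous_map by blast

lemma p_surj: "p ` (A \<times> UNIV) = topspace M"
  using quotient_imp_surjective_map[OF p_quotient] by simp

lemma p_in: "z \<in> A \<Longrightarrow> p (z, r) \<in> topspace M"
  using p_surj by blast

lemma M_cases:
  assumes "w \<in> topspace M"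
  obtains z r where "z \<in> A" "w = p (z, r)"
  using assms p_surj by (metis (no_types, lifting) SigmaE imageE)

text \<open>The saturation of an open set is the union of its deck translates, each of which is
  open.\<close>

lemma p_open: "open_map XR M p"
  unfolding open_map_def
proof (intro allI impI)
  fix V assume V: "openin XR V"
  have VX: "V \<subseteq> A \<times> UNIV" using openin_subset[OF V] by simp
  have "{x \<in> topspace XR. p x \<in> p ` V} = (\<Union>i. {x \<in> topspace XR. (Ji i (fst x), snd x - real_of_int i) \<in> V})"
  proof (intro equalityI subsetI)
    fix x assume x: "x \<in> {x \<in> topspace XR. p x \<in> p ` V}"
    obtain z r where zr: "x = (z, r)" "z \<in> A" using x by auto
    obtain w s where ws: "(w, s) \<in> V" "p (z, r) = p (w, s)" using x zr by auto
    have "w \<in> A" using ws VX by blast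
    then obtain i where "w = Ji i z" "s = r - real_of_int i" using ws(2) p_eq_iff zr(2) by blast
    then show "x \<in> (\<Union>i. {x \<in> topspace XR. (Ji i (fst x), snd x - real_of_int i) \<in> V})" using ws zr by auto
  next
    fix x assume "x \<in> (\<Union>i. {x \<in> topspace XR. (Ji i (fst x), snd x - real_of_int i) \<in> V})"
    then obtain i z r where "z \<in> A" "x = (z, r)" "(Ji i z, r - real_of_int i) \<in> V" by auto
    then show "x \<in> {x \<in> topspace XR. p x \<in> p ` V}" using p_shift[of z i r] by (auto intro: image_eqI[of _ p])
  qed
  moreover have "openin XR {x \<in> topspace XR. (Ji i (fst x), snd x - real_of_int i) \<in> V}" for i
  proof (rule openin_continuous_map_preimage[OF _ V])
    have "continuous_map XR S (\<lambda>x. Ji i (fst x))"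
      using continuous_map_compose[OF continuous_map_fst homeomorphic_imp_continuous_map[OF Ji_homeo]] by (simp add: o_def)
    moreover have "continuous_map XR euclideanreal (\<lambda>x. snd x - real_of_int i)"
      by (intro continuous_map_diff continuous_map_snd) simp
    ultimately show "continuous_map XR XR (\<lambda>x. (Ji i (fst x), snd x - real_of_int i))"
      by (simp add: continuous_map_pairwise o_def)
  qed
  ultimately have "openin XR {x \<in> topspace XR. p x \<in> p ` V}" by (simp only:) (intro openin_Union; blast)
  moreover have "p ` V \<subseteq> topspace M" using VX p_surj by blast
  ultimately show "openin M (p ` V)" using p_quotient unfolding quotient_map_def by blast
qed

lemma line_cont:
  assumes u: "continuous_on UNIV u" shows "continuous_map XR XR (\<lambda>(x, t). (x, u t))"
proof -
  have "continuous_map euclideanreal euclideanreal u" using u by simp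
  from continuous_map_compose[OF continuous_map_snd this] show ?thesis
    by (simp add: continuous_map_pairwise o_def case_prod_unfold continuous_map_fst)
qed

lemma short_line_embedding:
  assumes u: "short_line_map u"
  shows "embedding_map XR M (\<lambda>(x, t). p (x, u t))" "open_map XR M (\<lambda>(x, t). p (x, u t))"
proof -
  have u': "continuous_on UNIV u" "strict_mono u" using u by (auto simp: short_line_map_def)
  have eq: "(\<lambda>(x, t). p (x, u t)) = p \<circ> (\<lambda>(x, t). (x, u t))" by auto
  have "open_map XR XR (\<lambda>(x, t). (id x, u t))"
    by (rule open_map_prod[OF _ open_map_line[OF u']]) (simp add: open_map_def)
  then show op: "open_map XR M (\<lambda>(x, t). p (x, u t))" unfolding eq using open_map_compose[OF _ p_open] by simp
  have inj: "inj_on (\<lambda>(x, t). p (x, u t)) (topspace XR)"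
  proof (rule inj_onI, clarsimp)
    fix x t y s assume "x \<in> A" "y \<in> A" "p (x, u t) = p (y, u s)"
    moreover have "\<bar>u t - u s\<bar> < 1" using u by (simp add: short_line_map_def)
    ultimately have "x = y \<and> u t = u s" by (rule p_close)
    then show "x = y \<and> t = s" using strict_mono_eq[OF u'(2)] by simp
  qed
  have "continuous_map XR M (\<lambda>(x, t). p (x, u t))"
    unfolding eq by (rule continuous_map_compose[OF line_cont[OF u'(1)] p_cont])
  then show "embedding_map XR M (\<lambda>(x, t). p (x, u t))" by (rule injective_open_imp_embedding_map[OF _ op inj])
qed

text \<open>One representative can be replaced so that the heights differ by at most 1/2. Both
  points then lie in one embedded slab, and separating them becomes a question about the
  product.\<close>

lemma common_slab:
  assumes "a \<in> topspace M" "b \<in> topspace M"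
  obtains u x t y s where "short_line_map u" "x \<in> A" "y \<in> A" "a = p (x, u t)" "b = p (y, u s)"
proof -
  obtain x r where x: "x \<in> A" "a = p (x, r)" by (rule M_cases[OF assms(1)])
  obtain y' s' where y': "y' \<in> A" "b = p (y', s')" by (rule M_cases[OF assms(2)])
  \<comment> \<open>Rounding the difference of the heights selects the deck translate nearest to
    \<open>r\<close>.\<close>
  define i y s where "i = round (s' - r)" and "y = Ji i y'" and "s = s' - real_of_int i"
  have y: "y \<in> A" "b = p (y, s)" unfolding y_def s_def using y' p_shift by simp_all
  have rs: "\<bar>s - r\<bar> \<le> 1/2" unfolding s_def i_def
    using of_int_round_ge[of "s' - r"] of_int_round_le[of "s' - r"] unfolding abs_le_iff by linarith
  define c where "c = (r + s) / 2"
  let ?u = "\<lambda>t. c + arctan t / pi"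
  \<comment> \<open>The arctan chart centred at \<open>c\<close> covers all heights at distance less
    than 1/2, with the tangent as inverse. As \<open>c\<close> is the midpoint, \<open>r\<close> and
    \<open>s\<close> are within 1/4 of it.\<close>
  have reach: "?u (tan (pi * (v - c))) = v" if "\<bar>v - c\<bar> < 1/2" for v
  proof -
    have "v - c < 1/2" "- (1/2) < v - c" using that by linarith+
    from mult_strict_left_mono[OF this(1) pi_gt_zero] mult_strict_left_mono[OF this(2) pi_gt_zero]
    have "- (pi / 2) < pi * (v - c)" "pi * (v - c) < pi / 2" by simp_all
    then have "arctan (tan (pi * (v - c))) = pi * (v - c)" by (rule arctan_tan)
    then show ?thesis by simp
  qed
  have "s - r \<le> 1/2" "r - s \<le> 1/2" using rs by arith+
  then have "\<bar>r - c\<bar> < 1/2 \<and> \<bar>s - c\<bar> < 1/2"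
    unfolding c_def abs_less_iff by (intro conjI) (simp_all add: field_simps)
  then show thesis
    using that[OF short_line_map_arctan[of c] x(1) y(1), of "tan (pi * (r - c))" "tan (pi * (s - c))"] x(2) y(2)
    by (simp add: reach)
qed

lemma Hausdorff_M:
  assumes "Hausdorff_space S"
  shows "Hausdorff_space M"
  unfolding Hausdorff_space_def
proof (intro allI impI)
  fix a b assume ab: "a \<in> topspace M \<and> b \<in> topspace M \<and> a \<noteq> b"
  then obtain u x t y s where u: "short_line_map u" and xy: "x \<in> A" "y \<in> A" "a = p (x, u t)" "b = p (y, u s)"
    using common_slab by metis
  have haus: "Hausdorff_space XR"
    using assms Hausdorff_space_prod_topology Hausdorff_space_euclidean by blast
  have "(x, t) \<noteq> (y, s)" using xy ab by auto
  then obtain U V where UV: "openin XR U" "openin XR V" "(x, t) \<in> U" "(y, s) \<in> V" "disjnt U V"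
    using haus[unfolded Hausdorff_space_def, rule_format, of "(x, t)" "(y, s)"] xy by auto
  let ?e = "\<lambda>(x, t). p (x, u t)"
  have inj: "inj_on ?e (topspace XR)"
    using short_line_embedding(1)[OF u] unfolding embedding_map_def by (rule homeomorphic_imp_injective_map)
  show "\<exists>U V. openin M U \<and> openin M V \<and> a \<in> U \<and> b \<in> V \<and> disjnt U V"
  proof (rule exI[of _ "?e ` U"], rule exI[of _ "?e ` V"], intro conjI)
    show "openin M (?e ` U)" "openin M (?e ` V)" using short_line_embedding(2)[OF u] UV by (auto simp: open_map_def)
    show "a \<in> ?e ` U" "b \<in> ?e ` V" using UV xy by (auto intro: rev_image_eqI)
    have "?e ` U \<inter> ?e ` V = ?e ` (U \<inter> V)"
      by (rule inj_on_image_Int[OF inj openin_subset[OF UV(1)] openin_subset[OF UV(2)], symmetric])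
    then show "disjnt (?e ` U) (?e ` V)" using UV(5) by (simp add: disjnt_def)
  qed
qed

lemma compactin_slab:
  assumes "compact_space S" shows "compactin M (p ` (A \<times> {a..b}))"
  by (rule image_compactin[OF _ p_cont])
    (use assms in \<open>simp add: compactin_Times compact_space_def\<close>)

lemma compact_M:
  assumes "compact_space S" shows "compact_space M"
proof -
  have "p (z, r) \<in> p ` (A \<times> {0..1})" if z: "z \<in> A" for z r
  proof -
    have "(Ji \<lfloor>r\<rfloor> z, r - real_of_int \<lfloor>r\<rfloor>) \<in> A \<times> {0..1}"
      using z floor_correct[of r] by (simp, linarith)
    then show ?thesis using p_shift[OF z, of "\<lfloor>r\<rfloor>" r] by (metis imageI)
  qed
  then have "topspace M = p ` (A \<times> {0..1})" unfolding p_surj[symmetric] by auto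
  then show ?thesis using compactin_slab[OF assms, of 0 1] by (simp add: compact_space_def)
qed

lemma connected_M:
  assumes "connected_space S" shows "connected_space M"
  by (rule connected_space_quotient_map_image[OF p_quotient])
    (use assms connectedin_topspace[of euclideanreal] in \<open>simp add: connected_space_prod_topology\<close>)

lemma manifold_M:
  assumes S: "topological_manifold n S"
  shows "topological_manifold (Suc n) M"
  unfolding topological_manifold_def
proof (intro conjI ballI)
  show "Hausdorff_space M" using S Hausdorff_M by (simp add: topological_manifold_def)
  have "second_countable XR" using S by (intro second_countable_prod second_countable_real) (simp add: topological_manifold_def)
  then show "second_countable M"
    using second_countable_open_map_image[OF p_cont p_open] p_surj by simp
  fix w assume "w \<in> topspace M"
  then obtain z r where z: "z \<in> A" "w = p (z, r)" by (rule M_cases)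
  obtain U where U: "openin S U" "z \<in> U" "subtopology S U homeomorphic_space Euclidean_space n"
    using S z(1) unfolding topological_manifold_def by blast
  \<comment> \<open>The short chart has the whole line as its parameter space, so over a chart of
    \<open>S\<close> the slab is homeomorphic to all of Euclidean space and not only to an open
    piece of it.\<close>
  let ?e = "\<lambda>(x, t). p (x, r + arctan t / pi)"
  note e = short_line_embedding[OF short_line_map_arctan[of r]]
  have UX: "U \<times> UNIV \<subseteq> topspace XR" using openin_subset[OF U(1)] by auto
  have emb: "homeomorphic_map XR (subtopology M (?e ` topspace XR)) ?e"
    using e(1) unfolding embedding_map_def .
  have sub: "?e ` (U \<times> UNIV) \<subseteq> ?e ` topspace XR" by (rule image_mono[OF UX])
  have "homeomorphic_map (subtopology XR (U \<times> UNIV)) (subtopology (subtopology M (?e ` topspace XR)) (?e ` (U \<times> UNIV))) ?e"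
    using homeomorphic_imp_surjective_map[OF emb] Int_absorb1[OF UX] Int_absorb1[OF sub]
    by (intro homeomorphic_map_subtopologies[OF emb]) (simp only:)
  then have "subtopology XR (U \<times> UNIV) homeomorphic_space subtopology M (?e ` (U \<times> UNIV))"
    unfolding subtopology_subtopology Int_absorb1[OF sub] by (rule homeomorphic_map_imp_homeomorphic_space)
  then have "subtopology M (?e ` (U \<times> UNIV)) homeomorphic_space subtopology XR (U \<times> UNIV)"
    by (rule homeomorphic_space_sym[THEN iffD1])
  also have "subtopology XR (U \<times> UNIV) = prod_topology (subtopology S U) euclideanreal"
    by (simp add: prod_topology_subtopology)
  also have "prod_topology (subtopology S U) euclideanreal homeomorphic_space prod_topology (Euclidean_space n) euclideanreal"
    using U(3) homeomorphic_space_prod_topology homeomorphic_space_refl by blast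
  also have "\<dots> homeomorphic_space Euclidean_space (Suc n)" by (rule Euclidean_space_Suc)
  finally (homeomorphic_space_trans) have "subtopology M (?e ` (U \<times> UNIV)) homeomorphic_space Euclidean_space (Suc n)" .
  moreover have "openin M (?e ` (U \<times> UNIV))"
    using e(2) U(1) by (simp add: open_map_def openin_prod_Times_iff)
  moreover have "w \<in> ?e ` (U \<times> UNIV)" using U(2) z(2) by (intro image_eqI[of _ _ "(z, 0)"]) auto
  ultimately show "\<exists>V. openin M V \<and> w \<in> V \<and> subtopology M V homeomorphic_space Euclidean_space (Suc n)" by blast
qed

text \<open>Points with the same projection differ by a power of \<open>J\<close>, which keeps
  \<omega>; this power is the map demanded by \<open>deck\<close>.\<close>

lemma line_bundle:
  assumes S: "Hausdorff_space S" and \<omega>: "manifold_orientation n S \<omega>" and J\<omega>: "preserves_orientation n S \<omega> J"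
  shows "line_bundle_quotient n S \<omega> M p"
proof
  show "Hausdorff_space M" by (rule Hausdorff_M[OF S])
  show "embedding_map XR M (\<lambda>(x, t). p (x, u t)) \<and> openin M ((\<lambda>(x, t). p (x, u t)) ` (A \<times> UNIV))"
    if "short_line_map u" for u
    using short_line_embedding[OF that] openin_topspace[of XR] by (simp add: open_map_def openin_prod_Times_iff)
  fix x r y s assume xy: "x \<in> A" "y \<in> A" and eq: "p (x, r) = p (y, s)"
  show "x = y \<and> r = s" if "\<bar>r - s\<bar> < 1" by (rule p_close[OF xy eq that])
  obtain i where i: "y = Ji i x" "s = r - real_of_int i" using eq p_eq_iff xy by blast
  show "\<exists>f. continuous_map S S f \<and> inj_on f A \<and> y = f x \<and>
      hom_induced (int n) S (A - {x}) S (A - {f x}) f (\<omega> x) = \<omega> (f x) \<and>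
      (\<forall>z\<in>A. \<forall>t. p (f z, s + t) = p (z, r + t))"
  proof (intro exI[of _ "Ji i"] conjI ballI allI)
    show "hom_induced (int n) S (A - {x}) S (A - {Ji i x}) (Ji i) (\<omega> x) = \<omega> (Ji i x)"
      using preserves_orientation_int_iterate[OF \<omega> J\<omega>] xy(1) by (simp add: preserves_orientation_def)
    show "p (Ji i z, s + t) = p (z, r + t)" if "z \<in> A" for z t
      using p_shift[OF that, of i "r + t"] i(2) by (simp add: diff_add_eq)
  qed (use i Ji_homeo homeomorphic_imp_continuous_map homeomorphic_imp_injective_map in blast)+
qed (use S \<omega> p_cont p_surj in simp_all)

end

section \<open>Dynamics on the line\<close>

definition wave :: "real \<Rightarrow> real" where
  "wave x = x + sin (pi * x) / (2 * pi)"

lemma wave_deriv: "(wave has_real_derivative 1 + cos (pi * x) / 2) (at x)"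
  unfolding wave_def by (auto intro!: derivative_eq_intros)

lemma continuous_wave: "continuous_on UNIV wave"
  unfolding wave_def by (intro continuous_intros) auto

lemma strict_mono_wave: "strict_mono wave"
proof (rule strict_monoI)
  fix x y :: real assume "x < y"
  then show "wave x < wave y"
  proof (rule DERIV_pos_imp_increasing)
    fix z show "\<exists>d. (wave has_real_derivative d) (at z) \<and> 0 < d"
      using wave_deriv[of z] cos_ge_minus_one[of "pi * z"] by (intro exI[of _ "1 + cos (pi * z) / 2"] conjI) (assumption, linarith)
  qed
qed

lemmas wave_less = strict_mono_less[OF strict_mono_wave]

lemma wave_int [simp]: "wave (real_of_int i) = real_of_int i"
  by (simp add: wave_def)

lemma wave_shift: "wave (x + 2 * real_of_int j) = wave x + 2 * real_of_int j"
proof -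
  have "pi * (x + 2 * real_of_int j) = pi * x + 2 * pi * real_of_int j" by (simp add: algebra_simps)
  then show ?thesis by (simp add: wave_def sin_add cos_int_2pin sin_int_2pin)
qed

lemma surj_wave: "surj wave"
  unfolding surj_def
proof
  fix y
  have bound: "\<bar>sin t / (2 * pi)\<bar> \<le> 1" for t
  proof -
    have "\<bar>sin t\<bar> \<le> 2 * pi" using order_trans[OF abs_sin_le_one, of "2 * pi"] pi_gt3 by simp
    then show ?thesis by (simp add: abs_divide divide_le_eq)
  qed
  have "wave (y - 1) \<le> y" "y \<le> wave (y + 1)"
    using bound[of "pi * (y - 1)"] bound[of "pi * (y + 1)"] unfolding wave_def abs_le_iff by linarith+
  then obtain x where "wave x = y"
    using IVT'[of wave "y - 1" y "y + 1"] continuous_on_subset[OF continuous_wave] by auto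
  then show "\<exists>x. y = wave x" by blast
qed

definition wave_inverse :: "real \<Rightarrow> real" where
  "wave_inverse = inv_into UNIV wave"

lemma wave_wave_inverse [simp]: "wave (wave_inverse y) = y"
  unfolding wave_inverse_def by (rule surj_f_inv_f[OF surj_wave])

text \<open>The radius 1/3 comes from cos(\<pi>/3) = 1/2; the parity of the integer decides the
  sign.\<close>

lemma cos_near_integer:
  assumes "\<bar>x - real_of_int i\<bar> \<le> 1/3"
  shows "if even i then 1/2 \<le> cos (pi * x) else cos (pi * x) \<le> - 1/2"
proof -
  let ?t = "pi * (x - real_of_int i)"
  have "\<bar>?t\<bar> \<le> pi * (1/3)" unfolding abs_mult using assms pi_gt_zero by (intro mult_mono) auto
  then have "cos (pi / 3) \<le> cos \<bar>?t\<bar>" by (intro cos_monotone_0_pi_le) auto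
  then have t: "1/2 \<le> cos ?t" by (simp add: cos_60)
  have "pi * x = ?t + pi * real_of_int i" by (simp add: algebra_simps)
  then have "cos (pi * x) = cos ?t * cos (pi * real_of_int i)" by (simp add: cos_add)
  then show ?thesis using t by (cases "even i") auto
qed

text \<open>By the mean value theorem \<open>d\<close> is the derivative 1 + cos(\<pi> y)/2 at some
  y at least as close to i as x. The cosine is at least 1/2 for even i and lies between -1 and -1/2
  for odd i.\<close>

lemma wave_slope:
  assumes x: "\<bar>x - real_of_int i\<bar> \<le> 1/3"
  obtains d where "wave x - real_of_int i = d * (x - real_of_int i)"
    "if even i then 5/4 \<le> d else 1/2 \<le> d \<and> d \<le> 3/4"
proof -
  have "\<exists>y. \<bar>y - real_of_int i\<bar> \<le> 1/3 \<and> wave x - wave (real_of_int i) = (1 + cos (pi * y) / 2) * (x - real_of_int i)"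
  proof (cases x "real_of_int i" rule: linorder_cases)
    case less
    obtain z where "z > x" "z < real_of_int i" "wave (real_of_int i) - wave x = (real_of_int i - x) * (1 + cos (pi * z) / 2)"
      using MVT2[OF less, of wave "\<lambda>x. 1 + cos (pi * x) / 2"] wave_deriv by blast
    moreover have "wave x - wave (real_of_int i) = - (wave (real_of_int i) - wave x)" by (simp only: minus_diff_eq)
    then have "wave x - wave (real_of_int i) = (1 + cos (pi * z) / 2) * (x - real_of_int i)"
      unfolding \<open>wave (real_of_int i) - wave x = _\<close> by (simp only: minus_mult_left minus_diff_eq mult.commute)
    ultimately show ?thesis using x by (intro exI[of _ z] conjI) (auto simp: abs_le_iff)
  next
    case equal
    then show ?thesis by (intro exI[of _ x]) simp
  next
    case greater
    obtain z where "z > real_of_int i" "z < x" "wave x - wave (real_of_int i) = (x - real_of_int i) * (1 + cos (pi * z) / 2)"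
      using MVT2[OF greater, of wave "\<lambda>x. 1 + cos (pi * x) / 2"] wave_deriv by blast
    then show ?thesis using x by (intro exI[of _ z]) (auto simp: algebra_simps abs_le_iff)
  qed
  then obtain y where y: "\<bar>y - real_of_int i\<bar> \<le> 1/3"
    and eq: "wave x - real_of_int i = (1 + cos (pi * y) / 2) * (x - real_of_int i)" by auto
  have "if even i then 5/4 \<le> 1 + cos (pi * y) / 2 else 1/2 \<le> 1 + cos (pi * y) / 2 \<and> 1 + cos (pi * y) / 2 \<le> 3/4"
  proof (cases "even i")
    case True
    then show ?thesis using cos_near_integer[OF y] by simp
  next
    case False
    then have "cos (pi * y) \<le> - 1/2" using cos_near_integer[OF y] by simp
    moreover have "-1 \<le> cos (pi * y)" by (rule cos_ge_minus_one)
    ultimately have "1/2 \<le> 1 + cos (pi * y) / 2" "1 + cos (pi * y) / 2 \<le> 3/4" by linarith+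
    then show ?thesis using False by simp
  qed
  from that[OF eq this] show thesis .
qed

text \<open>The radius 1/3 is the one on which the slopes of \<open>wave\<close> are controlled; it
  is also the radius of the trapping neighbourhoods of the levels.\<close>

definition contracts :: "(real \<Rightarrow> real) \<Rightarrow> real \<Rightarrow> bool" where
  "contracts f a \<longleftrightarrow> (\<exists>c. 0 \<le> c \<and> c < 1 \<and> (\<forall>x. \<bar>x - a\<bar> \<le> 1/3 \<longrightarrow> \<bar>f x - a\<bar> \<le> c * \<bar>x - a\<bar>))"

lemma contracts_funpow:
  assumes c: "0 \<le> c" "c \<le> 1" and f: "\<And>x. \<bar>x - a\<bar> \<le> 1/3 \<Longrightarrow> \<bar>f x - a\<bar> \<le> c * \<bar>x - a\<bar>"
    and x: "\<bar>x - a\<bar> \<le> (1/3::real)"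
  shows "\<bar>(f ^^ m) x - a\<bar> \<le> c ^ m * \<bar>x - a\<bar>"
proof (induction m)
  case (Suc m)
  have "c ^ m * \<bar>x - a\<bar> \<le> 1 * \<bar>x - a\<bar>" using c by (intro mult_right_mono power_le_one) auto
  from order_trans[OF order_trans[OF Suc this], of "1/3"] have "\<bar>(f ^^ m) x - a\<bar> \<le> 1/3" using x by (simp only: mult_1)
  from f[OF this] mult_left_mono[OF Suc c(1)] show ?case by (simp add: mult.assoc)
qed simp

lemma contracts_power:
  assumes "contracts f a" "m > 0"
  shows "contracts (f ^^ m) a"
proof -
  obtain c where c: "0 \<le> c" "c < 1" "\<forall>x. \<bar>x - a\<bar> \<le> 1/3 \<longrightarrow> \<bar>f x - a\<bar> \<le> c * \<bar>x - a\<bar>"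
    using assms(1) unfolding contracts_def by (elim exE conjE)
  have "c ^ m < 1" using c(1,2) assms(2) by (simp add: power_less_one_iff)
  then show ?thesis unfolding contracts_def using c contracts_funpow[of c a f]
    by (intro exI[of _ "c ^ m"]) auto
qed

lemma contracts_wave:
  assumes "odd i"
  shows "contracts wave (real_of_int i)"
  unfolding contracts_def
proof (intro exI[of _ "3/4"] conjI allI impI)
  fix x assume "\<bar>x - real_of_int i\<bar> \<le> 1/3"
  then obtain d where "wave x - real_of_int i = d * (x - real_of_int i)" "1/2 \<le> d" "d \<le> 3/4"
    using wave_slope[of x i] assms by metis
  then have "\<bar>wave x - real_of_int i\<bar> = d * \<bar>x - real_of_int i\<bar>" by (simp add: abs_mult)
  also have "\<dots> \<le> 3/4 * \<bar>x - real_of_int i\<bar>" by (rule mult_right_mono[OF \<open>d \<le> 3/4\<close>]) simp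
  finally show "\<bar>wave x - real_of_int i\<bar> \<le> 3/4 * \<bar>x - real_of_int i\<bar>" .
qed auto

text \<open>The factor 4/5 is the inverse of the least slope 5/4 near an even integer.\<close>

lemma contracts_wave_inverse:
  assumes "even i"
  shows "contracts (wave_inverse) (real_of_int i)"
  unfolding contracts_def
proof (intro exI[of _ "4/5"] conjI allI impI)
  fix y assume y: "\<bar>y - real_of_int i\<bar> \<le> 1/3"
  define x where "x = wave_inverse y"
  have xy: "wave x = y" by (simp add: x_def)
  \<comment> \<open>The points at distance 1/3 from i are moved to distance at least 5/12, which
    exceeds 1/3. By monotonicity the preimage of a point within 1/3 of i stays within 1/3, where the
    slope bound applies.\<close>
  have right: "real_of_int i + 5/12 \<le> wave (real_of_int i + 1/3)"
    by (rule wave_slope[of "real_of_int i + 1/3" i]) (use assms in auto)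
  have left: "wave (real_of_int i - 1/3) \<le> real_of_int i - 5/12"
    by (rule wave_slope[of "real_of_int i - 1/3" i]) (use assms in auto)
  have "\<not> real_of_int i + 1/3 < x" using wave_less[of "real_of_int i + 1/3" x] right xy y by linarith
  moreover have "\<not> x < real_of_int i - 1/3" using wave_less[of x "real_of_int i - 1/3"] left xy y by linarith
  ultimately have "\<bar>x - real_of_int i\<bar> \<le> 1/3" by linarith
  then obtain d where d: "wave x - real_of_int i = d * (x - real_of_int i)" "5/4 \<le> d"
    using wave_slope[of x i] assms by metis
  have bound: "5/4 * \<bar>x - real_of_int i\<bar> \<le> \<bar>y - real_of_int i\<bar>"
    using d mult_right_mono[OF d(2), of "\<bar>x - real_of_int i\<bar>"] xy by (simp add: abs_mult)
  show "\<bar>wave_inverse y - real_of_int i\<bar> \<le> 4/5 * \<bar>y - real_of_int i\<bar>" unfolding x_def[symmetric] using mult_left_mono[OF bound, of "4/5"] by simp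
qed auto

text \<open>The integers are fixed and \<open>wave\<close> is increasing, so orbits cannot cross an
  integer.\<close>

lemma wave_unit_interval:
  assumes "real_of_int j < x" "x < real_of_int j + 1"
  shows "real_of_int j < (wave ^^ m) x" "(wave ^^ m) x < real_of_int j + 1"
proof -
  have "real_of_int j < (wave ^^ m) x \<and> (wave ^^ m) x < real_of_int (j + 1)"
  proof (induction m)
    case (Suc m)
    then show ?case
      using wave_less[of "real_of_int j" "(wave ^^ m) x"] wave_less[of "(wave ^^ m) x" "real_of_int (j + 1)"]
      by (simp del: of_int_add)
  qed (use assms in simp)
  then show "real_of_int j < (wave ^^ m) x" "(wave ^^ m) x < real_of_int j + 1" by simp_all
qed

text \<open>Monotonicity turns one step of displacement into permanent departure: if the image of
  one end lies beyond the other end, all points of the interval have left it after one step and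
  never return. The interval is kept between consecutive integers so that integer translations can
  be excluded in the quotient.\<close>

lemma wave_displaces:
  assumes x: "x \<notin> \<int>"
  shows "\<exists>(j::int) a b. real_of_int j \<le> a \<and> a < x \<and> x < b \<and> b \<le> real_of_int j + 1 \<and>
    (\<forall>y m. a < y \<longrightarrow> y < b \<longrightarrow> m > 0 \<longrightarrow> \<not> (a < (wave ^^ m) y \<and> (wave ^^ m) y < b))"
proof -
  define j where "j = \<lfloor>x\<rfloor>"
  have j: "real_of_int j < x" "x < real_of_int j + 1"
  proof -
    have "real_of_int j \<noteq> x" using x by (metis Ints_of_int)
    then show "real_of_int j < x" "x < real_of_int j + 1" unfolding j_def using floor_correct[of x] by linarith+
  qed
  have "sin (pi * x) \<noteq> 0"
  proof
    assume "sin (pi * x) = 0"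
    then obtain i :: int where "pi * x = of_int i * pi" by (auto simp: sin_zero_iff_int2)
    then have "x = of_int i" by simp
    then show False using x by simp
  qed
  then have "wave x \<noteq> x" by (simp add: wave_def)
  then consider "wave x > x" | "wave x < x" by linarith
  then show ?thesis
  proof cases
    case 1
    \<comment> \<open>\<open>b\<close> lies between \<open>x\<close> and its image; \<open>a\<close>
      is then taken above \<open>j\<close> and so close to \<open>x\<close> that its image still
      exceeds \<open>b\<close>.\<close>
    define b where "b = (x + wave x) / 2"
    have b: "x < b" "b < wave x" using 1 by (simp_all add: b_def)
    define c where "c = wave_inverse b"
    have c: "wave c = b" "c < x" using b(2) wave_less[of c x] by (simp_all add: c_def)
    define a where "a = max ((c + x) / 2) ((real_of_int j + x) / 2)"
    have a: "c < a" "real_of_int j < a" "a < x" using c j by (auto simp: a_def less_max_iff_disj)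
    have ab: "wave a > b" using wave_less[of c a] a c by simp
    show ?thesis
    proof (rule exI[of _ j], rule exI[of _ a], rule exI[of _ b], intro conjI allI impI)
      show "b \<le> real_of_int j + 1" using b wave_unit_interval(2)[OF j, of 1] by simp
      fix y m assume y: "a < y" and "m > (0::nat)"
      have "(wave ^^ Suc i) y > b" for i
      proof (induction i)
        case 0
        then show ?case using wave_less[of a y] y ab by simp
      next
        case (Suc i)
        have "wave a < wave ((wave ^^ Suc i) y)" using Suc a b wave_less by simp
        then show ?case using ab by simp
      qed
      from this[of "m - 1"] \<open>m > 0\<close> show "\<not> (a < (wave ^^ m) y \<and> (wave ^^ m) y < b)" by auto
    qed (use a b in auto)
  next
    case 2
    define a where "a = (x + wave x) / 2"
    have a: "a < x" "wave x < a" using 2 by (simp_all add: a_def)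
    define c where "c = wave_inverse a"
    have c: "wave c = a" "x < c" using a(2) wave_less[of x c] by (simp_all add: c_def)
    define b where "b = min ((c + x) / 2) ((real_of_int j + 1 + x) / 2)"
    have b: "b < c" "b < real_of_int j + 1" "x < b" using c j by (auto simp: b_def min_less_iff_disj)
    have ab: "wave b < a" using wave_less[of b c] b c by simp
    show ?thesis
    proof (rule exI[of _ j], rule exI[of _ a], rule exI[of _ b], intro conjI allI impI)
      show "real_of_int j \<le> a" using a wave_unit_interval(1)[OF j, of 1] by simp
      fix y m assume y: "y < b" and "m > (0::nat)"
      have "(wave ^^ Suc i) y < a" for i
      proof (induction i)
        case 0
        then show ?case using wave_less[of y b] y ab by simp
      next
        case (Suc i)
        have "wave ((wave ^^ Suc i) y) < wave b" using Suc a b wave_less by simp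
        then show ?case using ab by simp
      qed
      from this[of "m - 1"] \<open>m > 0\<close> show "\<not> (a < (wave ^^ m) y \<and> (wave ^^ m) y < b)" by auto
    qed (use a b in auto)
  qed
qed

section \<open>Model maps\<close>

locale model = torus_bundle S J for S :: "'a topology" and J :: "'a \<Rightarrow> 'a" +
  fixes P :: "'a \<Rightarrow> 'a" and n k :: nat and l :: int
  assumes S_haus: "Hausdorff_space S" and S_compact: "compact_space S"
    and n: "n > 0" and k: "k > 0"
    and P: "homeomorphic_map S S P" and PJ: "\<And>z. z \<in> topspace S \<Longrightarrow> P (J z) = J (P z)"
begin

text \<open>The sine in the lifted map vanishes exactly at the multiples of 1/(2nk), so
  \<open>N\<close> counts the levels in one period of the line.\<close>

definition N :: int where "N = 2 * int n * int k"
abbreviation \<phi> where "\<phi> \<equiv> lifted_model_fun n k l"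
abbreviation F where "F \<equiv> model_map S P J n k l"
abbreviation NR :: real where "NR \<equiv> real_of_int N"

text \<open>Rescaled coordinates, in which the invariant levels of the model map are the integers.\<close>

definition q :: "'a \<Rightarrow> real \<Rightarrow> ('a \<times> real) set" where "q z x = p (z, x / NR)"

lemma N2: "N \<ge> 2"
proof -
  have "1 \<le> int n * int k" using n k by (simp add: int_one_le_iff_zero_less)
  then show ?thesis unfolding N_def by simp
qed

lemma NR_pos: "NR > 0" and NR2: "NR \<ge> 2"
  using N2 by linarith+

lemma \<phi>_eq: "\<phi> r = (wave (NR * r) + 2 * real n * real_of_int l) / NR"
  using n k by (simp add: lifted_model_fun_def wave_def N_def field_simps)

lemma \<phi>_shift: "\<phi> (r - real_of_int i) = \<phi> r - real_of_int i"
proof -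
  \<comment> \<open>A unit shift of \<open>r\<close> is a shift by 2nk in the rescaled coordinate.
    This number is even, so \<open>wave\<close> commutes with the shift.\<close>
  let ?j = "real_of_int (- (int n * int k * i))"
  have j: "2 * ?j = - (NR * real_of_int i)" by (simp add: N_def)
  have "NR * (r - real_of_int i) = NR * r + 2 * ?j" unfolding j by (simp add: right_diff_distrib)
  then have "wave (NR * (r - real_of_int i)) = wave (NR * r) - NR * real_of_int i"
    unfolding diff_conv_add_uminus j[symmetric] by (simp only: wave_shift)
  then show ?thesis unfolding \<phi>_eq using NR_pos by (simp add: field_simps)
qed

lemma \<phi>_cont: "continuous_on UNIV \<phi>"
proof -
  have "continuous_on UNIV (\<lambda>r. (wave (NR * r) + 2 * real n * real_of_int l) / NR)"
    using NR_pos by (intro continuous_intros continuous_on_compose2[OF continuous_wave]) auto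
  then show ?thesis by (simp only: \<phi>_eq[abs_def])
qed

lemma \<phi>_mono: "strict_mono \<phi>"
  using NR_pos by (intro strict_monoI) (simp add: \<phi>_eq wave_less divide_strict_right_mono)

lemma \<phi>_surj: "\<exists>r. \<phi> r = s"
proof
  show "\<phi> (wave_inverse (NR * s - 2 * real n * real_of_int l) / NR) = s" using NR_pos by (simp add: \<phi>_eq)
qed

lemma P_in [simp]: "z \<in> A \<Longrightarrow> P z \<in> A"
  using homeomorphic_imp_surjective_map[OF P] by blast

lemma P_surj: assumes "z \<in> A" obtains y where "y \<in> A" "z = P y"
proof -
  have "z \<in> P ` A" unfolding homeomorphic_imp_surjective_map[OF P] by (rule assms)
  then show thesis using that by (elim imageE)
qed

lemma P_inj: "z \<in> A \<Longrightarrow> w \<in> A \<Longrightarrow> P z = P w \<longleftrightarrow> z = w"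
  using homeomorphic_imp_injective_map[OF P] by (simp add: inj_on_eq_iff)

lemma P_Ji:
  assumes z: "z \<in> A" shows "P (Ji i z) = Ji i (P z)"
proof (induction i rule: int_induct[of _ 0])
  case base
  then show ?case by simp
next
  case (step1 i)
  then show ?case using int_iterate_step(2)[OF bij] z PJ by simp
next
  case (step2 i)
  have "J (P (Ji (i - 1) z)) = P (J (Ji (i - 1) z))" using PJ z by simp
  also have "J (Ji (i - 1) z) = Ji i z" using int_iterate_step(2)[OF bij z, of "i - 1"] by simp
  also have "P (Ji i z) = J (Ji (i - 1) (P z))" using step2 int_iterate_step(2)[OF bij P_in[OF z], of "i - 1"] by simp
  finally show ?case
    by (rule inj_onD[OF bij_betw_imp_inj_on[OF bij]]) (use z in simp_all)
qed

text \<open>All representatives of a point are deck translates of each other, and the lifted map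
  commutes with these translations. The image set is therefore a singleton, which gives
  \<open>the_elem\<close> its meaning.\<close>

lemma model_map_p:
  assumes z: "z \<in> A"
  shows "F (p (z, r)) = p (P z, \<phi> r)"
proof -
  have "p (lifted_model_map P n k l x) = p (P z, \<phi> r)" if "x \<in> {x \<in> A \<times> UNIV. p x = p (z, r)}" for x
  proof -
    obtain w s where ws: "x = (w, s)" by (cases x)
    have x: "x = (w, s)" "w \<in> A" "p (z, r) = p (w, s)" using that unfolding ws by simp_all
    then obtain i where "w = Ji i z" "s = r - real_of_int i" using p_eq_iff[OF z x(2)] by blast
    then show ?thesis using x(1) z p_shift[OF P_in[OF z]] by (simp add: lifted_model_map_def P_Ji \<phi>_shift)
  qed
  then have "p ` lifted_model_map P n k l ` {x \<in> A \<times> UNIV. p x = p (z, r)} \<subseteq> {p (P z, \<phi> r)}" by blast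
  moreover have "(z, r) \<in> {x \<in> A \<times> UNIV. p x = p (z, r)}" using z by simp
  then have "p ` lifted_model_map P n k l ` {x \<in> A \<times> UNIV. p x = p (z, r)} \<noteq> {}" by blast
  ultimately have "p ` lifted_model_map P n k l ` {x \<in> A \<times> UNIV. p x = p (z, r)} = {p (P z, \<phi> r)}" by (simp only: subset_singleton_iff) blast
  then show ?thesis by (simp add: model_map_def)
qed

text \<open>Continuity is tested on the lift through the quotient map, and openness follows from
  that of the lift and of the projection. Injectivity holds since a deck translation relating two
  images also relates the original representatives.\<close>

lemma F_homeo: "homeomorphic_map M M F"
proof (rule bijective_open_imp_homeomorphic_map)
  let ?\<Phi> = "\<lambda>(z, r). (P z, \<phi> r)"
  have lift: "(p \<circ> ?\<Phi>) x = (F \<circ> p) x" if "x \<in> topspace XR" for x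
    using that model_map_p by (cases x) auto
  have "continuous_map euclideanreal euclideanreal \<phi>" using \<phi>_cont by simp
  from continuous_map_compose[OF continuous_map_fst[of S euclideanreal] homeomorphic_imp_continuous_map[OF P]]
    continuous_map_compose[OF continuous_map_snd[of S euclideanreal] this]
  have "continuous_map XR XR ?\<Phi>" by (simp add: continuous_map_pairwise o_def case_prod_unfold)
  from continuous_map_eq[OF continuous_map_compose[OF this p_cont] lift]
  show "continuous_map M M F" by (rule continuous_compose_quotient_map[OF p_quotient])
  show "open_map M M F"
    unfolding open_map_def
  proof (intro allI impI)
    fix V assume V: "openin M V"
    let ?V = "{x \<in> topspace XR. p x \<in> V}"
    have V': "openin XR ?V" using openin_continuous_map_preimage[OF p_cont V] .
    have "F ` V = (F \<circ> p) ` ?V"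
    proof -
      have "V = p ` ?V"
      proof (intro equalityI subsetI)
        fix w assume w: "w \<in> V"
        then have "w \<in> topspace M" using openin_subset[OF V] by blast
        then obtain z r where "z \<in> A" "w = p (z, r)" by (rule M_cases)
        then show "w \<in> p ` ?V" using w by (intro image_eqI[of _ _ "(z, r)"]) auto
      qed blast
      then show ?thesis by (metis image_comp)
    qed
    also have "\<dots> = (p \<circ> ?\<Phi>) ` ?V" using lift by (intro image_cong) simp_all
    also have "\<dots> = p ` ?\<Phi> ` ?V" by (simp only: image_comp)
    also have "openin M \<dots>"
      using open_map_prod[OF homeomorphic_imp_open_map[OF P] open_map_line[OF \<phi>_cont \<phi>_mono]] V' p_open
      unfolding open_map_def by blast
    finally show "openin M (F ` V)" .
  qed
  show "F ` topspace M = topspace M"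
  proof (intro equalityI subsetI)
    fix w assume "w \<in> F ` topspace M"
    then obtain v where v: "v \<in> topspace M" "w = F v" by (elim imageE)
    obtain z r where "z \<in> A" "v = p (z, r)" using v(1) by (rule M_cases)
    then show "w \<in> topspace M" using v(2) model_map_p p_in by simp
  next
    fix w assume w: "w \<in> topspace M"
    obtain z r where z: "z \<in> A" "w = p (z, r)" using w by (rule M_cases)
    obtain y where y: "y \<in> A" "z = P y" using z(1) by (rule P_surj)
    obtain s where s: "\<phi> s = r" using \<phi>_surj by blast
    show "w \<in> F ` topspace M" using y z s model_map_p[OF y(1)] p_in[OF y(1)] by (intro image_eqI[of _ _ "p (y, s)"]) auto
  qed
  show "inj_on F (topspace M)"
  proof (rule inj_onI)
    fix v w assume v: "v \<in> topspace M" and w: "w \<in> topspace M" and eq: "F v = F w"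
    obtain z r where z: "z \<in> A" "v = p (z, r)" using v by (rule M_cases)
    obtain y s where y: "y \<in> A" "w = p (y, s)" using w by (rule M_cases)
    have "p (P z, \<phi> r) = p (P y, \<phi> s)" using eq z y by (simp add: model_map_p)
    then obtain i where i: "P y = Ji i (P z)" "\<phi> s = \<phi> r - real_of_int i" using p_eq_iff z y by auto
    have "y = Ji i z" using i(1) z(1) y(1) by (simp add: P_Ji[symmetric] P_inj)
    moreover have "s = r - real_of_int i" using i(2) strict_mono_eq[OF \<phi>_mono] by (simp add: \<phi>_shift[symmetric])
    ultimately show "v = w" using z y p_shift by simp
  qed
qed

lemma F_orientation_preserving:
  assumes \<omega>: "manifold_orientation m S \<omega>" "preserves_orientation m S \<omega> J" "preserves_orientation m S \<omega> P"
  shows "orientation_preserving (Suc m) M F" "orientable_manifold (Suc m) M"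
proof -
  interpret lb: line_bundle_quotient m S \<omega> M p by (rule line_bundle[OF S_haus \<omega>(1,2)])
  show "orientation_preserving (Suc m) M F"
  proof (rule lb.orientation_preserving_quotient_map[OF F_homeo model_map_p _ _ _ \<phi>_cont \<phi>_mono])
    show "continuous_map S S P" "inj_on P A" using P homeomorphic_imp_continuous_map homeomorphic_imp_injective_map by blast+
    show "hom_induced (int m) S (A - {x}) S (A - {P x}) P (\<omega> x) = \<omega> (P x)" if "x \<in> A" for x
      using \<omega>(3) that by (simp add: preserves_orientation_def)
    show "\<phi> (r + 1) = \<phi> r + 1" for r using \<phi>_shift[of r "-1"] by simp
  qed
  show "orientable_manifold (Suc m) M" using lb.manifold_orientation_orient unfolding orientable_manifold_def by blast
qed

section \<open>Rescaled coordinates and the return map\<close>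

lemma q_eq_iff:
  assumes "z \<in> A" "w \<in> A"
  shows "q z x = q w y \<longleftrightarrow> (\<exists>i. w = Ji i z \<and> y = x - NR * real_of_int i)"
proof -
  have "y / NR = x / NR - real_of_int i \<longleftrightarrow> y = x - NR * real_of_int i" for i using NR_pos by (simp add: field_simps)
  then show ?thesis unfolding q_def p_eq_iff[OF assms] by simp
qed

text \<open>Since \<open>N\<close> is at least 2, rescaled heights at distance less than 2 are
  original heights at distance less than one.\<close>

lemma q_close:
  assumes "z \<in> A" "w \<in> A" "q z x = q w y" "\<bar>x - y\<bar> < 2"
  shows "z = w \<and> x = y"
proof -
  have "z = w \<and> x / NR = y / NR"
  proof (rule p_close[OF assms(1,2)])
    show "p (z, x / NR) = p (w, y / NR)" using assms(3) by (simp only: q_def)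
    have "\<bar>x / NR - y / NR\<bar> = \<bar>x - y\<bar> / NR" using NR_pos by (simp add: diff_divide_distrib[symmetric] abs_divide)
    then show "\<bar>x / NR - y / NR\<bar> < 1" using NR_pos NR2 assms(4) by simp
  qed
  then show ?thesis using NR_pos by simp
qed

lemma q_in: "z \<in> A \<Longrightarrow> q z x \<in> topspace M"
  unfolding q_def by (rule p_in)

lemma q_cases:
  assumes "w \<in> topspace M"
  obtains z x where "z \<in> A" "w = q z x"
proof -
  obtain z r where "z \<in> A" "w = p (z, r)" using assms by (rule M_cases)
  then show thesis using that[of z "NR * r"] NR_pos by (simp add: q_def)
qed

lemma q_cont: "continuous_map XR M (\<lambda>(z, x). q z x)"
proof -
  have "continuous_on UNIV (\<lambda>x. x / NR)" using NR_pos by (intro continuous_intros) auto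
  from continuous_map_compose[OF line_cont[OF this] p_cont] show ?thesis by (simp add: o_def case_prod_unfold q_def)
qed

lemma q_open: "open_map XR M (\<lambda>(z, x). q z x)"
proof -
  have "continuous_on UNIV (\<lambda>x. x / NR)" "strict_mono (\<lambda>x. x / NR)"
    using NR_pos by (auto intro!: continuous_intros simp: strict_mono_def divide_strict_right_mono)
  from open_map_prod[OF homeomorphic_imp_open_map[OF homeomorphic_map_id[THEN iffD2, OF refl]] open_map_line[OF this]]
  have "open_map XR XR (\<lambda>(z, x). (id z, x / NR))" .
  from open_map_compose[OF this p_open] show ?thesis by (simp add: o_def case_prod_unfold q_def)
qed

lemma F_q:
  assumes z: "z \<in> A"
  shows "F (q z x) = q (P z) (wave x + 2 * real_of_int (int n * l))"
  unfolding q_def model_map_p[OF z] \<phi>_eq using NR_pos by (simp add: mult.assoc)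

lemma P_pow_in [simp]: "z \<in> A \<Longrightarrow> (P ^^ m) z \<in> A"
  by (induction m) simp_all

text \<open>The translation 2nl is an even integer and commutes with \<open>wave\<close>, so the
  translations accumulate separately.\<close>

lemma F_pow_q:
  assumes z: "z \<in> A"
  shows "(F ^^ m) (q z x) = q ((P ^^ m) z) ((wave ^^ m) x + 2 * real_of_int (int n * l * int m))"
proof (induction m)
  case (Suc m)
  have "(F ^^ Suc m) (q z x) = F (q ((P ^^ m) z) ((wave ^^ m) x + 2 * real_of_int (int n * l * int m)))" using Suc by simp
  also have "\<dots> = q (P ((P ^^ m) z)) (wave ((wave ^^ m) x) + 2 * real_of_int (int n * l * int m) + 2 * real_of_int (int n * l))"
    unfolding F_q[OF P_pow_in[OF z]] wave_shift ..
  finally show ?case by (simp add: algebra_simps)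
qed simp

definition Q where "Q = Ji l \<circ> (P ^^ k)"

lemma Q_homeo: "homeomorphic_map S S Q"
  unfolding Q_def by (rule homeomorphic_map_compose[OF homeomorphic_map_funpow[OF P] Ji_homeo])

lemma Q_image: "Q ` A = A"
  by (rule homeomorphic_imp_surjective_map[OF Q_homeo])

lemma Q_in [simp]: "z \<in> A \<Longrightarrow> Q z \<in> A"
  using Q_image by blast

text \<open>After \<open>k\<close> steps the accumulated translation 2nlk is l times
  \<open>N\<close>. It is absorbed by the l-th power of the deck map, which contributes the power of
  \<open>J\<close> in \<open>Q\<close>.\<close>

lemma F_period_q:
  assumes z: "z \<in> A"
  shows "(F ^^ k) (q z x) = q (Q z) ((wave ^^ k) x)"
proof -
  have e: "2 * real_of_int (int n * l * int k) = NR * real_of_int l" by (simp add: N_def)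
  have "(F ^^ k) (q z x) = q ((P ^^ k) z) ((wave ^^ k) x + NR * real_of_int l)"
    using F_pow_q[OF z, of k x] unfolding e .
  also have "\<dots> = q (Q z) ((wave ^^ k) x)"
    using z by (subst q_eq_iff) (auto simp: Q_def)
  finally show ?thesis .
qed

end

text \<open>With finitely many closed pieces the complement of each piece is closed, so every piece
  is clopen as well as connected.\<close>

lemma connected_components_of_closed_partition:
  assumes fin: "finite \<B>" and B: "\<And>B. B \<in> \<B> \<Longrightarrow> closedin X B" "\<And>B. B \<in> \<B> \<Longrightarrow> connectedin X B" "\<And>B. B \<in> \<B> \<Longrightarrow> B \<noteq> {}"
    and disj: "pairwise disjnt \<B>" and cover: "\<Union>\<B> = topspace X"
  shows "connected_components_of X = \<B>"
proof -
  have comp: "connected_component_of_set X x = B" if "B \<in> \<B>" "x \<in> B" for B x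
  proof (rule subset_antisym)
    have "topspace X - B = \<Union>(\<B> - {B})"
      using disj that(1) unfolding cover[symmetric] pairwise_def disjnt_def by blast
    moreover have "closedin X (\<Union>(\<B> - {B}))" using fin B(1) by (intro closedin_Union) auto
    ultimately have "openin X B" using closedin_subset[OF B(1)[OF that(1)]] by (simp add: openin_closedin)
    then have "connected_component_of_set X x \<subseteq> B \<or> disjnt (connected_component_of_set X x) B"
      by (intro connectedin_clopen_cases[OF connectedin_connected_component_of B(1)[OF that(1)]])
    moreover have "x \<in> topspace X" using that cover by blast
    then have "x \<in> connected_component_of_set X x" by (simp add: connected_component_of_refl)
    ultimately show "connected_component_of_set X x \<subseteq> B" using that(2) unfolding disjnt_def by blast
    show "B \<subseteq> connected_component_of_set X x" by (rule connected_component_of_maximal[OF B(2)[OF that(1)] that(2)])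
  qed
  show ?thesis
  proof (intro equalityI subsetI)
    fix C assume "C \<in> connected_components_of X"
    then obtain x where x: "x \<in> topspace X" "C = connected_component_of_set X x"
      unfolding connected_components_of_def by (elim imageE)
    then obtain D where "D \<in> \<B>" "x \<in> D" using cover by blast
    then show "C \<in> \<B>" using comp x(2) by simp
  next
    fix D assume D: "D \<in> \<B>"
    then obtain x where x: "x \<in> D" using B(3) by blast
    then have "x \<in> topspace X" using D cover by blast
    then show "D \<in> connected_components_of X"
      unfolding connected_components_of_def by (rule rev_image_eqI) (rule comp[OF D x, symmetric])
  qed
qed

lemma wave_pow_int [simp]: "(wave ^^ m) (real_of_int i) = real_of_int i"
  by (induction m) simp_all

lemma wave_pow_inverse: "(wave ^^ m) ((wave_inverse ^^ m) x) = x"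
proof (induction m)
  case (Suc m)
  have "(wave ^^ Suc m) ((wave_inverse ^^ Suc m) x) = (wave ^^ m) (wave (wave_inverse ((wave_inverse ^^ m) x)))"
    by (simp only: funpow_Suc_right comp_apply) (simp only: funpow_swap1[symmetric])
  then show ?case using Suc by simp
qed simp

section \<open>Levels as periodic surfaces, attractors and repellers\<close>

context model
begin

definition level :: "int \<Rightarrow> ('a \<times> real) set set" where
  "level i = (\<lambda>z. q z (real_of_int i)) ` A"

lemma level_shift: "level (i + N * m) = level i"
proof -
  have "q z (real_of_int (i + N * m)) = q (Ji m z) (real_of_int i)" if "z \<in> A" for z
    using that by (subst q_eq_iff) auto
  then have "level (i + N * m) = (\<lambda>z. q (Ji m z) (real_of_int i)) ` A" unfolding level_def by (rule image_cong[OF refl])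
  also have "\<dots> = (\<lambda>z. q z (real_of_int i)) ` Ji m ` A" by (simp only: image_image)
  also have "Ji m ` A = A" by (rule homeomorphic_imp_surjective_map[OF Ji_homeo])
  finally show ?thesis unfolding level_def .
qed

lemma level_dvd: "N dvd j - i \<Longrightarrow> level j = level i"
  using level_shift[of i] by (elim dvdE) (metis add_diff_cancel_left' diff_add_cancel add.commute)

lemma level_meet:
  assumes "z \<in> A" "w \<in> A" "q z (real_of_int i) = q w (real_of_int j)"
  shows "N dvd j - i"
proof -
  obtain m where "real_of_int j = real_of_int i - NR * real_of_int m" using assms(3) q_eq_iff[OF assms(1,2)] by blast
  then have "real_of_int j = real_of_int (i - N * m)" by simp
  then have "j = i - N * m" by (simp only: of_int_eq_iff)
  then show ?thesis by simp
qed

lemma level_disjoint: "\<not> N dvd j - i \<Longrightarrow> level i \<inter> level j = {}"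
  using level_meet unfolding level_def by blast

lemma level_subset: "level i \<subseteq> topspace M"
  unfolding level_def using q_in by blast

lemma F_pow_level: "(F ^^ m) ` level i = level (i + 2 * (int n * l * int m))"
proof -
  have "(F ^^ m) ` level i = (\<lambda>z. (F ^^ m) (q z (real_of_int i))) ` A" unfolding level_def by (simp only: image_image)
  also have "\<dots> = (\<lambda>z. q ((P ^^ m) z) (real_of_int (i + 2 * (int n * l * int m)))) ` A"
    by (rule image_cong[OF refl]) (simp add: F_pow_q)
  also have "\<dots> = (\<lambda>z. q z (real_of_int (i + 2 * (int n * l * int m)))) ` (P ^^ m) ` A" by (simp only: image_image)
  also have "(P ^^ m) ` A = A" by (rule funpow_image[OF homeomorphic_imp_surjective_map[OF P]])
  finally show ?thesis unfolding level_def .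
qed

lemma level_cont: "continuous_map S M (\<lambda>z. q z x)"
proof -
  have "continuous_map S XR (\<lambda>z. (z, x))" by (simp add: continuous_map_pairwise o_def)
  from continuous_map_compose[OF this q_cont] show ?thesis by (simp add: o_def)
qed

lemma level_embedding: "embedding_map S M (\<lambda>z. q z x)"
proof (rule injective_closed_imp_embedding_map[OF level_cont])
  show "closed_map S M (\<lambda>z. q z x)" by (rule continuous_imp_closed_map[OF level_cont S_compact Hausdorff_M[OF S_haus]])
  show "inj_on (\<lambda>z. q z x) A" using q_close by (intro inj_onI) auto
qed

lemma level_pair:
  obtains d where "homeomorphism_pair S (subtopology M (level i)) (\<lambda>z. q z (real_of_int i)) d"
  using level_embedding[of "real_of_int i"] that
  unfolding embedding_map_def level_def homeomorphic_map_maps homeomorphism_pair_def by blast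

lemma level_closed: "closedin M (level i)"
  unfolding level_def using S_compact
  by (intro compactin_imp_closedin[OF Hausdorff_M[OF S_haus]] image_compactin[OF _ level_cont]) (simp add: compact_space_def)

lemma level_connected: "connected_space S \<Longrightarrow> connectedin M (level i)"
  unfolding level_def by (intro connectedin_continuous_map_image[OF level_cont]) (simp add: connectedin_topspace)

lemma level_cylinder:
  assumes "closed_orientable_surface S g" "g > 1"
  shows "cylindrically_embedded_surface M (level i)"
proof -
  obtain d where "homeomorphism_pair S (subtopology M (level i)) (\<lambda>z. q z (real_of_int i)) d" by (rule level_pair)
  then interpret e: homeomorphism_pair S "subtopology M (level i)" "\<lambda>z. q z (real_of_int i)" d .
  \<comment> \<open>The level itself, as a subspace of the quotient, plays the part of the surface.
    With half-width 1/4 the heights of the collar spread over at most 1/2, well below the distance 2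
    within which \<open>q\<close> separates points.\<close>
  let ?h = "\<lambda>(w, t). q (d w) (real_of_int i + t / 4)"
  let ?C = "prod_topology (subtopology M (level i)) (top_of_set {-1..1::real})"
  have top: "topspace (subtopology M (level i)) = level i" using level_subset by (simp add: Int_absorb1)
  have d: "d w \<in> A" if "w \<in> level i" for w using e.in_space(2) that top by simp
  have cont: "continuous_map ?C M ?h"
  proof -
    have "continuous_map ?C S (\<lambda>x. d (fst x))"
      using continuous_map_compose[OF continuous_map_fst[of "subtopology M (level i)" "top_of_set {-1..1::real}"] e.cont(2)] by (simp add: o_def)
    moreover have "continuous_map ?C euclideanreal (\<lambda>x. real_of_int i + snd x / 4)"
      using continuous_map_into_fulltopology[OF continuous_map_snd[of "subtopology M (level i)" "top_of_set {-1..1::real}"]]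
      by (intro continuous_map_add continuous_map_real_divide) auto
    ultimately have "continuous_map ?C XR (\<lambda>x. (d (fst x), real_of_int i + snd x / 4))"
      by (simp add: continuous_map_pairwise o_def)
    from continuous_map_compose[OF this q_cont] show ?thesis by (simp add: o_def case_prod_unfold)
  qed
  have "compactin M (level i)"
    unfolding level_def using S_compact by (intro image_compactin[OF _ level_cont]) (simp add: compact_space_def)
  then have "compact_space (subtopology M (level i))" by (rule compact_space_subtopology)
  moreover have "compact_space (top_of_set {-1..1::real})" by (rule compact_space_subtopology) simp
  ultimately have "compact_space ?C" by (intro compact_space_prod_topology[THEN iffD2] disjI2 conjI)
  then have closed: "closed_map ?C M ?h" using cont Hausdorff_M[OF S_haus] by (intro continuous_imp_closed_map)
  have inj: "inj_on ?h (topspace ?C)"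
  proof (rule inj_onI)
    fix a b assume a: "a \<in> topspace ?C" and b: "b \<in> topspace ?C" and eq: "?h a = ?h b"
    obtain w t v s where ws: "a = (w, t)" "b = (v, s)" by (cases a, cases b)
    have *: "w \<in> level i" "v \<in> level i" "\<bar>t\<bar> \<le> 1" "\<bar>s\<bar> \<le> 1" using a b top unfolding ws by (auto simp: abs_le_iff)
    have "d w = d v \<and> real_of_int i + t / 4 = real_of_int i + s / 4"
    proof (rule q_close)
      show "q (d w) (real_of_int i + t / 4) = q (d v) (real_of_int i + s / 4)" using eq unfolding ws by simp
      show "\<bar>real_of_int i + t / 4 - (real_of_int i + s / 4)\<bar> < 2" using *(3,4) by (simp add: abs_le_iff abs_less_iff)
    qed (use * d in auto)
    moreover have "w = v" if "d w = d v" using e.inv(2)[of w] e.inv(2)[of v] that * top by metis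
    ultimately show "a = b" unfolding ws by simp
  qed
  have "level i = ?h ` (level i \<times> {0})"
  proof -
    have "?h (w, 0) = w" if "w \<in> level i" for w using e.inv(2)[of w] that top by simp
    then have "(\<lambda>w. ?h (w, 0)) ` level i = (\<lambda>w. w) ` level i" by (rule image_cong[OF refl])
    moreover have "level i \<times> {0::real} = (\<lambda>w. (w, 0)) ` level i" by auto
    ultimately show ?thesis by (simp only: image_image image_ident)
  qed
  then have "level i = ?h ` (topspace (subtopology M (level i)) \<times> {0})" unfolding top .
  then show ?thesis
    using injective_closed_imp_embedding_map[OF cont closed inj] e.closed_orientable_surface_transported[OF assms(1)] assms(2)
    unfolding cylindrically_embedded_surface_def by blast
qed

text \<open>The conjugating map is the identity: the pseudo-Anosov homeomorphism on the level is the
  return map \<open>Q\<close> carried over from \<open>S\<close>.\<close>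

lemma level_conjugate:
  assumes "closed_orientable_surface S g" "g > 1" and "pseudo_anosov S Q" and "orientation_preserving 2 S Q"
  shows "conjugate_to_pseudo_anosov M (level i) (F ^^ k)"
proof -
  obtain d where pair: "homeomorphism_pair S (subtopology M (level i)) (\<lambda>z. q z (real_of_int i)) d" by (rule level_pair)
  then interpret e: homeomorphism_pair S "subtopology M (level i)" "\<lambda>z. q z (real_of_int i)" d .
  let ?e = "\<lambda>z. q z (real_of_int i)"
  have "id ((F ^^ k) w) = (?e \<circ> Q \<circ> d) (id w)" if "w \<in> level i" for w
  proof -
    obtain z where z: "z \<in> A" "w = ?e z" using \<open>w \<in> level i\<close> unfolding level_def by (elim imageE)
    then show ?thesis using F_period_q[OF z(1)] e.inv(1)[OF z(1)] by simp
  qed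
  moreover have "homeomorphic_map (subtopology M (level i)) (subtopology M (level i)) id" by simp
  ultimately show ?thesis
    unfolding conjugate_to_pseudo_anosov_def
    using e.closed_orientable_surface_transported[OF assms(1)] assms(2) pseudo_anosov_transported[OF pair assms(3)]
      e.orientation_preserving_transported[OF assms(4) Q_homeo]
    by (intro exI[of _ "subtopology M (level i)"] exI[of _ g] exI[of _ "?e \<circ> Q \<circ> d"] exI[of _ id] conjI ballI)
qed

text \<open>The map is only assumed to be covered by a product of a surjection of the surface and a
  contraction of the line, so that the lemma serves the return map near odd levels and its inverse
  near even ones.\<close>

lemma attractor_level:
  assumes G: "\<And>z x. z \<in> A \<Longrightarrow> G (q z x) = q (R z) (\<psi> x)" and R: "R ` A = A" and \<psi>: "contracts \<psi> (real_of_int i)"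
  shows "attractor M G (level i)"
proof -
  obtain c where c: "0 \<le> c" "c < 1" and contr: "\<forall>x. \<bar>x - real_of_int i\<bar> \<le> 1/3 \<longrightarrow> \<bar>\<psi> x - real_of_int i\<bar> \<le> c * \<bar>x - real_of_int i\<bar>"
    using \<psi> unfolding contracts_def by (elim exE conjE)
  have Rpow: "(R ^^ m) z \<in> A" if "z \<in> A" for m z using funpow_image[OF R, of m] that by blast
  have Gpow: "(G ^^ m) (q z x) = q ((R ^^ m) z) ((\<psi> ^^ m) x)" if "z \<in> A" for m z x
    using that by (induction m) (simp_all add: G Rpow)
  have fixed: "\<psi> (real_of_int i) = real_of_int i" using contr[rule_format, of "real_of_int i"] by simp
  have "G ` level i = (\<lambda>z. G (q z (real_of_int i))) ` A" unfolding level_def by (simp only: image_image)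
  also have "\<dots> = (\<lambda>z. q (R z) (real_of_int i)) ` A" by (rule image_cong[OF refl]) (simp add: G fixed)
  also have "\<dots> = (\<lambda>z. q z (real_of_int i)) ` R ` A" by (simp only: image_image)
  finally have GB: "G ` level i = level i" unfolding R level_def .
  let ?i = "real_of_int i"
  \<comment> \<open>The closed collar of radius 1/3 is compact, hence closed, and is mapped into the
    open collar of the same radius.\<close>
  define U where "U = (\<lambda>(z, x). q z x) ` (A \<times> {?i - 1/3..?i + 1/3})"
  define V where "V = (\<lambda>(z, x). q z x) ` (A \<times> {?i - 1/3<..<?i + 1/3})"
  have U_cases: "\<exists>z x. z \<in> A \<and> \<bar>x - ?i\<bar> \<le> 1/3 \<and> w = q z x" if w: "w \<in> U" for w
  proof -
    obtain y where y: "y \<in> A \<times> {?i - 1/3..?i + 1/3}" "w = (\<lambda>(z, x). q z x) y" using w unfolding U_def by (elim imageE)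
    obtain z x where zx: "y = (z, x)" by (cases y)
    have x: "z \<in> A" "?i - 1/3 \<le> x" "x \<le> ?i + 1/3" using y(1) unfolding zx by auto
    have "\<bar>x - ?i\<bar> \<le> 1/3" by (rule abs_leI) (use x in linarith)+
    then show ?thesis using x(1) y(2) unfolding zx by auto
  qed
  have "compactin M U"
    unfolding U_def using S_compact by (intro image_compactin[OF _ q_cont]) (simp add: compactin_Times compact_space_def)
  then have closed: "closedin M U" by (rule compactin_imp_closedin[OF Hausdorff_M[OF S_haus]])
  have "openin M V" unfolding V_def using q_open by (simp add: open_map_def openin_prod_Times_iff)
  moreover have "V \<subseteq> U" unfolding U_def V_def by (intro image_mono) auto
  ultimately have VU: "V \<subseteq> M interior_of U" by (simp add: interior_of_maximal)
  have BV: "level i \<subseteq> V" unfolding level_def V_def by force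
  have "G w \<in> V" if "w \<in> U" for w
  proof -
    obtain z x where zx: "z \<in> A" "\<bar>x - ?i\<bar> \<le> 1/3" "w = q z x" using U_cases[OF \<open>w \<in> U\<close>] by (elim exE conjE)
    have "\<bar>\<psi> x - ?i\<bar> \<le> c * (1/3)" using contr[rule_format, OF zx(2)] mult_left_mono[OF zx(2) c(1)] by linarith
    then have "\<bar>\<psi> x - ?i\<bar> < 1/3" using c(2) by linarith
    then have "\<psi> x - ?i < 1/3" "- (1/3) < \<psi> x - ?i" by arith+
    then have "\<psi> x \<in> {?i - 1/3<..<?i + 1/3}" unfolding greaterThanLessThan_iff by (intro conjI) linarith+
    moreover have "R z \<in> A" using R zx(1) by blast
    ultimately show ?thesis unfolding V_def zx(3) G[OF zx(1)] by (intro image_eqI[of _ _ "(R z, \<psi> x)"]) auto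
  qed
  then have GU: "G ` U \<subseteq> V" by blast
  have "(\<Inter>j. (G ^^ j) ` U) = level i"
  proof (intro equalityI subsetI)
    fix w assume w: "w \<in> level i"
    have "w \<in> (G ^^ j) ` U" for j
    proof -
      have "w \<in> (G ^^ j) ` level i" unfolding funpow_image[OF GB] by (rule w)
      then show ?thesis using BV VU interior_of_subset[of M U] by blast
    qed
    then show "w \<in> (\<Inter>j. (G ^^ j) ` U)" by blast
  next
    fix w assume w: "w \<in> (\<Inter>j. (G ^^ j) ` U)"
    then have "w \<in> (G ^^ 0) ` U" by blast
    then have "w \<in> U" by simp
    obtain z x where zx: "z \<in> A" "\<bar>x - ?i\<bar> \<le> 1/3" "w = q z x" using U_cases[OF \<open>w \<in> U\<close>] by (elim exE conjE)
    \<comment> \<open>A point of the \<open>j\<close>-th image of the collar has a representative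
      within c^j of the level. Representatives whose heights differ by less than 2 have the same
      height, so the bound holds for \<open>x\<close> itself.\<close>
    have bound: "\<bar>x - ?i\<bar> \<le> c ^ j" for j
    proof -
      obtain v where v: "v \<in> U" "w = (G ^^ j) v" using w by blast
      obtain y t where yt: "y \<in> A" "\<bar>t - ?i\<bar> \<le> 1/3" "v = q y t" using U_cases[OF v(1)] by (elim exE conjE)
      have t: "\<bar>(\<psi> ^^ j) t - ?i\<bar> \<le> c ^ j * \<bar>t - ?i\<bar>"
        using c contr yt(2) by (intro contracts_funpow) auto
      also have "\<dots> \<le> c ^ j * (1/3)" using c(1) yt(2) by (intro mult_left_mono) auto
      finally have t1: "\<bar>(\<psi> ^^ j) t - ?i\<bar> \<le> c ^ j * (1/3)" .
      have "c ^ j \<le> 1" "0 \<le> c ^ j" using c by (simp_all add: power_le_one)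
      then have "\<bar>x - (\<psi> ^^ j) t\<bar> < 2" using t1 zx(2) by arith
      moreover have "q z x = q ((R ^^ j) y) ((\<psi> ^^ j) t)" using zx(3) v(2) yt(1,3) Gpow by simp
      ultimately have "x = (\<psi> ^^ j) t" using q_close[OF zx(1) Rpow[OF yt(1)]] by blast
      then show ?thesis using t1 \<open>0 \<le> c ^ j\<close> by simp
    qed
    have "x = ?i"
    proof (rule ccontr)
      assume "x \<noteq> ?i"
      then obtain j where "c ^ j < \<bar>x - ?i\<bar>" using real_arch_pow_inv[of "\<bar>x - ?i\<bar>" c] c(2) by auto
      then show False using bound[of j] by simp
    qed
    then show "w \<in> level i" unfolding level_def zx(3) using zx(1) by blast
  qed
  then show ?thesis
    unfolding attractor_def using GB closed VU BV GU by (intro conjI exI[of _ U]) auto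
qed

lemma level_attractor: "odd i \<Longrightarrow> attractor M (F ^^ k) (level i)"
  by (rule attractor_level[OF F_period_q Q_image contracts_power[OF contracts_wave k]])

text \<open>The inverse of the return map is covered by the product of the inverse of
  \<open>Q\<close> and the iterated \<open>wave_inverse\<close>, and the latter contracts towards
  even integers.\<close>

lemma level_repeller:
  assumes "even i" shows "repeller M (F ^^ k) (level i)"
  unfolding repeller_def
proof (rule attractor_level[OF _ _ contracts_power[OF contracts_wave_inverse[OF assms] k]])
  show R: "inv_into A Q ` A = A" by (rule homeomorphic_imp_surjective_map[OF homeomorphic_map_inv_into[OF Q_homeo]])
  fix z x assume z: "z \<in> A"
  have y: "inv_into A Q z \<in> A" "Q (inv_into A Q z) = z" using R z Q_image by (blast, simp add: f_inv_into_f)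
  show "inv_into (topspace M) (F ^^ k) (q z x) = q (inv_into A Q z) ((wave_inverse ^^ k) x)"
  proof (rule inv_into_f_eq)
    show "inj_on (F ^^ k) (topspace M)" by (rule homeomorphic_imp_injective_map[OF homeomorphic_map_funpow[OF F_homeo]])
    show "q (inv_into A Q z) ((wave_inverse ^^ k) x) \<in> topspace M" by (rule q_in[OF y(1)])
    show "(F ^^ k) (q (inv_into A Q z) ((wave_inverse ^^ k) x)) = q z x"
      using F_period_q[OF y(1)] y(2) by (simp add: wave_pow_inverse)
  qed
qed

lemma nonwandering_levels:
  assumes nw: "\<And>V. openin S V \<Longrightarrow> V \<noteq> {} \<Longrightarrow> \<exists>m>0. (Q ^^ m) ` V \<inter> V \<noteq> {}"
  shows "nonwandering_set M F = (\<Union>i. level i)"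
proof (intro equalityI subsetI)
  fix w assume w: "w \<in> (\<Union>i. level i)"
  then obtain i z where z: "z \<in> A" "w = q z (real_of_int i)" unfolding level_def by blast
  have "\<exists>m>0. (F ^^ m) ` U \<inter> U \<noteq> {}" if U: "openin M U" "w \<in> U" for U
  proof -
    \<comment> \<open>These are the points of \<open>S\<close> whose copies on the level lie in
      \<open>U\<close>. A return of \<open>Q\<close> to \<open>V\<close> after \<open>m\<close>
      steps is a return of the model map to \<open>U\<close> after k * m steps.\<close>
    define V where "V = {z \<in> A. q z (real_of_int i) \<in> U}"
    have "openin S V" unfolding V_def by (rule openin_continuous_map_preimage[OF level_cont U(1)])
    moreover have "V \<noteq> {}" using z U(2) unfolding V_def by blast
    ultimately obtain m v where m: "m > 0" "v \<in> V" "(Q ^^ m) v \<in> V" using nw by blast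
    have v: "v \<in> A" "q v (real_of_int i) \<in> U" "q ((Q ^^ m) v) (real_of_int i) \<in> U" using m unfolding V_def by auto
    have iter: "((F ^^ k) ^^ j) (q v (real_of_int i)) = q ((Q ^^ j) v) (real_of_int i) \<and> (Q ^^ j) v \<in> A" for j
      by (induction j) (simp_all add: v F_period_q)
    have "((F ^^ k) ^^ m) (q v (real_of_int i)) \<in> U" unfolding conjunct1[OF iter[of m]] by (rule v(3))
    then have "(F ^^ (k * m)) (q v (real_of_int i)) \<in> U" by (simp only: funpow_mult)
    then show ?thesis using v(2) k m(1) by (intro exI[of _ "k * m"]) auto
  qed
  then show "w \<in> nonwandering_set M F" using z q_in unfolding nonwandering_set_def by blast
next
  fix w assume w: "w \<in> nonwandering_set M F"
  then have "w \<in> topspace M" by (simp add: nonwandering_set_def)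
  then obtain z x where z: "z \<in> A" "w = q z x" by (rule q_cases)
  show "w \<in> (\<Union>i. level i)"
  proof (cases "x \<in> \<int>")
    case True
    then obtain i where "x = real_of_int i" by (elim Ints_cases)
    then show ?thesis using z unfolding level_def by blast
  next
    case False
    obtain j a b where j: "real_of_int j \<le> a" "a < x" "x < b" "b \<le> real_of_int j + 1"
      and away: "\<forall>y m. a < y \<longrightarrow> y < b \<longrightarrow> m > 0 \<longrightarrow> \<not> (a < (wave ^^ m) y \<and> (wave ^^ m) y < b)"
      using wave_displaces[OF False] by (elim exE conjE)
    let ?U = "(\<lambda>(z, x). q z x) ` (A \<times> {a<..<b})"
    have return: "\<forall>U. openin M U \<and> w \<in> U \<longrightarrow> (\<exists>m>0. (F ^^ m) ` U \<inter> U \<noteq> {})"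
      using w unfolding nonwandering_set_def mem_Collect_eq by (rule conjunct2)
    have U: "openin M ?U" using q_open by (simp add: open_map_def openin_prod_Times_iff)
    have wU: "w \<in> ?U" using z j by force
    obtain m where m: "m > 0" "(F ^^ m) ` ?U \<inter> ?U \<noteq> {}"
      using return[THEN spec, THEN mp, OF conjI[OF U wU]] by (elim exE conjE)
    obtain u where u: "u \<in> (F ^^ m) ` ?U" "u \<in> ?U"
      using m(2) unfolding ex_in_conv[symmetric] by (elim exE IntE)
    obtain y s where y: "y \<in> A" "a < s" "s < b" "u = (F ^^ m) (q y s)" using u(1) by auto
    obtain v t where v: "v \<in> A" "a < t" "t < b" "u = q v t" using u(2) by auto
    have "q ((P ^^ m) y) ((wave ^^ m) s + 2 * real_of_int (int n * l * int m)) = q v t"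
      using y(4) v(4) F_pow_q[OF y(1)] by simp
    then obtain i where i: "t = (wave ^^ m) s + 2 * real_of_int (int n * l * int m) - NR * real_of_int i"
      using q_eq_iff[OF P_pow_in[OF y(1)] v(1)] by blast
    \<comment> \<open>A return in the quotient is a return of the lifted height up to an integer
      translation \<open>e\<close>. Both heights lie in the same open unit interval, so
      \<open>e\<close> is 0, and the lifted orbit would have to come back to the interval that it
      has left.\<close>
    define e where "e = 2 * (int n * l * int m) - N * i"
    have e: "t = (wave ^^ m) s + real_of_int e" unfolding i e_def by simp
    have s: "real_of_int j < s" "s < real_of_int j + 1" using y j by linarith+
    have "\<bar>real_of_int e\<bar> < 1" using wave_unit_interval[OF s, of m] e v j by linarith
    then have "e = 0" by linarith
    then show ?thesis using away y(2,3) m(1) v e by simp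
  qed
qed

lemma components_nonwandering:
  assumes nw: "nonwandering_set M F = (\<Union>i. level i)" and S: "connected_space S" "A \<noteq> {}"
  shows "connected_components_of (subtopology M (nonwandering_set M F)) = level ` {0..<N}"
proof (rule connected_components_of_closed_partition)
  have sub: "level i \<subseteq> nonwandering_set M F" for i unfolding nw by blast
  show "finite (level ` {0..<N})" by simp
  fix B assume "B \<in> level ` {0..<N}"
  then obtain i where B: "B = level i" by blast
  show "closedin (subtopology M (nonwandering_set M F)) B"
    unfolding B by (rule closedin_subset_topspace[OF level_closed sub])
  show "connectedin (subtopology M (nonwandering_set M F)) B"
    unfolding B connectedin_subtopology using level_connected[OF S(1)] sub by blast
  show "B \<noteq> {}" unfolding B level_def using S(2) by blast
next
  have "disjnt B C" if BC: "B \<in> level ` {0..<N}" "C \<in> level ` {0..<N}" "B \<noteq> C" for B C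
  proof -
    obtain i j where "B = level i" "C = level j" using BC(1,2) by (elim imageE)
    then show ?thesis using BC(3) level_dvd[of j i] level_disjoint[of j i] by (auto simp: disjnt_def)
  qed
  then show "pairwise disjnt (level ` {0..<N})" by (rule pairwiseI)
next
  have "level i \<in> level ` {0..<N}" for i
  proof (rule image_eqI)
    show "level i = level (i mod N)" by (rule level_dvd) (simp add: minus_mod_eq_mult_div)
    show "i mod N \<in> {0..<N}" using N2 by simp
  qed
  then have "(\<Union>i. level i) = \<Union>(level ` {0..<N})" by blast
  moreover have "(\<Union>i. level i) \<subseteq> topspace M" using level_subset by blast
  ultimately show "\<Union>(level ` {0..<N}) = topspace (subtopology M (nonwandering_set M F))"
    unfolding nw by (simp add: Int_absorb1)
qed

text \<open>The \<open>m\<close>-th iterate shifts the index by 2nlm, and two indices give the same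
  level exactly when they agree modulo 2nk. So a level returns if and only if k divides lm, which by
  coprimality means that k divides m.\<close>

lemma level_period:
  assumes "A \<noteq> {}" and kl: "coprime l (int k)"
  shows "(F ^^ m) ` level i = level i \<longleftrightarrow> k dvd m"
proof -
  have "(F ^^ m) ` level i = level i \<longleftrightarrow> N dvd 2 * (int n * l * int m)"
    unfolding F_pow_level
  proof
    assume eq: "level (i + 2 * (int n * l * int m)) = level i"
    show "N dvd 2 * (int n * l * int m)"
    proof (rule ccontr)
      assume "\<not> N dvd 2 * (int n * l * int m)"
      then have "level i \<inter> level (i + 2 * (int n * l * int m)) = {}" by (intro level_disjoint) simp
      then show False using eq assms(1) by (simp add: level_def)
    qed
  next
    assume "N dvd 2 * (int n * l * int m)"
    then show "level (i + 2 * (int n * l * int m)) = level i" by (intro level_dvd) simp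
  qed
  also have "2 * (int n * l * int m) = 2 * int n * (l * int m)" by simp
  also have "N dvd 2 * int n * (l * int m) \<longleftrightarrow> int k dvd l * int m" unfolding N_def using n by (subst dvd_mult_cancel_left) simp
  also have "\<dots> \<longleftrightarrow> int k dvd int m" using kl by (simp add: coprime_commute coprime_dvd_mult_right_iff)
  finally show ?thesis by simp
qed

theorem model_in_class_G:
  assumes S: "closed_orientable_surface S g" "g > 1" and kl: "coprime l (int k)"
    and pA: "pseudo_anosov S Q" and or: "orientation_preserving 2 S P" "orientation_preserving 2 S J"
    and nw: "\<And>V. openin S V \<Longrightarrow> V \<noteq> {} \<Longrightarrow> \<exists>m>0. (Q ^^ m) ` V \<inter> V \<noteq> {}"
  shows "(M, F) \<in> class_G"
proof -
  have mS: "topological_manifold 2 S" "connected_space S" "A \<noteq> {}" "orientable_manifold 2 S"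
    using S(1) unfolding closed_orientable_surface_def closed_connected_orientable_manifold_def by blast+
  obtain \<omega> where \<omega>: "manifold_orientation 2 S \<omega>" using mS(4) unfolding orientable_manifold_def by blast
  \<comment> \<open>Both maps are made to preserve the one chosen \<omega>. Then the return map
    preserves it too, and the product orientation descends to the quotient.\<close>
  have P\<omega>: "preserves_orientation 2 S \<omega> P" and J\<omega>: "preserves_orientation 2 S \<omega> J"
    using orientation_preserving_any[OF mS(1,2) P or(1) \<omega>] orientation_preserving_any[OF mS(1,2) J or(2) \<omega>] P J
    by (simp_all add: preserves_orientation_def)
  have "preserves_orientation 2 S \<omega> Q"
    unfolding Q_def by (intro preserves_orientation_compose preserves_orientation_int_iterate[OF \<omega> J\<omega>] preserves_orientation_funpow[OF \<omega> P\<omega>])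
  then have Q_or: "orientation_preserving 2 S Q" using \<omega> unfolding orientation_preserving_def preserves_orientation_def by blast
  note or3 = F_orientation_preserving[OF \<omega> J\<omega> P\<omega>, unfolded Suc_numeral, simplified]
  have "topspace M \<noteq> {}" using mS(3) p_in by blast
  moreover have "topological_manifold 3 M" using manifold_M[OF mS(1)] by simp
  ultimately have "closed_connected_orientable_manifold 3 M"
    unfolding closed_connected_orientable_manifold_def using or3(2) compact_M[OF S_compact] connected_M[OF mS(2)] by simp
  moreover have comps: "connected_components_of (subtopology M (nonwandering_set M F)) = level ` {0..<N}"
    by (rule components_nonwandering[OF nonwandering_levels[OF nw] mS(2,3)])
  moreover have "cylindrically_embedded_surface M B \<and>
      (\<exists>k>0. (F ^^ k) ` B = B \<and> (\<forall>k'. 0 < k' \<and> k' < k \<longrightarrow> (F ^^ k') ` B \<noteq> B) \<and>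
         conjugate_to_pseudo_anosov M B (F ^^ k) \<and> (attractor M (F ^^ k) B \<or> repeller M (F ^^ k) B))"
    if "B \<in> level ` {0..<N}" for B
  proof -
    obtain i where B: "B = level i" using \<open>B \<in> _\<close> by blast
    note per = level_period[OF mS(3) kl]
    show ?thesis
      unfolding B
    proof (intro conjI exI[of _ k] allI impI level_cylinder[OF S] level_conjugate[OF S pA Q_or] k)
      show "(F ^^ k) ` level i = level i" using per by simp
      show "(F ^^ k') ` level i \<noteq> level i" if "0 < k' \<and> k' < k" for k'
        using that per by (auto dest: dvd_imp_le)
      show "attractor M (F ^^ k) (level i) \<or> repeller M (F ^^ k) (level i)"
        using level_attractor level_repeller by blast
    qed
  qed
  ultimately show ?thesis unfolding class_G_def using F_homeo or3(1) by simp
qed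

end

theorem theorem2:
  fixes S :: "'a topology" and P J :: "'a \<Rightarrow> 'a" and g n k :: nat and l :: int
  assumes "g > 1" and "closed_orientable_surface S g"
    and "n > 0" and "k > 0"
    and "k = 1 \<Longrightarrow> l = 0"
    and "k > 1 \<Longrightarrow> l \<in> {1..int k - 1} \<and> coprime l (int k)"
    and "pseudo_anosov S P" and "orientation_preserving 2 S P"
    and "homeomorphic_map S S J" and "orientation_preserving 2 S J"
    and "\<And>z. z \<in> topspace S \<Longrightarrow> P (J z) = J (P z)"
    and "pseudo_anosov S (int_iterate (topspace S) J l \<circ> (P ^^ k))"
  shows "(mapping_torus S J, model_map S P J n k l) \<in> class_G"
proof -
  have S: "Hausdorff_space S" "compact_space S"
    using assms(2)
    by (simp_all add: closed_orientable_surface_def closed_connected_orientable_manifold_def topological_manifold_def)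
  have P: "homeomorphic_map S S P"
    using assms(7) by (auto simp: pseudo_anosov_def pseudo_anosov_with_dilatation_def)
  interpret model S J P n k l
    by unfold_locales (use assms(3,4,9,11) S P in auto)
  have kl: "coprime l (int k)"
  proof (cases "k = 1")
    case False
    then show ?thesis using assms(4,6) by simp
  qed simp
  have pA: "pseudo_anosov S Q"
    using assms(12) by (simp only: Q_def)
  show ?thesis
    by (rule model_in_class_G[OF assms(2,1) kl pA assms(8,10) pseudo_anosov_nonwandering[OF S pA]])
qed

end
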